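(* Assume the prior $P_{\mathtt{x}}$ is centered, is of unit variance and has bounded support. Then for all $0\le\lambda<\lambda_c$, $$\lim_{N\to\infty}D_{\mathsf{KL}}(\mathbb{P}_\lambda,\mathbb{P}_0)=\tfrac14\big(-\log(1-\lambda)-\lambda\big).$$
   Context: Let $P_{\mathtt{x}}$ (the prior) be a probability distribution on $\mathbb{R}$ with bounded support. Spiked Wigner model with the diagonal discarded (this is what the paper's convention $\sigma=+\infty$ means): for $\lambda\ge 0$ and $N\ge 1$, $\boldsymbol{Y}=\{Y_{ij}:1\le i<j\le N\}$ with $Y_{ij}=\sqrt{\lambda/N}\,x_i^*x_j^*+W_{ij}$, where $W_{ij}\sim\mathcal{N}(0,1)$ i.i.d., and $\boldsymbol{x}^*=(x_1^*,\dots,x_N^* )$ has i.i.d. coordinates from $P_{\mathtt{x}}$, independent of $\boldsymbol W$. $\mathbb{P}_\lambda$ denotes the law of $\boldsymbol{Y}$ (dependence on $N$ is suppressed). $D_{\mathsf{KL}}(\mathbb{P}_\lambda,\mathbb{P}_0)=\mathbb{E}_{\mathbb{P}_\lambda}\log\frac{\mathrm{d}\mathbb{P}_\lambda}{\mathrm{d}\mathbb{P}_0}(\boldsymbol Y)$ is the Kullback–Leibler divergence. For $r\ge0$ let $\psi(r)=\mathbb{E}_{x^*,z}\log\int\exp\big(\sqrt r zx+rxx^*-\tfrac r2x^2\big)\mathrm{d}P_{\mathtt{x}}(x)$ with $z\sim\mathcal{N}(0,1)$ and $x^*\sim P_{\mathtt{x}}$ independent. Let $F(\lambda,q)=\psi(\lambda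 q)-\frac{\lambda q^2}{4}$ and $\phi_{\mathsf{RS}}(\lambda)=\sup_{q\ge0}F(\lambda,q)$. The reconstruction threshold is $\lambda_c=\sup\{\lambda>0:\phi_{\mathsf{RS}}(\lambda)=0\}$ (with $\sup\emptyset=0$). In the unit-variance case $\lambda_c\le1$. *)

theory Defs
  imports "HOL-Probability.Probability"
begin

definition measure_support :: "'a::topological_space measure \<Rightarrow> 'a set" where
  "measure_support M = {x. \<forall>U. open U \<longrightarrow> x \<in> U \<longrightarrow> emeasure M U > 0}"

abbreviation std_normal :: "real measure" where
  "std_normal \<equiv> density lborel std_normal_density"

text \<open>
  Coordinates are numbered \<open>0, \<dots>, N - 1\<close>; the observed entries are those strictly above
  the diagonal.
\<close>

definition upper_pairs :: "nat \<Rightarrow> (nat \<times> nat) set" where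
  "upper_pairs N = {(i, j). i < j \<and> j < N}"

definition wigner_noise :: "nat \<Rightarrow> (nat \<times> nat \<Rightarrow> real) measure" where
  "wigner_noise N = (\<Pi>\<^sub>M p\<in>upper_pairs N. std_normal)"

definition spike_law :: "real measure \<Rightarrow> nat \<Rightarrow> (nat \<Rightarrow> real) measure" where
  "spike_law P N = (\<Pi>\<^sub>M i\<in>{..<N}. P)"

definition observation ::
  "real \<Rightarrow> nat \<Rightarrow> (nat \<Rightarrow> real) \<Rightarrow> (nat \<times> nat \<Rightarrow> real) \<Rightarrow> (nat \<times> nat \<Rightarrow> real)" where
  "observation lam N x w =
     (\<lambda>(i, j)\<in>upper_pairs N. sqrt (lam / real N) * x i * x j + w (i, j))"

definition spiked_wigner :: "real measure \<Rightarrow> real \<Rightarrow> nat \<Rightarrow> (nat \<times> nat \<Rightarrow> real) measure" where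
  "spiked_wigner P lam N =
     distr (spike_law P N \<Otimes>\<^sub>M wigner_noise N) (\<Pi>\<^sub>M p\<in>upper_pairs N. borel)
       (\<lambda>(x, w). observation lam N x w)"

text \<open>
  The library's \<^const>\<open>KL_divergence\<close> takes the reference measure first:
  \<open>KL_divergence b M N\<close> integrates \<open>log b (dN/dM)\<close> against \<open>N\<close>.
\<close>

definition D_KL :: "'a measure \<Rightarrow> 'a measure \<Rightarrow> real" where
  "D_KL Q R = KL_divergence (exp 1) R Q"

definition psi :: "real measure \<Rightarrow> real \<Rightarrow> real" where
  "psi P r =
     (\<integral>(xs, z). ln (\<integral>x. exp (sqrt r * z * x + r * x * xs - r / 2 * x\<^sup>2) \<partial>P)
        \<partial>(P \<Otimes>\<^sub>M std_normal))"

definition rs_potential :: "real measure \<Rightarrow> real \<Rightarrow> real \<Rightarrow> real" where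
  "rs_potential P lam q = psi P (lam * q) - lam * q\<^sup>2 / 4"

text \<open>
  Suprema are taken in the extended reals so that they are meaningful without
  a boundedness proof; inserting \<open>0\<close> below implements the convention that the threshold is
  \<open>0\<close> if no positive \<open>lam\<close> qualifies.
\<close>

definition phi_RS :: "real measure \<Rightarrow> real \<Rightarrow> ereal" where
  "phi_RS P lam = (SUP q\<in>{0..}. ereal (rs_potential P lam q))"

definition reconstruction_threshold :: "real measure \<Rightarrow> ereal" where
  "reconstruction_threshold P = Sup (insert 0 (ereal ` {lam. lam > 0 \<and> phi_RS P lam = 0}))"

end

theory Submission imports Defs begin

text \<open>
  Let \<open>\<Phi>\<close> be the likelihood ratio, an average over the prior of the exponential weights
  \<open>exp (W \<bullet> S - \<bar>S\<bar>\<^sup>2 / 2)\<close> under pure noise \<open>W\<close>. Integration by parts turns the derivative of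
  \<open>E g \<Phi>\<close> along any change of signal-to-noise ratios into second derivatives of \<open>g\<close>. For
  \<open>g u = u ln u\<close> it expresses the derivative of the relative entropy through
  \<open>q = N E\<langle>R\<^sup>2\<rangle>\<close>, where \<open>R\<close> is the overlap of two replicas.

  Switching off the edges at one vertex decouples that coordinate. The energy of these edges is
  \<open>\<lambda> q\<close> up to terms of order \<open>N E\<langle>\<bar>R\<bar>\<^sup>3\<rangle>\<close>, and it is also \<open>q - 1\<close> on average, so
  \<open>q \<longlonglongrightarrow> 1 / (1 - \<lambda>)\<close> as soon as large overlaps are negligible.

  For large overlaps, the Gibbs weight of \<open>{R \<approx> m}\<close> relative to the planted signal is estimated by
  its moment of small order \<open>s\<close>: this needs no concentration of measure. Kahane's comparison
  factorises the moment over the coordinates, and as \<open>s\<close> tends to \<open>0\<close> its rate becomes the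
  replica-symmetric potential, which is strictly negative away from \<open>m = 0\<close> below the threshold.
\<close>

section \<open>Gaussian measures\<close>

text \<open>Being below the threshold does not by itself say that \<open>lam\<close> < 1. This is
  deduced: for \<open>a^2\<close> > 1 the two relations for \<open>al\<close> contradict each other
  once large overlaps are excluded. The error terms would have to be controlled at every
  intermediate interpolation time. This is possible because posterior second moments only grow with
  the amplitudes, so their values at the endpoint bound all earlier ones; odd overlap moments, which
  are not of this form, are traded for even ones. The same monotonicity makes the final estimate
  uniform in smaller amplitudes, as needed to integrate the entropy derivative. Fractional moments
  enter through p <= p^s for a probability p. The normalisation \<open>part\<close> may be bounded
  below by exp(-b), since the planted law charges the complementary event with at most exp(-b).
  Overlaps of either sign must be excluded. A negative one leads to a scalar channel with reflected
  signal, whose functional is at most \<open>psi\<close> by Gibbs' inequality; this covers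
  asymmetric priors. Every observation carries its own amplitude, so that one derivative formula
  serves the uniform path, the removal of a vertex and the rotation between edge and site
  fields.\<close>

lemma has_real_derivative_integral:
  fixes f f' :: "real \<Rightarrow> 'a \<Rightarrow> real"
  assumes "d > 0"
    and der: "\<And>t x. \<bar>t - t0\<bar> < d \<Longrightarrow> x \<in> space M \<Longrightarrow> ((\<lambda>s. f s x) has_real_derivative f' t x) (at t)"
    and int: "\<And>t. \<bar>t - t0\<bar> < d \<Longrightarrow> integrable M (f t)"
    and bound: "\<And>t x. \<bar>t - t0\<bar> < d \<Longrightarrow> x \<in> space M \<Longrightarrow> \<bar>f' t x\<bar> \<le> g x"
    and "integrable M g" and [measurable]: "f' t0 \<in> borel_measurable M"
  shows "((\<lambda>t. \<integral>x. f t x \<partial>M) has_real_derivative (\<integral>x. f' t0 x \<partial>M)) (at t0)"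
  unfolding has_field_derivative_iff tendsto_at_iff_sequentially comp_def
proof safe
  fix X :: "nat \<Rightarrow> real"
  assume X: "\<forall>i. X i \<in> UNIV - {t0}" and lim: "X \<longlonglongrightarrow> t0"
  have near: "eventually (\<lambda>n. \<bar>X n - t0\<bar> < d) sequentially"
    using tendstoD[OF lim \<open>d > 0\<close>] by (simp add: dist_real_def)
  then obtain n0 where n0: "\<And>n. n \<ge> n0 \<Longrightarrow> \<bar>X n - t0\<bar> < d"
    by (auto simp: eventually_sequentially)
  define Y where "Y n = X (n + n0)" for n
  have Y: "\<bar>Y n - t0\<bar> < d" "Y n \<noteq> t0" for n
    using n0[of "n + n0"] X by (auto simp: Y_def)
  have limY: "Y \<longlonglongrightarrow> t0"
    unfolding Y_def using lim by (rule LIMSEQ_ignore_initial_segment)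
  have d0: "\<bar>t0 - t0\<bar> < d" using \<open>d > 0\<close> by simp
  have "(\<lambda>n. \<integral>x. (f (Y n) x - f t0 x) / (Y n - t0) \<partial>M) \<longlonglongrightarrow> (\<integral>x. f' t0 x \<partial>M)"
  proof (rule integral_dominated_convergence[where w = g])
    show "(\<lambda>x. (f (Y n) x - f t0 x) / (Y n - t0)) \<in> borel_measurable M" for n
      using int[OF Y(1)[of n]] int[OF d0] by measurable
    show "AE x in M. (\<lambda>n. (f (Y n) x - f t0 x) / (Y n - t0)) \<longlonglongrightarrow> f' t0 x"
    proof (rule AE_I2)
      fix x assume "x \<in> space M"
      from der[OF d0 this] show "(\<lambda>n. (f (Y n) x - f t0 x) / (Y n - t0)) \<longlonglongrightarrow> f' t0 x"
        unfolding has_field_derivative_iff tendsto_at_iff_sequentially comp_def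
        using Y(2) limY by auto
    qed
    show "AE x in M. norm ((f (Y n) x - f t0 x) / (Y n - t0)) \<le> g x" for n
    proof (rule AE_I2)
      fix x assume x: "x \<in> space M"
      have "norm (f (Y n) x - f t0 x) \<le> g x * norm (Y n - t0)"
      proof (rule field_differentiable_bound[of "{t. \<bar>t - t0\<bar> < d}" _ "\<lambda>t. f' t x"])
        have "{t. \<bar>t - t0\<bar> < d} = ball t0 d" by (auto simp: ball_def dist_real_def)
        then show "convex {t. \<bar>t - t0\<bar> < d}" by simp
      qed (use der[OF _ x] bound[OF _ x] Y(1)[of n] \<open>d > 0\<close> in \<open>auto intro: has_field_derivative_at_within\<close>)
      then show "norm ((f (Y n) x - f t0 x) / (Y n - t0)) \<le> g x"
        using Y(2)[of n] by (simp add: field_simps)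
    qed
  qed (use assms in auto)
  moreover have "(\<integral>x. (f (Y n) x - f t0 x) / (Y n - t0) \<partial>M)
      = ((\<integral>x. f (Y n) x \<partial>M) - (\<integral>x. f t0 x \<partial>M)) / (Y n - t0)" for n
    using int[OF Y(1)[of n]] int[OF d0] by (simp add: Bochner_Integration.integral_diff)
  ultimately have "(\<lambda>n. ((\<integral>x. f (Y n) x \<partial>M) - (\<integral>x. f t0 x \<partial>M)) / (Y n - t0)) \<longlonglongrightarrow> (\<integral>x. f' t0 x \<partial>M)"
    by (simp only:)
  then show "(\<lambda>n. ((\<integral>x. f (X n) x \<partial>M) - (\<integral>x. f t0 x \<partial>M)) / (X n - t0)) \<longlonglongrightarrow> (\<integral>x. f' t0 x \<partial>M)"
    unfolding Y_def by (rule LIMSEQ_offset)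
qed

text \<open>Increments are bounded by comparing derivatives pointwise, so no derivative has to be
  integrated or shown continuous in the interpolation parameter.\<close>

lemma DERIV_le_diff:
  fixes h h' H H' :: "real \<Rightarrow> real"
  assumes "a \<le> b"
    and "\<And>t. a \<le> t \<Longrightarrow> t \<le> b \<Longrightarrow> (h has_real_derivative h' t) (at t)"
    and "\<And>t. a \<le> t \<Longrightarrow> t \<le> b \<Longrightarrow> (H has_real_derivative H' t) (at t)"
    and "\<And>t. a \<le> t \<Longrightarrow> t \<le> b \<Longrightarrow> h' t \<le> H' t"
  shows "h b - h a \<le> H b - H a"
proof -
  have "(\<lambda>t. H t - h t) a \<le> (\<lambda>t. H t - h t) b"
    by (rule DERIV_nonneg_imp_nondecreasing[OF assms(1)])
       (use assms(2-4) in \<open>force intro!: derivative_eq_intros\<close>)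
  then show ?thesis by simp
qed

section \<open>The standard normal law and its translations\<close>

interpretation std_normal: prob_space std_normal
  by (rule prob_space_normal_density) simp

lemma std_normal_density_shift: "std_normal_density (y - c) = exp (c * y - c\<^sup>2 / 2) * std_normal_density y"
  by (simp add: normal_density_def exp_add[symmetric] power2_eq_square field_simps)

text \<open>One-dimensional Cameron-Martin formula, for nonnegative \<open>f\<close> so that it can
  be iterated over coordinates without integrability conditions.\<close>

lemma nn_integral_std_normal_shift:
  fixes f :: "real \<Rightarrow> ennreal"
  assumes [measurable]: "f \<in> borel_measurable borel"
  shows "(\<integral>\<^sup>+x. f (x + c) \<partial>std_normal) = (\<integral>\<^sup>+x. exp (c * x - c\<^sup>2 / 2) * f x \<partial>std_normal)"
proof -
  have "(\<integral>\<^sup>+x. f (x + c) \<partial>std_normal) = (\<integral>\<^sup>+x. std_normal_density x * f (x + c) \<partial>lborel)"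
    by (subst nn_integral_density) auto
  also have "\<dots> = (\<integral>\<^sup>+y. std_normal_density y * f (y + c) \<partial>distr lborel borel ((+) (- c)))"
    by (subst lborel_distr_plus[of "-c"]) auto
  also have "\<dots> = (\<integral>\<^sup>+x. std_normal_density (x - c) * f x \<partial>lborel)"
    by (subst nn_integral_distr) auto
  also have "\<dots> = (\<integral>\<^sup>+x. std_normal_density x * (exp (c * x - c\<^sup>2 / 2) * f x) \<partial>lborel)"
    by (simp only: std_normal_density_shift ennreal_mult' exp_ge_zero mult.assoc mult.left_commute)
  also have "\<dots> = (\<integral>\<^sup>+x. exp (c * x - c\<^sup>2 / 2) * f x \<partial>std_normal)"
    by (subst nn_integral_density) auto
  finally show ?thesis .
qed

text \<open>The translation formula for the constant function 1 already contains the Gaussian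
  Laplace transform exp(c^2/2).\<close>

lemma integrable_std_normal_exp: "integrable std_normal (\<lambda>x. exp (c * x))"
proof (rule integrableI_nonneg)
  have "(\<integral>\<^sup>+x. exp (c * x - c\<^sup>2 / 2) \<partial>std_normal) = 1"
    using nn_integral_std_normal_shift[of "\<lambda>_. 1" c] std_normal.emeasure_space_1 by simp
  moreover have "ennreal (exp (c * x)) = exp (c\<^sup>2 / 2) * ennreal (exp (c * x - c\<^sup>2 / 2))" for x
    by (simp add: ennreal_mult'[symmetric] exp_add[symmetric])
  ultimately have "(\<integral>\<^sup>+x. exp (c * x) \<partial>std_normal) = exp (c\<^sup>2 / 2)"
    by (simp add: nn_integral_cmult del: ennreal_mult')
  then show "(\<integral>\<^sup>+x. exp (c * x) \<partial>std_normal) < \<infinity>" by simp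
qed auto

lemma integrable_std_normal_exp_abs: "integrable std_normal (\<lambda>x. exp (D * \<bar>x\<bar>))"
proof (rule Bochner_Integration.integrable_bound[OF Bochner_Integration.integrable_add
        [OF integrable_std_normal_exp[of D] integrable_std_normal_exp[of "-D"]]])
  show "AE x in std_normal. norm (exp (D * \<bar>x\<bar>)) \<le> norm (exp (D * x) + exp (- D * x))"
  proof (rule AE_I2)
    fix x :: real
    have "exp (D * x) > 0" "exp (- D * x) > 0" by auto
    then show "norm (exp (D * \<bar>x\<bar>)) \<le> norm (exp (D * x) + exp (- D * x))"
      by (cases "x \<ge> 0") auto
  qed
qed auto

section \<open>Gaussian vectors and the Cameron-Martin formula\<close>

abbreviation gauss :: "'k set \<Rightarrow> ('k \<Rightarrow> real) measure" where
  "gauss K \<equiv> (\<Pi>\<^sub>M k\<in>K. std_normal)"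

interpretation gauss: product_prob_space "\<lambda>_. std_normal" UNIV
  by unfold_locales

lemma prob_space_gauss: "prob_space (gauss K)"
  by (rule prob_space_PiM) (rule std_normal.prob_space_axioms)

lemma measurable_gauss_cong: "sets (gauss K) = sets (\<Pi>\<^sub>M k\<in>K. borel)"
  by (intro sets_PiM_cong) auto

lemma integrable_gauss_exp:
  assumes "finite K"
  shows "integrable (gauss K) (\<lambda>w. exp (D * (\<Sum>k\<in>K. \<bar>w k\<bar>)))"
proof -
  have "integrable (gauss K) (\<lambda>w. \<Prod>k\<in>K. exp (D * \<bar>w k\<bar>))"
    by (rule gauss.product_integrable_prod[OF assms]) (rule integrable_std_normal_exp_abs)
  then show ?thesis using assms by (simp add: exp_sum sum_distrib_left)
qed

text \<open>Adding a signal \<open>c\<close> to the noise reweights pure noise by the exponential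
  factor that recurs below as \<open>exp (ener c w x)\<close>. This is how planted expectations
  become expectations under pure noise.\<close>

lemma nn_integral_gauss_shift:
  fixes f :: "('k \<Rightarrow> real) \<Rightarrow> ennreal"
  assumes "finite K" "f \<in> borel_measurable (gauss K)"
  shows "(\<integral>\<^sup>+w. f (\<lambda>k\<in>K. w k + c k) \<partial>gauss K)
       = (\<integral>\<^sup>+w. exp (\<Sum>k\<in>K. c k * w k - (c k)\<^sup>2 / 2) * f w \<partial>gauss K)"
  using assms
proof (induction K arbitrary: f rule: finite_induct)
  case empty
  then show ?case
    by (simp add: PiM_empty nn_integral_count_space_finite restrict_def)
next
  case (insert i K)
  note [measurable] = insert.prems
  have ext: "w(i := y) \<in> space (gauss (insert i K))" if "w \<in> space (gauss K)" for w y
    using that by (auto simp: space_PiM PiE_def extensional_def)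
  have shift: "(\<lambda>k\<in>insert i K. (w(i := y)) k + c k) = (\<lambda>k\<in>K. w k + c k)(i := y + c i)" for w y
    using insert.hyps by (auto simp: fun_eq_iff)
  have upd[measurable]: "(\<lambda>y. f (w(i := y))) \<in> borel_measurable borel" if "w \<in> space (gauss K)" for w
    using measurable_comp[OF measurable_component_update[OF that insert.hyps(2)] insert.prems]
    by (simp add: comp_def)
  have res: "(\<lambda>k\<in>K. w k + c k) \<in> space (gauss K)" for w
    by (auto simp: space_PiM)
  have [measurable]: "(\<lambda>(w, y). f (w(i := y))) \<in> borel_measurable (gauss K \<Otimes>\<^sub>M std_normal)"
    by measurable
  have meas: "(\<lambda>w. \<integral>\<^sup>+y. f (w(i := y + c i)) \<partial>std_normal) \<in> borel_measurable (gauss K)"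
    by measurable
  have "(\<integral>\<^sup>+w. f (\<lambda>k\<in>insert i K. w k + c k) \<partial>gauss (insert i K))
      = (\<integral>\<^sup>+w. \<integral>\<^sup>+y. f (\<lambda>k\<in>insert i K. (w(i := y)) k + c k) \<partial>std_normal \<partial>gauss K)"
    by (rule gauss.product_nn_integral_insert[OF insert.hyps]) measurable
  also have "\<dots> = (\<integral>\<^sup>+w. \<integral>\<^sup>+y. f ((\<lambda>k\<in>K. w k + c k)(i := y + c i)) \<partial>std_normal \<partial>gauss K)"
    by (simp only: shift)
  also have "\<dots> = (\<integral>\<^sup>+w. exp (\<Sum>k\<in>K. c k * w k - (c k)\<^sup>2 / 2) * (\<integral>\<^sup>+y. f (w(i := y + c i)) \<partial>std_normal) \<partial>gauss K)"
    by (rule insert.IH[OF meas])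
  also have "\<dots> = (\<integral>\<^sup>+w. exp (\<Sum>k\<in>K. c k * w k - (c k)\<^sup>2 / 2) * (\<integral>\<^sup>+y. exp (c i * y - (c i)\<^sup>2 / 2) * f (w(i := y)) \<partial>std_normal) \<partial>gauss K)"
    by (intro nn_integral_cong) (simp add: nn_integral_std_normal_shift[where f = "\<lambda>y. f (_(i := y))"] upd)
  also have "\<dots> = (\<integral>\<^sup>+w. \<integral>\<^sup>+y. exp (\<Sum>k\<in>insert i K. c k * (w(i := y)) k - (c k)\<^sup>2 / 2) * f (w(i := y)) \<partial>std_normal \<partial>gauss K)"
  proof (intro nn_integral_cong, subst nn_integral_cmult[symmetric])
    fix w assume w: "w \<in> space (gauss K)"
    show "(\<lambda>y. ennreal (exp (c i * y - (c i)\<^sup>2 / 2)) * f (w(i := y))) \<in> borel_measurable std_normal"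
      using upd[OF w] by measurable
    have s: "(\<Sum>k\<in>K. c k * (if k = i then y else w k) - (c k)\<^sup>2 / 2) = (\<Sum>k\<in>K. c k * w k - (c k)\<^sup>2 / 2)" for y
      using insert.hyps by (intro sum.cong) auto
    show "(\<integral>\<^sup>+y. ennreal (exp (\<Sum>k\<in>K. c k * w k - (c k)\<^sup>2 / 2)) * (ennreal (exp (c i * y - (c i)\<^sup>2 / 2)) * f (w(i := y))) \<partial>std_normal)
        = (\<integral>\<^sup>+y. ennreal (exp (\<Sum>k\<in>insert i K. c k * (w(i := y)) k - (c k)\<^sup>2 / 2)) * f (w(i := y)) \<partial>std_normal)"
      using insert.hyps
      by (intro nn_integral_cong)
         (simp add: s mult.assoc[symmetric] ennreal_mult'[symmetric] exp_add[symmetric] add.commute)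
  qed
  also have "\<dots> = (\<integral>\<^sup>+w. exp (\<Sum>k\<in>insert i K. c k * w k - (c k)\<^sup>2 / 2) * f w \<partial>gauss (insert i K))"
    by (rule gauss.product_nn_integral_insert[OF insert.hyps, symmetric]) measurable
  finally show ?case .
qed

lemma distr_gauss_shift:
  assumes "finite K"
  shows "distr (gauss K) (gauss K) (\<lambda>w. \<lambda>k\<in>K. w k + c k)
       = density (gauss K) (\<lambda>w. exp (\<Sum>k\<in>K. c k * w k - (c k)\<^sup>2 / 2))"
proof (rule measure_eqI)
  fix A assume "A \<in> sets (distr (gauss K) (gauss K) (\<lambda>w. \<lambda>k\<in>K. w k + c k))"
  then have [measurable]: "A \<in> sets (gauss K)" by simp
  have "emeasure (distr (gauss K) (gauss K) (\<lambda>w. \<lambda>k\<in>K. w k + c k)) A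
      = (\<integral>\<^sup>+w. indicator A (\<lambda>k\<in>K. w k + c k) \<partial>gauss K)"
    by (subst emeasure_distr) (auto simp flip: nn_integral_indicator simp: indicator_def intro!: nn_integral_cong)
  also have "\<dots> = emeasure (density (gauss K) (\<lambda>w. exp (\<Sum>k\<in>K. c k * w k - (c k)\<^sup>2 / 2))) A"
    by (subst nn_integral_gauss_shift[OF assms, where f = "indicator A"]) (auto simp: emeasure_density)
  finally show "emeasure (distr (gauss K) (gauss K) (\<lambda>w. \<lambda>k\<in>K. w k + c k)) A
    = emeasure (density (gauss K) (\<lambda>w. exp (\<Sum>k\<in>K. c k * w k - (c k)\<^sup>2 / 2))) A" .
qed simp

lemma integral_gauss_shift:
  fixes f :: "_ \<Rightarrow> real"
  assumes "finite K" and [measurable]: "f \<in> borel_measurable (gauss K)"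
  shows "(\<integral>w. f (\<lambda>k\<in>K. w k + c k) \<partial>gauss K)
       = (\<integral>w. exp (\<Sum>k\<in>K. c k * w k - (c k)\<^sup>2 / 2) * f w \<partial>gauss K)"
proof -
  have "(\<integral>w. f (\<lambda>k\<in>K. w k + c k) \<partial>gauss K) = (\<integral>w. f w \<partial>distr (gauss K) (gauss K) (\<lambda>w. \<lambda>k\<in>K. w k + c k))"
    by (subst integral_distr) auto
  also have "\<dots> = (\<integral>w. exp (\<Sum>k\<in>K. c k * w k - (c k)\<^sup>2 / 2) * f w \<partial>gauss K)"
    unfolding distr_gauss_shift[OF assms(1)] by (subst integral_density) auto
  finally show ?thesis .
qed

section \<open>Gaussian interpolation\<close>

text \<open>A class closed under sums and products whose measurable members are integrable against
  \<open>gauss K\<close>. The bound is uniform over \<open>t\<close> in \<open>I\<close>, so it also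
  provides the majorant for differentiating in \<open>t\<close>; using the same \<open>D\<close> as
  prefactor and as rate leaves one constant to carry.\<close>

definition subexp :: "'k set \<Rightarrow> 't set \<Rightarrow> ('t \<Rightarrow> ('k \<Rightarrow> real) \<Rightarrow> real) \<Rightarrow> bool" where
  "subexp K I F \<longleftrightarrow> (\<exists>D\<ge>0. \<forall>t\<in>I. \<forall>w. \<bar>F t w\<bar> \<le> D * exp (D * (\<Sum>k\<in>K. \<bar>w k\<bar>)))"

lemma subexpE:
  assumes "subexp K I F"
  obtains D where "D \<ge> 0" "\<And>t w. t \<in> I \<Longrightarrow> \<bar>F t w\<bar> \<le> D * exp (D * (\<Sum>k\<in>K. \<bar>w k\<bar>))"
  using assms unfolding subexp_def by blast

lemma subexpI_exp:
  assumes "D \<ge> 0" "\<And>t w. t \<in> I \<Longrightarrow> \<bar>F t w\<bar> \<le> D * exp (C * (\<Sum>k\<in>K. \<bar>w k\<bar>))"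
  shows "subexp K I F"
  unfolding subexp_def
proof (intro exI[of _ "max D C"] conjI ballI allI)
  fix t w assume "t \<in> I"
  have "D * exp (C * (\<Sum>k\<in>K. \<bar>w k\<bar>)) \<le> max D C * exp (max D C * (\<Sum>k\<in>K. \<bar>w k\<bar>))"
    using assms(1) by (intro mult_mono) (auto intro!: mult_right_mono sum_nonneg)
  with assms(2)[OF \<open>t \<in> I\<close>, of w] show "\<bar>F t w\<bar> \<le> max D C * exp (max D C * (\<Sum>k\<in>K. \<bar>w k\<bar>))"
    by linarith
qed (use assms(1) in auto)

lemma subexp_bounded: "(\<And>t w. t \<in> I \<Longrightarrow> \<bar>F t w\<bar> \<le> L) \<Longrightarrow> subexp K I F"
  by (rule subexpI_exp[of "max L 0" _ _ 0]) (auto simp: le_max_iff_disj)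

lemma subexp_coord:
  assumes "finite K" "k \<in> K"
  shows "subexp K I (\<lambda>t w. w k)"
proof (rule subexpI_exp[of 1 _ _ 1])
  fix w :: "'a \<Rightarrow> real"
  have "\<bar>w k\<bar> \<le> (\<Sum>k\<in>K. \<bar>w k\<bar>)" using assms by (intro member_le_sum) auto
  also have "\<dots> \<le> exp (\<Sum>k\<in>K. \<bar>w k\<bar>)" using exp_ge_add_one_self[of "\<Sum>k\<in>K. \<bar>w k\<bar>"] by linarith
  finally show "\<bar>w k\<bar> \<le> 1 * exp (1 * (\<Sum>k\<in>K. \<bar>w k\<bar>))" by simp
qed simp

lemma subexp_add:
  assumes "subexp K I F" "subexp K I G"
  shows "subexp K I (\<lambda>t w. F t w + G t w)"
proof -
  obtain D where D: "D \<ge> 0" "\<And>t w. t \<in> I \<Longrightarrow> \<bar>F t w\<bar> \<le> D * exp (D * (\<Sum>k\<in>K. \<bar>w k\<bar>))"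
    using assms(1) unfolding subexp_def by blast
  obtain E where E: "E \<ge> 0" "\<And>t w. t \<in> I \<Longrightarrow> \<bar>G t w\<bar> \<le> E * exp (E * (\<Sum>k\<in>K. \<bar>w k\<bar>))"
    using assms(2) unfolding subexp_def by blast
  show ?thesis
  proof (rule subexpI_exp[of "D + E" _ _ "D + E"])
    fix t and w :: "_ \<Rightarrow> real" assume t: "t \<in> I"
    let ?s = "\<Sum>k\<in>K. \<bar>w k\<bar>"
    have s: "?s \<ge> 0" by (intro sum_nonneg) auto
    have "D * exp (D * ?s) \<le> D * exp ((D + E) * ?s)" "E * exp (E * ?s) \<le> E * exp ((D + E) * ?s)"
      using D(1) E(1) s by (auto intro!: mult_left_mono mult_right_mono)
    then show "\<bar>F t w + G t w\<bar> \<le> (D + E) * exp ((D + E) * ?s)"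
      using D(2)[OF t, of w] E(2)[OF t, of w] by (simp add: distrib_right)
  qed (use D E in auto)
qed

lemma subexp_mult:
  assumes "subexp K I F" "subexp K I G"
  shows "subexp K I (\<lambda>t w. F t w * G t w)"
proof -
  obtain D where D: "D \<ge> 0" "\<And>t w. t \<in> I \<Longrightarrow> \<bar>F t w\<bar> \<le> D * exp (D * (\<Sum>k\<in>K. \<bar>w k\<bar>))"
    using assms(1) unfolding subexp_def by blast
  obtain E where E: "E \<ge> 0" "\<And>t w. t \<in> I \<Longrightarrow> \<bar>G t w\<bar> \<le> E * exp (E * (\<Sum>k\<in>K. \<bar>w k\<bar>))"
    using assms(2) unfolding subexp_def by blast
  show ?thesis
  proof (rule subexpI_exp[of "D * E" _ _ "D + E"])
    fix t and w :: "_ \<Rightarrow> real" assume t: "t \<in> I"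
    let ?s = "\<Sum>k\<in>K. \<bar>w k\<bar>"
    have "\<bar>F t w * G t w\<bar> \<le> (D * exp (D * ?s)) * (E * exp (E * ?s))"
      unfolding abs_mult using D(2)[OF t, of w] E(2)[OF t, of w] D(1) by (intro mult_mono) auto
    then show "\<bar>F t w * G t w\<bar> \<le> D * E * exp ((D + E) * ?s)"
      by (simp add: distrib_right exp_add mult_ac)
  qed (use D E in auto)
qed

lemma subexp_const_mult: "subexp K I F \<Longrightarrow> subexp K I (\<lambda>t w. a * F t w)"
  by (rule subexp_mult[OF subexp_bounded[of _ _ "\<bar>a\<bar>"]]) auto

lemma subexp_diff: "subexp K I F \<Longrightarrow> subexp K I G \<Longrightarrow> subexp K I (\<lambda>t w. F t w - G t w)"
  using subexp_add[OF _ subexp_const_mult[of K I G "-1"]] by simp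

lemma subexp_sum:
  assumes "finite J" "\<And>j. j \<in> J \<Longrightarrow> subexp K I (F j)"
  shows "subexp K I (\<lambda>t w. \<Sum>j\<in>J. F j t w)"
  using assms by (induction J rule: finite_induct) (auto intro: subexp_bounded[of _ _ 0] subexp_add)

lemma subexp_power: "subexp K I F \<Longrightarrow> subexp K I (\<lambda>t w. F t w ^ n)"
  by (induction n) (auto intro: subexp_bounded[of _ _ 1] subexp_mult)

lemma subexp_mono_abs:
  assumes "subexp K I G" "\<And>t w. t \<in> I \<Longrightarrow> \<bar>F t w\<bar> \<le> \<bar>G t w\<bar>"
  shows "subexp K I F"
  using assms unfolding subexp_def by (meson order_trans)

lemma integrable_subexp:
  assumes "finite K" "subexp K I F" "t \<in> I" "F t \<in> borel_measurable (gauss K)"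
  shows "integrable (gauss K) (F t)"
proof -
  obtain D where D: "D \<ge> 0" "\<And>t w. t \<in> I \<Longrightarrow> \<bar>F t w\<bar> \<le> D * exp (D * (\<Sum>k\<in>K. \<bar>w k\<bar>))"
    using assms(2) unfolding subexp_def by blast
  show ?thesis
    by (rule Bochner_Integration.integrable_bound[of _ "\<lambda>w. D * exp (D * (\<Sum>k\<in>K. \<bar>w k\<bar>))"])
       (use assms D in \<open>auto intro!: integrable_gauss_exp\<close>)
qed

text \<open>Both sides are the derivative at 0 of the integral of \<open>F\<close> shifted by
  \<open>t\<close> in coordinate \<open>k\<close>: once by differentiating inside, once after the
  shift has become the weight exp(t w_k - t^2/2). Boundary terms never appear. The unit index set in
  \<open>subexp\<close> stands for the absence of a parameter.\<close>

lemma gauss_integration_by_parts: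
  assumes fin: "finite K" and k: "k \<in> K"
    and der: "\<And>w y. ((\<lambda>s. F (w(k := s))) has_real_derivative F' (w(k := y))) (at y)"
    and sF: "subexp K (UNIV::unit set) (\<lambda>_. F)" and sF': "subexp K (UNIV::unit set) (\<lambda>_. F')"
    and [measurable]: "F \<in> borel_measurable (gauss K)" "F' \<in> borel_measurable (gauss K)"
  shows "(\<integral>w. w k * F w \<partial>gauss K) = (\<integral>w. F' w \<partial>gauss K)"
proof -
  define sh where "sh t w = (\<lambda>j\<in>K. w j + (if j = k then t else 0))" for t :: real and w :: "'a \<Rightarrow> real"
  have sh: "sh t w = w(k := w k + t)" if "w \<in> space (gauss K)" for t w
    using that k by (auto simp: sh_def fun_eq_iff space_PiM PiE_def extensional_def)
  have [measurable]: "sh t \<in> gauss K \<rightarrow>\<^sub>M gauss K" for t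
    unfolding sh_def by measurable
  have [measurable]: "(\<lambda>w. w k) \<in> borel_measurable (gauss K)"
    using measurable_component_singleton[OF k, of "\<lambda>_. std_normal"] by simp
  obtain D where D: "D \<ge> 0" "\<And>w. \<bar>F w\<bar> \<le> D * exp (D * (\<Sum>k\<in>K. \<bar>w k\<bar>))"
    using sF by (auto elim: subexpE)
  obtain D' where D': "D' \<ge> 0" "\<And>w. \<bar>F' w\<bar> \<le> D' * exp (D' * (\<Sum>k\<in>K. \<bar>w k\<bar>))"
    using sF' by (auto elim: subexpE)
  have nrm: "(\<Sum>j\<in>K. \<bar>(w(k := w k + t)) j\<bar>) \<le> (\<Sum>j\<in>K. \<bar>w j\<bar>) + 1" if "\<bar>t\<bar> < 1" for w and t :: real
  proof -
    have "(\<Sum>j\<in>K. \<bar>(w(k := w k + t)) j\<bar>) \<le> (\<Sum>j\<in>K. \<bar>w j\<bar> + (if j = k then 1 else 0))"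
      using that by (intro sum_mono) auto
    also have "\<dots> = (\<Sum>j\<in>K. \<bar>w j\<bar>) + 1"
      using fin k by (simp add: sum.distrib)
    finally show ?thesis .
  qed
  have bnd: "C * exp (C * (\<Sum>j\<in>K. \<bar>(w(k := w k + t)) j\<bar>)) \<le> C * exp C * exp (C * (\<Sum>j\<in>K. \<bar>w j\<bar>))"
    if "\<bar>t\<bar> < 1" "C \<ge> 0" for C t :: real and w
  proof -
    have "exp (C * (\<Sum>j\<in>K. \<bar>(w(k := w k + t)) j\<bar>)) \<le> exp (C * ((\<Sum>j\<in>K. \<bar>w j\<bar>) + 1))"
      using nrm[OF that(1), of w] that(2) by (auto intro: mult_left_mono)
    then show ?thesis using that(2)
      by (simp add: distrib_left exp_add mult_ac mult_left_mono)
  qed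
  have iE: "integrable (gauss K) (\<lambda>w. C * exp (C' * (\<Sum>j\<in>K. \<bar>w j\<bar>)))" for C C'
    using integrable_gauss_exp[OF fin] by simp
  have 1: "((\<lambda>t. \<integral>w. F (sh t w) \<partial>gauss K) has_real_derivative (\<integral>w. F' (sh 0 w) \<partial>gauss K)) (at 0)"
  proof (rule has_real_derivative_integral[of 1 _ _ _ _ "\<lambda>w. D' * exp D' * exp (D' * (\<Sum>j\<in>K. \<bar>w j\<bar>))"])
    fix t :: real and w assume t: "\<bar>t - 0\<bar> < 1" and w: "w \<in> space (gauss K)"
    have "((\<lambda>s. F (w(k := w k + s))) has_real_derivative F' (w(k := w k + t))) (at t)"
      using der[of w "t + w k"] DERIV_shift[of "\<lambda>s. F (w(k := s))" _ t "w k"] by (simp add: add.commute)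
    then show "((\<lambda>s. F (sh s w)) has_real_derivative F' (sh t w)) (at t)"
      by (simp add: sh[OF w])
    show "\<bar>F' (sh t w)\<bar> \<le> D' * exp D' * exp (D' * (\<Sum>j\<in>K. \<bar>w j\<bar>))"
      unfolding sh[OF w] using D'(2)[of "w(k := w k + t)"] bnd[of t D' w] D'(1) t by auto
  next
    fix t :: real assume t: "\<bar>t - 0\<bar> < 1"
    show "integrable (gauss K) (\<lambda>w. F (sh t w))"
    proof (rule Bochner_Integration.integrable_bound[OF iE[of "D * exp D" D]])
      show "AE w in gauss K. norm (F (sh t w)) \<le> norm (D * exp D * exp (D * (\<Sum>j\<in>K. \<bar>w j\<bar>)))"
      proof (rule AE_I2)
        fix w assume w: "w \<in> space (gauss K)"
        show "norm (F (sh t w)) \<le> norm (D * exp D * exp (D * (\<Sum>j\<in>K. \<bar>w j\<bar>)))"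
          unfolding sh[OF w] using D(2)[of "w(k := w k + t)"] bnd[of t D w] D(1) t by auto
      qed
    qed measurable
  qed (use iE in auto)
  have se: "(\<Sum>j\<in>K. (if j = k then t else 0) * w j - (if j = k then t else 0)\<^sup>2 / 2) = t * w k - t\<^sup>2 / 2" for t :: real and w
  proof -
    have "(\<Sum>j\<in>K. (if j = k then t else 0) * w j - (if j = k then t else 0)\<^sup>2 / 2)
        = (\<Sum>j\<in>K. if j = k then t * w k - t\<^sup>2 / 2 else 0)" by (intro sum.cong) auto
    then show ?thesis using fin k by simp
  qed
  \<comment> \<open>After the change of measure the parameter sits only in a smooth weight, whose
    derivative at 0 is \<open>w k\<close>.\<close>
  have 2: "(\<integral>w. F (sh t w) \<partial>gauss K) = (\<integral>w. exp (t * w k - t\<^sup>2 / 2) * F w \<partial>gauss K)" for t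
    unfolding sh_def by (subst integral_gauss_shift[OF fin]) (auto simp: se)
  have ebd: "exp (t * w k - t\<^sup>2 / 2) \<le> exp (\<Sum>j\<in>K. \<bar>w j\<bar>)" if "\<bar>t\<bar> < 1" for t :: real and w
  proof -
    have "t * w k \<le> \<bar>t\<bar> * \<bar>w k\<bar>" by (metis abs_ge_self abs_mult)
    also have "\<dots> \<le> 1 * \<bar>w k\<bar>" using that by (intro mult_right_mono) auto
    also have "\<dots> \<le> (\<Sum>j\<in>K. \<bar>w j\<bar>)" using fin k member_le_sum[of k K "\<lambda>j. \<bar>w j\<bar>"] by auto
    also have "\<dots> \<le> (\<Sum>j\<in>K. \<bar>w j\<bar>) + t\<^sup>2 / 2" by simp
    finally show ?thesis by (simp add: algebra_simps)
  qed
  have s1: "subexp K {t. \<bar>t\<bar> < 1} (\<lambda>t w. exp (t * w k - t\<^sup>2 / 2))"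
    by (rule subexpI_exp[of 1 _ _ 1]) (use ebd in auto)
  have s2: "subexp K {t. \<bar>t\<bar> < 1} (\<lambda>t w. exp (t * w k - t\<^sup>2 / 2) * F w)"
    by (rule subexp_mult[OF s1 subexpI_exp[of D _ _ D]]) (use D in auto)
  have "subexp K {t::real. \<bar>t\<bar> < 1} (\<lambda>t w. w k - t)"
    by (rule subexp_diff[OF subexp_coord[OF fin k] subexp_bounded[of _ _ 1]]) auto
  from subexp_mult[OF this s2]
  have s3: "subexp K {t. \<bar>t\<bar> < 1} (\<lambda>t w. (w k - t) * (exp (t * w k - t\<^sup>2 / 2) * F w))" .
  then obtain E where E: "E \<ge> 0" "\<And>t w. t \<in> {t. \<bar>t\<bar> < 1} \<Longrightarrow> \<bar>(w k - t) * (exp (t * w k - t\<^sup>2 / 2) * F w)\<bar> \<le> E * exp (E * (\<Sum>k\<in>K. \<bar>w k\<bar>))"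
    unfolding subexp_def by blast
  have 3: "((\<lambda>t. \<integral>w. exp (t * w k - t\<^sup>2 / 2) * F w \<partial>gauss K) has_real_derivative
      (\<integral>w. (w k - 0) * (exp (0 * w k - 0\<^sup>2 / 2) * F w) \<partial>gauss K)) (at 0)"
  proof (rule has_real_derivative_integral[of 1 _ _ _ "\<lambda>t w. (w k - t) * (exp (t * w k - t\<^sup>2 / 2) * F w)"
          "\<lambda>w. E * exp (E * (\<Sum>k\<in>K. \<bar>w k\<bar>))"])
    fix t :: real assume "\<bar>t - 0\<bar> < 1"
    then show "integrable (gauss K) (\<lambda>w. exp (t * w k - t\<^sup>2 / 2) * F w)"
      by (intro integrable_subexp[OF fin s2]) auto
    fix w
    show "((\<lambda>t. exp (t * w k - t\<^sup>2 / 2) * F w) has_real_derivative (w k - t) * (exp (t * w k - t\<^sup>2 / 2) * F w)) (at t)"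
      by (auto intro!: derivative_eq_intros simp: algebra_simps)
    show "\<bar>(w k - t) * (exp (t * w k - t\<^sup>2 / 2) * F w)\<bar> \<le> E * exp (E * (\<Sum>k\<in>K. \<bar>w k\<bar>))"
      using E(2)[of t w] \<open>\<bar>t - 0\<bar> < 1\<close> by simp
  qed (use iE in auto)
  have "(\<integral>w. F' (sh 0 w) \<partial>gauss K) = (\<integral>w. F' w \<partial>gauss K)"
    by (intro Bochner_Integration.integral_cong) (auto simp: sh)
  with DERIV_unique[OF 1[unfolded 2] 3] show ?thesis by simp
qed

section \<open>Mixtures of exponential weights and their interpolation derivative\<close>

text \<open>The chain rule along arbitrary curves with positive second component. It is applied
  along the interpolation time and along a single noise coordinate.\<close>

definition has_partials :: "(real \<Rightarrow> real \<Rightarrow> real) \<Rightarrow> (real \<Rightarrow> real \<Rightarrow> real) \<Rightarrow> (real \<Rightarrow> real \<Rightarrow> real) \<Rightarrow> bool" where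
  "has_partials g g1 g2 \<longleftrightarrow> (\<forall>\<alpha> \<beta> \<alpha>' \<beta>' t.
     (\<alpha> has_real_derivative \<alpha>') (at t) \<longrightarrow> (\<beta> has_real_derivative \<beta>') (at t) \<longrightarrow> \<beta> t > 0 \<longrightarrow>
     ((\<lambda>s. g (\<alpha> s) (\<beta> s)) has_real_derivative (g1 (\<alpha> t) (\<beta> t) * \<alpha>' + g2 (\<alpha> t) (\<beta> t) * \<beta>')) (at t))"

text \<open>Only pairs with \<open>\<bar>a\<bar> \<le> L * f\<close> occur, because \<open>a\<close>
  is the mixture of a function bounded by \<open>L\<close> and \<open>f\<close> is the partition
  function. Singularities at f = 0 are harmless, since 1 / \<open>part\<close> is in the growth
  class as well.\<close>

definition tame :: "real \<Rightarrow> (real \<Rightarrow> real \<Rightarrow> real) \<Rightarrow> bool" where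
  "tame L g \<longleftrightarrow> case_prod g \<in> borel_measurable borel \<and>
     (\<exists>D\<ge>0. \<exists>p::nat. \<forall>a f. f > 0 \<longrightarrow> \<bar>a\<bar> \<le> L * f \<longrightarrow> \<bar>g a f\<bar> \<le> D * (f ^ p + (1 / f) ^ p))"

text \<open>Each index \<open>k\<close> is one scalar Gaussian observation of the feature
  \<open>S k\<close>. \<open>M\<close> is a finite measure rather than a probability, since the
  Gaussian comparison later uses a tilted, unnormalised prior. Bounds hold at every
  \<open>x\<close>, not just almost surely, which keeps all majorants pointwise.\<close>

locale gibbs = finite_measure M for M :: "'x measure" +
  fixes K :: "'k set" and S :: "'k \<Rightarrow> 'x \<Rightarrow> real" and B :: real
  assumes finite_K: "finite K"
    and S_measurable[measurable]: "\<And>k. k \<in> K \<Longrightarrow> S k \<in> borel_measurable M"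
    and S_bounded: "\<And>k x. k \<in> K \<Longrightarrow> \<bar>S k x\<bar> \<le> B"
    and nontrivial: "emeasure M (space M) \<noteq> 0"
begin

text \<open>The log-likelihood ratio of the signal \<open>x\<close> against pure noise; its
  quadratic term gives the exponential weight mean one.\<close>

definition ener :: "('k \<Rightarrow> real) \<Rightarrow> ('k \<Rightarrow> real) \<Rightarrow> 'x \<Rightarrow> real" where
  "ener c w x = (\<Sum>k\<in>K. c k * w k * S k x - (c k)\<^sup>2 * (S k x)\<^sup>2 / 2)"

definition mix :: "('k \<Rightarrow> real) \<Rightarrow> ('k \<Rightarrow> real) \<Rightarrow> ('x \<Rightarrow> real) \<Rightarrow> real" where
  "mix c w T = (\<integral>x. T x * exp (ener c w x) \<partial>M)"

abbreviation part :: "('k \<Rightarrow> real) \<Rightarrow> ('k \<Rightarrow> real) \<Rightarrow> real" where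
  "part c w \<equiv> mix c w (\<lambda>_. 1)"

definition bm :: "('x \<Rightarrow> real) \<Rightarrow> bool" where
  "bm T \<longleftrightarrow> T \<in> borel_measurable M \<and> (\<exists>L. \<forall>x. \<bar>T x\<bar> \<le> L)"

lemma bmI: "T \<in> borel_measurable M \<Longrightarrow> (\<And>x. \<bar>T x\<bar> \<le> L) \<Longrightarrow> bm T"
  unfolding bm_def by blast

lemma bmE:
  assumes "bm T"
  obtains L where "T \<in> borel_measurable M" "L \<ge> 0" "\<And>x. \<bar>T x\<bar> \<le> L"
proof -
  from assms obtain L where T: "T \<in> borel_measurable M" and L: "\<And>x. \<bar>T x\<bar> \<le> L"
    unfolding bm_def by blast
  have "L \<ge> 0" using L[of undefined] by linarith
  from that[OF T this L] show thesis .
qed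

lemma bm_const: "bm (\<lambda>_. a)"
  by (rule bmI[of _ "\<bar>a\<bar>"]) auto

lemma bm_S: "k \<in> K \<Longrightarrow> bm (S k)"
  by (rule bmI[of _ B]) (auto simp: S_bounded)

lemma bm_mult:
  assumes "bm T" "bm U" shows "bm (\<lambda>x. T x * U x)"
proof -
  obtain L where L: "T \<in> borel_measurable M" "L \<ge> 0" "\<And>x. \<bar>T x\<bar> \<le> L" using assms(1) by (rule bmE) blast
  obtain L' where L': "U \<in> borel_measurable M" "L' \<ge> 0" "\<And>x. \<bar>U x\<bar> \<le> L'" using assms(2) by (rule bmE) blast
  show ?thesis
    by (rule bmI[of _ "L * L'"]) (use L L' in \<open>auto simp: abs_mult intro!: mult_mono\<close>)
qed

lemma bm_power: assumes "bm T" shows "bm (\<lambda>x. T x ^ n)"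
proof (induction n)
  case 0 show ?case using bm_const[of 1] by simp
next
  case (Suc n) show ?case using bm_mult[OF assms Suc] by simp
qed

lemma measurable_ener[measurable]: "ener c w \<in> borel_measurable M"
  unfolding ener_def by measurable

lemma ener_bound:
  assumes "\<forall>k\<in>K. \<bar>c k\<bar> \<le> L"
  shows "\<bar>ener c w x\<bar> \<le> \<bar>L * B\<bar> * (\<Sum>k\<in>K. \<bar>w k\<bar>) + card K * (\<bar>L * B\<bar>)\<^sup>2"
proof -
  have "\<bar>c k * w k * S k x - (c k)\<^sup>2 * (S k x)\<^sup>2 / 2\<bar> \<le> \<bar>L * B\<bar> * \<bar>w k\<bar> + (\<bar>L * B\<bar>)\<^sup>2" if "k \<in> K" for k
  proof -
    have cs: "\<bar>c k * S k x\<bar> \<le> \<bar>L * B\<bar>"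
      unfolding abs_mult using bspec[OF assms that] S_bounded[OF that, of x] by (intro mult_mono) auto
    then have "(c k * S k x)\<^sup>2 \<le> (\<bar>L * B\<bar>)\<^sup>2" by (metis abs_le_square_iff abs_abs)
    moreover have "\<bar>c k * S k x\<bar> * \<bar>w k\<bar> \<le> \<bar>L * B\<bar> * \<bar>w k\<bar>" using cs by (intro mult_right_mono) auto
    moreover have "\<bar>(c k * S k x) * w k\<bar> = \<bar>c k * S k x\<bar> * \<bar>w k\<bar>" by (rule abs_mult)
    moreover have "c k * w k * S k x - (c k)\<^sup>2 * (S k x)\<^sup>2 / 2 = (c k * S k x) * w k - (c k * S k x)\<^sup>2 / 2"
      by (simp add: power_mult_distrib)
    moreover have "\<bar>a - b / 2\<bar> \<le> \<bar>a\<bar> + b" if "b \<ge> 0" for a b :: real using that by linarith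
    ultimately show ?thesis
      by (smt (verit) zero_le_power2)
  qed
  then have "\<bar>ener c w x\<bar> \<le> (\<Sum>k\<in>K. \<bar>L * B\<bar> * \<bar>w k\<bar> + (\<bar>L * B\<bar>)\<^sup>2)"
    unfolding ener_def by (intro order_trans[OF sum_abs] sum_mono) auto
  then show ?thesis by (simp add: sum.distrib sum_distrib_left)
qed

definition cst :: "real \<Rightarrow> real" where "cst L = \<bar>L * B\<bar> + card K * (\<bar>L * B\<bar>)\<^sup>2"

lemma cst_nonneg: "cst L \<ge> 0" by (simp add: cst_def)

lemma ener_bound':
  assumes "\<forall>k\<in>K. \<bar>c k\<bar> \<le> L"
  shows "\<bar>ener c w x\<bar> \<le> cst L + cst L * (\<Sum>k\<in>K. \<bar>w k\<bar>)"
proof -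
  have "\<bar>L * B\<bar> * (\<Sum>k\<in>K. \<bar>w k\<bar>) \<le> cst L * (\<Sum>k\<in>K. \<bar>w k\<bar>)"
    unfolding cst_def by (intro mult_right_mono sum_nonneg) auto
  moreover have "card K * (\<bar>L * B\<bar>)\<^sup>2 \<le> cst L" by (simp add: cst_def)
  ultimately show ?thesis using ener_bound[OF assms, where w = w and x = x] by linarith
qed

lemma ex_bound: "\<exists>L. \<forall>k\<in>K. \<bar>c k\<bar> \<le> (L::real)"
  using finite_K by (intro exI[of _ "\<Sum>k\<in>K. \<bar>c k\<bar>"]) (auto intro: member_le_sum)

lemma integrable_mix:
  assumes "bm T" shows "integrable M (\<lambda>x. T x * exp (ener c w x))"
proof -
  obtain L where L: "\<forall>k\<in>K. \<bar>c k\<bar> \<le> L" using ex_bound by blast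
  obtain L' where L'[measurable]: "T \<in> borel_measurable M" and "L' \<ge> 0" "\<And>x. \<bar>T x\<bar> \<le> L'"
    using assms by (rule bmE) blast
  let ?e = "cst L + cst L * (\<Sum>k\<in>K. \<bar>w k\<bar>)"
  show ?thesis
  proof (rule integrable_const_bound[of _ "L' * exp ?e"])
    have "ener c w x \<le> ?e" for x using ener_bound'[where c = c, OF L, where w = w and x = x] by linarith
    then show "AE x in M. norm (T x * exp (ener c w x)) \<le> L' * exp ?e"
      using \<open>\<And>x. \<bar>T x\<bar> \<le> L'\<close> \<open>L' \<ge> 0\<close> by (auto simp: abs_mult intro!: mult_mono)
  qed measurable
qed

lemma mix_mult_const: "mix c w (\<lambda>x. a * T x) = a * mix c w T"
  by (simp add: mix_def mult.assoc)

lemma mix_mono: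
  assumes "bm T" "bm U" "\<And>x. x \<in> space M \<Longrightarrow> T x \<le> U x" shows "mix c w T \<le> mix c w U"
  unfolding mix_def using assms by (intro integral_mono integrable_mix) (auto intro: mult_right_mono)

lemma mix_abs_le:
  assumes "bm T" "\<And>x. \<bar>T x\<bar> \<le> L" shows "\<bar>mix c w T\<bar> \<le> L * part c w"
proof -
  have *: "T x \<le> L * 1" "- L * 1 \<le> T x" for x using assms(2)[of x] by auto
  have "mix c w T \<le> mix c w (\<lambda>x. L * 1)" "mix c w (\<lambda>x. - L * 1) \<le> mix c w T"
    by (rule mix_mono[OF assms(1) bm_const *(1)], rule mix_mono[OF bm_const assms(1) *(2)])
  then show ?thesis unfolding mix_mult_const by (simp add: abs_le_iff)
qed

lemma measure_pos: "measure M (space M) > 0"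
  using nontrivial by (simp add: emeasure_eq_measure zero_less_measure_iff)

lemma part_bounds:
  assumes "\<forall>k\<in>K. \<bar>c k\<bar> \<le> L"
  shows "measure M (space M) * exp (- (cst L + cst L * (\<Sum>k\<in>K. \<bar>w k\<bar>))) \<le> part c w"
    and "part c w \<le> measure M (space M) * exp (cst L + cst L * (\<Sum>k\<in>K. \<bar>w k\<bar>))"
proof -
  let ?e = "cst L + cst L * (\<Sum>k\<in>K. \<bar>w k\<bar>)"
  have e: "exp (- ?e) \<le> exp (ener c w x)" "exp (ener c w x) \<le> exp ?e" for x
    using ener_bound'[OF assms, where w = w and x = x] by auto
  have "(\<integral>x. exp (- ?e) \<partial>M) \<le> part c w" "part c w \<le> (\<integral>x. exp ?e \<partial>M)"
    unfolding mix_def using e integrable_mix[OF bm_const, of 1]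
    by (intro integral_mono; simp)+
  then show "measure M (space M) * exp (- ?e) \<le> part c w" "part c w \<le> measure M (space M) * exp ?e"
    by auto
qed

lemma part_pos: "part c w > 0"
proof -
  obtain L where L: "\<forall>k\<in>K. \<bar>c k\<bar> \<le> L" using ex_bound by blast
  show ?thesis
    using part_bounds(1)[where c = c, OF L, where w = w] measure_pos
    by (smt (verit, best) exp_gt_zero mult_pos_pos)
qed

lemma measurable_mix[measurable]:
  assumes [measurable]: "T \<in> borel_measurable M"
  shows "(\<lambda>w. mix c w T) \<in> borel_measurable (gauss K)"
proof -
  have [measurable]: "(\<lambda>(w, x). w k) \<in> borel_measurable (gauss K \<Otimes>\<^sub>M M)" if "k \<in> K" for k
    using measurable_compose[OF measurable_fst measurable_component_singleton[OF that, of "\<lambda>_. std_normal"]]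
    by (simp add: split_def)
  have [measurable]: "(\<lambda>(w, x). ener c w x) \<in> borel_measurable (gauss K \<Otimes>\<^sub>M M)"
    unfolding ener_def split_def by measurable
  show ?thesis unfolding mix_def by measurable
qed

lemma subexp_part:
  assumes "\<And>t k. t \<in> I \<Longrightarrow> k \<in> K \<Longrightarrow> \<bar>c t k\<bar> \<le> L"
  shows "subexp K I (\<lambda>t w. part (c t) w)" "subexp K I (\<lambda>t w. 1 / part (c t) w)"
proof -
  let ?m = "measure M (space M)"
  have pb: "?m * exp (- (cst L + cst L * (\<Sum>k\<in>K. \<bar>w k\<bar>))) \<le> part (c t) w"
      "part (c t) w \<le> ?m * exp (cst L + cst L * (\<Sum>k\<in>K. \<bar>w k\<bar>))" if "t \<in> I" for t w
    using part_bounds[of "c t" L w] assms that by auto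
  show "subexp K I (\<lambda>t w. part (c t) w)"
  proof (rule subexpI_exp[of "?m * exp (cst L)" _ _ "cst L"])
    fix t w assume "t \<in> I"
    then show "\<bar>part (c t) w\<bar> \<le> ?m * exp (cst L) * exp (cst L * (\<Sum>k\<in>K. \<bar>w k\<bar>))"
      using pb(2)[of t w] part_pos[of "c t" w] by (simp add: exp_add mult_ac)
  qed auto
  show "subexp K I (\<lambda>t w. 1 / part (c t) w)"
  proof (rule subexpI_exp[of "1 / ?m * exp (cst L)" _ _ "cst L"])
    fix t w assume t: "t \<in> I"
    have "1 / part (c t) w \<le> 1 / (?m * exp (- (cst L + cst L * (\<Sum>k\<in>K. \<bar>w k\<bar>))))"
      using pb(1)[OF t, of w] measure_pos by (intro divide_left_mono) (auto intro!: mult_pos_pos part_pos)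
    also have "\<dots> = 1 / ?m * exp (cst L) * exp (cst L * (\<Sum>k\<in>K. \<bar>w k\<bar>))"
      by (simp add: exp_minus exp_add exp_diff field_simps)
    finally show "\<bar>1 / part (c t) w\<bar> \<le> 1 / ?m * exp (cst L) * exp (cst L * (\<Sum>k\<in>K. \<bar>w k\<bar>))"
      using part_pos[of "c t" w] by simp
  qed (use measure_pos in auto)
qed

lemma subexp_mix:
  assumes "\<And>t k. t \<in> I \<Longrightarrow> k \<in> K \<Longrightarrow> \<bar>c t k\<bar> \<le> L" "bm T"
  shows "subexp K I (\<lambda>t w. mix (c t) w T)"
proof -
  obtain L' where L': "L' \<ge> 0" "\<And>x. \<bar>T x\<bar> \<le> L'" using assms(2) by (rule bmE) blast
  have "\<bar>mix (c t) w T\<bar> \<le> \<bar>L' * part (c t) w\<bar>" for t w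
    using mix_abs_le[OF assms(2) L'(2), of "c t" w] by linarith
  then show ?thesis
    by (intro subexp_mono_abs[OF subexp_const_mult[OF subexp_part(1)[OF assms(1)], where a = L']])
qed

lemma subexp_tame:
  assumes "\<And>t k. t \<in> I \<Longrightarrow> k \<in> K \<Longrightarrow> \<bar>c t k\<bar> \<le> L" "bm T" "\<And>x. \<bar>T x\<bar> \<le> bT" "tame bT g"
  shows "subexp K I (\<lambda>t w. g (mix (c t) w T) (part (c t) w))"
proof -
  obtain D p where D: "D \<ge> 0" "\<And>a f. f > 0 \<Longrightarrow> \<bar>a\<bar> \<le> bT * f \<Longrightarrow> \<bar>g a f\<bar> \<le> D * (f ^ p + (1 / f) ^ p)"
    using assms(4) unfolding tame_def by blast
  have "subexp K I (\<lambda>t w. D * (part (c t) w ^ p + (1 / part (c t) w) ^ p))"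
    by (intro subexp_const_mult subexp_add subexp_power subexp_part[OF assms(1)])
  then show ?thesis
  proof (rule subexp_mono_abs)
    fix t w
    show "\<bar>g (mix (c t) w T) (part (c t) w)\<bar> \<le> \<bar>D * (part (c t) w ^ p + (1 / part (c t) w) ^ p)\<bar>"
      using D(2)[OF part_pos[of "c t" w] mix_abs_le[OF assms(2,3)]] by linarith
  qed
qed

lemma measurable_tame:
  assumes "tame bT g" and [measurable]: "T \<in> borel_measurable M"
  shows "(\<lambda>w. g (mix c w T) (part c w)) \<in> borel_measurable (gauss K)"
proof -
  have [measurable]: "case_prod g \<in> borel_measurable (borel \<Otimes>\<^sub>M borel)"
    using assms(1) by (simp add: tame_def borel_prod)
  have "(\<lambda>w. case_prod g (mix c w T, part c w)) \<in> borel_measurable (gauss K)"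
    by measurable
  then show ?thesis by simp
qed

lemma mix_has_derivative_path:
  assumes t: "a < t" "t < b" and T: "bm T"
    and c: "\<And>t k. a < t \<Longrightarrow> t < b \<Longrightarrow> k \<in> K \<Longrightarrow> ((\<lambda>t. c t k) has_real_derivative c' t k) (at t)"
    and L: "\<And>t k. a < t \<Longrightarrow> t < b \<Longrightarrow> k \<in> K \<Longrightarrow> \<bar>c t k\<bar> \<le> L"
      "\<And>t k. a < t \<Longrightarrow> t < b \<Longrightarrow> k \<in> K \<Longrightarrow> \<bar>c' t k\<bar> \<le> L"
  shows "((\<lambda>t. mix (c t) w T) has_real_derivative
     (\<Sum>k\<in>K. c' t k * (w k * mix (c t) w (\<lambda>x. T x * S k x) - c t k * mix (c t) w (\<lambda>x. T x * S k x * S k x)))) (at t)"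
proof -
  obtain L' where [measurable]: "T \<in> borel_measurable M" and L': "L' \<ge> 0" "\<And>x. \<bar>T x\<bar> \<le> L'"
    using T by (rule bmE) blast
  define d where "d = min (t - a) (b - t)"
  have d: "d > 0" "\<And>s. \<bar>s - t\<bar> < d \<Longrightarrow> a < s \<and> s < b" using t by (auto simp: d_def)
  let ?e = "cst L + cst L * (\<Sum>k\<in>K. \<bar>w k\<bar>)"
  let ?f' = "\<lambda>t x. T x * (exp (ener (c t) w x) * (\<Sum>k\<in>K. c' t k * w k * S k x - c t k * c' t k * (S k x)\<^sup>2))"
  let ?G = "L' * (exp ?e * (\<Sum>k\<in>K. \<bar>L\<bar> * \<bar>w k\<bar> * \<bar>B\<bar> + \<bar>L\<bar> * \<bar>L\<bar> * B\<^sup>2))"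
  have "((\<lambda>t. mix (c t) w T) has_real_derivative (\<integral>x. ?f' t x \<partial>M)) (at t)"
    unfolding mix_def
  proof (rule has_real_derivative_integral[OF d(1), of _ _ _ _ "\<lambda>_. ?G"])
    fix s x assume "\<bar>s - t\<bar> < d" "x \<in> space M"
    then have s: "a < s" "s < b" using d by auto
    have "((\<lambda>s. ener (c s) w x) has_real_derivative (\<Sum>k\<in>K. c' s k * w k * S k x - c s k * c' s k * (S k x)\<^sup>2)) (at s)"
      unfolding ener_def using c[OF s]
      by (auto intro!: DERIV_sum derivative_eq_intros)
    then show "((\<lambda>s. T x * exp (ener (c s) w x)) has_real_derivative ?f' s x) (at s)"
      by (auto intro!: derivative_eq_intros)
    have "ener (c s) w x \<le> ?e" using ener_bound'[of "c s" L w x] L(1)[OF s] by auto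
    moreover have "\<bar>c' s k * w k * S k x - c s k * c' s k * (S k x)\<^sup>2\<bar> \<le> \<bar>L\<bar> * \<bar>w k\<bar> * \<bar>B\<bar> + \<bar>L\<bar> * \<bar>L\<bar> * B\<^sup>2"
      if k: "k \<in> K" for k
    proof -
      have "\<bar>c' s k * w k * S k x\<bar> \<le> \<bar>L\<bar> * \<bar>w k\<bar> * \<bar>B\<bar>"
        unfolding abs_mult using L(2)[OF s k] S_bounded[OF k, of x] by (intro mult_mono) auto
      moreover have "\<bar>c s k * c' s k * (S k x)\<^sup>2\<bar> \<le> \<bar>L\<bar> * \<bar>L\<bar> * B\<^sup>2"
        unfolding abs_mult using L(2)[OF s k] L(1)[OF s k] S_bounded[OF k, of x]
        by (intro mult_mono) (auto simp: abs_le_square_iff[symmetric])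
      ultimately show ?thesis by linarith
    qed
    ultimately show "\<bar>?f' s x\<bar> \<le> ?G"
      unfolding abs_mult using L' by (intro mult_mono order_trans[OF sum_abs] sum_mono) (auto intro!: mult_nonneg_nonneg sum_nonneg)
  next
    fix s assume "\<bar>s - t\<bar> < d"
    show "integrable M (\<lambda>x. T x * exp (ener (c s) w x))" by (rule integrable_mix[OF T])
  next
    show "?f' t \<in> borel_measurable M" by measurable
  qed auto
  moreover have "(\<integral>x. ?f' t x \<partial>M) = (\<Sum>k\<in>K. c' t k * (w k * mix (c t) w (\<lambda>x. T x * S k x) - c t k * mix (c t) w (\<lambda>x. T x * S k x * S k x)))"
  proof -
    have "?f' t x = (\<Sum>k\<in>K. c' t k * (w k * ((T x * S k x) * exp (ener (c t) w x)) - c t k * ((T x * S k x * S k x) * exp (ener (c t) w x))))" for x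
      unfolding sum_distrib_left by (intro sum.cong) (auto simp: algebra_simps power2_eq_square)
    then show ?thesis
      unfolding mix_def
      by (auto intro!: sum.cong Bochner_Integration.integral_diff integrable_mix bm_mult T bm_S Bochner_Integration.integral_sum
            simp: Bochner_Integration.integral_sum Bochner_Integration.integral_diff integrable_mix bm_mult T bm_S)
  qed
  ultimately show ?thesis by simp
qed

lemma mix_has_derivative_coord:
  assumes k: "k \<in> K" and T: "bm T"
  shows "((\<lambda>s. mix c (w(k := s)) T) has_real_derivative
     c k * mix c (w(k := y)) (\<lambda>x. T x * S k x)) (at y)"
proof -
  obtain L' where [measurable]: "T \<in> borel_measurable M" and L': "L' \<ge> 0" "\<And>x. \<bar>T x\<bar> \<le> L'"
    using T by (rule bmE) blast
  obtain L where L: "\<forall>k\<in>K. \<bar>c k\<bar> \<le> L" using ex_bound by blast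
  let ?e = "cst L + cst L * (\<Sum>j\<in>K. \<bar>w j\<bar> + \<bar>y\<bar> + 1)"
  let ?f' = "\<lambda>s x. T x * (exp (ener c (w(k := s)) x) * (c k * S k x))"
  have "((\<lambda>s. mix c (w(k := s)) T) has_real_derivative (\<integral>x. ?f' y x \<partial>M)) (at y)"
    unfolding mix_def
  proof (rule has_real_derivative_integral[OF zero_less_one, of _ _ _ _ "\<lambda>_. L' * (exp ?e * (\<bar>c k\<bar> * \<bar>B\<bar>))"])
    fix s x assume s: "\<bar>s - y\<bar> < 1"
    have e: "ener c (w(k := s)) x = c k * s * S k x - (c k)\<^sup>2 * (S k x)\<^sup>2 / 2
        + (\<Sum>j\<in>K - {k}. c j * w j * S j x - (c j)\<^sup>2 * (S j x)\<^sup>2 / 2)" for s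
      unfolding ener_def by (subst sum.remove[OF finite_K k]) auto
    show "((\<lambda>s. T x * exp (ener c (w(k := s)) x)) has_real_derivative ?f' s x) (at s)"
      unfolding e by (auto intro!: derivative_eq_intros)
    have "\<bar>(w(k := s)) j\<bar> \<le> \<bar>w j\<bar> + \<bar>y\<bar> + 1" for j using s by auto
    then have "cst L * (\<Sum>j\<in>K. \<bar>(w(k := s)) j\<bar>) \<le> cst L * (\<Sum>j\<in>K. \<bar>w j\<bar> + \<bar>y\<bar> + 1)"
      using cst_nonneg by (intro mult_left_mono sum_mono) auto
    then have "ener c (w(k := s)) x \<le> ?e" using ener_bound'[where c = c, OF L, where w = "w(k := s)" and x = x] by linarith
    then show "\<bar>?f' s x\<bar> \<le> L' * (exp ?e * (\<bar>c k\<bar> * \<bar>B\<bar>))"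
      unfolding abs_mult using L' S_bounded[OF k, of x] by (intro mult_mono) auto
  qed (use k integrable_mix[OF T] in auto)
  moreover have "(\<integral>x. ?f' y x \<partial>M) = c k * mix c (w(k := y)) (\<lambda>x. T x * S k x)"
    unfolding mix_def integral_mult_right_zero[symmetric] by (simp add: mult_ac)
  ultimately show ?thesis by simp
qed

text \<open>
  The generator of the Gaussian interpolation: the drift terms coming from the normalisation
  of the exponential weights cancel against the first-order terms of the integration by parts,
  so only second derivatives of \<open>g\<close> survive.
\<close>
theorem interpolation_derivative:
  assumes t0: "a < t0" "t0 < b" and T: "bm T" and bT: "\<And>x. \<bar>T x\<bar> \<le> bT"
    and c: "\<And>t k. a < t \<Longrightarrow> t < b \<Longrightarrow> k \<in> K \<Longrightarrow> ((\<lambda>t. c t k) has_real_derivative c' t k) (at t)"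
    and L: "\<And>t k. a < t \<Longrightarrow> t < b \<Longrightarrow> k \<in> K \<Longrightarrow> \<bar>c t k\<bar> \<le> L"
      "\<And>t k. a < t \<Longrightarrow> t < b \<Longrightarrow> k \<in> K \<Longrightarrow> \<bar>c' t k\<bar> \<le> L"
    and g: "has_partials g g1 g2" "has_partials g1 g11 g12" "has_partials g2 g21 g22"
    and tm: "tame bT g" "tame bT g1" "tame bT g2" "tame bT g11" "tame bT g12" "tame bT g21" "tame bT g22"
  shows "((\<lambda>t. \<integral>w. g (mix (c t) w T) (part (c t) w) \<partial>gauss K) has_real_derivative
    (\<Sum>k\<in>K. c t0 k * c' t0 k * (\<integral>w.
        g11 (mix (c t0) w T) (part (c t0) w) * (mix (c t0) w (\<lambda>x. T x * S k x))\<^sup>2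
      + (g12 (mix (c t0) w T) (part (c t0) w) + g21 (mix (c t0) w T) (part (c t0) w))
          * mix (c t0) w (\<lambda>x. T x * S k x) * mix (c t0) w (S k)
      + g22 (mix (c t0) w T) (part (c t0) w) * (mix (c t0) w (S k))\<^sup>2 \<partial>gauss K))) (at t0)"
proof -
  define I where "I = {a<..<b}"
  have t0I: "t0 \<in> I" using t0 by (simp add: I_def)
  have LI: "\<And>t k. t \<in> I \<Longrightarrow> k \<in> K \<Longrightarrow> \<bar>c t k\<bar> \<le> L" "\<And>t k. t \<in> I \<Longrightarrow> k \<in> K \<Longrightarrow> \<bar>c' t k\<bar> \<le> L"
    using L by (auto simp: I_def)
  define A where "A t w = mix (c t) w T" for t w
  define P where "P t w = part (c t) w" for t w
  define A1 where "A1 k t w = mix (c t) w (\<lambda>x. T x * S k x)" for k t w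
  define A2 where "A2 k t w = mix (c t) w (\<lambda>x. T x * S k x * S k x)" for k t w
  define P1 where "P1 k t w = mix (c t) w (S k)" for k t w
  define P2 where "P2 k t w = mix (c t) w (\<lambda>x. S k x * S k x)" for k t w
  have [measurable]: "T \<in> borel_measurable M" using T by (simp add: bm_def)
  have mA[measurable]: "A t \<in> borel_measurable (gauss K)" "P t \<in> borel_measurable (gauss K)" for t
    unfolding A_def P_def by measurable
  have mAk[measurable]: "A1 k t \<in> borel_measurable (gauss K)" "A2 k t \<in> borel_measurable (gauss K)"
      "P1 k t \<in> borel_measurable (gauss K)" "P2 k t \<in> borel_measurable (gauss K)" if "k \<in> K" for k t
    unfolding A1_def A2_def P1_def P2_def using that by measurable
  have mg[measurable]: "(\<lambda>w. h (A t w) (P t w)) \<in> borel_measurable (gauss K)" if "tame bT h" for h t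
    unfolding A_def P_def by (rule measurable_tame[OF that]) measurable
  have mw[measurable]: "(\<lambda>w. w k) \<in> borel_measurable (gauss K)" if "k \<in> K" for k
    using measurable_component_singleton[OF that, of "\<lambda>_. std_normal"] by simp
  have sA: "subexp K I (A1 k)" "subexp K I (A2 k)" "subexp K I (P1 k)" "subexp K I (P2 k)" if "k \<in> K" for k
    unfolding A1_def A2_def P1_def P2_def using that LI(1)
    by (auto intro!: subexp_mix bm_mult T bm_S)
  have sg: "subexp K I (\<lambda>t w. h (A t w) (P t w))" if "tame bT h" for h
    unfolding A_def P_def using LI(1) by (rule subexp_tame[OF _ T bT that])
  have sc: "subexp K I (\<lambda>t w. c t k)" "subexp K I (\<lambda>t w. c' t k)" if "k \<in> K" for k
    by (rule subexp_bounded[of I _ L], use LI that in auto)+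
  have sw: "subexp K I (\<lambda>t w. w k)" if "k \<in> K" for k
    by (rule subexp_coord[OF finite_K that])
  note si = subexp_add subexp_mult subexp_diff subexp_sum[OF finite_K] sA sg sc sw tm
  define DA where "DA t w = (\<Sum>k\<in>K. c' t k * (w k * A1 k t w - c t k * A2 k t w))" for t w
  define DP where "DP t w = (\<Sum>k\<in>K. c' t k * (w k * P1 k t w - c t k * P2 k t w))" for t w
  define G' where "G' t w = g1 (A t w) (P t w) * DA t w + g2 (A t w) (P t w) * DP t w" for t w
  have dA: "((\<lambda>t. A t w) has_real_derivative DA t w) (at t)"
    and dP: "((\<lambda>t. P t w) has_real_derivative DP t w) (at t)" if "t \<in> I" for t w
    using mix_has_derivative_path[where c = c and c' = c' and L = L and a = a and b = b and t = t and w = w and T = T]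
      mix_has_derivative_path[where c = c and c' = c' and L = L and a = a and b = b and t = t and w = w and T = "\<lambda>_. 1"]
      that T bm_const[of 1] c L
    by (simp_all add: A_def P_def DA_def DP_def A1_def A2_def P1_def P2_def I_def)
  have Ppos: "P t w > 0" for t w by (simp add: P_def part_pos)
  have dG: "((\<lambda>t. g (A t w) (P t w)) has_real_derivative G' t w) (at t)" if "t \<in> I" for t w
    using g(1) dA[OF that] dP[OF that] Ppos unfolding has_partials_def G'_def by blast
  have sG': "subexp K I G'"
    unfolding G'_def DA_def DP_def by (intro si; assumption)
  then obtain E where E: "E \<ge> 0" "\<And>t w. t \<in> I \<Longrightarrow> \<bar>G' t w\<bar> \<le> E * exp (E * (\<Sum>k\<in>K. \<bar>w k\<bar>))"
    unfolding subexp_def by blast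
  have mG'[measurable]: "G' t0 \<in> borel_measurable (gauss K)"
    unfolding G'_def DA_def DP_def using tm by measurable
  define d where "d = min (t0 - a) (b - t0)"
  have d: "d > 0" "\<And>s. \<bar>s - t0\<bar> < d \<Longrightarrow> s \<in> I" using t0 by (auto simp: d_def I_def)
  have main: "((\<lambda>t. \<integral>w. g (A t w) (P t w) \<partial>gauss K) has_real_derivative (\<integral>w. G' t0 w \<partial>gauss K)) (at t0)"
  proof (rule has_real_derivative_integral[OF d(1), of _ _ _ _ "\<lambda>w. E * exp (E * (\<Sum>k\<in>K. \<bar>w k\<bar>))"])
    fix t assume "\<bar>t - t0\<bar> < d"
    then have t: "t \<in> I" by (rule d(2))
    show "integrable (gauss K) (\<lambda>w. g (A t w) (P t w))"
      using integrable_subexp[OF finite_K sg[OF tm(1)] t] mg[OF tm(1)] by blast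
    fix w
    show "((\<lambda>s. g (A s w) (P s w)) has_real_derivative G' t w) (at t)" by (rule dG[OF t])
    show "\<bar>G' t w\<bar> \<le> E * exp (E * (\<Sum>k\<in>K. \<bar>w k\<bar>))" by (rule E(2)[OF t])
  next
    show "integrable (gauss K) (\<lambda>w. E * exp (E * (\<Sum>k\<in>K. \<bar>w k\<bar>)))"
      using integrable_gauss_exp[OF finite_K, of E] by simp
  qed (rule mG')
  \<comment> \<open>\<open>F k\<close> is the factor of \<open>c' k * w k\<close> in the time
    derivative and \<open>F2 k\<close> that of the drift \<open>- c' k * c k\<close>.
    Differentiating \<open>F k\<close> in the noise coordinate \<open>k\<close> gives
    \<open>c k * (H k + F2 k)\<close>, where \<open>H k\<close> collects the second derivatives of
    \<open>g\<close>.\<close>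
  define F where "F k w = g1 (A t0 w) (P t0 w) * A1 k t0 w + g2 (A t0 w) (P t0 w) * P1 k t0 w" for k w
  define F2 where "F2 k w = g1 (A t0 w) (P t0 w) * A2 k t0 w + g2 (A t0 w) (P t0 w) * P2 k t0 w" for k w
  define H where "H k w = g11 (A t0 w) (P t0 w) * (A1 k t0 w)\<^sup>2
      + (g12 (A t0 w) (P t0 w) + g21 (A t0 w) (P t0 w)) * A1 k t0 w * P1 k t0 w
      + g22 (A t0 w) (P t0 w) * (P1 k t0 w)\<^sup>2" for k w
  have sub1: "subexp K (UNIV::unit set) (\<lambda>_. X t0)" if "subexp K I X" for X
    using that t0I unfolding subexp_def by blast
  have sF: "subexp K I (\<lambda>t w. F k w)" "subexp K I (\<lambda>t w. F2 k w)" "subexp K I (\<lambda>t w. H k w)" if k: "k \<in> K" for k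
  proof -
    note sA' = sA[OF k, THEN sub1] 
    note sg' = sg[THEN sub1]
    have "subexp K (UNIV::unit set) (\<lambda>_. F k)" "subexp K (UNIV::unit set) (\<lambda>_. F2 k)" "subexp K (UNIV::unit set) (\<lambda>_. H k)"
      unfolding F_def F2_def H_def power2_eq_square
      by (intro subexp_add subexp_mult sA' sg' tm)+
    then show "subexp K I (\<lambda>t w. F k w)" "subexp K I (\<lambda>t w. F2 k w)" "subexp K I (\<lambda>t w. H k w)"
      unfolding subexp_def by auto
  qed
  have mF[measurable]: "F k \<in> borel_measurable (gauss K)" "F2 k \<in> borel_measurable (gauss K)" "H k \<in> borel_measurable (gauss K)"
    if k: "k \<in> K" for k
    unfolding F_def F2_def H_def using tm k by measurable
  have iF: "integrable (gauss K) (F k)" "integrable (gauss K) (F2 k)" "integrable (gauss K) (H k)"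
      "integrable (gauss K) (\<lambda>w. w k * F k w)" if k: "k \<in> K" for k
    using integrable_subexp[OF finite_K sF(1)[OF k] t0I] integrable_subexp[OF finite_K sF(2)[OF k] t0I]
      integrable_subexp[OF finite_K sF(3)[OF k] t0I]
      integrable_subexp[OF finite_K subexp_mult[OF sw[OF k] sF(1)[OF k]] t0I] k
    by auto
  have ibp: "(\<integral>w. w k * F k w \<partial>gauss K) = (\<integral>w. c t0 k * H k w + c t0 k * F2 k w \<partial>gauss K)" if k: "k \<in> K" for k
  proof (rule gauss_integration_by_parts[OF finite_K k])
    fix w y
    note dc = mix_has_derivative_coord[OF k, of _ "c t0" w y]
    have d1: "((\<lambda>s. A t0 (w(k := s))) has_real_derivative c t0 k * A1 k t0 (w(k := y))) (at y)"
      "((\<lambda>s. A1 k t0 (w(k := s))) has_real_derivative c t0 k * A2 k t0 (w(k := y))) (at y)"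
      "((\<lambda>s. P1 k t0 (w(k := s))) has_real_derivative c t0 k * P2 k t0 (w(k := y))) (at y)"
      unfolding A_def A1_def A2_def P1_def P2_def by (intro dc T bm_mult bm_S k)+
    have d2: "((\<lambda>s. P t0 (w(k := s))) has_real_derivative c t0 k * P1 k t0 (w(k := y))) (at y)"
      using dc[OF bm_const[of 1]] by (simp add: P_def P1_def)
    have d3: "((\<lambda>s. g1 (A t0 (w(k := s))) (P t0 (w(k := s)))) has_real_derivative
        g11 (A t0 (w(k := y))) (P t0 (w(k := y))) * (c t0 k * A1 k t0 (w(k := y)))
        + g12 (A t0 (w(k := y))) (P t0 (w(k := y))) * (c t0 k * P1 k t0 (w(k := y)))) (at y)"
      using g(2) d1(1) d2 Ppos unfolding has_partials_def by blast
    have d4: "((\<lambda>s. g2 (A t0 (w(k := s))) (P t0 (w(k := s)))) has_real_derivative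
        g21 (A t0 (w(k := y))) (P t0 (w(k := y))) * (c t0 k * A1 k t0 (w(k := y)))
        + g22 (A t0 (w(k := y))) (P t0 (w(k := y))) * (c t0 k * P1 k t0 (w(k := y)))) (at y)"
      using g(3) d1(1) d2 Ppos unfolding has_partials_def by blast
    show "((\<lambda>s. F k (w(k := s))) has_real_derivative c t0 k * H k (w(k := y)) + c t0 k * F2 k (w(k := y))) (at y)"
      unfolding F_def H_def F2_def
      by (rule DERIV_cong[OF DERIV_add[OF DERIV_mult[OF d3 d1(2)] DERIV_mult[OF d4 d1(3)]]])
         (simp add: algebra_simps power2_eq_square)
  next
    show "subexp K (UNIV::unit set) (\<lambda>_. F k)" by (rule sub1[OF sF(1)[OF k]])
    show "subexp K (UNIV::unit set) (\<lambda>_ w. c t0 k * H k w + c t0 k * F2 k w)"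
      by (intro subexp_add subexp_const_mult sub1[OF sF(2)[OF k]] sub1[OF sF(3)[OF k]])
  qed (use k in measurable)
  have "(\<integral>w. G' t0 w \<partial>gauss K) = (\<integral>w. (\<Sum>k\<in>K. c' t0 k * (w k * F k w - c t0 k * F2 k w)) \<partial>gauss K)"
    unfolding G'_def DA_def DP_def F_def F2_def sum_distrib_left sum.distrib[symmetric]
    by (intro Bochner_Integration.integral_cong sum.cong) (auto simp: algebra_simps)
  also have "\<dots> = (\<Sum>k\<in>K. c' t0 k * ((\<integral>w. w k * F k w \<partial>gauss K) - c t0 k * (\<integral>w. F2 k w \<partial>gauss K)))"
    using iF by (simp add: Bochner_Integration.integral_sum)
  also have "\<dots> = (\<Sum>k\<in>K. c t0 k * c' t0 k * (\<integral>w. H k w \<partial>gauss K))"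
    using iF by (intro sum.cong refl) (simp add: ibp algebra_simps)
  finally show ?thesis
    using main unfolding A_def P_def H_def A1_def P1_def by simp
qed

end

section \<open>The functions of the partition function that are interpolated\<close>

text \<open>Real exponents are dominated by integer powers of \<open>f\<close> and
  \<open>1 / f\<close>, the form in which the growth class is stable.\<close>

lemma powr_le_tame:
  fixes f r :: real
  assumes "f > 0" "\<bar>r\<bar> \<le> real p"
  shows "f powr r \<le> f ^ p + (1 / f) ^ p"
proof (cases "f \<ge> 1")
  case True
  then have "f powr r \<le> f powr real p" using assms by (intro powr_mono) auto
  then show ?thesis using assms(1) by (simp add: powr_realpow add_increasing2)
next
  case False
  then have "f powr r \<le> f powr (- real p)" using assms by (intro powr_mono') auto
  also have "\<dots> = (1 / f) ^ p" using assms(1) by (simp add: powr_minus powr_realpow power_one_over inverse_eq_divide)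
  finally show ?thesis using assms(1) by (simp add: add_increasing)
qed

lemma tameI:
  assumes "case_prod g \<in> borel_measurable (borel \<Otimes>\<^sub>M borel)" "D \<ge> 0"
    and "\<And>a f. f > 0 \<Longrightarrow> \<bar>a\<bar> \<le> L * f \<Longrightarrow> \<bar>g a f\<bar> \<le> D * (f powr r + f powr r')"
  shows "tame L g"
  unfolding tame_def
proof (intro conjI exI[of _ "2 * D"] exI[of _ "nat \<lceil>max \<bar>r\<bar> \<bar>r'\<bar>\<rceil>"] allI impI)
  show "case_prod g \<in> borel_measurable borel" using assms(1) by (simp add: borel_prod)
  fix a f :: real assume f: "f > 0" and a: "\<bar>a\<bar> \<le> L * f"
  define p where "p = nat \<lceil>max \<bar>r\<bar> \<bar>r'\<bar>\<rceil>"
  have p: "\<bar>r\<bar> \<le> real p" "\<bar>r'\<bar> \<le> real p" unfolding p_def by linarith+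
  have "D * (f powr r + f powr r') \<le> D * (2 * (f ^ p + (1 / f) ^ p))"
    using powr_le_tame[OF f p(1)] powr_le_tame[OF f p(2)] assms(2) by (intro mult_left_mono) auto
  with assms(3)[OF f a] show "\<bar>g a f\<bar> \<le> 2 * D * (f ^ nat \<lceil>max \<bar>r\<bar> \<bar>r'\<bar>\<rceil> + (1 / f) ^ nat \<lceil>max \<bar>r\<bar> \<bar>r'\<bar>\<rceil>)"
    unfolding p_def by linarith
qed (use assms in auto)

lemma abs_ln_le:
  assumes "x > 0" shows "\<bar>ln x\<bar> \<le> x + 1 / (x::real)"
proof -
  have "1 / x > 0" "ln (1 / x) = - ln x" using assms by (auto simp: ln_div)
  then show ?thesis
    using assms ln_le_minus_one[of x] ln_le_minus_one[of "1 / x"] by linarith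
qed

lemma partials_xlnx:
  "has_partials (\<lambda>a f. f * ln f) (\<lambda>a f. 0) (\<lambda>a f. ln f + 1)"
  "has_partials (\<lambda>a f. ln f + 1) (\<lambda>a f. 0) (\<lambda>a f. 1 / f)"
  "has_partials (\<lambda>a f. 0) (\<lambda>a f. 0) (\<lambda>a f. 0)"
  unfolding has_partials_def by (auto intro!: derivative_eq_intros simp: algebra_simps)

lemma tame_xlnx:
  "tame L (\<lambda>a f. f * ln f)" "tame L (\<lambda>a f. ln f + 1)" "tame L (\<lambda>a f. 1 / f)" "tame L (\<lambda>a f. 0)"
proof -
  show "tame L (\<lambda>a f. 0)" by (rule tameI[of _ 0 _ 0 0]) auto
  show "tame L (\<lambda>a f. 1 / f)" by (rule tameI[of _ 1 _ "-1" 0]) (auto simp: powr_minus inverse_eq_divide)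
  show "tame L (\<lambda>a f. f * ln f)"
  proof (rule tameI[of _ 1 _ 2 0])
    fix a f :: real assume f: "f > 0"
    have "\<bar>f * ln f\<bar> \<le> f * (f + 1 / f)" using f abs_ln_le[OF f] by (simp add: abs_mult)
    then show "\<bar>f * ln f\<bar> \<le> 1 * (f powr 2 + f powr 0)" using f by (simp add: distrib_left power2_eq_square)
  qed auto
  show "tame L (\<lambda>a f. ln f + 1)"
  proof (rule tameI[of _ 2 _ 1 "-1"])
    fix a f :: real assume f: "f > 0"
    have "1 \<le> f + 1 / f" using powr_le_tame[of f 0 1] f by simp
    then show "\<bar>ln f + 1\<bar> \<le> 2 * (f powr 1 + f powr -1)"
      using f abs_ln_le[OF f] by (simp add: powr_minus inverse_eq_divide)
  qed auto
qed

lemma partials_sq_div: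
  "has_partials (\<lambda>a f. a\<^sup>2 / f) (\<lambda>a f. 2 * a / f) (\<lambda>a f. - a\<^sup>2 / f\<^sup>2)"
  "has_partials (\<lambda>a f. 2 * a / f) (\<lambda>a f. 2 / f) (\<lambda>a f. - 2 * a / f\<^sup>2)"
  "has_partials (\<lambda>a f. - a\<^sup>2 / f\<^sup>2) (\<lambda>a f. - 2 * a / f\<^sup>2) (\<lambda>a f. 2 * a\<^sup>2 / f ^ 3)"
  unfolding has_partials_def
  by (auto intro!: derivative_eq_intros simp: field_simps power2_eq_square power3_eq_cube power4_eq_xxxx)

lemma tame_sq_div:
  assumes "L \<ge> 0"
  shows "tame L (\<lambda>a f. a\<^sup>2 / f)" "tame L (\<lambda>a f. 2 * a / f)" "tame L (\<lambda>a f. - a\<^sup>2 / f\<^sup>2)"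
    "tame L (\<lambda>a f. 2 / f)" "tame L (\<lambda>a f. - 2 * a / f\<^sup>2)" "tame L (\<lambda>a f. 2 * a\<^sup>2 / f ^ 3)"
proof -
  have sq: "a\<^sup>2 \<le> L\<^sup>2 * f\<^sup>2" if "\<bar>a\<bar> \<le> L * f" for a f :: real
    using power_mono[OF that, of 2] by (simp add: power_mult_distrib)
  show "tame L (\<lambda>a f. a\<^sup>2 / f)"
  proof (rule tameI[of _ "L\<^sup>2" _ 1 1])
    fix a f :: real assume f: "f > 0" and a: "\<bar>a\<bar> \<le> L * f"
    have "a\<^sup>2 / f \<le> L\<^sup>2 * f\<^sup>2 / f" using sq[OF a] f by (intro divide_right_mono) auto
    also have "\<dots> = L\<^sup>2 * f" using f by (simp add: power2_eq_square)
    also have "\<dots> \<le> L\<^sup>2 * (f powr 1 + f powr 1)" using f by (intro mult_left_mono) auto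
    finally show "\<bar>a\<^sup>2 / f\<bar> \<le> L\<^sup>2 * (f powr 1 + f powr 1)" using f by simp
  qed auto
  show "tame L (\<lambda>a f. 2 * a / f)"
  proof (rule tameI[of _ "L" _ 0 0])
    fix a f :: real assume f: "f > 0" and a: "\<bar>a\<bar> \<le> L * f"
    then have "\<bar>2 * a\<bar> \<le> 2 * L * f" unfolding abs_mult by simp
    then show "\<bar>2 * a / f\<bar> \<le> L * (f powr 0 + f powr 0)"
      using f by (simp add: divide_le_eq mult_ac)
  qed (use assms in auto)
  show "tame L (\<lambda>a f. - a\<^sup>2 / f\<^sup>2)"
  proof (rule tameI[of _ "L\<^sup>2" _ 0 0])
    fix a f :: real assume f: "f > 0" and a: "\<bar>a\<bar> \<le> L * f"
    have "a\<^sup>2 / f\<^sup>2 \<le> L\<^sup>2" using sq[OF a] f by (simp add: field_simps)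
    then have "a\<^sup>2 / f\<^sup>2 \<le> L\<^sup>2 * 2" using zero_le_power2[of L] by linarith
    then show "\<bar>- a\<^sup>2 / f\<^sup>2\<bar> \<le> L\<^sup>2 * (f powr 0 + f powr 0)" using f by simp
  qed auto
  show "tame L (\<lambda>a f. 2 / f)" by (rule tameI[of _ 2 _ "-1" 0]) (auto simp: powr_minus inverse_eq_divide)
  show "tame L (\<lambda>a f. - 2 * a / f\<^sup>2)"
  proof (rule tameI[of _ "L" _ "-1" "-1"])
    fix a f :: real assume f: "f > 0" and a: "\<bar>a\<bar> \<le> L * f"
    have "\<bar>- 2 * a / f\<^sup>2\<bar> = 2 * \<bar>a\<bar> / f\<^sup>2" by (simp add: abs_mult)
    also have "\<dots> \<le> 2 * (L * f) / f\<^sup>2" using a by (intro divide_right_mono mult_left_mono) auto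
    also have "\<dots> = L * (f powr -1 + f powr -1)" using f by (simp add: powr_minus inverse_eq_divide power2_eq_square)
    finally show "\<bar>- 2 * a / f\<^sup>2\<bar> \<le> L * (f powr -1 + f powr -1)" .
  qed (use assms in auto)
  show "tame L (\<lambda>a f. 2 * a\<^sup>2 / f ^ 3)"
  proof (rule tameI[of _ "L\<^sup>2" _ "-1" "-1"])
    fix a f :: real assume f: "f > 0" and a: "\<bar>a\<bar> \<le> L * f"
    have "2 * a\<^sup>2 / f ^ 3 \<le> 2 * (L\<^sup>2 * f\<^sup>2) / f ^ 3" using sq[OF a] f by (intro divide_right_mono mult_left_mono) auto
    also have "\<dots> = L\<^sup>2 * (f powr -1 + f powr -1)"
      using f by (simp add: powr_minus inverse_eq_divide power2_eq_square power3_eq_cube)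
    finally show "\<bar>2 * a\<^sup>2 / f ^ 3\<bar> \<le> L\<^sup>2 * (f powr -1 + f powr -1)" using f by simp
  qed auto
qed

lemma partials_powr:
  "has_partials (\<lambda>a f. C * f powr s) (\<lambda>a f. 0) (\<lambda>a f. C * s * f powr (s - 1))"
  unfolding has_partials_def by (auto intro!: derivative_eq_intros)

lemma tame_powr: "tame L (\<lambda>a f. C * f powr s)"
  by (rule tameI[of _ "\<bar>C\<bar>" _ s s]) (auto simp: abs_mult)

section \<open>Derivatives of relative entropy, posterior second moments and fractional
  moments\<close>

context gibbs
begin

definition post :: "('k \<Rightarrow> real) \<Rightarrow> ('k \<Rightarrow> real) \<Rightarrow> ('x \<Rightarrow> real) \<Rightarrow> real" where
  "post c w T = mix c w T / part c w"

text \<open>Expectation over the planted observation, written against the pure noise.\<close>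
definition avg :: "('k \<Rightarrow> real) \<Rightarrow> (('k \<Rightarrow> real) \<Rightarrow> real) \<Rightarrow> real" where
  "avg c h = (\<integral>w. part c w * h w \<partial>gauss K)"

text \<open>For g(u) = u ln u the second derivative is 1/u, and the squared mixture of
  \<open>S k\<close> divided by \<open>part\<close> is \<open>part\<close> times the squared
  posterior mean: a form of the I-MMSE relation.\<close>

lemma KL_derivative:
  assumes t0: "a < t0" "t0 < b"
    and c: "\<And>t k. a < t \<Longrightarrow> t < b \<Longrightarrow> k \<in> K \<Longrightarrow> ((\<lambda>t. c t k) has_real_derivative c' t k) (at t)"
    and L: "\<And>t k. a < t \<Longrightarrow> t < b \<Longrightarrow> k \<in> K \<Longrightarrow> \<bar>c t k\<bar> \<le> L"
      "\<And>t k. a < t \<Longrightarrow> t < b \<Longrightarrow> k \<in> K \<Longrightarrow> \<bar>c' t k\<bar> \<le> L"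
  shows "((\<lambda>t. \<integral>w. part (c t) w * ln (part (c t) w) \<partial>gauss K) has_real_derivative
    (\<Sum>k\<in>K. c t0 k * c' t0 k * avg (c t0) (\<lambda>w. (post (c t0) w (S k))\<^sup>2))) (at t0)"
proof -
  have eq: "part c w * (post c w T)\<^sup>2 = 1 / part c w * (mix c w T)\<^sup>2" for c w T
    using part_pos[of c w] by (simp add: post_def power2_eq_square field_simps)
  show ?thesis
    unfolding avg_def eq
    using interpolation_derivative[OF t0 bm_const[of 1] _ c L partials_xlnx(1,3,2) tame_xlnx(1,4,2,4,4,4,3), where bT = 1]
    by simp
qed

text \<open>The Hessian form of a^2/f is a perfect square, so the derivative consists of squared
  posterior covariances. It is nonnegative as soon as all products of \<open>c\<close> and
  \<open>c'\<close> are: more information never lowers such a moment.\<close>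

lemma avg_sq_derivative:
  assumes t0: "a < t0" "t0 < b" and T: "bm T"
    and c: "\<And>t k. a < t \<Longrightarrow> t < b \<Longrightarrow> k \<in> K \<Longrightarrow> ((\<lambda>t. c t k) has_real_derivative c' t k) (at t)"
    and L: "\<And>t k. a < t \<Longrightarrow> t < b \<Longrightarrow> k \<in> K \<Longrightarrow> \<bar>c t k\<bar> \<le> L"
      "\<And>t k. a < t \<Longrightarrow> t < b \<Longrightarrow> k \<in> K \<Longrightarrow> \<bar>c' t k\<bar> \<le> L"
  shows "((\<lambda>t. avg (c t) (\<lambda>w. (post (c t) w T)\<^sup>2)) has_real_derivative
    (\<Sum>k\<in>K. 2 * c t0 k * c' t0 k *
      avg (c t0) (\<lambda>w. (post (c t0) w (\<lambda>x. T x * S k x) - post (c t0) w T * post (c t0) w (S k))\<^sup>2))) (at t0)"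
proof -
  obtain bT where bT: "bT \<ge> 0" "\<And>x. \<bar>T x\<bar> \<le> bT" using T by (rule bmE) blast
  have eq: "part c w * (post c w T)\<^sup>2 = (mix c w T)\<^sup>2 / part c w" for c w T
    using part_pos[of c w] by (simp add: post_def power2_eq_square field_simps)
  \<comment> \<open>The Hessian form of a^2/f in the direction (u, v), completed to a
    square.\<close>
  have eq2: "2 / f * u\<^sup>2 + (- 2 * a / f\<^sup>2 + - 2 * a / f\<^sup>2) * u * v + 2 * a\<^sup>2 / f ^ 3 * v\<^sup>2
      = 2 * (f * (u / f - a / f * (v / f))\<^sup>2)" if "f > 0" for f u a v :: real
    using that by (simp add: field_simps power2_eq_square power3_eq_cube)
  note tm = tame_sq_div[OF bT(1)]
  show ?thesis
    unfolding avg_def eq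
    using interpolation_derivative[OF t0 T bT(2) c L partials_sq_div(1,2,3) tm(1,2,3,4,5,5,6)]
    unfolding eq2[OF part_pos] by (simp add: post_def mult_ac)
qed

text \<open>For 0 < s < 1 the factor s(s - 1) is negative; this is the concavity used by the
  Gaussian comparison.\<close>

lemma powr_derivative:
  assumes t0: "a < t0" "t0 < b"
    and c: "\<And>t k. a < t \<Longrightarrow> t < b \<Longrightarrow> k \<in> K \<Longrightarrow> ((\<lambda>t. c t k) has_real_derivative c' t k) (at t)"
    and L: "\<And>t k. a < t \<Longrightarrow> t < b \<Longrightarrow> k \<in> K \<Longrightarrow> \<bar>c t k\<bar> \<le> L"
      "\<And>t k. a < t \<Longrightarrow> t < b \<Longrightarrow> k \<in> K \<Longrightarrow> \<bar>c' t k\<bar> \<le> L"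
  shows "((\<lambda>t. \<integral>w. part (c t) w powr s \<partial>gauss K) has_real_derivative
    (\<Sum>k\<in>K. c t0 k * c' t0 k * (\<integral>w. s * (s - 1) * (part (c t0) w powr s * (post (c t0) w (S k))\<^sup>2) \<partial>gauss K))) (at t0)"
proof -
  have z: "has_partials (\<lambda>a f. 0) (\<lambda>a f. 0) (\<lambda>a f. 0)" by (rule partials_xlnx)
  have tz: "tame 1 (\<lambda>a f. 0)" by (rule tame_xlnx)
  have eq: "f powr s * (u / f)\<^sup>2 = f powr (s - 1 - 1) * u\<^sup>2" if "f > 0" for f u :: real
    using that by (simp add: powr_diff power2_eq_square power_divide)
  show ?thesis
    unfolding post_def eq[OF part_pos]
    using interpolation_derivative[OF t0 bm_const[of 1] _ c L partials_powr[of 1 s] z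
        partials_powr[of "1 * s" "s - 1"] tame_powr tz tame_powr tz tz tz tame_powr]
    by (simp add: mult.assoc)
qed

end

section \<open>Overlaps of two replicas\<close>

text \<open>In use, \<open>\<mu>\<close> is the posterior at a fixed observation, so the estimates
  here hold pointwise in the noise.\<close>

locale replicas = prob_space \<mu> for \<mu> :: "'x measure" +
  fixes N :: nat and xi :: "nat \<Rightarrow> 'x \<Rightarrow> real" and B :: real
  assumes xi_measurable[measurable]: "\<And>i. i < N \<Longrightarrow> xi i \<in> borel_measurable \<mu>"
    and xi_bounded: "\<And>i x. i < N \<Longrightarrow> \<bar>xi i x\<bar> \<le> B"
    and B_ge_1: "1 \<le> B"
begin

sublocale P: pair_prob_space \<mu> \<mu> ..

text \<open>The overlap is not normalised by \<open>N\<close> here: \<open>ov = N R\<close>.\<close>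
definition ov :: "'x \<times> 'x \<Rightarrow> real" where
  "ov z = (\<Sum>i<N. xi i (fst z) * xi i (snd z))"

definition om :: "nat \<Rightarrow> real" where
  "om n = (\<integral>z. \<bar>ov z\<bar> ^ n \<partial>(\<mu> \<Otimes>\<^sub>M \<mu>))"

text \<open>Monomials indexed by functions, with repetitions: the entries of the \<open>n\<close>-th
  tensor power of the coordinate vector. Hence the kernel they generate is the \<open>n\<close>-th
  power of the overlap.\<close>

definition mon :: "nat \<Rightarrow> (nat \<Rightarrow> nat) \<Rightarrow> 'x \<Rightarrow> real" where
  "mon n f x = (\<Prod>r<n. xi (f r) x)"

lemma measurable_ov[measurable]: "ov \<in> borel_measurable (\<mu> \<Otimes>\<^sub>M \<mu>)"
  unfolding ov_def by measurable

lemma measurable_mon[measurable]: "f \<in> {..<n} \<rightarrow>\<^sub>E {..<N} \<Longrightarrow> mon n f \<in> borel_measurable \<mu>"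
  unfolding mon_def by (intro borel_measurable_prod xi_measurable) auto

lemma ov_bounded: "\<bar>ov z\<bar> \<le> B\<^sup>2 * N"
proof -
  have "\<bar>xi i (fst z) * xi i (snd z)\<bar> \<le> B\<^sup>2" if "i < N" for i
    unfolding abs_mult power2_eq_square using xi_bounded[OF that] B_ge_1 by (intro mult_mono) auto
  then have "\<bar>ov z\<bar> \<le> (\<Sum>i<N. B\<^sup>2)"
    unfolding ov_def by (intro order_trans[OF sum_abs] sum_mono) auto
  then show ?thesis by (simp add: mult.commute)
qed

lemma integrable_bounded_by:
  fixes f :: "'x \<Rightarrow> real"
  shows "f \<in> borel_measurable \<mu> \<Longrightarrow> (\<And>x. \<bar>f x\<bar> \<le> L) \<Longrightarrow> integrable \<mu> f"
  by (rule integrable_const_bound[of _ L]) auto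

lemma integrable_pair_bounded_by:
  fixes f :: "'x \<times> 'x \<Rightarrow> real"
  shows "f \<in> borel_measurable (\<mu> \<Otimes>\<^sub>M \<mu>) \<Longrightarrow> (\<And>x. \<bar>f x\<bar> \<le> L) \<Longrightarrow> integrable (\<mu> \<Otimes>\<^sub>M \<mu>) f"
  by (rule P.integrable_const_bound[of _ L]) auto

lemma integrable_ov_pow: "integrable (\<mu> \<Otimes>\<^sub>M \<mu>) (\<lambda>z. \<bar>ov z\<bar> ^ n)"
  by (rule integrable_pair_bounded_by[of _ "(B\<^sup>2 * N) ^ n"]) (auto intro: power_mono ov_bounded)

lemma om_nonneg: "om n \<ge> 0"
  by (simp add: om_def)

lemma xi_pow_bounded: "v < N \<Longrightarrow> \<bar>xi v x ^ p\<bar> \<le> B ^ p"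
  using xi_bounded[of v x] by (simp add: power_abs power_mono)

lemma mon_bounded:
  assumes "f \<in> {..<n} \<rightarrow>\<^sub>E {..<N}" shows "\<bar>mon n f x\<bar> \<le> B ^ n"
proof -
  have "\<bar>mon n f x\<bar> = (\<Prod>r<n. \<bar>xi (f r) x\<bar>)" by (simp add: mon_def abs_prod)
  also have "\<dots> \<le> (\<Prod>r<n. B)" using assms by (intro prod_mono) (auto intro!: xi_bounded)
  finally show ?thesis by simp
qed

lemma square_integral_pair:
  fixes f :: "'x \<Rightarrow> real"
  assumes [measurable]: "f \<in> borel_measurable \<mu>" and L: "\<And>x. \<bar>f x\<bar> \<le> L"
  shows "integrable (\<mu> \<Otimes>\<^sub>M \<mu>) (\<lambda>z. f (fst z) * f (snd z))"
    and "(\<integral>x. f x \<partial>\<mu>)\<^sup>2 = (\<integral>z. f (fst z) * f (snd z) \<partial>(\<mu> \<Otimes>\<^sub>M \<mu>))"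
proof -
  have L0: "L \<ge> 0" using L[of undefined] by linarith
  show *: "integrable (\<mu> \<Otimes>\<^sub>M \<mu>) (\<lambda>z. f (fst z) * f (snd z))"
    by (rule integrable_pair_bounded_by[of _ "L * L"]) (auto simp: abs_mult L L0 intro!: mult_mono)
  have "(\<integral>z. f (fst z) * f (snd z) \<partial>(\<mu> \<Otimes>\<^sub>M \<mu>)) = (\<integral>x. \<integral>y. f x * f y \<partial>\<mu> \<partial>\<mu>)"
    using P.integral_fst'[OF *] by simp
  also have "\<dots> = (\<integral>x. f x \<partial>\<mu>)\<^sup>2" by (simp add: power2_eq_square)
  finally show "(\<integral>x. f x \<partial>\<mu>)\<^sup>2 = (\<integral>z. f (fst z) * f (snd z) \<partial>(\<mu> \<Otimes>\<^sub>M \<mu>))" ..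
qed

lemma sum_square_integral:
  fixes h :: "'b \<Rightarrow> 'x \<Rightarrow> real"
  assumes "finite A" and m: "\<And>a. a \<in> A \<Longrightarrow> h a \<in> borel_measurable \<mu>" and L: "\<And>a x. a \<in> A \<Longrightarrow> \<bar>h a x\<bar> \<le> L"
  shows "(\<Sum>a\<in>A. (\<integral>x. h a x \<partial>\<mu>)\<^sup>2) = (\<integral>z. (\<Sum>a\<in>A. h a (fst z) * h a (snd z)) \<partial>(\<mu> \<Otimes>\<^sub>M \<mu>))"
proof -
  have "(\<Sum>a\<in>A. (\<integral>x. h a x \<partial>\<mu>)\<^sup>2) = (\<Sum>a\<in>A. \<integral>z. h a (fst z) * h a (snd z) \<partial>(\<mu> \<Otimes>\<^sub>M \<mu>))"
    using m L by (intro sum.cong square_integral_pair) auto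
  also have "\<dots> = (\<integral>z. (\<Sum>a\<in>A. h a (fst z) * h a (snd z)) \<partial>(\<mu> \<Otimes>\<^sub>M \<mu>))"
    using m L by (subst Bochner_Integration.integral_sum) (auto intro!: square_integral_pair)
  finally show ?thesis .
qed

text \<open>Summed over a complete set of indices, squared means become a two-replica average with
  kernel \<open>ov z ^ n\<close>. An inserted bounded factor \<open>g\<close>, in use a power of one
  coordinate, then costs only the square of \<open>G\<close> and no power of
  \<open>N\<close>.\<close>

lemma sum_square_integral_le:
  fixes h :: "'b \<Rightarrow> 'x \<Rightarrow> real"
  assumes A: "finite A" and m: "\<And>a. a \<in> A \<Longrightarrow> h a \<in> borel_measurable \<mu>" and L: "\<And>a x. a \<in> A \<Longrightarrow> \<bar>h a x\<bar> \<le> L"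
    and g[measurable]: "g \<in> borel_measurable \<mu>" and G: "\<And>x. \<bar>g x\<bar> \<le> G"
    and ker: "\<And>z. (\<Sum>a\<in>A. h a (fst z) * h a (snd z)) = ov z ^ n"
  shows "(\<Sum>a\<in>A. (\<integral>x. g x * h a x \<partial>\<mu>)\<^sup>2) \<le> G\<^sup>2 * om n"
proof -
  have G0: "G \<ge> 0" using G[of undefined] by linarith
  have k: "(\<Sum>a\<in>A. (g (fst z) * h a (fst z)) * (g (snd z) * h a (snd z))) = g (fst z) * g (snd z) * ov z ^ n" for z
    by (simp add: ker[symmetric] sum_distrib_left mult_ac)
  have b: "\<bar>g (fst z) * g (snd z) * ov z ^ n\<bar> \<le> G\<^sup>2 * \<bar>ov z\<bar> ^ n" for z
    unfolding abs_mult power_abs power2_eq_square using G G0 by (intro mult_right_mono mult_mono) auto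
  have "(\<Sum>a\<in>A. (\<integral>x. g x * h a x \<partial>\<mu>)\<^sup>2)
      = (\<integral>z. (\<Sum>a\<in>A. (g (fst z) * h a (fst z)) * (g (snd z) * h a (snd z))) \<partial>(\<mu> \<Otimes>\<^sub>M \<mu>))"
    by (rule sum_square_integral[OF A, of _ "G * L"])
       (use m L G G0 in \<open>auto simp: abs_mult intro!: mult_mono borel_measurable_times\<close>)
  also have "\<dots> \<le> (\<integral>z. G\<^sup>2 * \<bar>ov z\<bar> ^ n \<partial>(\<mu> \<Otimes>\<^sub>M \<mu>))"
    unfolding k
  proof (rule integral_mono)
    show "integrable (\<mu> \<Otimes>\<^sub>M \<mu>) (\<lambda>z. G\<^sup>2 * \<bar>ov z\<bar> ^ n)"
      using integrable_ov_pow by simp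
    then show "integrable (\<mu> \<Otimes>\<^sub>M \<mu>) (\<lambda>z. g (fst z) * g (snd z) * ov z ^ n)"
      by (rule Bochner_Integration.integrable_bound) (use b G0 in \<open>auto simp: power_abs\<close>)
    show "g (fst z) * g (snd z) * ov z ^ n \<le> G\<^sup>2 * \<bar>ov z\<bar> ^ n" for z
      using b[of z] by linarith
  qed
  finally show ?thesis by (simp add: om_def)
qed

lemma kernel_1: "(\<Sum>a<N. xi a (fst z) * xi a (snd z)) = ov z ^ 1"
  by (simp add: ov_def)

lemma kernel_mon: "(\<Sum>f\<in>{..<n} \<rightarrow>\<^sub>E {..<N}. mon n f (fst z) * mon n f (snd z)) = ov z ^ n"
proof -
  have "ov z ^ n = (\<Prod>r<n. \<Sum>i<N. xi i (fst z) * xi i (snd z))" by (simp add: ov_def)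
  also have "\<dots> = (\<Sum>f\<in>{..<n} \<rightarrow>\<^sub>E {..<N}. \<Prod>r<n. xi (f r) (fst z) * xi (f r) (snd z))"
    by (rule prod_sum_PiE) auto
  finally show ?thesis by (simp add: mon_def prod.distrib)
qed

lemma kernel_mon_Suc:
  "(\<Sum>a\<in>({..<n} \<rightarrow>\<^sub>E {..<N}) \<times> {..<N}. (case a of (f, k) \<Rightarrow> \<lambda>x. mon n f x * xi k x) (fst z) * (case a of (f, k) \<Rightarrow> \<lambda>x. mon n f x * xi k x) (snd z)) = ov z ^ Suc n"
proof -
  have "ov z ^ Suc n = (\<Sum>f\<in>{..<n} \<rightarrow>\<^sub>E {..<N}. mon n f (fst z) * mon n f (snd z)) * (\<Sum>k<N. xi k (fst z) * xi k (snd z))"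
    unfolding kernel_mon kernel_1 by simp
  also have "\<dots> = (\<Sum>f\<in>{..<n} \<rightarrow>\<^sub>E {..<N}. \<Sum>k<N. (mon n f (fst z) * xi k (fst z)) * (mon n f (snd z) * xi k (snd z)))"
    unfolding sum_product by (simp add: mult_ac)
  finally show ?thesis by (simp add: sum.cartesian_product split_def)
qed

text \<open>For even \<open>n\<close> the absolute value in \<open>om\<close> is invisible, so the
  moment is a sum of squared posterior means and inherits their monotonicity. This is why odd
  moments are traded for even ones.\<close>

lemma om_even: "even n \<Longrightarrow> (\<Sum>f\<in>{..<n} \<rightarrow>\<^sub>E {..<N}. (\<integral>x. mon n f x \<partial>\<mu>)\<^sup>2) = om n"
  by (subst sum_square_integral[of _ _ "B ^ n"])
     (auto simp: kernel_mon om_def power_even_abs finite_PiE intro: mon_bounded)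

text \<open>Chebyshev's correlation inequality: two increasing functions of the same variable are
  positively correlated. It merges a product of overlap moments into one moment of the total
  order.\<close>

lemma om_mult: "om n * om 1 \<le> om (Suc n)"
proof -
  define c where "c = om 1"
  have c: "c \<ge> 0" by (simp add: c_def om_nonneg)
  \<comment> \<open>\<open>c ^ n\<close> may stand in for the mean of the n-th power: the terms
    containing it cancel, because \<open>c\<close> is the mean of the absolute overlap.\<close>
  have "0 \<le> (\<bar>ov z\<bar> ^ n - c ^ n) * (\<bar>ov z\<bar> - c)" for z
  proof (cases "\<bar>ov z\<bar> \<ge> c")
    case True then show ?thesis using c by (intro mult_nonneg_nonneg) (auto intro: power_mono)
  next
    case False then show ?thesis by (intro mult_nonpos_nonpos) (auto intro: power_mono)
  qed
  then have "0 \<le> (\<integral>z. (\<bar>ov z\<bar> ^ n - c ^ n) * (\<bar>ov z\<bar> - c) \<partial>(\<mu> \<Otimes>\<^sub>M \<mu>))" by simp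
  also have "\<dots> = (\<integral>z. \<bar>ov z\<bar> ^ Suc n - c * \<bar>ov z\<bar> ^ n - c ^ n * \<bar>ov z\<bar> ^ 1 + c ^ n * c \<partial>(\<mu> \<Otimes>\<^sub>M \<mu>))"
    by (intro Bochner_Integration.integral_cong) (auto simp: algebra_simps)
  also have "\<dots> = om (Suc n) - c * om n - c ^ n * om 1 + c ^ n * c"
    unfolding om_def using integrable_ov_pow[of "Suc n"] integrable_ov_pow[of n] integrable_ov_pow[of 1]
    by (simp add: P.prob_space)
  finally show ?thesis by (simp add: c_def mult.commute)
qed

text \<open>AM-GM with a free scale \<open>d\<close>, later taken proportional to
  \<open>N\<close>.\<close>

lemma om_young:
  assumes "d > 0" shows "om (Suc n) \<le> (d * om n + om (n + 2) / d) / 2"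
proof -
  have "\<bar>ov z\<bar> ^ Suc n \<le> d / 2 * \<bar>ov z\<bar> ^ n + 1 / (2 * d) * \<bar>ov z\<bar> ^ (n + 2)" for z
  proof -
    define a where "a = \<bar>ov z\<bar>"
    have "2 * d * a \<le> d\<^sup>2 + a\<^sup>2" by (rule sum_squares_bound)
    then have "a \<le> d / 2 + 1 / (2 * d) * a\<^sup>2" using assms by (simp add: field_simps power2_eq_square)
    then have "a ^ n * a \<le> a ^ n * (d / 2 + 1 / (2 * d) * a\<^sup>2)"
      by (intro mult_left_mono) (auto simp: a_def)
    then show ?thesis unfolding a_def[symmetric] by (simp add: algebra_simps power_add power2_eq_square)
  qed
  then have "om (Suc n) \<le> (\<integral>z. d / 2 * \<bar>ov z\<bar> ^ n + 1 / (2 * d) * \<bar>ov z\<bar> ^ (n + 2) \<partial>(\<mu> \<Otimes>\<^sub>M \<mu>))"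
    unfolding om_def
    by (intro integral_mono Bochner_Integration.integrable_add integrable_mult_right integrable_ov_pow)
  also have "\<dots> = d / 2 * om n + 1 / (2 * d) * om (n + 2)"
    unfolding om_def using integrable_ov_pow[of n] integrable_ov_pow[of "n + 2"] by simp
  finally show ?thesis by (simp add: field_simps)
qed

lemma om_0: "om 0 = 1"
  by (simp add: om_def P.prob_space)

text \<open>Overlaps up to \<open>e\<close> give back the second moment with a small factor. Larger
  ones are charged at the maximal size of an overlap, which is affordable because their probability
  will be exponentially small.\<close>

lemma om_4_le:
  assumes "e \<ge> 0"
  shows "om 4 \<le> e\<^sup>2 * om 2 + (B\<^sup>2 * N) ^ 4 * measure (\<mu> \<Otimes>\<^sub>M \<mu>) {z \<in> space (\<mu> \<Otimes>\<^sub>M \<mu>). \<bar>ov z\<bar> > e}"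
proof -
  define E where "E = {z \<in> space (\<mu> \<Otimes>\<^sub>M \<mu>). \<bar>ov z\<bar> > e}"
  have [measurable]: "E \<in> sets (\<mu> \<Otimes>\<^sub>M \<mu>)" unfolding E_def by measurable
  have "\<bar>ov z\<bar> ^ 4 \<le> e\<^sup>2 * \<bar>ov z\<bar> ^ 2 + (B\<^sup>2 * N) ^ 4 * indicator E z" if "z \<in> space (\<mu> \<Otimes>\<^sub>M \<mu>)" for z
  proof (cases "\<bar>ov z\<bar> > e")
    case True
    then show ?thesis using that power_mono[OF ov_bounded, of z 4] by (simp add: E_def add_increasing)
  next
    case False
    then have "\<bar>ov z\<bar>\<^sup>2 * \<bar>ov z\<bar>\<^sup>2 \<le> e\<^sup>2 * \<bar>ov z\<bar>\<^sup>2" by (intro mult_right_mono power_mono) auto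
    then show ?thesis using False by (simp add: E_def power2_eq_square power4_eq_xxxx mult.assoc)
  qed
  then have "om 4 \<le> (\<integral>z. e\<^sup>2 * \<bar>ov z\<bar> ^ 2 + (B\<^sup>2 * N) ^ 4 * indicator E z \<partial>(\<mu> \<Otimes>\<^sub>M \<mu>))"
    unfolding om_def
    by (intro integral_mono Bochner_Integration.integrable_add integrable_mult_right integrable_ov_pow)
       (auto simp: integrable_indicator_iff P.emeasure_eq_measure)
  also have "\<dots> = e\<^sup>2 * om 2 + (B\<^sup>2 * N) ^ 4 * measure (\<mu> \<Otimes>\<^sub>M \<mu>) E"
    unfolding om_def using integrable_ov_pow[of 2]
    by (subst Bochner_Integration.integral_add) (auto simp: integrable_indicator_iff P.emeasure_eq_measure simp del: power2_abs)
  finally show ?thesis by (simp add: E_def)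
qed

section \<open>Squared covariances in terms of overlap moments\<close>

text \<open>Pairing with one more coordinate raises the order of the overlap moment by one, both for
  the joint mean and for the product of means; for the latter this is \<open>om_mult\<close>. The
  gain of one order makes drift terms of the vertex removal negligible.\<close>

lemma covariance_bound:
  assumes v: "v < N" and J: "J \<subseteq> {..<N}"
  shows "(\<Sum>f\<in>{..<n} \<rightarrow>\<^sub>E J. \<Sum>k\<in>J. ((\<integral>x. xi v x ^ p * mon n f x * (xi v x * xi k x) \<partial>\<mu>)
      - (\<integral>x. xi v x ^ p * mon n f x \<partial>\<mu>) * (\<integral>x. xi v x * xi k x \<partial>\<mu>))\<^sup>2) \<le> 4 * B ^ (2 * p + 2) * om (Suc n)"
proof -
  define a where "a f k = (\<integral>x. xi v x ^ Suc p * (mon n f x * xi k x) \<partial>\<mu>)" for f k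
  define b where "b f = (\<integral>x. xi v x ^ p * mon n f x \<partial>\<mu>)" for f
  define c where "c k = (\<integral>x. xi v x * xi k x \<partial>\<mu>)" for k
  have [measurable]: "(\<lambda>x. xi v x ^ q) \<in> borel_measurable \<mu>" for q using v by measurable
  have fin: "finite ({..<n} \<rightarrow>\<^sub>E {..<N})" by (simp add: finite_PiE)
  have sub: "{..<n} \<rightarrow>\<^sub>E J \<subseteq> {..<n} \<rightarrow>\<^sub>E {..<N}" using J by (rule PiE_mono)
  have a: "(\<Sum>f\<in>{..<n} \<rightarrow>\<^sub>E {..<N}. \<Sum>k<N. (a f k)\<^sup>2) \<le> B ^ (2 * p + 2) * om (Suc n)"
  proof -
    have "(\<Sum>w\<in>({..<n} \<rightarrow>\<^sub>E {..<N}) \<times> {..<N}. (\<integral>x. xi v x ^ Suc p * (case w of (f, k) \<Rightarrow> \<lambda>x. mon n f x * xi k x) x \<partial>\<mu>)\<^sup>2)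
        \<le> (B ^ Suc p)\<^sup>2 * om (Suc n)"
    proof (rule sum_square_integral_le[OF _ _ _ _ _ kernel_mon_Suc, where L = "B ^ n * B"])
      fix w x assume "w \<in> ({..<n} \<rightarrow>\<^sub>E {..<N}) \<times> {..<N}"
      then obtain f k where w: "w = (f, k)" "f \<in> {..<n} \<rightarrow>\<^sub>E {..<N}" "k < N" by auto
      show "(case w of (f, k) \<Rightarrow> \<lambda>x. mon n f x * xi k x) \<in> borel_measurable \<mu>"
        using w by simp
      show "\<bar>(case w of (f, k) \<Rightarrow> \<lambda>x. mon n f x * xi k x) x\<bar> \<le> B ^ n * B"
        unfolding w split abs_mult using w B_ge_1
        by (intro mult_mono mon_bounded xi_bounded) auto
    qed (use fin v xi_pow_bounded[OF v, of _ "Suc p"] in auto)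
    moreover have "(B ^ Suc p)\<^sup>2 = B ^ (2 * p + 2)"
      unfolding power_mult[symmetric] by (simp add: mult.commute)
    moreover have "(\<Sum>w\<in>({..<n} \<rightarrow>\<^sub>E {..<N}) \<times> {..<N}. (\<integral>x. xi v x ^ Suc p * (case w of (f, k) \<Rightarrow> \<lambda>x. mon n f x * xi k x) x \<partial>\<mu>)\<^sup>2)
        = (\<Sum>f\<in>{..<n} \<rightarrow>\<^sub>E {..<N}. \<Sum>k<N. (a f k)\<^sup>2)"
      unfolding a_def sum.cartesian_product by (intro sum.cong) auto
    ultimately show ?thesis by simp
  qed
  have b: "(\<Sum>f\<in>{..<n} \<rightarrow>\<^sub>E {..<N}. (b f)\<^sup>2) \<le> (B ^ p)\<^sup>2 * om n"
    unfolding b_def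
    by (rule sum_square_integral_le[OF fin _ _ _ _ kernel_mon, where L = "B ^ n"])
       (use v xi_pow_bounded[OF v] in \<open>auto intro: mon_bounded\<close>)
  have c: "(\<Sum>k<N. (c k)\<^sup>2) \<le> B\<^sup>2 * om 1"
    unfolding c_def
    by (rule sum_square_integral_le[OF _ _ _ _ _ kernel_1, where L = B])
       (use v xi_bounded in auto)
  have "(\<Sum>f\<in>{..<n} \<rightarrow>\<^sub>E J. \<Sum>k\<in>J. (a f k - b f * c k)\<^sup>2)
      \<le> (\<Sum>f\<in>{..<n} \<rightarrow>\<^sub>E {..<N}. \<Sum>k<N. 2 * (a f k)\<^sup>2 + 2 * ((b f)\<^sup>2 * (c k)\<^sup>2))"
  proof -
    have "(u - w)\<^sup>2 \<le> 2 * u\<^sup>2 + 2 * w\<^sup>2" for u w :: real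
      using zero_le_power2[of "u + w"] by (simp add: power2_eq_square algebra_simps)
    then have *: "(a f k - b f * c k)\<^sup>2 \<le> 2 * (a f k)\<^sup>2 + 2 * ((b f)\<^sup>2 * (c k)\<^sup>2)" for f k
      by (metis power_mult_distrib)
    have "(\<Sum>f\<in>{..<n} \<rightarrow>\<^sub>E J. \<Sum>k\<in>J. (a f k - b f * c k)\<^sup>2) \<le> (\<Sum>f\<in>{..<n} \<rightarrow>\<^sub>E J. \<Sum>k<N. (a f k - b f * c k)\<^sup>2)"
      using J by (intro sum_mono sum_mono2) auto
    also have "\<dots> \<le> (\<Sum>f\<in>{..<n} \<rightarrow>\<^sub>E {..<N}. \<Sum>k<N. (a f k - b f * c k)\<^sup>2)"
      using sub fin by (intro sum_mono2) (auto intro: sum_nonneg)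
    also have "\<dots> \<le> (\<Sum>f\<in>{..<n} \<rightarrow>\<^sub>E {..<N}. \<Sum>k<N. 2 * (a f k)\<^sup>2 + 2 * ((b f)\<^sup>2 * (c k)\<^sup>2))"
      by (intro sum_mono *)
    finally show ?thesis .
  qed
  also have "\<dots> = 2 * (\<Sum>f\<in>{..<n} \<rightarrow>\<^sub>E {..<N}. \<Sum>k<N. (a f k)\<^sup>2)
      + 2 * ((\<Sum>f\<in>{..<n} \<rightarrow>\<^sub>E {..<N}. (b f)\<^sup>2) * (\<Sum>k<N. (c k)\<^sup>2))"
    by (simp add: sum.distrib sum_distrib_left sum_product mult_ac)
  also have "\<dots> \<le> 2 * (B ^ (2 * p + 2) * om (Suc n)) + 2 * (((B ^ p)\<^sup>2 * om n) * (B\<^sup>2 * om 1))"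
    using a b c om_nonneg by (intro add_mono mult_left_mono mult_mono) (auto intro!: sum_nonneg)
  also have "\<dots> = 2 * (B ^ (2 * p + 2) * om (Suc n)) + 2 * (B ^ (2 * p + 2) * (om n * om 1))"
  proof -
    have "(B ^ p)\<^sup>2 * B\<^sup>2 = B ^ (2 * p + 2)" unfolding power_add power_even_eq ..
    moreover have "((B ^ p)\<^sup>2 * om n) * (B\<^sup>2 * om 1) = ((B ^ p)\<^sup>2 * B\<^sup>2) * (om n * om 1)"
      by (simp only: mult_ac)
    ultimately show ?thesis by (simp only:)
  qed
  also have "\<dots> \<le> 4 * B ^ (2 * p + 2) * om (Suc n)"
    using mult_left_mono[OF om_mult[of n], of "B ^ (2 * p + 2)"] B_ge_1 by simp
  finally show ?thesis by (simp add: a_def b_def c_def mult_ac)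
qed

text \<open>Here the uncentred matrix is the main term, not an error. Subtracting the rank-one
  matrix \<open>m i * m k\<close> cannot increase the sum of squares, by Jensen's inequality. It
  decreases it by an amount that Young's inequality controls through the size of the vector
  \<open>m\<close>; the parameter \<open>h\<close> keeps this bound linear in that size.\<close>

lemma covariance_matrix:
  assumes v: "v < N" and J: "J \<subseteq> {..<N}" and h: "h > 0"
  defines "m \<equiv> \<lambda>i. \<integral>x. xi v x * xi i x \<partial>\<mu>"
    and "A \<equiv> \<lambda>i k. \<integral>x. (xi v x * xi i x) * (xi v x * xi k x) \<partial>\<mu>"
  shows "(\<Sum>i\<in>J. \<Sum>k\<in>J. (A i k - m i * m k)\<^sup>2) \<le> (\<Sum>i\<in>J. \<Sum>k\<in>J. (A i k)\<^sup>2)" (is ?upper)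
    and "(\<Sum>i\<in>J. \<Sum>k\<in>J. (A i k)\<^sup>2) - h * (\<Sum>i\<in>J. (m i)\<^sup>2) - B ^ 6 / h * om 3
      \<le> (\<Sum>i\<in>J. \<Sum>k\<in>J. (A i k - m i * m k)\<^sup>2)" (is ?lower)
proof -
  have finJ: "finite J" using J by (rule finite_subset) simp
  have [measurable]: "xi v \<in> borel_measurable \<mu>" using v by simp
  have [measurable]: "xi i \<in> borel_measurable \<mu>" if "i \<in> J" for i using J that by auto
  have xb: "\<bar>xi i x\<bar> \<le> B" if "i \<in> J" for i x using J that xi_bounded by auto
  have sb: "\<bar>xi v x * xi i x\<bar> \<le> B * B" if "i \<in> J" for i x
    unfolding abs_mult using xb[OF that] xi_bounded[OF v] B_ge_1 by (intro mult_mono) auto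
  have int1: "integrable \<mu> (\<lambda>x. xi v x * xi i x)" if "i \<in> J" for i
    using that sb by (intro integrable_bounded_by[of _ "B * B"]) auto
  have int2: "integrable \<mu> (\<lambda>x. (xi v x * xi i x) * (xi v x * xi k x))" if "i \<in> J" "k \<in> J" for i k
  proof (rule integrable_bounded_by[of _ "B * B * (B * B)"])
    show "\<bar>xi v x * xi i x * (xi v x * xi k x)\<bar> \<le> B * B * (B * B)" for x
      unfolding abs_mult[of "xi v x * xi i x"] using sb[OF that(1), of x] sb[OF that(2), of x] B_ge_1
      by (intro mult_mono) auto
  qed (use that in measurable)
  define b where "b = (\<Sum>i\<in>J. (m i)\<^sup>2)"
  define X where "X = (\<Sum>i\<in>J. \<Sum>k\<in>J. A i k * (m i * m k))"
  define Y where "Y = (\<Sum>i\<in>J. \<Sum>k\<in>J. (A i k)\<^sup>2)"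
  have b0: "b \<ge> 0" unfolding b_def by (rule sum_nonneg) auto
  have bb: "(\<Sum>i\<in>J. \<Sum>k\<in>J. (m i * m k)\<^sup>2) = b\<^sup>2"
    by (simp add: b_def power2_eq_square[of "\<Sum>i\<in>J. (m i)\<^sup>2"] sum_product power_mult_distrib)
  have expand: "(\<Sum>i\<in>J. \<Sum>k\<in>J. (A i k - m i * m k)\<^sup>2) = Y - 2 * X + b\<^sup>2"
    unfolding bb[symmetric] X_def Y_def
    by (simp add: power2_diff sum.distrib sum_subtractf sum_distrib_left mult.assoc)
  \<comment> \<open>\<open>X\<close> is the second moment of the linear combination with
    coefficients \<open>m i\<close>, and \<open>b\<close> is its mean; this gives
    \<open>b\<^sup>2 \<le> X\<close>.\<close>
  have X: "X = (\<integral>x. (\<Sum>i\<in>J. m i * (xi v x * xi i x))\<^sup>2 \<partial>\<mu>)"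
  proof -
    have "(\<Sum>i\<in>J. m i * (xi v x * xi i x))\<^sup>2 = (\<Sum>i\<in>J. \<Sum>k\<in>J. (m i * m k) * ((xi v x * xi i x) * (xi v x * xi k x)))" for x
      by (simp add: power2_eq_square sum_product mult_ac)
    then show ?thesis using int2
      by (simp add: X_def A_def Bochner_Integration.integral_sum mult.commute[of _ "m _ * m _"])
  qed
  have bm: "b = (\<integral>x. (\<Sum>i\<in>J. m i * (xi v x * xi i x)) \<partial>\<mu>)"
    using int1 by (simp add: b_def m_def Bochner_Integration.integral_sum power2_eq_square)
  have "b\<^sup>2 \<le> X"
  proof -
    let ?g = "\<lambda>x. \<Sum>i\<in>J. m i * (xi v x * xi i x)"
    have i1: "integrable \<mu> ?g" using int1 by (intro Bochner_Integration.integrable_sum integrable_mult_right) auto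
    have i2: "integrable \<mu> (\<lambda>x. (?g x)\<^sup>2)"
      unfolding power2_eq_square sum_product
      using int2 by (intro Bochner_Integration.integrable_sum) (simp add: mult_ac)
    have "0 \<le> (\<integral>x. (?g x - b)\<^sup>2 \<partial>\<mu>)" by simp
    also have "\<dots> = (\<integral>x. (?g x)\<^sup>2 - 2 * b * ?g x + b\<^sup>2 \<partial>\<mu>)"
      by (intro Bochner_Integration.integral_cong) (auto simp: power2_diff)
    also have "\<dots> = X - 2 * b * b + b\<^sup>2" unfolding X using i1 i2 by (simp add: bm[symmetric] prob_space)
    finally show ?thesis by (simp add: power2_eq_square)
  qed
  then show ?upper using expand zero_le_power2[of b] unfolding Y_def by linarith
  have Y: "Y \<le> B ^ 4 * om 2"
  proof -
    have "Y \<le> (\<Sum>i<N. \<Sum>k<N. (A i k)\<^sup>2)"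
    proof -
      have "Y \<le> (\<Sum>i\<in>J. \<Sum>k<N. (A i k)\<^sup>2)"
        unfolding Y_def using J by (intro sum_mono sum_mono2) auto
      also have "\<dots> \<le> (\<Sum>i<N. \<Sum>k<N. (A i k)\<^sup>2)"
        using J by (intro sum_mono2) (auto intro: sum_nonneg)
      finally show ?thesis .
    qed
    also have "\<dots> = (\<Sum>w\<in>{..<N} \<times> {..<N}. (\<integral>x. xi v x ^ 2 * (xi (fst w) x * xi (snd w) x) \<partial>\<mu>)\<^sup>2)"
      unfolding A_def by (simp add: sum.cartesian_product split_def power2_eq_square mult_ac)
    also have "\<dots> \<le> (B ^ 2)\<^sup>2 * om 2"
    proof (rule sum_square_integral_le[where L = "B * B"])
      fix w x assume w: "w \<in> {..<N} \<times> {..<N}"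
      then show "\<bar>xi (fst w) x * xi (snd w) x\<bar> \<le> B * B"
        unfolding abs_mult using xi_bounded B_ge_1 by (intro mult_mono) auto
    next
      fix z
      show "(\<Sum>w\<in>{..<N} \<times> {..<N}. xi (fst w) (fst z) * xi (snd w) (fst z) * (xi (fst w) (snd z) * xi (snd w) (snd z))) = ov z ^ 2"
        by (simp add: ov_def power2_eq_square[of "sum _ _"] sum_product sum.cartesian_product split_def mult_ac)
    qed (use v xi_pow_bounded[OF v, of _ 2] in \<open>auto simp del: abs_power2 power_abs\<close>)
    finally show ?thesis by (simp add: power_mult[symmetric])
  qed
  have bo: "b \<le> B\<^sup>2 * om 1"
  proof -
    have "b \<le> (\<Sum>i<N. (m i)\<^sup>2)" unfolding b_def using J by (intro sum_mono2) auto
    also have "\<dots> \<le> B\<^sup>2 * om 1"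
      unfolding m_def
      by (rule sum_square_integral_le[OF _ _ _ _ _ kernel_1, where L = B]) (use v xi_bounded in auto)
    finally show ?thesis .
  qed
  have "b * Y \<le> (B\<^sup>2 * om 1) * (B ^ 4 * om 2)"
    using bo Y b0 om_nonneg by (intro mult_mono) (auto simp: Y_def intro!: sum_nonneg)
  also have "\<dots> = B ^ 6 * (om 2 * om 1)" by (simp add: power_add[symmetric])
  also have "\<dots> \<le> B ^ 6 * om 3" using om_mult[of 2] B_ge_1 by (intro mult_left_mono) (auto simp: numeral_3_eq_3 numeral_2_eq_2)
  finally have bY: "b * Y \<le> B ^ 6 * om 3" .
  have "2 * X \<le> h * b + b * Y / h"
  proof (cases "b = 0")
    case True
    then have "m i = 0" if "i \<in> J" for i
      using that finJ unfolding b_def by (simp add: sum_nonneg_eq_0_iff)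
    then show ?thesis using True by (simp add: X_def)
  next
    case False
    \<comment> \<open>The weight \<open>b / h\<close> in Young's inequality splits
      \<open>2 * X\<close> into \<open>h * b\<close>, which is kept, and \<open>b * Y / h\<close>, a
      product of overlap moments of total order three. It must be positive, hence the separate case
      \<open>b = 0\<close>.\<close>
    define q where "q = b / h"
    have q: "q > 0" using False b0 h by (simp add: q_def)
    have "2 * (A i k * (m i * m k)) \<le> q * (A i k)\<^sup>2 + (m i * m k)\<^sup>2 / q" for i k
    proof -
      have "0 \<le> (q * A i k - m i * m k)\<^sup>2 / q" using q by simp
      also have "\<dots> = q * (A i k)\<^sup>2 - 2 * (A i k * (m i * m k)) + (m i * m k)\<^sup>2 / q"
        using q by (simp add: power2_diff field_simps power2_eq_square)
      finally show ?thesis by simp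
    qed
    then have "(\<Sum>i\<in>J. \<Sum>k\<in>J. 2 * (A i k * (m i * m k))) \<le> (\<Sum>i\<in>J. \<Sum>k\<in>J. q * (A i k)\<^sup>2 + (m i * m k)\<^sup>2 / q)"
      by (intro sum_mono)
    also have "\<dots> = q * Y + b\<^sup>2 / q"
      unfolding bb[symmetric] Y_def by (simp add: sum.distrib sum_distrib_left sum_divide_distrib)
    also have "\<dots> = h * b + b * Y / h"
      using False h by (simp add: q_def power2_eq_square field_simps)
    finally show ?thesis by (simp add: X_def sum_distrib_left)
  qed
  moreover have "b * Y / h \<le> B ^ 6 / h * om 3"
    using divide_right_mono[OF bY, of h] h by (simp add: mult.commute)
  ultimately show ?lower
    unfolding expand b_def[symmetric] Y_def[symmetric] using zero_le_power2[of b] by linarith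
qed

end

section \<open>Posterior averages\<close>

context gibbs
begin

text \<open>The posterior law of the signal when the observed array is \<open>w\<close>.\<close>

definition pm :: "('k \<Rightarrow> real) \<Rightarrow> ('k \<Rightarrow> real) \<Rightarrow> 'x measure" where
  "pm c w = density M (\<lambda>x. exp (ener c w x) / part c w)"

lemma sets_pm[simp, measurable_cong]: "sets (pm c w) = sets M"
  by (simp add: pm_def)

lemma space_pm[simp]: "space (pm c w) = space M"
  by (simp add: pm_def)

lemma integral_pm:
  assumes [measurable]: "T \<in> borel_measurable M"
  shows "(\<integral>x. T x \<partial>pm c w) = post c w T"
proof -
  have "(\<integral>x. T x \<partial>pm c w) = (\<integral>x. (exp (ener c w x) / part c w) *\<^sub>R T x \<partial>M)"
    unfolding pm_def using part_pos[of c w] by (intro integral_density) auto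
  then show ?thesis by (simp add: post_def mix_def mult.commute)
qed

lemma prob_space_pm: "prob_space (pm c w)"
proof (rule prob_spaceI)
  have "emeasure (pm c w) (space (pm c w)) = (\<integral>\<^sup>+x. exp (ener c w x) / part c w \<partial>M)"
    by (simp add: pm_def emeasure_density cong: nn_integral_cong)
  also have "\<dots> = ennreal (\<integral>x. exp (ener c w x) / part c w \<partial>M)"
    using integrable_mix[OF bm_const[of 1], of c w] part_pos[of c w]
    by (intro nn_integral_eq_integral) auto
  also have "\<dots> = 1" using part_pos[of c w] by (simp add: mix_def)
  finally show "emeasure (pm c w) (space (pm c w)) = 1" .
qed

definition nice :: "(('k \<Rightarrow> real) \<Rightarrow> real) \<Rightarrow> bool" where
  "nice h \<longleftrightarrow> h \<in> borel_measurable (gauss K) \<and> (\<exists>L. \<forall>w. \<bar>h w\<bar> \<le> L)"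

lemma niceI: "h \<in> borel_measurable (gauss K) \<Longrightarrow> (\<And>w. \<bar>h w\<bar> \<le> L) \<Longrightarrow> nice h"
  unfolding nice_def by blast

lemma nice_const: "nice (\<lambda>_. a)"
  by (rule niceI[of _ "\<bar>a\<bar>"]) auto

lemma nice_add:
  assumes "nice g" "nice h" shows "nice (\<lambda>w. g w + h w)"
proof -
  obtain L L' where *: "\<And>w. \<bar>g w\<bar> \<le> L" "\<And>w. \<bar>h w\<bar> \<le> L'" using assms unfolding nice_def by blast
  have "\<bar>g w + h w\<bar> \<le> L + L'" for w using *(1)[of w] *(2)[of w] by linarith
  then show ?thesis using assms by (intro niceI) (auto simp: nice_def)
qed

lemma nice_mult:
  assumes "nice g" "nice h" shows "nice (\<lambda>w. g w * h w)"
proof -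
  obtain L L' where *: "\<And>w. \<bar>g w\<bar> \<le> L" "\<And>w. \<bar>h w\<bar> \<le> L'" using assms unfolding nice_def by blast
  have "L \<ge> 0" using *(1)[of undefined] by linarith
  then have "\<bar>g w * h w\<bar> \<le> L * L'" for w unfolding abs_mult using * by (intro mult_mono) auto
  then show ?thesis using assms by (intro niceI) (auto simp: nice_def)
qed

lemma nice_diff: "nice g \<Longrightarrow> nice h \<Longrightarrow> nice (\<lambda>w. g w - h w)"
  using nice_add[OF _ nice_mult[OF nice_const[of "-1"]], of g h] by simp

lemma nice_power2: "nice g \<Longrightarrow> nice (\<lambda>w. (g w)\<^sup>2)"
  unfolding power2_eq_square by (rule nice_mult)

lemma nice_sum:
  assumes "finite A" "\<And>a. a \<in> A \<Longrightarrow> nice (g a)" shows "nice (\<lambda>w. \<Sum>a\<in>A. g a w)"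
  using assms
proof (induction A rule: finite_induct)
  case empty show ?case using nice_const[of 0] by simp
next
  case (insert a A)
  then have "nice (\<lambda>w. g a w + (\<Sum>a\<in>A. g a w))" by (intro nice_add) auto
  then show ?case using insert.hyps by simp
qed

lemma abs_post_le:
  assumes "bm T" "\<And>x. \<bar>T x\<bar> \<le> L" shows "\<bar>post c w T\<bar> \<le> L"
  using mix_abs_le[OF assms, of c w] part_pos[of c w] by (simp add: post_def divide_le_eq)

lemma measurable_post[measurable]:
  "T \<in> borel_measurable M \<Longrightarrow> (\<lambda>w. post c w T) \<in> borel_measurable (gauss K)"
  unfolding post_def by (intro borel_measurable_divide measurable_mix) auto

lemma nice_post:
  assumes "bm T" shows "nice (\<lambda>w. post c w T)"
proof -
  obtain L where [measurable]: "T \<in> borel_measurable M" and L: "\<And>x. \<bar>T x\<bar> \<le> L"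
    using assms unfolding bm_def by blast
  show ?thesis by (rule niceI[OF measurable_post abs_post_le[OF assms L]]) measurable
qed

lemma integrable_avg:
  assumes "nice h" shows "integrable (gauss K) (\<lambda>w. part c w * h w)"
proof -
  obtain L where L: "\<And>k. k \<in> K \<Longrightarrow> \<bar>c k\<bar> \<le> L" using ex_bound by blast
  obtain L' where *: "\<And>w. \<bar>h w\<bar> \<le> L'" and [measurable]: "h \<in> borel_measurable (gauss K)"
    using assms unfolding nice_def by blast
  have "subexp K {()} (\<lambda>_ w. part c w * h w)"
    using subexp_mult[OF subexp_part(1)[of "{()}" "\<lambda>_. c" L] subexp_bounded[of "{()}" "\<lambda>_. h" L']] L * by auto
  from integrable_subexp[OF finite_K this, of "()"] show ?thesis by simp
qed

lemma avg_mono: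
  assumes "nice g" "nice h" "\<And>w. g w \<le> h w" shows "avg c g \<le> avg c h"
  unfolding avg_def
  by (intro integral_mono integrable_avg assms(1,2) mult_left_mono assms(3)) (simp add: part_pos less_imp_le)

lemma avg_nonneg: "(\<And>w. 0 \<le> h w) \<Longrightarrow> 0 \<le> avg c h"
  unfolding avg_def using part_pos[THEN less_imp_le] by (intro integral_nonneg_AE) auto

lemma avg_add: "nice g \<Longrightarrow> nice h \<Longrightarrow> avg c (\<lambda>w. g w + h w) = avg c g + avg c h"
  unfolding avg_def distrib_left by (intro Bochner_Integration.integral_add integrable_avg)

lemma avg_mult: "avg c (\<lambda>w. a * h w) = a * avg c h"
  unfolding avg_def by (simp add: mult.left_commute)

lemma avg_diff: "nice g \<Longrightarrow> nice h \<Longrightarrow> avg c (\<lambda>w. g w - h w) = avg c g - avg c h"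
  unfolding avg_def right_diff_distrib by (intro Bochner_Integration.integral_diff integrable_avg)

lemma avg_sum:
  "(\<And>a. a \<in> A \<Longrightarrow> nice (g a)) \<Longrightarrow> avg c (\<lambda>w. \<Sum>a\<in>A. g a w) = (\<Sum>a\<in>A. avg c (g a))"
  unfolding avg_def sum_distrib_left by (intro Bochner_Integration.integral_sum integrable_avg)

lemma measurable_ener_pair[measurable]: "(\<lambda>(w, x). ener c w x) \<in> borel_measurable (gauss K \<Otimes>\<^sub>M M)"
proof -
  have [measurable]: "(\<lambda>(w, x). w k) \<in> borel_measurable (gauss K \<Otimes>\<^sub>M M)" if "k \<in> K" for k
    using measurable_compose[OF measurable_fst measurable_component_singleton[OF that, of "\<lambda>_. std_normal"]]
    by (simp add: split_def)
  show ?thesis unfolding ener_def split_def by measurable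
qed

text \<open>By Cameron-Martin each exponential weight is a probability density against the noise;
  hence \<open>part\<close> integrates to the mass of the prior.\<close>

lemma nn_integral_exp_ener: "(\<integral>\<^sup>+w. exp (ener c w x) \<partial>gauss K) = 1"
proof -
  interpret G: prob_space "gauss K" by (rule prob_space_gauss)
  have "(\<integral>\<^sup>+w. exp (\<Sum>k\<in>K. (c k * S k x) * w k - (c k * S k x)\<^sup>2 / 2) \<partial>gauss K) = (\<integral>\<^sup>+w. 1 \<partial>gauss K)"
    using nn_integral_gauss_shift[OF finite_K, of "\<lambda>_. 1" "\<lambda>k. c k * S k x"] by simp
  then show ?thesis by (simp add: ener_def G.emeasure_space_1 power_mult_distrib mult_ac)
qed

lemma nn_integral_part: "ennreal (part c w) = (\<integral>\<^sup>+x. exp (ener c w x) \<partial>M)"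
  unfolding mix_def using integrable_mix[OF bm_const[of 1], of c w]
  by (subst nn_integral_eq_integral) auto

lemma integral_part: "(\<integral>w. part c w \<partial>gauss K) = measure M (space M)"
proof -
  interpret G: prob_space "gauss K" by (rule prob_space_gauss)
  interpret GM: pair_sigma_finite "gauss K" M ..
  have "(\<integral>\<^sup>+w. part c w \<partial>gauss K) = (\<integral>\<^sup>+w. \<integral>\<^sup>+x. exp (ener c w x) \<partial>M \<partial>gauss K)"
    by (simp add: nn_integral_part)
  also have "\<dots> = (\<integral>\<^sup>+x. \<integral>\<^sup>+w. exp (ener c w x) \<partial>gauss K \<partial>M)"
    by (rule GM.Fubini'[symmetric]) measurable
  also have "\<dots> = emeasure M (space M)" by (simp add: nn_integral_exp_ener)
  finally have "(\<integral>\<^sup>+w. part c w \<partial>gauss K) = ennreal (measure M (space M))"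
    by (simp add: emeasure_eq_measure)
  then show ?thesis
    using part_pos[THEN less_imp_le]
    by (subst integral_eq_nn_integral) auto
qed

lemma avg_const: "avg c (\<lambda>_. a) = a * measure M (space M)"
  using avg_mult[of c a "\<lambda>_. 1"] by (simp add: avg_def integral_part)

end

section \<open>The product prior with clipped coordinates\<close>

lemma finite_upper_pairs[simp]: "finite (upper_pairs N)"
  by (rule finite_subset[of _ "{..<N} \<times> {..<N}"]) (auto simp: upper_pairs_def)

lemma sum_PiE_2: "(\<Sum>f\<in>{..<2::nat} \<rightarrow>\<^sub>E J. h (f 0) (f 1)) = (\<Sum>i\<in>J. \<Sum>k\<in>J. h i k)"
proof -
  have "(\<Sum>f\<in>{..<2::nat} \<rightarrow>\<^sub>E J. h (f 0) (f 1)) = (\<Sum>(i, k)\<in>J \<times> J. h i k)"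
    by (rule sum.reindex_bij_witness[of _ "\<lambda>(i, k). \<lambda>r\<in>{..<2}. if r = 0 then i else k" "\<lambda>f. (f 0, f 1)"])
       (auto simp: PiE_def extensional_def fun_eq_iff less_2_cases_iff Pi_iff)
  then show ?thesis by (simp add: sum.cartesian_product)
qed

text \<open>
  The signal is clipped to \<open>[-B, B]\<close>, which changes nothing almost surely and makes every
  function of it bounded everywhere.
\<close>
definition clip :: "real \<Rightarrow> real \<Rightarrow> real" where
  "clip B y = max (- B) (min B y)"

text \<open>\<open>N\<close> is a parameter of the locale: everything inside is for a fixed size
  with explicit dependence on \<open>N\<close>, and the limit is taken outside.\<close>

locale spins = prior: prob_space P for P :: "real measure" +
  fixes B :: real and N :: nat
  assumes sets_P[measurable_cong]: "sets P = sets borel"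
    and B_ge_1: "1 \<le> B" and AE_bound: "AE x in P. \<bar>x\<bar> \<le> B"
    and mean: "(\<integral>x. x \<partial>P) = 0" and second_moment: "(\<integral>x. x\<^sup>2 \<partial>P) = 1"
begin

abbreviation xi :: "nat \<Rightarrow> (nat \<Rightarrow> real) \<Rightarrow> real" where
  "xi i x \<equiv> clip B (x i)"

lemma measurable_clip[measurable]: "clip B \<in> borel_measurable borel"
  unfolding clip_def[abs_def] by measurable

lemma clip_bounded: "\<bar>clip B y\<bar> \<le> B"
  using B_ge_1 by (auto simp: clip_def)

lemma clip_AE: "AE x in P. clip B x = x"
  using AE_bound by eventually_elim (auto simp: clip_def)

lemma clip_moments: "(\<integral>y. clip B y \<partial>P) = 0" "(\<integral>y. (clip B y)\<^sup>2 \<partial>P) = 1"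
proof -
  have "(\<integral>y. clip B y \<partial>P) = (\<integral>x. x \<partial>P)" "(\<integral>y. (clip B y)\<^sup>2 \<partial>P) = (\<integral>x. x\<^sup>2 \<partial>P)"
    by (intro integral_cong_AE; use clip_AE in \<open>auto simp: measurable_cong_sets[OF sets_P refl] elim: AE_mp\<close>)+
  then show "(\<integral>y. clip B y \<partial>P) = 0" "(\<integral>y. (clip B y)\<^sup>2 \<partial>P) = 1"
    using mean second_moment by auto
qed

abbreviation "M \<equiv> spike_law P N"

sublocale prior_product: product_prob_space "\<lambda>_::nat. P" "{..<N}"
  by unfold_locales

lemma prob_space_M: "prob_space M"
  unfolding spike_law_def by (rule prob_space_PiM) (rule prior.prob_space_axioms)

lemma measurable_xi[measurable]: "i < N \<Longrightarrow> xi i \<in> borel_measurable M"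
  unfolding spike_law_def by measurable

sublocale gibbs M "upper_pairs N" "\<lambda>(i, j) x. xi i x * xi j x" "B * B"
proof -
  interpret M: prob_space M by (rule prob_space_M)
  show "gibbs M (upper_pairs N) (\<lambda>(i, j) x. xi i x * xi j x) (B * B)"
  proof unfold_locales
    fix k assume "k \<in> upper_pairs N"
    then obtain i j where k: "k = (i, j)" "i < N" "j < N" by (auto simp: upper_pairs_def)
    show "(case k of (i, j) \<Rightarrow> \<lambda>x. xi i x * xi j x) \<in> borel_measurable M"
      using k by simp
    show "\<bar>(case k of (i, j) \<Rightarrow> \<lambda>x. xi i x * xi j x) x\<bar> \<le> B * B" for x
      unfolding k split abs_mult using clip_bounded B_ge_1 by (intro mult_mono) auto
  qed (auto simp: M.emeasure_space_1)
qed

lemma replicas_pm: "replicas (pm c w) N xi B"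
proof -
  interpret prob_space "pm c w" by (rule prob_space_pm)
  show ?thesis
    by unfold_locales (auto intro: clip_bounded B_ge_1)
qed

abbreviation xmon :: "nat \<Rightarrow> (nat \<Rightarrow> nat) \<Rightarrow> (nat \<Rightarrow> real) \<Rightarrow> real" where
  "xmon \<equiv> replicas.mon xi"

text \<open>\<open>mon\<close> depends on \<open>xi\<close> alone, so it may be unfolded through any
  instance of the replica locale; the arguments \<open>undefined\<close> are placeholders.\<close>

lemma xmon_def: "xmon n f x = (\<Prod>r<n. xi (f r) x)"
  using replicas.mon_def[OF replicas_pm[of undefined undefined]] .

lemma mon_2: "xmon 2 f x = xi (f 0) x * xi (f 1) x"
  by (simp add: xmon_def numeral_2_eq_2 lessThan_Suc)

lemma bm_xi: "i < N \<Longrightarrow> bm (xi i)"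
  by (rule bmI[of _ B]) (auto simp: clip_bounded)

lemma bm_mon:
  assumes "f \<in> {..<n} \<rightarrow>\<^sub>E {..<N}" shows "bm (xmon n f)"
proof -
  interpret R: replicas "pm undefined undefined" N xi B by (rule replicas_pm)
  show ?thesis
    using R.measurable_mon[OF assms] R.mon_bounded[OF assms] by (intro bmI[of _ "B ^ n"]) auto
qed

lemma finite_idx[simp]: "finite J \<Longrightarrow> finite ({..<n::nat} \<rightarrow>\<^sub>E (J::nat set))"
  by (simp add: finite_PiE)

definition moment :: "(nat \<times> nat \<Rightarrow> real) \<Rightarrow> nat \<Rightarrow> real" where
  "moment c n = (\<Sum>f\<in>{..<n} \<rightarrow>\<^sub>E {..<N}. avg c (\<lambda>w. (post c w (xmon n f))\<^sup>2))"

text \<open>The overlap moment at a fixed observation, given directly as a sum of squares. For even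
  \<open>n\<close> it agrees with \<open>om\<close> of the posterior, and its planted average is
  \<open>moment\<close>.\<close>

definition om' :: "nat \<Rightarrow> (nat \<times> nat \<Rightarrow> real) \<Rightarrow> (nat \<times> nat \<Rightarrow> real) \<Rightarrow> real" where
  "om' n c w = (\<Sum>f\<in>{..<n} \<rightarrow>\<^sub>E {..<N}. (post c w (xmon n f))\<^sup>2)"

lemma nice_om': "nice (om' n c)"
  unfolding om'_def[abs_def] by (intro nice_sum nice_power2 nice_post bm_mon) auto

lemma avg_om': "avg c (om' n c) = moment c n"
  unfolding om'_def[abs_def] moment_def
  by (intro avg_sum nice_power2 nice_post bm_mon) auto

lemma om_eq: "even n \<Longrightarrow> replicas.om (pm c w) N xi n = om' n c w"
proof -
  assume n: "even n"
  interpret R: replicas "pm c w" N xi B by (rule replicas_pm)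
  show ?thesis
    unfolding R.om_even[OF n, symmetric] om'_def
    by (intro sum.cong refl, subst integral_pm) (auto simp: bm_mon[unfolded bm_def])
qed

lemma om_3_le: "d > 0 \<Longrightarrow> replicas.om (pm c w) N xi 3 \<le> (d * om' 2 c w + om' 4 c w / d) / 2"
  using replicas.om_young[OF replicas_pm, of d c w 2] om_eq[of 2 c w] om_eq[of 4 c w] by simp

lemma om_1_le: "d > 0 \<Longrightarrow> replicas.om (pm c w) N xi 1 \<le> (d + om' 2 c w / d) / 2"
  using replicas.om_young[OF replicas_pm, of d c w 0] replicas.om_0[OF replicas_pm, of c w]
    om_eq[of 2 c w] by (simp add: numeral_2_eq_2)

end

section \<open>Decoupling one coordinate\<close>

context spins
begin

abbreviation edge :: "nat \<times> nat \<Rightarrow> (nat \<Rightarrow> real) \<Rightarrow> real" where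
  "edge \<equiv> \<lambda>(i, j) x. xi i x * xi j x"

text \<open>\<open>a\<close> is the square root of the signal-to-noise ratio \<open>lam\<close>,
  which keeps the coefficients differentiable at 0.\<close>

definition unif :: "real \<Rightarrow> nat \<times> nat \<Rightarrow> real" where
  "unif a = (\<lambda>_. a / sqrt N)"

text \<open>The edges at vertex \<open>v\<close> are scaled by \<open>t\<close>: at
  \<open>t = 1\<close> this is the full model, at \<open>t = 0\<close> coordinate \<open>v\<close>
  follows its prior independently of the others.\<close>

definition cav :: "real \<Rightarrow> nat \<Rightarrow> real \<Rightarrow> nat \<times> nat \<Rightarrow> real" where
  "cav a v t k = a / sqrt N * (if v = fst k \<or> v = snd k then t else 1)"

abbreviation others :: "nat \<Rightarrow> nat set" where
  "others v \<equiv> {..<N} - {v}"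

lemma cav_1: "cav a v 1 = unif a"
  by (auto simp: cav_def unif_def)

lemma sum_touching:
  fixes h :: "((nat \<Rightarrow> real) \<Rightarrow> real) \<Rightarrow> real"
  assumes "v < N"
  shows "(\<Sum>k\<in>{k \<in> upper_pairs N. v = fst k \<or> v = snd k}. h (edge k)) = (\<Sum>i\<in>others v. h (\<lambda>x. xi v x * xi i x))"
  by (rule sum.reindex_bij_witness[of _ "\<lambda>i. (min v i, max v i)" "\<lambda>k. if fst k = v then snd k else fst k"])
     (use assms in \<open>auto simp: upper_pairs_def min_def max_def mult.commute\<close>)

lemma sum_off_diagonal:
  fixes h :: "((nat \<Rightarrow> real) \<Rightarrow> real) \<Rightarrow> real"
  shows "(\<Sum>v<N. \<Sum>i\<in>others v. h (\<lambda>x. xi v x * xi i x)) = 2 * (\<Sum>k\<in>upper_pairs N. h (edge k))"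
proof -
  let ?L = "{(v, i). v < N \<and> i < v}"
  have fin: "finite ?L" by (rule finite_subset[of _ "{..<N} \<times> {..<N}"]) auto
  have "(\<Sum>v<N. \<Sum>i\<in>others v. h (\<lambda>x. xi v x * xi i x))
      = (\<Sum>(v, i)\<in>Sigma {..<N} others. h (\<lambda>x. xi v x * xi i x))"
    by (simp add: sum.Sigma)
  also have "Sigma {..<N} others = upper_pairs N \<union> ?L" by (auto simp: upper_pairs_def)
  also have "(\<Sum>(v, i)\<in>upper_pairs N \<union> ?L. h (\<lambda>x. xi v x * xi i x))
      = (\<Sum>(v, i)\<in>upper_pairs N. h (\<lambda>x. xi v x * xi i x)) + (\<Sum>(v, i)\<in>?L. h (\<lambda>x. xi v x * xi i x))"
    using fin finite_upper_pairs[of N] by (intro sum.union_disjoint) (auto simp: upper_pairs_def simp del: finite_upper_pairs)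
  also have "(\<Sum>(v, i)\<in>?L. h (\<lambda>x. xi v x * xi i x)) = (\<Sum>k\<in>upper_pairs N. h (edge k))"
    by (rule sum.reindex_bij_witness[of _ "\<lambda>(i, j). (j, i)" "\<lambda>(i, j). (j, i)"])
       (auto simp: upper_pairs_def mult.commute)
  also have "(\<Sum>(v, i)\<in>upper_pairs N. h (\<lambda>x. xi v x * xi i x)) = (\<Sum>k\<in>upper_pairs N. h (edge k))"
    by (auto intro: sum.cong)
  finally show ?thesis by simp
qed

lemma cav_derivative:
  assumes v: "v < N" and T: "bm T" and t: "-1 \<le> t" "t \<le> 2"
  shows "((\<lambda>t. avg (cav a v t) (\<lambda>w. (post (cav a v t) w T)\<^sup>2)) has_real_derivative
    2 * t * (a\<^sup>2 / N * (\<Sum>k\<in>others v. avg (cav a v t) (\<lambda>w. (post (cav a v t) w (\<lambda>x. T x * (xi v x * xi k x))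
      - post (cav a v t) w T * post (cav a v t) w (\<lambda>x. xi v x * xi k x))\<^sup>2)))) (at t)"
proof -
  define c' :: "real \<Rightarrow> nat \<times> nat \<Rightarrow> real" where "c' t k = a / sqrt N * (if v = fst k \<or> v = snd k then 1 else 0)" for t k
  define h where "h U = avg (cav a v t) (\<lambda>w. (post (cav a v t) w (\<lambda>x. T x * U x)
      - post (cav a v t) w T * post (cav a v t) w U)\<^sup>2)" for U
  have "((\<lambda>t. avg (cav a v t) (\<lambda>w. (post (cav a v t) w T)\<^sup>2)) has_real_derivative
    (\<Sum>k\<in>upper_pairs N. 2 * cav a v t k * c' t k * h (edge k))) (at t)"
    unfolding h_def
  proof (rule avg_sq_derivative[of "-2" t 3, OF _ _ T, where L = "\<bar>a / sqrt N\<bar> * 3"])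
    fix s k assume s: "-2 < s" "s < (3::real)"
    show "((\<lambda>t. cav a v t k) has_real_derivative c' s k) (at s)"
      unfolding cav_def c'_def by (rule DERIV_cmult) (cases "v = fst k \<or> v = snd k"; simp)
    show "\<bar>cav a v s k\<bar> \<le> \<bar>a / sqrt N\<bar> * 3" "\<bar>c' s k\<bar> \<le> \<bar>a / sqrt N\<bar> * 3"
      unfolding cav_def c'_def abs_mult using s by (intro mult_left_mono; auto)+
  qed (use t in auto)
  moreover have "(\<Sum>k\<in>upper_pairs N. 2 * cav a v t k * c' t k * h (edge k))
      = (\<Sum>k\<in>upper_pairs N. if v = fst k \<or> v = snd k then 2 * t * (a\<^sup>2 / N * h (edge k)) else 0)"
    by (intro sum.cong refl) (auto simp: cav_def c'_def power2_eq_square)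
  moreover have "\<dots> = 2 * t * (a\<^sup>2 / N * (\<Sum>k\<in>{k \<in> upper_pairs N. v = fst k \<or> v = snd k}. h (edge k)))"
    by (simp add: sum.If_cases sum_distrib_left Int_def)
  ultimately show ?thesis
    unfolding sum_touching[OF v] by (simp only: h_def)
qed

text \<open>Up to the factor \<open>2 * t * a\<^sup>2 / N\<close> and the average over observations,
  this is the speed of the squared posterior mean of \<open>T\<close> along
  \<open>cav\<close>.\<close>

definition cov2 :: "(nat \<times> nat \<Rightarrow> real) \<Rightarrow> nat \<Rightarrow> ((nat \<Rightarrow> real) \<Rightarrow> real) \<Rightarrow> (nat \<times> nat \<Rightarrow> real) \<Rightarrow> real" where
  "cov2 c v T w = (\<Sum>k\<in>others v. (post c w (\<lambda>x. T x * (xi v x * xi k x))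
      - post c w T * post c w (\<lambda>x. xi v x * xi k x))\<^sup>2)"

lemma bm_edge: "v < N \<Longrightarrow> k < N \<Longrightarrow> bm (\<lambda>x. xi v x * xi k x)"
  by (intro bm_mult bm_xi)

lemma nice_cov2: "v < N \<Longrightarrow> bm T \<Longrightarrow> nice (cov2 c v T)"
  unfolding cov2_def[abs_def]
  by (intro nice_sum nice_power2 nice_diff nice_mult nice_post bm_mult bm_edge bm_xi) auto

lemma cov2_nonneg: "cov2 c v T w \<ge> 0"
  unfolding cov2_def by (intro sum_nonneg) auto

lemma cav_derivative_sum:
  assumes v: "v < N" and "finite A" and T: "\<And>f. f \<in> A \<Longrightarrow> bm (T f)" and t: "-1 \<le> t" "t \<le> 2"
  shows "((\<lambda>t. \<Sum>f\<in>A. avg (cav a v t) (\<lambda>w. (post (cav a v t) w (T f))\<^sup>2)) has_real_derivative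
    2 * t * (a\<^sup>2 / N * avg (cav a v t) (\<lambda>w. \<Sum>f\<in>A. cov2 (cav a v t) v (T f) w))) (at t)"
proof -
  have "avg (cav a v t) (\<lambda>w. \<Sum>f\<in>A. cov2 (cav a v t) v (T f) w) = (\<Sum>f\<in>A. avg (cav a v t) (cov2 (cav a v t) v (T f)))"
    using T v by (intro avg_sum nice_cov2) auto
  also have "\<dots> = (\<Sum>f\<in>A. \<Sum>k\<in>others v. avg (cav a v t) (\<lambda>w. (post (cav a v t) w (\<lambda>x. T f x * (xi v x * xi k x))
      - post (cav a v t) w (T f) * post (cav a v t) w (\<lambda>x. xi v x * xi k x))\<^sup>2))"
    unfolding cov2_def[abs_def] using T v
    by (intro sum.cong refl avg_sum nice_power2 nice_diff nice_mult nice_post bm_mult bm_edge bm_xi) auto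
  finally have eq: "2 * t * (a\<^sup>2 / N * avg (cav a v t) (\<lambda>w. \<Sum>f\<in>A. cov2 (cav a v t) v (T f) w))
    = (\<Sum>f\<in>A. 2 * t * (a\<^sup>2 / N * (\<Sum>k\<in>others v. avg (cav a v t) (\<lambda>w. (post (cav a v t) w (\<lambda>x. T f x * (xi v x * xi k x))
      - post (cav a v t) w (T f) * post (cav a v t) w (\<lambda>x. xi v x * xi k x))\<^sup>2))))"
    by (simp add: sum_distrib_left)
  show ?thesis unfolding eq
    by (intro DERIV_sum cav_derivative v T t)
qed

text \<open>The factor \<open>2 * t\<close> of the derivative integrates to
  \<open>s\<^sup>2\<close>, so a bound \<open>U\<close> on the remaining factor is a bound on the
  increment.\<close>

lemma cav_increment_le:
  assumes v: "v < N" and A: "finite A" and T: "\<And>f. f \<in> A \<Longrightarrow> bm (T f)"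
    and U: "\<And>t. 0 \<le> t \<Longrightarrow> t \<le> 1 \<Longrightarrow> a\<^sup>2 / N * avg (cav a v t) (\<lambda>w. \<Sum>f\<in>A. cov2 (cav a v t) v (T f) w) \<le> U"
    and s: "0 \<le> s" "s \<le> 1"
  shows "(\<Sum>f\<in>A. avg (cav a v s) (\<lambda>w. (post (cav a v s) w (T f))\<^sup>2))
    - (\<Sum>f\<in>A. avg (cav a v 0) (\<lambda>w. (post (cav a v 0) w (T f))\<^sup>2)) \<le> U"
proof -
  have "0 \<le> a\<^sup>2 / N * avg (cav a v 0) (\<lambda>w. \<Sum>f\<in>A. cov2 (cav a v 0) v (T f) w)"
    by (intro mult_nonneg_nonneg avg_nonneg sum_nonneg cov2_nonneg) auto
  then have U0: "U \<ge> 0" using U[of 0] by linarith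
  let ?h = "\<lambda>s. \<Sum>f\<in>A. avg (cav a v s) (\<lambda>w. (post (cav a v s) w (T f))\<^sup>2)"
  have "?h s - ?h 0 \<le> s\<^sup>2 * U - 0\<^sup>2 * U"
  proof (rule DERIV_le_diff[OF s(1)])
    fix t assume t: "0 \<le> t" "t \<le> s"
    show "(?h has_real_derivative 2 * t * (a\<^sup>2 / N * avg (cav a v t) (\<lambda>w. \<Sum>f\<in>A. cov2 (cav a v t) v (T f) w))) (at t)"
      using t s by (intro cav_derivative_sum v A T) auto
    show "((\<lambda>t. t\<^sup>2 * U) has_real_derivative 2 * t * U) (at t)" by (auto intro!: derivative_eq_intros)
    show "2 * t * (a\<^sup>2 / N * avg (cav a v t) (\<lambda>w. \<Sum>f\<in>A. cov2 (cav a v t) v (T f) w)) \<le> 2 * t * U"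
      using U[of t] t s by (intro mult_left_mono) auto
  qed
  also have "\<dots> \<le> U" using s U0 by (simp add: mult_left_le_one_le power_le_one)
  finally show ?thesis .
qed

lemma cav_increment_ge:
  assumes v: "v < N" and A: "finite A" and T: "\<And>f. f \<in> A \<Longrightarrow> bm (T f)"
    and U: "\<And>t. 0 \<le> t \<Longrightarrow> t \<le> 1 \<Longrightarrow> U \<le> a\<^sup>2 / N * avg (cav a v t) (\<lambda>w. \<Sum>f\<in>A. cov2 (cav a v t) v (T f) w)"
  shows "U \<le> (\<Sum>f\<in>A. avg (cav a v 1) (\<lambda>w. (post (cav a v 1) w (T f))\<^sup>2))
    - (\<Sum>f\<in>A. avg (cav a v 0) (\<lambda>w. (post (cav a v 0) w (T f))\<^sup>2))"
proof -
  let ?h = "\<lambda>s. \<Sum>f\<in>A. avg (cav a v s) (\<lambda>w. (post (cav a v s) w (T f))\<^sup>2)"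
  have "1\<^sup>2 * U - 0\<^sup>2 * U \<le> ?h 1 - ?h 0"
  proof (rule DERIV_le_diff)
    fix t :: real assume t: "0 \<le> t" "t \<le> 1"
    show "(?h has_real_derivative 2 * t * (a\<^sup>2 / N * avg (cav a v t) (\<lambda>w. \<Sum>f\<in>A. cov2 (cav a v t) v (T f) w))) (at t)"
      using t by (intro cav_derivative_sum v A T) auto
    show "((\<lambda>t. t\<^sup>2 * U) has_real_derivative 2 * t * U) (at t)" by (auto intro!: derivative_eq_intros)
    show "2 * t * U \<le> 2 * t * (a\<^sup>2 / N * avg (cav a v t) (\<lambda>w. \<Sum>f\<in>A. cov2 (cav a v t) v (T f) w))"
      using U[of t] t by (intro mult_left_mono) auto
  qed simp
  then show ?thesis by simp
qed

lemma cav_mono: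
  assumes v: "v < N" and A: "finite A" and T: "\<And>f. f \<in> A \<Longrightarrow> bm (T f)" and s: "0 \<le> s" "s \<le> t" "t \<le> 1"
  shows "(\<Sum>f\<in>A. avg (cav a v s) (\<lambda>w. (post (cav a v s) w (T f))\<^sup>2))
    \<le> (\<Sum>f\<in>A. avg (cav a v t) (\<lambda>w. (post (cav a v t) w (T f))\<^sup>2))"
proof (rule DERIV_nonneg_imp_nondecreasing[OF s(2)])
  fix r assume r: "s \<le> r" "r \<le> t"
  have "((\<lambda>t. \<Sum>f\<in>A. avg (cav a v t) (\<lambda>w. (post (cav a v t) w (T f))\<^sup>2)) has_real_derivative
    2 * r * (a\<^sup>2 / N * avg (cav a v r) (\<lambda>w. \<Sum>f\<in>A. cov2 (cav a v r) v (T f) w))) (at r)"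
    using r s by (intro cav_derivative_sum v A T) auto
  moreover have "0 \<le> 2 * r * (a\<^sup>2 / N * avg (cav a v r) (\<lambda>w. \<Sum>f\<in>A. cov2 (cav a v r) v (T f) w))"
    using r s by (intro mult_nonneg_nonneg avg_nonneg sum_nonneg cov2_nonneg) auto
  ultimately show "\<exists>y. ((\<lambda>t. \<Sum>f\<in>A. avg (cav a v t) (\<lambda>w. (post (cav a v t) w (T f))\<^sup>2)) has_real_derivative y) (at r) \<and> 0 \<le> y"
    by blast
qed

text \<open>Errors can be stated through the full model alone, since along the whole path the
  moments stay below their value at \<open>t = 1\<close>.\<close>

lemma moment_cav_le: "v < N \<Longrightarrow> 0 \<le> t \<Longrightarrow> t \<le> 1 \<Longrightarrow> moment (cav a v t) n \<le> moment (unif a) n"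
  unfolding moment_def cav_1[of a v, symmetric] by (intro cav_mono bm_mon) auto

text \<open>\<open>p\<close> copies of the removed coordinate times a monomial in the others. The
  cases used are \<open>p = 2\<close>, \<open>n = 2\<close> for the matrix of edge products,
  \<open>p = 0\<close>, \<open>n = 2\<close> for the system without \<open>v\<close>, and
  \<open>p = 2\<close>, \<open>n = 0\<close> for the self-overlap.\<close>

definition Tm :: "nat \<Rightarrow> nat \<Rightarrow> nat \<Rightarrow> (nat \<Rightarrow> nat) \<Rightarrow> (nat \<Rightarrow> real) \<Rightarrow> real" where
  "Tm v p n f x = xi v x ^ p * xmon n f x"

lemma PiE_others: "f \<in> {..<n} \<rightarrow>\<^sub>E others v \<Longrightarrow> f \<in> {..<n} \<rightarrow>\<^sub>E {..<N}"
  by (auto simp: PiE_iff)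

lemma bm_Tm: "v < N \<Longrightarrow> f \<in> {..<n} \<rightarrow>\<^sub>E others v \<Longrightarrow> bm (Tm v p n f)"
  unfolding Tm_def[abs_def] by (intro bm_mult bm_power bm_xi bm_mon PiE_others)

lemma cov2_Tm_le:
  assumes v: "v < N"
  shows "(\<Sum>f\<in>{..<n} \<rightarrow>\<^sub>E others v. cov2 c v (Tm v p n f) w) \<le> 4 * B ^ (2 * p + 2) * replicas.om (pm c w) N xi (Suc n)"
proof -
  interpret R: replicas "pm c w" N xi B by (rule replicas_pm)
  have "(\<Sum>f\<in>{..<n} \<rightarrow>\<^sub>E others v. cov2 c v (Tm v p n f) w) =
    (\<Sum>f\<in>{..<n} \<rightarrow>\<^sub>E others v. \<Sum>k\<in>others v. ((\<integral>x. xi v x ^ p * xmon n f x * (xi v x * xi k x) \<partial>pm c w)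
      - (\<integral>x. xi v x ^ p * xmon n f x \<partial>pm c w) * (\<integral>x. xi v x * xi k x \<partial>pm c w))\<^sup>2)"
    unfolding cov2_def
  proof (intro sum.cong refl arg_cong[where f = "\<lambda>u. u\<^sup>2"] arg_cong2[where f = "(-)"] arg_cong2[where f = "(*)"])
    fix f k assume fk: "f \<in> {..<n} \<rightarrow>\<^sub>E others v" "k \<in> others v"
    show "post c w (\<lambda>x. Tm v p n f x * (xi v x * xi k x)) = (\<integral>x. xi v x ^ p * xmon n f x * (xi v x * xi k x) \<partial>pm c w)"
      using bm_mult[OF bm_Tm[OF v fk(1)] bm_edge[OF v], of k p] fk
      by (subst integral_pm) (auto simp: bm_def Tm_def[abs_def])
    show "post c w (Tm v p n f) = (\<integral>x. xi v x ^ p * xmon n f x \<partial>pm c w)"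
      using bm_Tm[OF v fk(1), of p] by (subst integral_pm) (auto simp: bm_def Tm_def[abs_def])
    show "post c w (\<lambda>x. xi v x * xi k x) = (\<integral>x. xi v x * xi k x \<partial>pm c w)"
      using bm_edge[OF v, of k] fk by (subst integral_pm) (auto simp: bm_def)
  qed
  also have "\<dots> \<le> 4 * B ^ (2 * p + 2) * R.om (Suc n)"
    by (rule R.covariance_bound[OF v]) auto
  finally show ?thesis .
qed

text \<open>Averaged Young bounds for the third and, in \<open>E1\<close>, the first absolute
  overlap moment. Evaluated at the full model, they hold along the whole path.\<close>

definition E3 :: "real \<Rightarrow> real \<Rightarrow> real" where
  "E3 a d = (d * moment (unif a) 2 + moment (unif a) 4 / d) / 2"

definition E1 :: "real \<Rightarrow> real \<Rightarrow> real" where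
  "E1 a d = (d + moment (unif a) 2 / d) / 2"

lemma avg_1: "avg c (\<lambda>_. a) = a"
proof -
  interpret M: prob_space M by (rule prob_space_M)
  show ?thesis by (simp add: avg_const M.prob_space)
qed

lemma avg_E3:
  assumes "v < N" "0 \<le> t" "t \<le> 1" "d > 0"
  shows "avg (cav a v t) (\<lambda>w. (d * om' 2 (cav a v t) w + om' 4 (cav a v t) w / d) / 2) \<le> E3 a d"
proof -
  have "avg (cav a v t) (\<lambda>w. (d * om' 2 (cav a v t) w + om' 4 (cav a v t) w / d) / 2)
      = avg (cav a v t) (\<lambda>w. (d / 2) * om' 2 (cav a v t) w + (1 / (2 * d)) * om' 4 (cav a v t) w)"
    by (intro arg_cong[where f = "avg _"]) (auto simp: fun_eq_iff field_simps)
  also have "\<dots> = (d / 2) * moment (cav a v t) 2 + (1 / (2 * d)) * moment (cav a v t) 4"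
    by (simp only: avg_add nice_mult nice_const nice_om' avg_mult avg_om')
  also have "\<dots> \<le> (d / 2) * moment (unif a) 2 + (1 / (2 * d)) * moment (unif a) 4"
    using assms by (intro add_mono mult_left_mono moment_cav_le) auto
  finally show ?thesis by (simp add: E3_def field_simps)
qed

lemma avg_E1:
  assumes "v < N" "0 \<le> t" "t \<le> 1" "d > 0"
  shows "avg (cav a v t) (\<lambda>w. (d + om' 2 (cav a v t) w / d) / 2) \<le> E1 a d"
proof -
  have "avg (cav a v t) (\<lambda>w. (d + om' 2 (cav a v t) w / d) / 2)
      = avg (cav a v t) (\<lambda>w. d / 2 + (1 / (2 * d)) * om' 2 (cav a v t) w)"
    by (intro arg_cong[where f = "avg _"]) (auto simp: fun_eq_iff field_simps)
  also have "\<dots> = d / 2 + (1 / (2 * d)) * moment (cav a v t) 2"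
    by (simp only: avg_add nice_mult nice_const nice_om' avg_mult avg_om' avg_1)
  also have "\<dots> \<le> d / 2 + (1 / (2 * d)) * moment (unif a) 2"
    using assms by (intro add_mono mult_left_mono moment_cav_le) auto
  finally show ?thesis by (simp add: E1_def field_simps)
qed

lemma nice_E3: "nice (\<lambda>w. (d * om' 2 c w + om' 4 c w / d) / 2)"
proof -
  have "nice (\<lambda>w. (d / 2) * om' 2 c w + (1 / (2 * d)) * om' 4 c w)"
    by (intro nice_add nice_mult nice_const nice_om')
  then show ?thesis by (simp add: add_divide_distrib mult.commute)
qed

lemma nice_E1: "nice (\<lambda>w. (d + om' 2 c w / d) / 2)"
proof -
  have "nice (\<lambda>w. d / 2 + (1 / (2 * d)) * om' 2 c w)"
    by (intro nice_add nice_mult nice_const nice_om')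
  then show ?thesis by (simp add: add_divide_distrib mult.commute)
qed

lemma increment_Tm_2:
  assumes v: "v < N" and d: "d > 0" and p: "p \<le> 2" and s: "0 \<le> s" "s \<le> 1"
  shows "(\<Sum>f\<in>{..<2} \<rightarrow>\<^sub>E others v. avg (cav a v s) (\<lambda>w. (post (cav a v s) w (Tm v p 2 f))\<^sup>2))
    - (\<Sum>f\<in>{..<2} \<rightarrow>\<^sub>E others v. avg (cav a v 0) (\<lambda>w. (post (cav a v 0) w (Tm v p 2 f))\<^sup>2))
    \<le> a\<^sup>2 / N * (4 * B ^ 6 * E3 a d)"
proof (rule cav_increment_le[OF v _ _ _ s])
  fix t :: real assume t: "0 \<le> t" "t \<le> 1"
  \<comment> \<open>The constant \<open>B ^ 6\<close> covers the cases \<open>p = 0\<close> and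
    \<open>p = 2\<close> at once.\<close>
  have Bp: "B ^ (2 * p + 2) \<le> B ^ 6" using p B_ge_1 by (intro power_increasing) auto
  have "avg (cav a v t) (\<lambda>w. \<Sum>f\<in>{..<2} \<rightarrow>\<^sub>E others v. cov2 (cav a v t) v (Tm v p 2 f) w)
      \<le> avg (cav a v t) (\<lambda>w. 4 * B ^ 6 * ((d * om' 2 (cav a v t) w + om' 4 (cav a v t) w / d) / 2))"
  proof (rule avg_mono)
    fix w
    have "(\<Sum>f\<in>{..<2} \<rightarrow>\<^sub>E others v. cov2 (cav a v t) v (Tm v p 2 f) w)
        \<le> 4 * B ^ (2 * p + 2) * replicas.om (pm (cav a v t) w) N xi 3"
      using cov2_Tm_le[OF v, where n = 2] by (simp add: numeral_3_eq_3 numeral_2_eq_2)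
    also have "\<dots> \<le> 4 * B ^ 6 * ((d * om' 2 (cav a v t) w + om' 4 (cav a v t) w / d) / 2)"
      using Bp om_3_le[OF d] replicas.om_nonneg[OF replicas_pm] B_ge_1 by (intro mult_mono) auto
    finally show "(\<Sum>f\<in>{..<2} \<rightarrow>\<^sub>E others v. cov2 (cav a v t) v (Tm v p 2 f) w)
        \<le> 4 * B ^ 6 * ((d * om' 2 (cav a v t) w + om' 4 (cav a v t) w / d) / 2)" .
  qed (intro nice_sum nice_cov2 bm_Tm v nice_mult[OF nice_const nice_E3] finite_idx finite_Diff finite_lessThan; assumption)+
  also have "\<dots> \<le> 4 * B ^ 6 * E3 a d"
    unfolding avg_mult using avg_E3[OF v t d, of a] B_ge_1 by (intro mult_left_mono) auto
  finally show "a\<^sup>2 / N * avg (cav a v t) (\<lambda>w. \<Sum>f\<in>{..<2} \<rightarrow>\<^sub>E others v. cov2 (cav a v t) v (Tm v p 2 f) w)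
      \<le> a\<^sup>2 / N * (4 * B ^ 6 * E3 a d)"
    by (intro mult_left_mono) auto
qed (use v in \<open>auto intro: bm_Tm\<close>)

lemma increment_Tm_0:
  assumes v: "v < N" and d: "d > 0"
  shows "avg (unif a) (\<lambda>w. (post (unif a) w (\<lambda>x. xi v x ^ 2))\<^sup>2)
    - avg (cav a v 0) (\<lambda>w. (post (cav a v 0) w (\<lambda>x. xi v x ^ 2))\<^sup>2) \<le> a\<^sup>2 / N * (4 * B ^ 6 * E1 a d)"
proof -
  \<comment> \<open>For \<open>n = 0\<close> the index set has a single element, so the sums have
    one term and the general estimate applies.\<close>
  have "(\<Sum>f\<in>{..<0::nat} \<rightarrow>\<^sub>E others v. avg (cav a v 1) (\<lambda>w. (post (cav a v 1) w (Tm v 2 0 f))\<^sup>2))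
    - (\<Sum>f\<in>{..<0} \<rightarrow>\<^sub>E others v. avg (cav a v 0) (\<lambda>w. (post (cav a v 0) w (Tm v 2 0 f))\<^sup>2))
    \<le> a\<^sup>2 / N * (4 * B ^ 6 * E1 a d)"
  proof (rule cav_increment_le[OF v])
    fix t :: real assume t: "0 \<le> t" "t \<le> 1"
    have "avg (cav a v t) (\<lambda>w. \<Sum>f\<in>{..<0} \<rightarrow>\<^sub>E others v. cov2 (cav a v t) v (Tm v 2 0 f) w)
        \<le> avg (cav a v t) (\<lambda>w. 4 * B ^ 6 * ((d + om' 2 (cav a v t) w / d) / 2))"
    proof (rule avg_mono)
      fix w
      have "(\<Sum>f\<in>{..<0} \<rightarrow>\<^sub>E others v. cov2 (cav a v t) v (Tm v 2 0 f) w)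
          \<le> 4 * B ^ 6 * replicas.om (pm (cav a v t) w) N xi 1"
        using cov2_Tm_le[OF v, where n = 0 and p = 2] by simp
      also have "\<dots> \<le> 4 * B ^ 6 * ((d + om' 2 (cav a v t) w / d) / 2)"
        using om_1_le[OF d, of "cav a v t" w] B_ge_1 by (intro mult_left_mono) auto
      finally show "(\<Sum>f\<in>{..<0} \<rightarrow>\<^sub>E others v. cov2 (cav a v t) v (Tm v 2 0 f) w)
          \<le> 4 * B ^ 6 * ((d + om' 2 (cav a v t) w / d) / 2)" .
    qed (intro nice_sum nice_cov2 bm_Tm v nice_mult[OF nice_const nice_E1] finite_idx finite_Diff finite_lessThan; assumption)+
    also have "\<dots> \<le> 4 * B ^ 6 * E1 a d"
      unfolding avg_mult using avg_E1[OF v t d, of a] B_ge_1 by (intro mult_left_mono) auto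
    finally show "a\<^sup>2 / N * avg (cav a v t) (\<lambda>w. \<Sum>f\<in>{..<0} \<rightarrow>\<^sub>E others v. cov2 (cav a v t) v (Tm v 2 0 f) w)
        \<le> a\<^sup>2 / N * (4 * B ^ 6 * E1 a d)"
      by (intro mult_left_mono) auto
  qed (use v in \<open>auto intro!: bm_Tm\<close>)
  then show ?thesis
    by (simp add: cav_1 Tm_def[abs_def] xmon_def)
qed

section \<open>The decoupled endpoint\<close>

lemma integral_split_coordinate:
  fixes u :: "real \<Rightarrow> real" and h :: "(nat \<Rightarrow> real) \<Rightarrow> real"
  assumes v: "v < N" and int: "integrable M (\<lambda>x. u (x v) * h x)" "integrable M h"
    and h: "\<And>x y. h (x(v := y)) = h x"
  shows "(\<integral>x. u (x v) * h x \<partial>M) = (\<integral>y. u y \<partial>P) * (\<integral>x. h x \<partial>M)"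
proof -
  have ins: "{..<N} = insert v (others v)" using v by auto
  have M: "M = (\<Pi>\<^sub>M i\<in>insert v (others v). P)" unfolding spike_law_def by (subst ins) simp
  have "(\<integral>x. h x \<partial>M) = (\<integral>x. (\<integral>y. h (x(v := y)) \<partial>P) \<partial>(\<Pi>\<^sub>M i\<in>others v. P))"
    using int(2) unfolding M by (intro prior_product.product_integral_insert) auto
  then have 1: "(\<integral>x. h x \<partial>M) = (\<integral>x. h x \<partial>(\<Pi>\<^sub>M i\<in>others v. P))"
    by (simp add: h prior.prob_space)
  have "(\<integral>x. u (x v) * h x \<partial>M) = (\<integral>x. (\<integral>y. u ((x(v := y)) v) * h (x(v := y)) \<partial>P) \<partial>(\<Pi>\<^sub>M i\<in>others v. P))"
    using int(1) unfolding M by (intro prior_product.product_integral_insert) auto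
  then show ?thesis unfolding 1 by (simp add: h)
qed

text \<open>At \<open>t = 0\<close> the energy does not see \<open>x v\<close>, so Fubini over this
  coordinate splits off a plain moment of the prior.\<close>

lemma mix_cav_0:
  assumes v: "v < N" and U: "bm U" "\<And>x y. U (x(v := y)) = U x"
  shows "mix (cav a v 0) w (\<lambda>x. xi v x ^ p * U x) = (\<integral>y. clip B y ^ p \<partial>P) * mix (cav a v 0) w U"
proof -
  have e: "ener (cav a v 0) w (x(v := y)) = ener (cav a v 0) w x" for x y
    unfolding ener_def by (intro sum.cong refl) (auto simp: cav_def split: prod.splits)
  have "mix (cav a v 0) w (\<lambda>x. xi v x ^ p * U x) = (\<integral>x. clip B (x v) ^ p * (U x * exp (ener (cav a v 0) w x)) \<partial>M)"
    unfolding mix_def by (simp add: mult.assoc)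
  also have "\<dots> = (\<integral>y. clip B y ^ p \<partial>P) * (\<integral>x. U x * exp (ener (cav a v 0) w x) \<partial>M)"
  proof (rule integral_split_coordinate[OF v])
    show "integrable M (\<lambda>x. clip B (x v) ^ p * (U x * exp (ener (cav a v 0) w x)))"
      using integrable_mix[OF bm_mult[OF bm_power[OF bm_xi[OF v], of p] U(1)]] by (simp add: mult.assoc)
  qed (use integrable_mix[OF U(1)] U(2) e in auto)
  finally show ?thesis by (simp add: mix_def)
qed

lemma post_cav_0:
  assumes "v < N" "bm U" "\<And>x y. U (x(v := y)) = U x"
  shows "post (cav a v 0) w (\<lambda>x. xi v x ^ p * U x) = (\<integral>y. clip B y ^ p \<partial>P) * post (cav a v 0) w U"
  unfolding post_def mix_cav_0[OF assms] by simp

lemma xmon_update: "f \<in> {..<n} \<rightarrow>\<^sub>E others v \<Longrightarrow> xmon n f (x(v := y)) = xmon n f x"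
  unfolding xmon_def by (intro prod.cong refl) (auto simp: PiE_iff)

lemma post_const: "post c w (\<lambda>_. 1) = 1"
  using part_pos[of c w] by (simp add: post_def)

text \<open>The energy of the edges at \<open>v\<close>; its average over sites drives the relative
  entropy.\<close>

definition link :: "real \<Rightarrow> nat \<Rightarrow> real" where
  "link a v = (\<Sum>k\<in>others v. avg (unif a) (\<lambda>w. (post (unif a) w (\<lambda>x. xi v x * xi k x))\<^sup>2))"

text \<open>The diagonal counterpart of \<open>link\<close>: no edge carries it, but it is part of
  the second overlap moment.\<close>

definition self :: "real \<Rightarrow> nat \<Rightarrow> real" where
  "self a v = avg (unif a) (\<lambda>w. (post (unif a) w (\<lambda>x. xi v x ^ 2))\<^sup>2)"

text \<open>The second overlap moment of the system from which vertex \<open>v\<close> has been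
  removed.\<close>

definition hole :: "real \<Rightarrow> nat \<Rightarrow> real" where
  "hole a v = (\<Sum>f\<in>{..<2} \<rightarrow>\<^sub>E others v. avg (cav a v 0) (\<lambda>w. (post (cav a v 0) w (xmon 2 f))\<^sup>2))"

lemma cov_matrix_bounds:
  assumes v: "v < N" and h: "h > 0"
  shows "(\<Sum>i\<in>others v. cov2 c v (\<lambda>x. xi v x * xi i x) w) \<le> (\<Sum>f\<in>{..<2} \<rightarrow>\<^sub>E others v. (post c w (Tm v 2 2 f))\<^sup>2)"
    and "(\<Sum>f\<in>{..<2} \<rightarrow>\<^sub>E others v. (post c w (Tm v 2 2 f))\<^sup>2)
      - h * (\<Sum>i\<in>others v. (post c w (\<lambda>x. xi v x * xi i x))\<^sup>2) - B ^ 6 / h * replicas.om (pm c w) N xi 3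
      \<le> (\<Sum>i\<in>others v. cov2 c v (\<lambda>x. xi v x * xi i x) w)"
proof -
  interpret R: replicas "pm c w" N xi B by (rule replicas_pm)
  have m: "post c w (\<lambda>x. xi v x * xi i x) = (\<integral>x. xi v x * xi i x \<partial>pm c w)" if "i \<in> others v" for i
    using bm_edge[OF v, of i] that by (subst integral_pm) (auto simp: bm_def)
  have A: "post c w (\<lambda>x. xi v x * xi i x * (xi v x * xi k x)) = (\<integral>x. xi v x * xi i x * (xi v x * xi k x) \<partial>pm c w)"
    if "i \<in> others v" "k \<in> others v" for i k
    using bm_mult[OF bm_edge[OF v, of i] bm_edge[OF v, of k]] that by (subst integral_pm) (auto simp: bm_def)
  have 1: "(\<Sum>i\<in>others v. cov2 c v (\<lambda>x. xi v x * xi i x) w) =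
    (\<Sum>i\<in>others v. \<Sum>k\<in>others v. ((\<integral>x. xi v x * xi i x * (xi v x * xi k x) \<partial>pm c w)
      - (\<integral>x. xi v x * xi i x \<partial>pm c w) * (\<integral>x. xi v x * xi k x \<partial>pm c w))\<^sup>2)"
    unfolding cov2_def by (intro sum.cong refl) (simp only: m A)
  have "Tm v 2 2 f x = xi v x * xi (f 0) x * (xi v x * xi (f 1) x)" for f x
    by (simp add: Tm_def mon_2 power2_eq_square mult_ac)
  then have "Tm v 2 2 f = (\<lambda>x. xi v x * xi (f 0) x * (xi v x * xi (f 1) x))" for f by (rule ext)
  then have "(\<Sum>f\<in>{..<2} \<rightarrow>\<^sub>E others v. (post c w (Tm v 2 2 f))\<^sup>2)
      = (\<Sum>f\<in>{..<2::nat} \<rightarrow>\<^sub>E others v. (post c w (\<lambda>x. xi v x * xi (f 0) x * (xi v x * xi (f 1) x)))\<^sup>2)"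
    by (simp only:)
  also have "\<dots> = (\<Sum>i\<in>others v. \<Sum>k\<in>others v. (post c w (\<lambda>x. xi v x * xi i x * (xi v x * xi k x)))\<^sup>2)"
    by (rule sum_PiE_2[where h = "\<lambda>i k. (post c w (\<lambda>x. xi v x * xi i x * (xi v x * xi k x)))\<^sup>2"])
  also have "\<dots> = (\<Sum>i\<in>others v. \<Sum>k\<in>others v. (\<integral>x. xi v x * xi i x * (xi v x * xi k x) \<partial>pm c w)\<^sup>2)"
    by (intro sum.cong refl) (simp only: A)
  finally have 2: "(\<Sum>f\<in>{..<2} \<rightarrow>\<^sub>E others v. (post c w (Tm v 2 2 f))\<^sup>2)
    = (\<Sum>i\<in>others v. \<Sum>k\<in>others v. (\<integral>x. xi v x * xi i x * (xi v x * xi k x) \<partial>pm c w)\<^sup>2)" .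
  have 3: "(\<Sum>i\<in>others v. (post c w (\<lambda>x. xi v x * xi i x))\<^sup>2) = (\<Sum>i\<in>others v. (\<integral>x. xi v x * xi i x \<partial>pm c w)\<^sup>2)"
    by (intro sum.cong refl) (simp only: m)
  have J: "others v \<subseteq> {..<N}" by auto
  show "(\<Sum>i\<in>others v. cov2 c v (\<lambda>x. xi v x * xi i x) w) \<le> (\<Sum>f\<in>{..<2} \<rightarrow>\<^sub>E others v. (post c w (Tm v 2 2 f))\<^sup>2)"
    unfolding 1 2 by (rule R.covariance_matrix(1)[OF v J h])
  show "(\<Sum>f\<in>{..<2} \<rightarrow>\<^sub>E others v. (post c w (Tm v 2 2 f))\<^sup>2)
      - h * (\<Sum>i\<in>others v. (post c w (\<lambda>x. xi v x * xi i x))\<^sup>2) - B ^ 6 / h * R.om 3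
      \<le> (\<Sum>i\<in>others v. cov2 c v (\<lambda>x. xi v x * xi i x) w)"
    unfolding 1 2 3 by (rule R.covariance_matrix(2)[OF v J h])
qed

text \<open>Inserting the square of the decoupled coordinate multiplies by its second moment, which
  is 1.\<close>

lemma hole_eq:
  assumes v: "v < N"
  shows "(\<Sum>f\<in>{..<2} \<rightarrow>\<^sub>E others v. avg (cav a v 0) (\<lambda>w. (post (cav a v 0) w (Tm v 2 2 f))\<^sup>2)) = hole a v"
    "(\<Sum>f\<in>{..<2} \<rightarrow>\<^sub>E others v. avg (cav a v 0) (\<lambda>w. (post (cav a v 0) w (Tm v 0 2 f))\<^sup>2)) = hole a v"
proof -
  have "post (cav a v 0) w (Tm v 2 2 f) = post (cav a v 0) w (xmon 2 f)" if "f \<in> {..<2} \<rightarrow>\<^sub>E others v" for f w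
    unfolding Tm_def using that
    by (subst post_cav_0[OF v bm_mon[OF PiE_others]]) (auto simp: xmon_update clip_moments)
  then show "(\<Sum>f\<in>{..<2} \<rightarrow>\<^sub>E others v. avg (cav a v 0) (\<lambda>w. (post (cav a v 0) w (Tm v 2 2 f))\<^sup>2)) = hole a v"
    unfolding hole_def by (intro sum.cong refl) simp
  have "Tm v 0 2 f = xmon 2 f" for f by (simp add: Tm_def fun_eq_iff)
  then show "(\<Sum>f\<in>{..<2} \<rightarrow>\<^sub>E others v. avg (cav a v 0) (\<lambda>w. (post (cav a v 0) w (Tm v 0 2 f))\<^sup>2)) = hole a v"
    by (simp add: hole_def)
qed

text \<open>Centering enters here: the decoupled coordinate has posterior mean zero.\<close>

lemma link_0:
  assumes v: "v < N"
  shows "(\<Sum>k\<in>others v. avg (cav a v 0) (\<lambda>w. (post (cav a v 0) w (\<lambda>x. xi v x * xi k x))\<^sup>2)) = 0"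
proof (intro sum.neutral ballI)
  fix k assume k: "k \<in> others v"
  have "post (cav a v 0) w (\<lambda>x. xi v x * xi k x) = 0" for w
    using post_cav_0[OF v bm_xi, of k a w 1] k by (simp add: clip_moments)
  then show "avg (cav a v 0) (\<lambda>w. (post (cav a v 0) w (\<lambda>x. xi v x * xi k x))\<^sup>2) = 0"
    by (simp add: avg_def)
qed

lemma self_0:
  assumes v: "v < N"
  shows "avg (cav a v 0) (\<lambda>w. (post (cav a v 0) w (\<lambda>x. xi v x ^ 2))\<^sup>2) = 1"
  using post_cav_0[OF v bm_const[of 1], of a _ 2] by (simp add: clip_moments post_const avg_1)

lemma hole_le:
  assumes v: "v < N" shows "hole a v \<le> moment (unif a) 2"
proof -
  have "hole a v \<le> (\<Sum>f\<in>{..<2} \<rightarrow>\<^sub>E others v. avg (cav a v 1) (\<lambda>w. (post (cav a v 1) w (xmon 2 f))\<^sup>2))"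
    unfolding hole_def by (rule cav_mono[OF v]) (auto intro: bm_mon PiE_others)
  also have "\<dots> \<le> moment (unif a) 2"
    unfolding moment_def cav_1 using PiE_mono[of "{..<2}" "\<lambda>_. others v" "\<lambda>_. {..<N}"]
    by (intro sum_mono2 avg_nonneg) auto
  finally show ?thesis .
qed

lemma nice_Tm_sum: "v < N \<Longrightarrow> nice (\<lambda>w. \<Sum>f\<in>{..<2} \<rightarrow>\<^sub>E others v. (post c w (Tm v 2 2 f))\<^sup>2)"
  by (intro nice_sum nice_power2 nice_post bm_Tm) auto

lemma nice_link_sum: "v < N \<Longrightarrow> nice (\<lambda>w. \<Sum>i\<in>others v. (post c w (\<lambda>x. xi v x * xi i x))\<^sup>2)"
  by (intro nice_sum nice_power2 nice_post bm_edge) auto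

lemma nice_cov_sum: "v < N \<Longrightarrow> nice (\<lambda>w. \<Sum>i\<in>others v. cov2 c v (\<lambda>x. xi v x * xi i x) w)"
  by (intro nice_sum nice_cov2 bm_edge) auto

section \<open>Inequalities between edge energy and overlap moments\<close>

text \<open>\<open>link\<close> vanishes at \<open>t = 0\<close>, so it equals its increment. Its
  speed is at most the sum of the squared entries of the uncentred matrix, and that sum starts at
  \<open>hole\<close> and exceeds it only by a drift of third order in the overlaps.\<close>

lemma link_upper:
  assumes v: "v < N" and d: "d > 0"
  shows "link a v \<le> a\<^sup>2 / N * (hole a v + a\<^sup>2 / N * (4 * B ^ 6 * E3 a d))"
proof -
  have "(\<Sum>k\<in>others v. avg (cav a v 1) (\<lambda>w. (post (cav a v 1) w (\<lambda>x. xi v x * xi k x))\<^sup>2))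
    - (\<Sum>k\<in>others v. avg (cav a v 0) (\<lambda>w. (post (cav a v 0) w (\<lambda>x. xi v x * xi k x))\<^sup>2))
    \<le> a\<^sup>2 / N * (hole a v + a\<^sup>2 / N * (4 * B ^ 6 * E3 a d))"
  proof (rule cav_increment_le[OF v])
    fix t :: real assume t: "0 \<le> t" "t \<le> 1"
    have "avg (cav a v t) (\<lambda>w. \<Sum>i\<in>others v. cov2 (cav a v t) v (\<lambda>x. xi v x * xi i x) w)
        \<le> avg (cav a v t) (\<lambda>w. \<Sum>f\<in>{..<2} \<rightarrow>\<^sub>E others v. (post (cav a v t) w (Tm v 2 2 f))\<^sup>2)"
      by (rule avg_mono[OF nice_cov_sum[OF v] nice_Tm_sum[OF v]]) (rule cov_matrix_bounds(1)[OF v zero_less_one])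
    also have "\<dots> = (\<Sum>f\<in>{..<2} \<rightarrow>\<^sub>E others v. avg (cav a v t) (\<lambda>w. (post (cav a v t) w (Tm v 2 2 f))\<^sup>2))"
      using v by (intro avg_sum nice_power2 nice_post bm_Tm) auto
    also have "\<dots> \<le> hole a v + a\<^sup>2 / N * (4 * B ^ 6 * E3 a d)"
      using increment_Tm_2[OF v d order_refl t, of a] unfolding hole_eq[OF v] by linarith
    finally show "a\<^sup>2 / N * avg (cav a v t) (\<lambda>w. \<Sum>i\<in>others v. cov2 (cav a v t) v (\<lambda>x. xi v x * xi i x) w)
      \<le> a\<^sup>2 / N * (hole a v + a\<^sup>2 / N * (4 * B ^ 6 * E3 a d))"
      by (intro mult_left_mono) auto
  qed (use v in \<open>auto intro: bm_edge\<close>)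
  then show ?thesis unfolding link_0[OF v] by (simp add: cav_1 link_def)
qed

text \<open>The same path from below. The uncentred sum never falls below \<open>hole\<close>;
  centering it costs a small multiple of \<open>link\<close> itself and a third-order overlap term
  weighted by \<open>1 / h\<close>.\<close>

lemma link_lower:
  assumes v: "v < N" and d: "d > 0" and h: "h > 0"
  shows "a\<^sup>2 / N * (hole a v - h * link a v - B ^ 6 / h * E3 a d) \<le> link a v"
proof -
  have "a\<^sup>2 / N * (hole a v - h * link a v - B ^ 6 / h * E3 a d) \<le>
    (\<Sum>k\<in>others v. avg (cav a v 1) (\<lambda>w. (post (cav a v 1) w (\<lambda>x. xi v x * xi k x))\<^sup>2))
    - (\<Sum>k\<in>others v. avg (cav a v 0) (\<lambda>w. (post (cav a v 0) w (\<lambda>x. xi v x * xi k x))\<^sup>2))"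
  proof (rule cav_increment_ge[OF v])
    fix t :: real assume t: "0 \<le> t" "t \<le> 1"
    let ?c = "cav a v t"
    let ?e = "\<lambda>w. (d * om' 2 ?c w + om' 4 ?c w / d) / 2"
    have l: "avg ?c (\<lambda>w. \<Sum>i\<in>others v. (post ?c w (\<lambda>x. xi v x * xi i x))\<^sup>2) \<le> link a v"
    proof -
      have "avg ?c (\<lambda>w. \<Sum>i\<in>others v. (post ?c w (\<lambda>x. xi v x * xi i x))\<^sup>2) = (\<Sum>i\<in>others v. avg ?c (\<lambda>w. (post ?c w (\<lambda>x. xi v x * xi i x))\<^sup>2))"
        using v by (intro avg_sum nice_power2 nice_post bm_edge) auto
      also have "\<dots> \<le> link a v"
        unfolding link_def cav_1[of a v, symmetric] by (rule cav_mono[OF v]) (use v t in \<open>auto intro: bm_edge\<close>)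
      finally show ?thesis .
    qed
    have z: "hole a v \<le> avg ?c (\<lambda>w. \<Sum>f\<in>{..<2} \<rightarrow>\<^sub>E others v. (post ?c w (Tm v 2 2 f))\<^sup>2)"
    proof -
      have "hole a v \<le> (\<Sum>f\<in>{..<2} \<rightarrow>\<^sub>E others v. avg ?c (\<lambda>w. (post ?c w (Tm v 2 2 f))\<^sup>2))"
        unfolding hole_eq(1)[OF v, symmetric] by (rule cav_mono[OF v]) (use v t in \<open>auto intro: bm_Tm\<close>)
      also have "\<dots> = avg ?c (\<lambda>w. \<Sum>f\<in>{..<2} \<rightarrow>\<^sub>E others v. (post ?c w (Tm v 2 2 f))\<^sup>2)"
        using v by (intro avg_sum[symmetric] nice_power2 nice_post bm_Tm) auto
      finally show ?thesis .
    qed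
    have "hole a v - h * link a v - B ^ 6 / h * E3 a d
      \<le> avg ?c (\<lambda>w. \<Sum>f\<in>{..<2} \<rightarrow>\<^sub>E others v. (post ?c w (Tm v 2 2 f))\<^sup>2)
        - h * avg ?c (\<lambda>w. \<Sum>i\<in>others v. (post ?c w (\<lambda>x. xi v x * xi i x))\<^sup>2) - B ^ 6 / h * avg ?c ?e"
    proof -
      have "h * avg ?c (\<lambda>w. \<Sum>i\<in>others v. (post ?c w (\<lambda>x. xi v x * xi i x))\<^sup>2) \<le> h * link a v"
        using l h by (intro mult_left_mono) auto
      moreover have "B ^ 6 / h * avg ?c ?e \<le> B ^ 6 / h * E3 a d"
        using avg_E3[OF v t d, of a] h B_ge_1 by (intro mult_left_mono) auto
      ultimately show ?thesis using z by linarith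
    qed
    also have "\<dots> = avg ?c (\<lambda>w. (\<Sum>f\<in>{..<2} \<rightarrow>\<^sub>E others v. (post ?c w (Tm v 2 2 f))\<^sup>2)
        - h * (\<Sum>i\<in>others v. (post ?c w (\<lambda>x. xi v x * xi i x))\<^sup>2) - B ^ 6 / h * ?e w)"
      by (simp only: avg_diff avg_mult nice_diff nice_mult nice_const nice_E3 nice_Tm_sum[OF v] nice_link_sum[OF v])
    also have "\<dots> \<le> avg ?c (\<lambda>w. \<Sum>i\<in>others v. cov2 ?c v (\<lambda>x. xi v x * xi i x) w)"
    proof (rule avg_mono[OF _ nice_cov_sum[OF v]])
      fix w
      have "B ^ 6 / h * replicas.om (pm ?c w) N xi 3 \<le> B ^ 6 / h * ?e w"
        using om_3_le[OF d, of ?c w] h B_ge_1 by (intro mult_left_mono) auto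
      then show "(\<Sum>f\<in>{..<2} \<rightarrow>\<^sub>E others v. (post ?c w (Tm v 2 2 f))\<^sup>2)
        - h * (\<Sum>i\<in>others v. (post ?c w (\<lambda>x. xi v x * xi i x))\<^sup>2) - B ^ 6 / h * ?e w
        \<le> (\<Sum>i\<in>others v. cov2 ?c v (\<lambda>x. xi v x * xi i x) w)"
        using cov_matrix_bounds(2)[OF v h, where c = ?c and w = w] by linarith
    qed (simp only: nice_diff nice_mult nice_const nice_E3 nice_Tm_sum[OF v] nice_link_sum[OF v])
    finally show "a\<^sup>2 / N * (hole a v - h * link a v - B ^ 6 / h * E3 a d)
      \<le> a\<^sup>2 / N * avg ?c (\<lambda>w. \<Sum>i\<in>others v. cov2 ?c v (\<lambda>x. xi v x * xi i x) w)"
      by (intro mult_left_mono) auto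
  qed (use v in \<open>auto intro: bm_edge\<close>)
  then show ?thesis unfolding link_0[OF v] by (simp add: cav_1 link_def)
qed

lemma moment_2: "moment (unif a) 2 = (\<Sum>i<N. \<Sum>k<N. avg (unif a) (\<lambda>w. (post (unif a) w (\<lambda>x. xi i x * xi k x))\<^sup>2))"
proof -
  have "xmon 2 f = (\<lambda>x. xi (f 0) x * xi (f 1) x)" for f by (simp add: fun_eq_iff mon_2)
  then have "moment (unif a) 2 = (\<Sum>f\<in>{..<2::nat} \<rightarrow>\<^sub>E {..<N}. avg (unif a) (\<lambda>w. (post (unif a) w (\<lambda>x. xi (f 0) x * xi (f 1) x))\<^sup>2))"
    unfolding moment_def by simp
  also have "\<dots> = (\<Sum>i<N. \<Sum>k<N. avg (unif a) (\<lambda>w. (post (unif a) w (\<lambda>x. xi i x * xi k x))\<^sup>2))"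
    by (rule sum_PiE_2[where h = "\<lambda>i k. avg (unif a) (\<lambda>w. (post (unif a) w (\<lambda>x. xi i x * xi k x))\<^sup>2)"])
  finally show ?thesis .
qed

lemma self_bound: assumes "v < N" shows "self a v \<le> B ^ 4"
proof -
  have "(post (unif a) w (\<lambda>x. xi v x ^ 2))\<^sup>2 \<le> (B ^ 2)\<^sup>2" for w
  proof -
    have "\<bar>xi v x ^ 2\<bar> \<le> B ^ 2" for x using clip_bounded[of "x v"] B_ge_1 by (simp add: abs_le_square_iff[symmetric])
    moreover have "bm (\<lambda>x. xi v x ^ 2)" by (intro bm_power bm_xi assms)
    ultimately have "\<bar>post (unif a) w (\<lambda>x. xi v x ^ 2)\<bar> \<le> B ^ 2" by (intro abs_post_le)
    then show ?thesis by (intro abs_le_square_iff[THEN iffD1]) simp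
  qed
  then have "self a v \<le> avg (unif a) (\<lambda>_. (B ^ 2)\<^sup>2)"
    unfolding self_def using assms by (intro avg_mono nice_power2 nice_post nice_const bm_power bm_xi) auto
  then show ?thesis by (simp add: avg_1 power_mult[symmetric])
qed

text \<open>Deleting row and column \<open>v\<close> from the matrix of second moments removes
  \<open>2 * link + self\<close>. What remains differs from \<open>hole\<close> by switching off the
  edges at \<open>v\<close>, again a third-order drift.\<close>

lemma hole_lower:
  assumes v: "v < N" and d: "d > 0"
  shows "moment (unif a) 2 - 2 * link a v - B ^ 4 - a\<^sup>2 / N * (4 * B ^ 6 * E3 a d) \<le> hole a v"
proof -
  define q where "q i k = avg (unif a) (\<lambda>w. (post (unif a) w (\<lambda>x. xi i x * xi k x))\<^sup>2)" for i k
  have sym: "(\<Sum>i\<in>others v. q i v) = (\<Sum>i\<in>others v. q v i)"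
    unfolding q_def by (simp add: mult.commute)
  have sp: "(\<Sum>i<N. g i) = g v + (\<Sum>i\<in>others v. g i)" for g :: "nat \<Rightarrow> real"
    using v by (simp add: sum.remove)
  have "moment (unif a) 2 = (\<Sum>i<N. q i v) + (\<Sum>i<N. \<Sum>k\<in>others v. q i k)"
    unfolding moment_2 q_def[symmetric] by (subst sp) (simp add: sum.distrib)
  also have "\<dots> = q v v + 2 * (\<Sum>k\<in>others v. q v k) + (\<Sum>i\<in>others v. \<Sum>k\<in>others v. q i k)"
    unfolding sp[of "\<lambda>i. q i v"] sp[of "\<lambda>i. \<Sum>k\<in>others v. q i k"] by (simp add: sym sum.distrib)
  also have "q v v = self a v" by (simp add: q_def self_def power2_eq_square)
  also have "(\<Sum>k\<in>others v. q v k) = link a v" by (simp add: q_def link_def)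
  also have "(\<Sum>i\<in>others v. \<Sum>k\<in>others v. q i k)
      = (\<Sum>f\<in>{..<2} \<rightarrow>\<^sub>E others v. avg (cav a v 1) (\<lambda>w. (post (cav a v 1) w (Tm v 0 2 f))\<^sup>2))"
  proof -
    have "Tm v 0 2 f = (\<lambda>x. xi (f 0) x * xi (f 1) x)" for f by (simp add: fun_eq_iff Tm_def mon_2)
    then show ?thesis using sum_PiE_2[where h = q and J = "others v"] by (simp add: q_def cav_1)
  qed
  finally show ?thesis
    using increment_Tm_2[OF v d, of 0 1 a] self_bound[OF v, of a] unfolding hole_eq(2)[OF v] by simp
qed

text \<open>By unit variance the value at \<open>t = 0\<close> is 1; from there it grows at a speed
  of first order in the overlaps.\<close>

lemma self_bounds:
  assumes v: "v < N" and d: "d > 0"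
  shows "1 \<le> self a v" "self a v \<le> 1 + a\<^sup>2 / N * (4 * B ^ 6 * E1 a d)"
proof -
  have "(\<Sum>f\<in>{()}. avg (cav a v 0) (\<lambda>w. (post (cav a v 0) w (\<lambda>x. xi v x ^ 2))\<^sup>2))
      \<le> (\<Sum>f\<in>{()}. avg (cav a v 1) (\<lambda>w. (post (cav a v 1) w (\<lambda>x. xi v x ^ 2))\<^sup>2))"
    using v by (intro cav_mono bm_power bm_xi) auto
  then show "1 \<le> self a v" by (simp add: self_0[OF v] self_def cav_1)
  show "self a v \<le> 1 + a\<^sup>2 / N * (4 * B ^ 6 * E1 a d)"
    using increment_Tm_0[OF v d, of a] by (simp add: self_0[OF v] self_def)
qed

text \<open>Exact bookkeeping of the second-moment matrix. Its diagonal contributes about one per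
  site, which is where the relation with \<open>q - 1\<close> comes from.\<close>

lemma sum_link: "(\<Sum>v<N. link a v) = moment (unif a) 2 - (\<Sum>v<N. self a v)"
proof -
  have "moment (unif a) 2 = (\<Sum>v<N. self a v + link a v)"
    unfolding moment_2
  proof (intro sum.cong refl)
    fix v assume "v \<in> {..<N}"
    then show "(\<Sum>k<N. avg (unif a) (\<lambda>w. (post (unif a) w (\<lambda>x. xi v x * xi k x))\<^sup>2)) = self a v + link a v"
      by (subst sum.remove[of _ v]) (auto simp: self_def link_def power2_eq_square)
  qed
  then show ?thesis by (simp add: sum.distrib)
qed

lemma link_nonneg: "link a v \<ge> 0"
  unfolding link_def by (intro sum_nonneg avg_nonneg) auto

lemma unif_derivative_bounds:
  assumes "- 1 < s" "s < T"
  shows "\<bar>s / sqrt N\<bar> \<le> (\<bar>T\<bar> + 1) * (1 / sqrt N)" "\<bar>1 / sqrt N\<bar> \<le> (\<bar>T\<bar> + 1) * (1 / sqrt N)"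
  using assms by (auto simp: abs_divide intro!: divide_right_mono)

text \<open>Error bounds at one amplitude thereby hold at all smaller ones.\<close>

lemma moment_unif_mono:
  assumes "0 \<le> a" "a \<le> b" shows "moment (unif a) n \<le> moment (unif b) n"
  unfolding moment_def
proof (rule sum_mono)
  fix f assume f: "f \<in> {..<n} \<rightarrow>\<^sub>E {..<N}"
  show "avg (unif a) (\<lambda>w. (post (unif a) w (xmon n f))\<^sup>2) \<le> avg (unif b) (\<lambda>w. (post (unif b) w (xmon n f))\<^sup>2)"
  proof (rule DERIV_nonneg_imp_nondecreasing[OF assms(2)])
    fix t assume t: "a \<le> t" "t \<le> b"
    have "((\<lambda>t. avg (unif t) (\<lambda>w. (post (unif t) w (xmon n f))\<^sup>2)) has_real_derivative
      (\<Sum>k\<in>upper_pairs N. 2 * unif t k * (1 / sqrt N) * avg (unif t) (\<lambda>w. (post (unif t) w (\<lambda>x. xmon n f x * edge k x)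
        - post (unif t) w (xmon n f) * post (unif t) w (edge k))\<^sup>2))) (at t)"
    proof (rule avg_sq_derivative[of "-1" t "b + 1", OF _ _ bm_mon[OF f], where c' = "\<lambda>_ _. 1 / sqrt N"])
      fix s k assume "-1 < s" "s < b + 1"
      from unif_derivative_bounds[OF this]
      show "\<bar>unif s k\<bar> \<le> (\<bar>b + 1\<bar> + 1) * (1 / sqrt N)" "\<bar>1 / sqrt N\<bar> \<le> (\<bar>b + 1\<bar> + 1) * (1 / sqrt N)"
        by (auto simp: unif_def)
      show "((\<lambda>t. unif t k) has_real_derivative 1 / sqrt N) (at s)"
        unfolding unif_def by (rule DERIV_cdivide[OF DERIV_ident])
    qed (use t assms in auto)
    moreover have "0 \<le> (\<Sum>k\<in>upper_pairs N. 2 * unif t k * (1 / sqrt N) * avg (unif t) (\<lambda>w. (post (unif t) w (\<lambda>x. xmon n f x * edge k x)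
        - post (unif t) w (xmon n f) * post (unif t) w (edge k))\<^sup>2))"
      using t assms by (intro sum_nonneg mult_nonneg_nonneg avg_nonneg) (auto simp: unif_def)
    ultimately show "\<exists>y. ((\<lambda>t. avg (unif t) (\<lambda>w. (post (unif t) w (xmon n f))\<^sup>2)) has_real_derivative y) (at t) \<and> 0 \<le> y"
      by blast
  qed
qed

definition entropy_rel :: "real \<Rightarrow> real" where
  "entropy_rel a = (\<integral>w. part (unif a) w * ln (part (unif a) w) \<partial>gauss (upper_pairs N))"

lemma entropy_rel_derivative:
  assumes t: "0 \<le> t"
  shows "(entropy_rel has_real_derivative t / 2 * ((\<Sum>v<N. link t v) / N)) (at t)"
proof -
  have "(entropy_rel has_real_derivative
      (\<Sum>k\<in>upper_pairs N. unif t k * (1 / sqrt N) * avg (unif t) (\<lambda>w. (post (unif t) w (edge k))\<^sup>2))) (at t)"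
    unfolding entropy_rel_def[abs_def]
  proof (rule KL_derivative[of "-1" t "t + 1", where c' = "\<lambda>_ _. 1 / sqrt N"])
    fix s k assume "-1 < s" "s < t + 1"
    from unif_derivative_bounds[OF this]
    show "\<bar>unif s k\<bar> \<le> (\<bar>t + 1\<bar> + 1) * (1 / sqrt N)" "\<bar>1 / sqrt N\<bar> \<le> (\<bar>t + 1\<bar> + 1) * (1 / sqrt N)"
      by (auto simp: unif_def)
    show "((\<lambda>t. unif t k) has_real_derivative 1 / sqrt N) (at s)"
      unfolding unif_def by (rule DERIV_cdivide[OF DERIV_ident])
  qed (use t in auto)
  also have "(\<Sum>k\<in>upper_pairs N. unif t k * (1 / sqrt N) * avg (unif t) (\<lambda>w. (post (unif t) w (edge k))\<^sup>2))
      = t / N * (\<Sum>k\<in>upper_pairs N. avg (unif t) (\<lambda>w. (post (unif t) w (edge k))\<^sup>2))"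
    unfolding sum_distrib_left by (intro sum.cong refl) (simp add: unif_def)
  \<comment> \<open>Each edge is counted from both of its endpoints, whence the factor 1/2.\<close>
  also have "\<dots> = t / 2 * ((\<Sum>v<N. link t v) / N)"
    unfolding link_def
    by (subst sum_off_diagonal[where h = "\<lambda>U. avg (unif t) (\<lambda>w. (post (unif t) w U)\<^sup>2)"]) simp
  finally show ?thesis .
qed

end

section \<open>Comparison with independent sites\<close>

context replicas
begin

text \<open>Jensen's inequality for the overlap, whose two-replica mean is the sum of squared
  single-site means. It makes the edge covariance dominate the square of the site
  covariance.\<close>

lemma square_mean_overlap_le: "(\<Sum>i<N. (\<integral>x. xi i x \<partial>\<mu>)\<^sup>2)\<^sup>2 \<le> (\<Sum>i<N. \<Sum>j<N. (\<integral>x. xi i x * xi j x \<partial>\<mu>)\<^sup>2)"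
proof -
  define u where "u = (\<Sum>i<N. (\<integral>x. xi i x \<partial>\<mu>)\<^sup>2)"
  have u: "u = (\<integral>z. ov z \<partial>(\<mu> \<Otimes>\<^sub>M \<mu>))"
    unfolding u_def ov_def by (rule sum_square_integral[of _ _ B]) (auto intro: xi_bounded)
  have "(\<Sum>i<N. \<Sum>j<N. (\<integral>x. xi i x * xi j x \<partial>\<mu>)\<^sup>2) = (\<Sum>f\<in>{..<2} \<rightarrow>\<^sub>E {..<N}. (\<integral>x. mon 2 f x \<partial>\<mu>)\<^sup>2)"
  proof -
    have "mon 2 f = (\<lambda>x. xi (f 0) x * xi (f 1) x)" for f
      by (simp add: fun_eq_iff mon_def numeral_2_eq_2 lessThan_Suc)
    then show ?thesis
      using sum_PiE_2[where h = "\<lambda>i j. (\<integral>x. xi i x * xi j x \<partial>\<mu>)\<^sup>2" and J = "{..<N}"] by (simp only:)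
  qed
  also have "\<dots> = om 2" by (rule om_even) simp
  finally have *: "(\<Sum>i<N. \<Sum>j<N. (\<integral>x. xi i x * xi j x \<partial>\<mu>)\<^sup>2) = om 2" .
  have i: "integrable (\<mu> \<Otimes>\<^sub>M \<mu>) ov" "integrable (\<mu> \<Otimes>\<^sub>M \<mu>) (\<lambda>z. (ov z)\<^sup>2)"
    using integrable_ov_pow[of 2] by (auto intro: integrable_pair_bounded_by ov_bounded)
  have "0 \<le> (\<integral>z. (ov z - u)\<^sup>2 \<partial>(\<mu> \<Otimes>\<^sub>M \<mu>))" by simp
  also have "\<dots> = (\<integral>z. (ov z)\<^sup>2 - 2 * u * ov z + u\<^sup>2 \<partial>(\<mu> \<Otimes>\<^sub>M \<mu>))"
    by (intro Bochner_Integration.integral_cong) (auto simp: power2_diff)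
  also have "\<dots> = om 2 - 2 * u * u + u\<^sup>2" using i by (simp add: u[symmetric] P.prob_space om_def)
  finally show ?thesis unfolding * u_def[symmetric] by (simp add: power2_eq_square)
qed

end

context gibbs
begin

lemma integrable_part_powr:
  assumes "nice h" shows "integrable (gauss K) (\<lambda>w. part c w powr s * h w)"
proof -
  obtain L where L: "\<And>k. k \<in> K \<Longrightarrow> \<bar>c k\<bar> \<le> L" using ex_bound by blast
  obtain L' where *: "\<And>w. \<bar>h w\<bar> \<le> L'" and [measurable]: "h \<in> borel_measurable (gauss K)"
    using assms unfolding nice_def by blast
  have "tame 1 (\<lambda>a f. 1 * f powr s)" by (rule tame_powr)
  then have "subexp K {()} (\<lambda>_ w. part c w powr s)"
    using subexp_tame[of "{()}" "\<lambda>_. c" L "\<lambda>_. 1" 1 "\<lambda>a f. 1 * f powr s"] L bm_const[of 1] by simp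
  then have "subexp K {()} (\<lambda>_ w. part c w powr s * h w)"
    using * subexp_bounded[of "{()}" "\<lambda>_. h" L' K] by (intro subexp_mult) auto
  from integrable_subexp[OF finite_K this, of "()"] show ?thesis by simp
qed

end

text \<open>One noise vector for both fields of the comparison: off-diagonal entries drive the
  edges, and the diagonal entries, free because the model discards the diagonal, drive the
  independent site fields.\<close>

definition diag_pairs :: "nat \<Rightarrow> (nat \<times> nat) set" where
  "diag_pairs N = {(i, j). i \<le> j \<and> j < N}"

lemma finite_diag_pairs[simp]: "finite (diag_pairs N)"
  by (rule finite_subset[of _ "{..<N} \<times> {..<N}"]) (auto simp: diag_pairs_def)

lemma diag_pairs_split: "(\<Sum>k\<in>diag_pairs N. g k) = (\<Sum>k\<in>upper_pairs N. g k) + (\<Sum>i<N. g (i, i))" for g :: "_ \<Rightarrow> real"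
proof -
  have "diag_pairs N = upper_pairs N \<union> (\<lambda>i. (i, i)) ` {..<N}" by (auto simp: diag_pairs_def upper_pairs_def)
  then have "(\<Sum>k\<in>diag_pairs N. g k) = (\<Sum>k\<in>upper_pairs N. g k) + (\<Sum>k\<in>(\<lambda>i. (i, i)) ` {..<N}. g k)"
    using finite_upper_pairs[of N] by (simp only:) (intro sum.union_disjoint; auto simp: upper_pairs_def)
  also have "(\<Sum>k\<in>(\<lambda>i. (i, i)) ` {..<N}. g k) = (\<Sum>i<N. g (i, i))"
    by (subst sum.reindex) (auto simp: inj_on_def)
  finally show ?thesis .
qed

context spins
begin

definition site_ener :: "real \<Rightarrow> (nat \<times> nat \<Rightarrow> real) \<Rightarrow> (nat \<Rightarrow> real) \<Rightarrow> real" where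
  "site_ener g w x = (\<Sum>i<N. g * w (i, i) * xi i x - g\<^sup>2 * (xi i x)\<^sup>2 / 2)"

text \<open>
  Kahane's comparison: the Gaussian field with covariance \<open>a\<^sup>2/N * (\<Sum>i<j. \<dots>)\<close> is traded for
  independent site fields. The covariances differ by a perfect square up to the constant in the
  exponent, and \<open>u \<mapsto> u powr s\<close> is concave.
\<close>
lemma kahane_comparison:
  fixes rho :: "(nat \<Rightarrow> real) \<Rightarrow> real" and a q s r1 :: real
  assumes rho[measurable]: "rho \<in> borel_measurable M" and rb: "\<And>x. 0 < rho x" "\<And>x. rho x \<le> r1"
    and s: "0 < s" "s < 1" and q: "0 \<le> q"
  defines "v \<equiv> a\<^sup>2 * N * q\<^sup>2 / 2 + a\<^sup>2 * B ^ 4 / 2"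
  shows "(\<integral>w. mix (unif a) w rho powr s \<partial>gauss (upper_pairs N))
    \<le> exp (s * v / 2) * (\<integral>w. (\<integral>x. rho x * exp (site_ener (a * sqrt q) w x) \<partial>M) powr s \<partial>gauss (diag_pairs N))"
proof -
  interpret M: prob_space M by (rule prob_space_M)
  define S' :: "nat \<times> nat \<Rightarrow> (nat \<Rightarrow> real) \<Rightarrow> real" where
    "S' = (\<lambda>(i, j) x. if i = j then xi i x else xi i x * xi j x)"
  have irho: "integrable M rho"
    by (rule integrable_const_bound[of _ r1]) (use rb in \<open>auto simp: abs_of_pos\<close>)
  have B2: "B \<le> B * B" using B_ge_1 by simp
  have e: "emeasure (density M rho) (space M) = (\<integral>\<^sup>+x. rho x \<partial>M)"
    by (simp add: emeasure_density cong: nn_integral_cong)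
  also have "\<dots> = ennreal (\<integral>x. rho x \<partial>M)"
    using rb by (intro nn_integral_eq_integral irho) (auto intro: less_imp_le)
  finally have e: "emeasure (density M rho) (space M) = ennreal (\<integral>x. rho x \<partial>M)" .
  \<comment> \<open>The tilt \<open>rho\<close> becomes part of the reference measure, so that
    \<open>G.part\<close> is the tilted partition function whose power is compared.\<close>
  interpret G: gibbs "density M rho" "diag_pairs N" S' "B * B"
  proof (intro gibbs.intro gibbs_axioms.intro)
    show "finite_measure (density M rho)" by (rule finite_measureI) (simp add: e)
    have "(\<integral>x. rho x \<partial>M) \<noteq> 0"
    proof
      assume "(\<integral>x. rho x \<partial>M) = 0"
      then have "AE x in M. rho x = 0"
        using rb(1) by (subst (asm) integral_nonneg_eq_0_iff_AE[OF irho]) (auto intro: less_imp_le)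
      then have "AE x in M. False" by eventually_elim (use rb(1) in \<open>auto simp: less_le\<close>)
      then show False by simp
    qed
    moreover have "0 \<le> (\<integral>x. rho x \<partial>M)" using rb(1) by (intro integral_nonneg_AE) (auto intro: less_imp_le)
    ultimately have "0 < (\<integral>x. rho x \<partial>M)" by linarith
    then show "emeasure (density M rho) (space (density M rho)) \<noteq> 0" by (simp add: e)
    fix k assume "k \<in> diag_pairs N"
    then obtain i j where k: "k = (i, j)" "i < N" "j < N" by (auto simp: diag_pairs_def)
    show "S' k \<in> borel_measurable (density M rho)"
      unfolding S'_def k by (cases "i = j") (use k in auto)
    show "\<bar>S' k x\<bar> \<le> B * B" for x
    proof (cases "i = j")
      case True then show ?thesis using clip_bounded[of "x j"] B2 by (simp add: S'_def k)
    next
      case False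
      have "\<bar>xi i x * xi j x\<bar> \<le> B * B" unfolding abs_mult using clip_bounded B_ge_1 by (intro mult_mono) auto
      then show ?thesis using False by (simp add: S'_def k)
    qed
  qed simp
  \<comment> \<open>A rotation of amplitudes: \<open>t = 0\<close> leaves only the site fields,
    \<open>t = pi / 2\<close> only the edges. The products of \<open>c\<close> and \<open>c'\<close>
    share the factor \<open>sin t * cos t\<close>, with opposite signs for the two fields.\<close>
  define c :: "real \<Rightarrow> nat \<times> nat \<Rightarrow> real" where
    "c t k = (if fst k = snd k then a * sqrt q * cos t else a / sqrt N * sin t)" for t k
  define c' :: "real \<Rightarrow> nat \<times> nat \<Rightarrow> real" where
    "c' t k = (if fst k = snd k then - (a * sqrt q * sin t) else a / sqrt N * cos t)" for t k
  define h where "h t = (\<integral>w. G.part (c t) w powr s \<partial>gauss (diag_pairs N))" for t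
  define h' where "h' t = (\<Sum>k\<in>diag_pairs N. c t k * c' t k * (\<integral>w. s * (s - 1) * (G.part (c t) w powr s * (G.post (c t) w (S' k))\<^sup>2) \<partial>gauss (diag_pairs N)))" for t
  have h': "(h has_real_derivative h' t) (at t)" for t
    unfolding h_def[abs_def] h'_def
  proof (rule G.powr_derivative[of "t - 1" t "t + 1"])
    fix r k
    show "((\<lambda>t. c t k) has_real_derivative c' r k) (at r)"
      using DERIV_cmult[OF DERIV_cos, of "a * sqrt q" r] DERIV_cmult[OF DERIV_sin, of "a / sqrt N" r]
      unfolding c_def c'_def by (cases "fst k = snd k") auto
    let ?L = "\<bar>a * sqrt q\<bar> + \<bar>a / sqrt N\<bar>"
    have 1: "\<bar>u * z\<bar> \<le> \<bar>u\<bar> + y" "\<bar>u * z\<bar> \<le> y + \<bar>u\<bar>" if "\<bar>z\<bar> \<le> 1" "y \<ge> 0" for u z y :: real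
      using mult_left_le[OF that(1), of "\<bar>u\<bar>"] that(2) by (auto simp: abs_mult)
    show "\<bar>c r k\<bar> \<le> ?L" unfolding c_def
      using 1(1)[OF abs_cos_le_one[of r] abs_ge_zero[of "a / sqrt N"], of "a * sqrt q"]
        1(2)[OF abs_sin_le_one[of r] abs_ge_zero[of "a * sqrt q"], of "a / sqrt N"]
      by (cases "fst k = snd k") (simp_all only: if_True if_False simp_thms)
    show "\<bar>c' r k\<bar> \<le> ?L" unfolding c'_def
      using 1(1)[OF abs_sin_le_one[of r] abs_ge_zero[of "a / sqrt N"], of "a * sqrt q"]
        1(2)[OF abs_cos_le_one[of r] abs_ge_zero[of "a * sqrt q"], of "a / sqrt N"]
      by (cases "fst k = snd k") (simp_all only: if_True if_False simp_thms abs_minus_cancel)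
  qed auto
  have nb: "G.nice (\<lambda>w. (G.post (c t) w (S' k))\<^sup>2)" if "k \<in> diag_pairs N" for k t
    using that by (intro G.nice_power2 G.nice_post G.bm_S)
  have ip: "integrable (gauss (diag_pairs N)) (\<lambda>w. G.part (c t) w powr s * (G.post (c t) w (S' k))\<^sup>2)"
    if "k \<in> diag_pairs N" for k t
    using nb[OF that] by (rule G.integrable_part_powr)
  have ip1: "integrable (gauss (diag_pairs N)) (\<lambda>w. G.part (c t) w powr s)" for t
    using G.integrable_part_powr[OF G.nice_const[of 1], of "c t" s] by simp
  \<comment> \<open>The covariance gap at fixed noise, bounded below by completing the square around
    the overlap \<open>N * q\<close>; \<open>v\<close> is the constant that this leaves.\<close>
  have pw: "- v \<le> a\<^sup>2 / N * (\<Sum>k\<in>upper_pairs N. (G.post (c t) w (S' k))\<^sup>2) - a\<^sup>2 * q * (\<Sum>i<N. (G.post (c t) w (S' (i, i)))\<^sup>2)" for t w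
  proof (cases "N = 0")
    case True
    then show ?thesis by (simp add: v_def upper_pairs_def)
  next
    case False
    interpret R: replicas "G.pm (c t) w" N xi B
    proof -
      interpret prob_space "G.pm (c t) w" by (rule G.prob_space_pm)
      show "replicas (G.pm (c t) w) N xi B"
        by unfold_locales (auto intro: clip_bounded B_ge_1)
    qed
    define u where "u = (\<Sum>i<N. (\<integral>x. xi i x \<partial>G.pm (c t) w)\<^sup>2)"
    define m2 where "m2 i j = (\<integral>x. xi i x * xi j x \<partial>G.pm (c t) w)\<^sup>2" for i j
    have d: "G.post (c t) w (S' (i, i)) = (\<integral>x. xi i x \<partial>G.pm (c t) w)" if "i < N" for i
      using that by (subst G.integral_pm) (auto simp: S'_def)
    have e: "(G.post (c t) w (S' (i, j)))\<^sup>2 = m2 i j" if "(i, j) \<in> upper_pairs N" for i j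
      using that unfolding m2_def by (subst G.integral_pm) (auto simp: S'_def upper_pairs_def)
    \<comment> \<open>The edges lack the diagonal terms of the squared overlap. Each is at most
      \<open>B ^ 4\<close>, which produces the second term of \<open>v\<close>.\<close>
    have m2d: "m2 i i \<le> B ^ 4" if "i < N" for i
    proof -
      have bb: "\<bar>xi i x * xi i x\<bar> \<le> B * B" for x
        unfolding abs_mult using clip_bounded B_ge_1 by (intro mult_mono) auto
      have "\<bar>\<integral>x. xi i x * xi i x \<partial>G.pm (c t) w\<bar> \<le> (\<integral>x. B * B \<partial>G.pm (c t) w)"
      proof (rule order_trans[OF integral_abs_bound], rule integral_mono)
        show "integrable (G.pm (c t) w) (\<lambda>x. \<bar>xi i x * xi i x\<bar>)"
          by (rule R.integrable_bounded_by[of _ "B * B"]) (use that bb in \<open>auto simp del: abs_mult_self_eq\<close>)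
        show "\<bar>xi i x * xi i x\<bar> \<le> B * B" for x by (rule bb)
      qed simp
      then have "\<bar>\<integral>x. xi i x * xi i x \<partial>G.pm (c t) w\<bar> \<le> \<bar>B * B\<bar>" using R.prob_space by simp
      then have "m2 i i \<le> (B * B)\<^sup>2" unfolding m2_def by (rule abs_le_square_iff[THEN iffD1])
      then show ?thesis by (simp add: power2_eq_square power4_eq_xxxx mult.assoc)
    qed
    have u0: "u \<ge> 0" unfolding u_def by (intro sum_nonneg) auto
    have "(\<Sum>i<N. \<Sum>j<N. m2 i j) = (\<Sum>i<N. m2 i i) + (\<Sum>i<N. \<Sum>j\<in>others i. m2 i j)"
      by (simp add: sum.distrib[symmetric] sum.remove[of "{..<N}"])
    also have "(\<Sum>i<N. \<Sum>j\<in>others i. m2 i j) = 2 * (\<Sum>k\<in>upper_pairs N. (G.post (c t) w (S' k))\<^sup>2)"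
      unfolding m2_def
      by (subst sum_off_diagonal[where h = "\<lambda>U. (\<integral>x. U x \<partial>G.pm (c t) w)\<^sup>2"])
         (auto intro!: sum.cong simp: e[unfolded m2_def] split: prod.splits)
    also have "(\<Sum>i<N. m2 i i) \<le> N * B ^ 4" using sum_mono[of "{..<N}" "\<lambda>i. m2 i i" "\<lambda>_. B ^ 4"] m2d by simp
    finally have "u\<^sup>2 \<le> N * B ^ 4 + 2 * (\<Sum>k\<in>upper_pairs N. (G.post (c t) w (S' k))\<^sup>2)"
      using R.square_mean_overlap_le unfolding u_def[symmetric] m2_def[symmetric] by linarith
    then have "a\<^sup>2 / (2 * N) * u\<^sup>2 \<le> a\<^sup>2 / (2 * N) * (N * B ^ 4 + 2 * (\<Sum>k\<in>upper_pairs N. (G.post (c t) w (S' k))\<^sup>2))"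
      by (intro mult_left_mono) auto
    also have "\<dots> = a\<^sup>2 * B ^ 4 / 2 + a\<^sup>2 / N * (\<Sum>k\<in>upper_pairs N. (G.post (c t) w (S' k))\<^sup>2)"
      using False by (simp add: field_simps)
    finally have 1: "a\<^sup>2 / (2 * N) * u\<^sup>2 - a\<^sup>2 * B ^ 4 / 2 \<le> a\<^sup>2 / N * (\<Sum>k\<in>upper_pairs N. (G.post (c t) w (S' k))\<^sup>2)"
      by linarith
    have "0 \<le> a\<^sup>2 / (2 * N) * (u - N * q)\<^sup>2" by simp
    also have "\<dots> = a\<^sup>2 / (2 * N) * u\<^sup>2 - a\<^sup>2 * q * u + a\<^sup>2 * N * q\<^sup>2 / 2"
      using False by (simp add: power2_diff field_simps power2_eq_square)
    finally have 2: "- v \<le> a\<^sup>2 / (2 * N) * u\<^sup>2 - a\<^sup>2 * B ^ 4 / 2 - a\<^sup>2 * q * u" by (simp add: v_def)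
    have "(\<Sum>i<N. (G.post (c t) w (S' (i, i)))\<^sup>2) = u" unfolding u_def by (intro sum.cong) (auto simp: d)
    then show ?thesis using 1 2 by simp
  qed
  \<comment> \<open>Since s(s - 1) is negative, the lower bound on the gap becomes an upper bound on
    the derivative.\<close>
  have h'_le: "h' t \<le> (s * (1 - s) * v * sin t * cos t) * h t" if t: "0 \<le> t" "t \<le> pi / 2" for t
  proof -
    have sc: "0 \<le> sin t * cos t" using t by (intro mult_nonneg_nonneg sin_ge_zero cos_ge_zero) auto
    let ?D = "\<lambda>w. a\<^sup>2 / N * (\<Sum>k\<in>upper_pairs N. (G.post (c t) w (S' k))\<^sup>2) - a\<^sup>2 * q * (\<Sum>i<N. (G.post (c t) w (S' (i, i)))\<^sup>2)"
    have cc: "c t k * c' t k = sin t * cos t * (if fst k = snd k then - (a\<^sup>2 * q) else a\<^sup>2 / N)" for k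
      using q by (auto simp: c_def c'_def power2_eq_square)
    have D: "?D w = (\<Sum>k\<in>diag_pairs N. (if fst k = snd k then - (a\<^sup>2 * q) else a\<^sup>2 / N) * (G.post (c t) w (S' k))\<^sup>2)" for w
    proof -
      have "(\<Sum>k\<in>upper_pairs N. (if fst k = snd k then - (a\<^sup>2 * q) else a\<^sup>2 / N) * (G.post (c t) w (S' k))\<^sup>2)
          = a\<^sup>2 / N * (\<Sum>k\<in>upper_pairs N. (G.post (c t) w (S' k))\<^sup>2)"
        unfolding sum_distrib_left by (intro sum.cong) (auto simp: upper_pairs_def)
      then show ?thesis unfolding diag_pairs_split by (simp add: sum_distrib_left sum_negf)
    qed
    have pD: "G.part (c t) w powr s * ?D w = (\<Sum>k\<in>diag_pairs N. (if fst k = snd k then - (a\<^sup>2 * q) else a\<^sup>2 / N) * (G.part (c t) w powr s * (G.post (c t) w (S' k))\<^sup>2))" for w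
      unfolding D by (simp only: sum_distrib_left mult.left_commute)
    have iD: "integrable (gauss (diag_pairs N)) (\<lambda>w. G.part (c t) w powr s * ?D w)"
      unfolding pD using ip by (intro Bochner_Integration.integrable_sum integrable_mult_right)
    define g where "g k = (if fst k = snd k then - (a\<^sup>2 * q) else a\<^sup>2 / N)" for k :: "nat \<times> nat"
    define J where "J k = (\<integral>w. G.part (c t) w powr s * (G.post (c t) w (S' k))\<^sup>2 \<partial>gauss (diag_pairs N))" for k
    have "(\<integral>w. G.part (c t) w powr s * ?D w \<partial>gauss (diag_pairs N)) = (\<Sum>k\<in>diag_pairs N. g k * J k)"
      unfolding pD g_def[symmetric] J_def using ip by (subst Bochner_Integration.integral_sum) auto
    moreover have "h' t = (\<Sum>k\<in>diag_pairs N. sin t * cos t * g k * (s * (s - 1) * J k))"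
      unfolding h'_def cc g_def[symmetric] J_def by (simp only: integral_mult_right_zero)
    ultimately have "h' t = - (s * (1 - s) * (sin t * cos t)) * (\<integral>w. G.part (c t) w powr s * ?D w \<partial>gauss (diag_pairs N))"
      unfolding sum_distrib_left by (simp add: sum_distrib_left sum_negf[symmetric]) (intro sum.cong refl, simp add: algebra_simps)
    moreover have "(\<integral>w. G.part (c t) w powr s * (- v) \<partial>gauss (diag_pairs N)) \<le> (\<integral>w. G.part (c t) w powr s * ?D w \<partial>gauss (diag_pairs N))"
      using ip1[of t] by (intro integral_mono iD mult_left_mono pw) auto
    then have "- v * h t \<le> (\<integral>w. G.part (c t) w powr s * ?D w \<partial>gauss (diag_pairs N))"
      by (simp add: h_def mult.commute)
    then have "(s * (1 - s) * (sin t * cos t)) * (- v * h t) \<le> (s * (1 - s) * (sin t * cos t)) * (\<integral>w. G.part (c t) w powr s * ?D w \<partial>gauss (diag_pairs N))"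
      using s sc by (intro mult_left_mono) auto
    ultimately show ?thesis by (simp add: mult_ac)
  qed
  define ka where "ka = s * (1 - s) * v"
  note h'_le = h'_le[folded ka_def]
  \<comment> \<open>Integrating factor of the differential inequality; its exponent is the integral
    of \<open>ka * sin t * cos t\<close>.\<close>
  define E where "E t = h t * exp (- (ka * (sin t)\<^sup>2 / 2))" for t
  have "E (pi / 2) \<le> E 0"
  proof (rule DERIV_nonpos_imp_nonincreasing[of 0 "pi / 2" E])
    fix t :: real assume t: "0 \<le> t" "t \<le> pi / 2"
    have "(E has_real_derivative (h' t - (ka * sin t * cos t) * h t) * exp (- (ka * (sin t)\<^sup>2 / 2))) (at t)"
      unfolding E_def[abs_def] by (auto intro!: derivative_eq_intros h' simp: field_simps)
    moreover have "(h' t - (ka * sin t * cos t) * h t) * exp (- (ka * (sin t)\<^sup>2 / 2)) \<le> 0"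
      using h'_le[OF t] by (intro mult_nonpos_nonneg) auto
    ultimately show "\<exists>y. (E has_real_derivative y) (at t) \<and> y \<le> 0" by blast
  qed simp
  then have "h (pi / 2) * exp (- (s * (1 - s) * v / 2)) \<le> h 0" by (simp add: E_def ka_def)
  then have "h (pi / 2) \<le> exp (s * (1 - s) * v / 2) * h 0"
    by (simp add: exp_minus field_simps)
  \<comment> \<open>Dropping the factor \<open>1 - s\<close> loses nothing in the rate as
    \<open>s\<close> tends to 0.\<close>
  also have "\<dots> \<le> exp (s * v / 2) * h 0"
  proof (rule mult_right_mono)
    have "v \<ge> 0" by (simp add: v_def)
    then have "s * (1 - s) * v \<le> s * v" using s by (intro mult_right_mono) auto
    then show "exp (s * (1 - s) * v / 2) \<le> exp (s * v / 2)" by simp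
    show "0 \<le> h 0" unfolding h_def by simp
  qed
  finally have main: "h (pi / 2) \<le> exp (s * v / 2) * h 0" .
  have mixG: "G.part c w = (\<integral>x. rho x * exp (G.ener c w x) \<partial>M)" for c w
    unfolding G.mix_def using rb by (subst integral_density) (auto intro: less_imp_le)
  have e0: "G.ener (c 0) w x = site_ener (a * sqrt q) w x" for w x
    unfolding G.ener_def site_ener_def diag_pairs_split
    by (subst sum.neutral) (auto simp: c_def upper_pairs_def S'_def)
  have e1: "G.ener (c (pi / 2)) w x = ener (unif a) (restrict w (upper_pairs N)) x" for w x
    unfolding G.ener_def ener_def diag_pairs_split
    by (subst (2) sum.neutral) (auto intro!: sum.cong simp: c_def upper_pairs_def S'_def unif_def)
  \<comment> \<open>At this end only the off-diagonal noise is left, so the Gaussian vector may be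
    replaced by its marginal on the edges.\<close>
  have "h (pi / 2) = (\<integral>w. mix (unif a) (restrict w (upper_pairs N)) rho powr s \<partial>gauss (diag_pairs N))"
    unfolding h_def mixG e1 mix_def ..
  also have "\<dots> = (\<integral>w. mix (unif a) w rho powr s \<partial>distr (gauss (diag_pairs N)) (gauss (upper_pairs N)) (\<lambda>f. restrict f (upper_pairs N)))"
  proof (rule integral_distr[symmetric])
    show "(\<lambda>f. restrict f (upper_pairs N)) \<in> gauss (diag_pairs N) \<rightarrow>\<^sub>M gauss (upper_pairs N)"
      by (rule measurable_restrict_subset) (auto simp: upper_pairs_def diag_pairs_def)
  qed measurable
  also have "distr (gauss (diag_pairs N)) (gauss (upper_pairs N)) (\<lambda>f. restrict f (upper_pairs N)) = gauss (upper_pairs N)"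
    by (rule gauss.distr_restrict[symmetric]) (auto simp: upper_pairs_def diag_pairs_def intro: finite_subset[OF _ finite_diag_pairs[of N]])
  finally show ?thesis using main unfolding h_def mixG e0 by simp
qed

end

section \<open>The scalar Gaussian channel at one site\<close>

lemma integral_std_normal_shift:
  fixes f :: "real \<Rightarrow> real"
  assumes [measurable]: "f \<in> borel_measurable borel"
  shows "(\<integral>x. f (x + c) \<partial>std_normal) = (\<integral>x. exp (c * x - c\<^sup>2 / 2) * f x \<partial>std_normal)"
proof -
  have "distr std_normal borel (\<lambda>x. x + c) = density std_normal (\<lambda>x. exp (c * x - c\<^sup>2 / 2))"
  proof (rule measure_eqI)
    fix A assume "A \<in> sets (distr std_normal borel (\<lambda>x. x + c))"
    then have [measurable]: "A \<in> sets borel" by simp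
    have "emeasure (distr std_normal borel (\<lambda>x. x + c)) A = (\<integral>\<^sup>+x. indicator A x \<partial>distr std_normal borel (\<lambda>x. x + c))"
      by simp
    also have "\<dots> = (\<integral>\<^sup>+x. indicator A (x + c) \<partial>std_normal)"
      by (rule nn_integral_distr) auto
    also have "\<dots> = emeasure (density std_normal (\<lambda>x. exp (c * x - c\<^sup>2 / 2))) A"
      by (subst nn_integral_std_normal_shift) (auto simp: emeasure_density)
    finally show "emeasure (distr std_normal borel (\<lambda>x. x + c)) A = emeasure (density std_normal (\<lambda>x. exp (c * x - c\<^sup>2 / 2))) A" .
  qed simp
  moreover have "(\<integral>x. f (x + c) \<partial>std_normal) = (\<integral>x. f x \<partial>distr std_normal borel (\<lambda>x. x + c))"
    by (subst integral_distr) auto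
  ultimately show ?thesis by (simp add: integral_density)
qed

lemma integral_std_normal_uminus:
  fixes f :: "real \<Rightarrow> real"
  assumes [measurable]: "f \<in> borel_measurable borel"
  shows "(\<integral>x. f (- x) \<partial>std_normal) = (\<integral>x. f x \<partial>std_normal)"
proof -
  have "(\<integral>x. f (- x) \<partial>std_normal) = (\<integral>x. std_normal_density x * f (- x) \<partial>lborel)"
    by (subst integral_density) auto
  also have "\<dots> = (\<integral>x. std_normal_density (0 + (-1) * x) * f (- (0 + (-1) * x)) \<partial>lborel)"
    by (subst lborel_integral_real_affine[of "-1" _ 0]) auto
  also have "\<dots> = (\<integral>x. f x \<partial>std_normal)"
    by (subst integral_density) (auto simp: normal_density_def)
  finally show ?thesis .
qed

lemma integrable_std_normal_linear_exp:
  assumes "f \<in> borel_measurable borel" "\<And>z. \<bar>f z\<bar> \<le> C * exp (D * \<bar>z\<bar>)"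
  shows "integrable std_normal f"
  by (rule Bochner_Integration.integrable_bound[OF integrable_mult_right[OF integrable_std_normal_exp_abs[of D], of C]])
     (use order_trans[OF assms(2) abs_ge_self] assms(1) in auto)

text \<open>The remainder is of order \<open>s\<^sup>2\<close> with a coefficient independent of
  \<open>s\<close>, and integrable when \<open>L\<close> grows linearly in a Gaussian
  variable.\<close>

lemma exp_taylor_le:
  fixes L s :: real
  assumes "0 \<le> s" "s \<le> 1"
  shows "exp (s * L) \<le> 1 + s * L + s\<^sup>2 * (2 * exp (2 * \<bar>L\<bar>))"
proof -
  have 1: "exp x \<le> 1 + x + x\<^sup>2 * exp \<bar>x\<bar>" for x :: real
  proof -
    obtain t where t: "\<bar>t\<bar> \<le> \<bar>x\<bar>" "exp x = (\<Sum>m<2. x ^ m / fact m) + exp t / fact 2 * x ^ 2"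
      using Maclaurin_exp_le[of x 2] by auto
    have "exp t / fact 2 * x\<^sup>2 \<le> exp \<bar>x\<bar> * x\<^sup>2"
    proof (rule mult_right_mono)
      have "exp t \<le> exp \<bar>x\<bar>" using t(1) by auto
      then have "exp t / 2 \<le> exp \<bar>x\<bar>" using exp_gt_zero[of "\<bar>x\<bar>"] by linarith
      then show "exp t / fact 2 \<le> exp \<bar>x\<bar>" by (simp add: fact_numeral)
    qed simp
    then show ?thesis using t(2) by (simp add: numeral_2_eq_2 mult.commute)
  qed
  have 2: "L\<^sup>2 \<le> 2 * exp \<bar>L\<bar>"
    using exp_lower_Taylor_quadratic[of "\<bar>L\<bar>"] by simp
  have 3: "exp \<bar>s * L\<bar> \<le> exp \<bar>L\<bar>"
    using assms by (simp add: abs_mult mult_left_le_one_le)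
  have "(s * L)\<^sup>2 * exp \<bar>s * L\<bar> \<le> (s\<^sup>2 * (2 * exp \<bar>L\<bar>)) * exp \<bar>L\<bar>"
    unfolding power_mult_distrib using 2 3 by (intro mult_mono mult_left_mono) auto
  also have "\<dots> = s\<^sup>2 * (2 * exp (2 * \<bar>L\<bar>))"
    by (simp add: exp_add[symmetric] mult.assoc)
  finally show ?thesis using 1[of "s * L"] by linarith
qed

context spins
begin

lemma measurable_clip_P[measurable]: "clip B \<in> borel_measurable P"
  by (simp add: measurable_cong_sets[OF sets_P refl])

text \<open>The log-likelihood ratio at observation \<open>z\<close> of the scalar channel that
  sends x to sqrt r x plus standard noise.\<close>

definition llr :: "real \<Rightarrow> real \<Rightarrow> real" where
  "llr r z = ln (\<integral>x. exp (sqrt r * z * clip B x - r * (clip B x)\<^sup>2 / 2) \<partial>P)"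

definition kap :: "real \<Rightarrow> real" where
  "kap r = sqrt r * B + r * B\<^sup>2"

lemma kap_nonneg: "0 \<le> r \<Longrightarrow> 0 \<le> kap r"
  using B_ge_1 by (simp add: kap_def)

lemma site_exponent_bound:
  assumes "0 \<le> r" shows "\<bar>sqrt r * z * clip B x - r * (clip B x)\<^sup>2 / 2\<bar> \<le> kap r * (1 + \<bar>z\<bar>)"
proof -
  have "\<bar>sqrt r * z * clip B x\<bar> \<le> sqrt r * \<bar>z\<bar> * B"
    unfolding abs_mult using clip_bounded assms by (intro mult_mono) auto
  moreover have "(clip B x)\<^sup>2 \<le> B\<^sup>2" using clip_bounded[of x] B_ge_1 by (simp add: abs_le_square_iff[symmetric])
  then have "r * (clip B x)\<^sup>2 \<le> r * B\<^sup>2" using assms by (rule mult_left_mono)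
  moreover have "0 \<le> r * B\<^sup>2" using assms by simp
  moreover have "0 \<le> r * (clip B x)\<^sup>2 / 2" using assms by simp
  moreover have "kap r * (1 + \<bar>z\<bar>) = sqrt r * B + r * B\<^sup>2 + sqrt r * \<bar>z\<bar> * B + r * B\<^sup>2 * \<bar>z\<bar>"
    by (simp add: kap_def algebra_simps)
  moreover have "0 \<le> sqrt r * B" "0 \<le> r * B\<^sup>2 * \<bar>z\<bar>" using assms B_ge_1 by auto
  ultimately show ?thesis by linarith
qed

lemma integrable_site: "0 \<le> r \<Longrightarrow> integrable P (\<lambda>x. exp (sqrt r * z * clip B x - r * (clip B x)\<^sup>2 / 2))"
  by (rule prior.integrable_const_bound[of _ "exp (kap r * (1 + \<bar>z\<bar>))"])
     (use abs_le_D1[OF site_exponent_bound] in auto)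

lemma exp_llr: assumes "0 \<le> r" shows "exp (llr r z) = (\<integral>x. exp (sqrt r * z * clip B x - r * (clip B x)\<^sup>2 / 2) \<partial>P)"
  and llr_bound: "\<bar>llr r z\<bar> \<le> kap r * (1 + \<bar>z\<bar>)"
proof -
  let ?I = "\<integral>x. exp (sqrt r * z * clip B x - r * (clip B x)\<^sup>2 / 2) \<partial>P"
  let ?e = "kap r * (1 + \<bar>z\<bar>)"
  have "- ?e \<le> sqrt r * z * clip B x - r * (clip B x)\<^sup>2 / 2" "sqrt r * z * clip B x - r * (clip B x)\<^sup>2 / 2 \<le> ?e" for x
    using site_exponent_bound[OF assms, of z x] by linarith+
  then have "(\<integral>x. exp (- ?e) \<partial>P) \<le> ?I" "?I \<le> (\<integral>x. exp ?e \<partial>P)"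
    using integrable_site[OF assms] by (intro integral_mono; simp)+
  then have b: "exp (- ?e) \<le> ?I" "?I \<le> exp ?e" by (auto simp: prior.prob_space)
  have pos: "?I > 0" using b(1) exp_gt_zero[of "- ?e"] by linarith
  then show "exp (llr r z) = ?I" by (simp add: llr_def)
  have "ln (exp (- ?e)) \<le> ln ?I" "ln ?I \<le> ln (exp ?e)"
    using b pos by (subst ln_le_cancel_iff; simp)+
  then have "- ?e \<le> llr r z" "llr r z \<le> ?e" unfolding llr_def ln_exp by blast+
  then show "\<bar>llr r z\<bar> \<le> ?e" by linarith
qed

lemma measurable_llr[measurable]: "llr r \<in> borel_measurable borel"
proof -
  have [measurable]: "(\<lambda>(z, x). clip B x) \<in> borel_measurable (borel \<Otimes>\<^sub>M P)"
    by measurable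
  show ?thesis unfolding llr_def[abs_def] by measurable
qed

lemma llr_shift_bound:
  assumes "0 \<le> r" "\<bar>sg\<bar> \<le> 1"
  shows "\<bar>llr r (z + sg * sqrt r * clip B y)\<bar> \<le> kap r * (1 + sqrt r * B) + kap r * \<bar>z\<bar>"
proof -
  have "\<bar>sg * sqrt r * clip B y\<bar> \<le> 1 * sqrt r * B"
    unfolding abs_mult using assms clip_bounded by (intro mult_mono) auto
  then have "\<bar>z + sg * sqrt r * clip B y\<bar> \<le> \<bar>z\<bar> + sqrt r * B" by linarith
  then have "kap r * (1 + \<bar>z + sg * sqrt r * clip B y\<bar>) \<le> kap r * (1 + (\<bar>z\<bar> + sqrt r * B))"
    using kap_nonneg[OF assms(1)] by (intro mult_left_mono) auto
  then show ?thesis using llr_bound[OF assms(1), of "z + sg * sqrt r * clip B y"] by (simp add: algebra_simps)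
qed

text \<open>With \<open>sg = 1\<close> the observation contains the true coordinate and the value is
  \<open>psi\<close>; \<open>sg = -1\<close> plants its negative, the situation when two replicas
  have negative overlap.\<close>

definition site_ell :: "real \<Rightarrow> real \<Rightarrow> real" where
  "site_ell sg r = (\<integral>y. (\<integral>z. llr r (z + sg * sqrt r * clip B y) \<partial>std_normal) \<partial>P)"

definition site_gen :: "real \<Rightarrow> real \<Rightarrow> real \<Rightarrow> real \<Rightarrow> real" where
  "site_gen sg r s y = (\<integral>z. exp (s * llr r (z + sg * sqrt r * clip B y)) \<partial>std_normal)"

lemma abs_le_exp_const: "\<bar>u\<bar> \<le> c + d * \<bar>z\<bar> \<Longrightarrow> \<bar>u\<bar> \<le> exp c * exp (d * \<bar>z\<bar>)" for u c d z :: real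
  using exp_ge_add_one_self[of "c + d * \<bar>z\<bar>"] by (simp add: exp_add)

lemma integrable_llr_shift:
  assumes "0 \<le> r" "\<bar>sg\<bar> \<le> 1" shows "integrable std_normal (\<lambda>z. llr r (z + sg * sqrt r * clip B y))"
proof (rule integrable_std_normal_linear_exp)
  show "\<bar>llr r (z + sg * sqrt r * clip B y)\<bar> \<le> exp (kap r * (1 + sqrt r * B)) * exp (kap r * \<bar>z\<bar>)" for z
    by (rule abs_le_exp_const[OF llr_shift_bound[OF assms]])
qed measurable

lemma exp_llr_shift_bound:
  assumes "0 \<le> r" "\<bar>sg\<bar> \<le> 1" "0 \<le> s"
  shows "exp (s * \<bar>llr r (z + sg * sqrt r * clip B y)\<bar>) \<le> exp (s * (kap r * (1 + sqrt r * B))) * exp (s * kap r * \<bar>z\<bar>)"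
  using mult_left_mono[OF llr_shift_bound[OF assms(1,2), of z y] assms(3)]
  by (simp add: exp_add[symmetric] algebra_simps)

lemma integrable_exp_llr_shift:
  assumes "0 \<le> r" "\<bar>sg\<bar> \<le> 1" "0 \<le> s"
  shows "integrable std_normal (\<lambda>z. exp (s * llr r (z + sg * sqrt r * clip B y)))"
    "integrable std_normal (\<lambda>z. exp (s * \<bar>llr r (z + sg * sqrt r * clip B y)\<bar>))"
proof -
  have le: "s * llr r (z + sg * sqrt r * clip B y) \<le> s * \<bar>llr r (z + sg * sqrt r * clip B y)\<bar>" for z
    using assms(3) by (intro mult_left_mono) auto
  show "integrable std_normal (\<lambda>z. exp (s * llr r (z + sg * sqrt r * clip B y)))"
    by (rule integrable_std_normal_linear_exp[OF _ order_trans[OF _ exp_llr_shift_bound[OF assms]]]) (use le in auto)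
  show "integrable std_normal (\<lambda>z. exp (s * \<bar>llr r (z + sg * sqrt r * clip B y)\<bar>))"
    by (rule integrable_std_normal_linear_exp[OF _ order_trans[OF _ exp_llr_shift_bound[OF assms]]]) auto
qed

lemma measurable_site_gen[measurable]: "site_gen sg r s \<in> borel_measurable P"
proof -
  have "(\<lambda>y. clip B y) \<in> borel_measurable P" by measurable
  then show ?thesis unfolding site_gen_def[abs_def] by measurable
qed

lemma site_gen_bound:
  assumes "0 \<le> r" "\<bar>sg\<bar> \<le> 1" "0 \<le> s"
  shows "0 \<le> site_gen sg r s y"
    "site_gen sg r s y \<le> exp (s * (kap r * (1 + sqrt r * B))) * (\<integral>z. exp (s * kap r * \<bar>z\<bar>) \<partial>std_normal)"
proof -
  show "0 \<le> site_gen sg r s y" unfolding site_gen_def by simp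
  have le: "s * llr r (z + sg * sqrt r * clip B y) \<le> s * \<bar>llr r (z + sg * sqrt r * clip B y)\<bar>" for z
    using assms(3) by (intro mult_left_mono) auto
  have le': "exp (s * llr r (z + sg * sqrt r * clip B y)) \<le> exp (s * (kap r * (1 + sqrt r * B))) * exp (s * kap r * \<bar>z\<bar>)" for z
    by (rule order_trans[OF _ exp_llr_shift_bound[OF assms]]) (use le in simp)
  have "site_gen sg r s y \<le> (\<integral>z. exp (s * (kap r * (1 + sqrt r * B))) * exp (s * kap r * \<bar>z\<bar>) \<partial>std_normal)"
    unfolding site_gen_def
    using integrable_exp_llr_shift(1)[OF assms] integrable_std_normal_exp_abs[of "s * kap r"]
    by (intro integral_mono le') auto
  then show "site_gen sg r s y \<le> exp (s * (kap r * (1 + sqrt r * B))) * (\<integral>z. exp (s * kap r * \<bar>z\<bar>) \<partial>std_normal)"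
    by simp
qed

lemma integrable_site_gen:
  assumes "0 \<le> r" "\<bar>sg\<bar> \<le> 1" "0 \<le> s" shows "integrable P (site_gen sg r s)"
  by (rule prior.integrable_const_bound) (use site_gen_bound[OF assms] in \<open>auto intro!: AE_I2\<close>)

text \<open>A moment of order \<open>s\<close> is 1 plus \<open>s\<close> times the mean of the
  log-likelihood ratio plus a term of order \<open>s\<^sup>2\<close>. This is where a mean of
  logarithms is recovered from moments.\<close>

lemma site_small_moment:
  assumes r: "0 \<le> r" and sg: "\<bar>sg\<bar> \<le> 1" and d: "0 < d"
  shows "\<exists>s. 0 < s \<and> s < 1 \<and> (\<integral>y. site_gen sg r s y \<partial>P) \<le> exp (s * (site_ell sg r + d))"
proof -
  define D where "D = 2 * (exp (2 * (kap r * (1 + sqrt r * B))) * (\<integral>z. exp (2 * kap r * \<bar>z\<bar>) \<partial>std_normal))"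
  have D0: "D \<ge> 0" by (simp add: D_def)
  \<comment> \<open>The first bound keeps \<open>s < 1\<close>; the second makes the remainder
    \<open>s\<^sup>2 * D\<close> at most \<open>s * d\<close>, and the added 1 avoids division by
    zero.\<close>
  define s where "s = min (1 / 2) (d / (D + 1))"
  have s: "0 < s" "s < 1" using d D0 by (auto simp: s_def)
  have sD: "s * D \<le> d"
  proof -
    have "s * D \<le> d / (D + 1) * D" using D0 by (intro mult_right_mono) (auto simp: s_def)
    also have "\<dots> \<le> d" using d D0 by (simp add: field_simps)
    finally show ?thesis .
  qed
  let ?L = "\<lambda>y z. llr r (z + sg * sqrt r * clip B y)"
  note il = integrable_llr_shift[OF r sg]
  have gen: "site_gen sg r s y \<le> 1 + s * (\<integral>z. ?L y z \<partial>std_normal) + s\<^sup>2 * D" for y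
  proof -
    have i2: "integrable std_normal (\<lambda>z. exp (2 * \<bar>?L y z\<bar>))"
      by (rule integrable_exp_llr_shift(2)[OF r sg]) simp
    have "site_gen sg r s y \<le> (\<integral>z. 1 + s * ?L y z + s\<^sup>2 * (2 * exp (2 * \<bar>?L y z\<bar>)) \<partial>std_normal)"
      unfolding site_gen_def using s il i2
      by (intro integral_mono integrable_exp_llr_shift(1)[OF r sg] exp_taylor_le) auto
    also have "\<dots> = 1 + s * (\<integral>z. ?L y z \<partial>std_normal) + s\<^sup>2 * (2 * (\<integral>z. exp (2 * \<bar>?L y z\<bar>) \<partial>std_normal))"
      using il i2 std_normal.prob_space by simp
    also have "(\<integral>z. exp (2 * \<bar>?L y z\<bar>) \<partial>std_normal) \<le> (\<integral>z. exp (2 * (kap r * (1 + sqrt r * B))) * exp (2 * kap r * \<bar>z\<bar>) \<partial>std_normal)"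
      using integrable_std_normal_exp_abs[of "2 * kap r"] exp_llr_shift_bound[OF r sg, of 2]
      by (intro integral_mono i2) auto
    then have "s\<^sup>2 * (2 * (\<integral>z. exp (2 * \<bar>?L y z\<bar>) \<partial>std_normal)) \<le> s\<^sup>2 * D"
      by (intro mult_left_mono) (auto simp: D_def)
    finally show ?thesis by linarith
  qed
  have il2: "integrable P (\<lambda>y. \<integral>z. ?L y z \<partial>std_normal)"
  proof (rule prior.integrable_const_bound)
    show "AE y in P. norm (\<integral>z. ?L y z \<partial>std_normal) \<le> (\<integral>z. kap r * (1 + sqrt r * B) + kap r * \<bar>z\<bar> \<partial>std_normal)"
    proof (rule AE_I2)
      fix y
      have "integrable std_normal (\<lambda>z. \<bar>z\<bar>)"
        by (rule integrable_std_normal_linear_exp[of _ 1 1]) (use abs_le_exp_const[of _ 0 1] in auto)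
      then have "integrable std_normal (\<lambda>z. kap r * (1 + sqrt r * B) + kap r * \<bar>z\<bar>)" by simp
      then show "norm (\<integral>z. ?L y z \<partial>std_normal) \<le> (\<integral>z. kap r * (1 + sqrt r * B) + kap r * \<bar>z\<bar> \<partial>std_normal)"
        using il[of y] llr_shift_bound[OF r sg]
        by (intro order_trans[OF integral_norm_bound] integral_mono) auto
    qed
    have [measurable]: "(\<lambda>y. clip B y) \<in> borel_measurable P" by measurable
    show "(\<lambda>y. \<integral>z. ?L y z \<partial>std_normal) \<in> borel_measurable P" by measurable
  qed
  have "(\<integral>y. site_gen sg r s y \<partial>P) \<le> (\<integral>y. 1 + s * (\<integral>z. ?L y z \<partial>std_normal) + s\<^sup>2 * D \<partial>P)"
    using s il2 gen by (intro integral_mono integrable_site_gen[OF r sg]) auto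
  also have "\<dots> = 1 + s * site_ell sg r + s\<^sup>2 * D"
    using il2 by (simp add: prior.prob_space site_ell_def)
  also have "\<dots> \<le> 1 + s * (site_ell sg r + d)"
    using mult_left_mono[OF sD, of s] s by (simp add: algebra_simps power2_eq_square)
  also have "\<dots> \<le> exp (s * (site_ell sg r + d))" using exp_ge_add_one_self .
  finally show ?thesis using s by blast
qed

text \<open>Cameron-Martin in the observation and then Fubini over the planted coordinate: against
  the noise, the observation has density \<open>exp (llr r (sg * z))\<close>.\<close>

lemma site_ell_null:
  assumes r: "0 \<le> r" and sg: "sg = 1 \<or> sg = -1"
  shows "site_ell sg r = (\<integral>z. llr r z * exp (llr r (sg * z)) \<partial>std_normal)"
proof -
  interpret SP: pair_sigma_finite P std_normal ..
  let ?f = "\<lambda>(y, z). exp (sg * sqrt r * clip B y * z - (sg * sqrt r * clip B y)\<^sup>2 / 2) * llr r z"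
  have [measurable]: "(\<lambda>(y, z). clip B y) \<in> borel_measurable (P \<Otimes>\<^sub>M std_normal)" by measurable
  have mf[measurable]: "?f \<in> borel_measurable (P \<Otimes>\<^sub>M std_normal)" by measurable
  have sq: "(sg * sqrt r * clip B y)\<^sup>2 = r * (clip B y)\<^sup>2" for y
    using sg r by (auto simp: power_mult_distrib)
  have fb: "\<bar>?f (y, z)\<bar> \<le> exp (2 * kap r) * exp (2 * kap r * \<bar>z\<bar>)" for y z
  proof -
    have "\<bar>sqrt r * (sg * z) * clip B y - r * (clip B y)\<^sup>2 / 2\<bar> \<le> kap r * (1 + \<bar>z\<bar>)"
      using site_exponent_bound[OF r, of "sg * z" y] sg by auto
    then have e: "exp (sg * sqrt r * clip B y * z - (sg * sqrt r * clip B y)\<^sup>2 / 2) \<le> exp (kap r * (1 + \<bar>z\<bar>))"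
      unfolding sq by (simp add: mult_ac)
    have "\<bar>llr r z\<bar> \<le> exp (kap r * (1 + \<bar>z\<bar>))"
      using llr_bound[OF r, of z] exp_ge_add_one_self[of "kap r * (1 + \<bar>z\<bar>)"] by linarith
    then have "\<bar>?f (y, z)\<bar> \<le> exp (kap r * (1 + \<bar>z\<bar>)) * exp (kap r * (1 + \<bar>z\<bar>))"
      using e by (auto simp: abs_mult intro!: mult_mono)
    then show ?thesis by (simp add: exp_add[symmetric] algebra_simps)
  qed
  have int: "integrable (P \<Otimes>\<^sub>M std_normal) ?f"
  proof (rule Bochner_Integration.integrable_bound)
    show "integrable (P \<Otimes>\<^sub>M std_normal) (\<lambda>(y, z). exp (2 * kap r) * exp (2 * kap r * \<bar>z\<bar>))"
      by (rule SP.Fubini_integrable) (auto simp: integrable_std_normal_exp_abs)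
    show "AE w in P \<Otimes>\<^sub>M std_normal. norm (?f w) \<le> norm (case w of (y, z) \<Rightarrow> exp (2 * kap r) * exp (2 * kap r * \<bar>z\<bar>))"
      using fb by (auto intro!: AE_I2)
  qed measurable
  have "site_ell sg r = (\<integral>y. (\<integral>z. ?f (y, z) \<partial>std_normal) \<partial>P)"
    unfolding site_ell_def by (subst integral_std_normal_shift) auto
  also have "\<dots> = (\<integral>z. (\<integral>y. ?f (y, z) \<partial>P) \<partial>std_normal)"
    using SP.integral_fst'[OF int] SP.integral_snd[OF int] by simp
  also have "\<dots> = (\<integral>z. llr r z * exp (llr r (sg * z)) \<partial>std_normal)"
    unfolding exp_llr[OF r] split sq
    by (intro Bochner_Integration.integral_cong refl) (simp add: mult_ac)
  finally show ?thesis .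
qed

text \<open>Gibbs' inequality: under a given law, no log-density has a larger mean than its own.
  Applied to the law of the observation and its reflection, it shows that negative overlaps are no
  more favourable than positive ones.\<close>

lemma site_ell_minus_le:
  assumes r: "0 \<le> r" shows "site_ell (-1) r \<le> site_ell 1 r"
proof -
  have b: "\<bar>llr r z * exp (llr r w)\<bar> \<le> exp (2 * kap r) * exp (2 * kap r * \<bar>z\<bar>)" "exp (llr r w) \<le> exp (2 * kap r) * exp (2 * kap r * \<bar>z\<bar>)"
    if "\<bar>w\<bar> = \<bar>z\<bar>" for z w
  proof -
    have 1: "\<bar>llr r z\<bar> \<le> exp (kap r * (1 + \<bar>z\<bar>))"
      using llr_bound[OF r, of z] exp_ge_add_one_self[of "kap r * (1 + \<bar>z\<bar>)"] by linarith
    have "llr r w \<le> kap r * (1 + \<bar>z\<bar>)" using abs_le_D1[OF llr_bound[OF r, of w]] unfolding that .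
    then have 2: "exp (llr r w) \<le> exp (kap r * (1 + \<bar>z\<bar>))" by simp
    have "\<bar>llr r z * exp (llr r w)\<bar> \<le> exp (kap r * (1 + \<bar>z\<bar>)) * exp (kap r * (1 + \<bar>z\<bar>))"
      unfolding abs_mult using 1 2 by (intro mult_mono) auto
    then show "\<bar>llr r z * exp (llr r w)\<bar> \<le> exp (2 * kap r) * exp (2 * kap r * \<bar>z\<bar>)"
      by (simp add: exp_add[symmetric] algebra_simps)
    have "kap r * (1 + \<bar>z\<bar>) \<ge> 0" using kap_nonneg[OF r] by simp
    then have "exp (llr r w) \<le> exp (2 * (kap r * (1 + \<bar>z\<bar>)))"
      using \<open>llr r w \<le> kap r * (1 + \<bar>z\<bar>)\<close> by simp
    then show "exp (llr r w) \<le> exp (2 * kap r) * exp (2 * kap r * \<bar>z\<bar>)"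
      by (simp add: exp_add[symmetric] algebra_simps)
  qed
  note I = integrable_std_normal_linear_exp[of _ "exp (2 * kap r)" "2 * kap r"]
  have i1: "integrable std_normal (\<lambda>z. llr r z * exp (llr r (- z)))"
  proof (rule I)
    show "\<bar>llr r z * exp (llr r (- z))\<bar> \<le> exp (2 * kap r) * exp (2 * kap r * \<bar>z\<bar>)" for z
      using b(1)[of "- z" z] by simp
  qed measurable
  have i2: "integrable std_normal (\<lambda>z. llr r (- z) * exp (llr r (- z)))"
  proof (rule I)
    show "\<bar>llr r (- z) * exp (llr r (- z))\<bar> \<le> exp (2 * kap r) * exp (2 * kap r * \<bar>z\<bar>)" for z
      using b(1)[of "- z" "- z"] by simp
  qed measurable
  have i3: "integrable std_normal (\<lambda>z. exp (llr r z))"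
  proof (rule I)
    show "\<bar>exp (llr r z)\<bar> \<le> exp (2 * kap r) * exp (2 * kap r * \<bar>z\<bar>)" for z
      using b(2)[of z z] by simp
  qed measurable
  have i4: "integrable std_normal (\<lambda>z. exp (llr r (- z)))"
  proof (rule I)
    show "\<bar>exp (llr r (- z))\<bar> \<le> exp (2 * kap r) * exp (2 * kap r * \<bar>z\<bar>)" for z
      using b(2)[of "- z" z] by simp
  qed measurable
  note i = i1 i2 i3 i4
  have "site_ell (-1) r = (\<integral>z. llr r z * exp (llr r (- z)) \<partial>std_normal)"
    using site_ell_null[OF r, of "-1"] by simp
  also have "\<dots> \<le> (\<integral>z. llr r (- z) * exp (llr r (- z)) + exp (llr r z) - exp (llr r (- z)) \<partial>std_normal)"
  proof (rule integral_mono)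
    fix z
    \<comment> \<open>The inequality 1 + u <= exp u at the log-ratio of the two densities; the two
      terms it leaves over have equal integrals by reflection.\<close>
    have "exp (llr r (- z)) * (1 + (llr r z - llr r (- z))) \<le> exp (llr r (- z)) * exp (llr r z - llr r (- z))"
      by (intro mult_left_mono exp_ge_add_one_self) auto
    also have "\<dots> = exp (llr r z)" by (simp add: exp_diff)
    finally show "llr r z * exp (llr r (- z)) \<le> llr r (- z) * exp (llr r (- z)) + exp (llr r z) - exp (llr r (- z))"
      by (simp add: algebra_simps)
  qed (use i in auto)
  also have "\<dots> = (\<integral>z. llr r (- z) * exp (llr r (- z)) \<partial>std_normal) + (\<integral>z. exp (llr r z) \<partial>std_normal) - (\<integral>z. exp (llr r (- z)) \<partial>std_normal)"
    using i by simp
  also have "\<dots> = (\<integral>z. llr r z * exp (llr r z) \<partial>std_normal)"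
    using integral_std_normal_uminus[of "\<lambda>z. llr r z * exp (llr r z)"] integral_std_normal_uminus[of "\<lambda>z. exp (llr r z)"] by simp
  also have "\<dots> = site_ell 1 r" using site_ell_null[OF r, of 1] by simp
  finally show ?thesis .
qed

text \<open>Multiplying out the shift of the noise by sqrt r times the true value gives the cross
  term of \<open>psi\<close>; clipping is invisible almost surely.\<close>

lemma psi_eq: assumes r: "0 \<le> r" shows "psi P r = site_ell 1 r"
proof -
  interpret SP: pair_sigma_finite P std_normal ..
  let ?f = "\<lambda>(y, z). llr r (z + 1 * sqrt r * clip B y)"
  have [measurable]: "(\<lambda>(y, z). clip B y) \<in> borel_measurable (P \<Otimes>\<^sub>M std_normal)" by measurable
  have [measurable]: "?f \<in> borel_measurable (P \<Otimes>\<^sub>M std_normal)" by measurable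
  have m1[measurable]: "(\<lambda>(xs, z). ln (\<integral>x. exp (sqrt r * z * x + r * x * xs - r / 2 * x\<^sup>2) \<partial>P)) \<in> borel_measurable (P \<Otimes>\<^sub>M std_normal)"
    by measurable
  have "psi P r = (\<integral>w. ?f w \<partial>(P \<Otimes>\<^sub>M std_normal))"
    unfolding psi_def
  proof (rule integral_cong_AE)
    have "AE w in P \<Otimes>\<^sub>M std_normal. clip B (fst w) = fst w"
    proof (rule SP.AE_pair_measure)
      show "{w \<in> space (P \<Otimes>\<^sub>M std_normal). clip B (fst w) = fst w} \<in> sets (P \<Otimes>\<^sub>M std_normal)" by measurable
      show "AE x in P. AE y in std_normal. clip B (fst (x, y)) = fst (x, y)" using clip_AE by eventually_elim simp
    qed
    then show "AE w in P \<Otimes>\<^sub>M std_normal. (case w of (xs, z) \<Rightarrow> ln (\<integral>x. exp (sqrt r * z * x + r * x * xs - r / 2 * x\<^sup>2) \<partial>P)) = ?f w"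
    proof eventually_elim
      case (elim w)
      obtain y z where w: "w = (y, z)" by force
      have "(\<integral>x. exp (sqrt r * z * x + r * x * y - r / 2 * x\<^sup>2) \<partial>P)
          = (\<integral>x. exp (sqrt r * (z + 1 * sqrt r * clip B y) * clip B x - r * (clip B x)\<^sup>2 / 2) \<partial>P)"
      proof (rule integral_cong_AE)
        show "AE x in P. exp (sqrt r * z * x + r * x * y - r / 2 * x\<^sup>2)
          = exp (sqrt r * (z + 1 * sqrt r * clip B y) * clip B x - r * (clip B x)\<^sup>2 / 2)"
          using clip_AE
        proof eventually_elim
          case (elim x)
          have "sqrt r * (z + sqrt r * y) = sqrt r * z + r * y"
            using r by (simp add: distrib_left mult.assoc[symmetric])
          then show ?case using elim \<open>clip B (fst w) = fst w\<close> w r by (simp add: algebra_simps)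
        qed
      qed measurable
      then show ?case by (simp add: w llr_def)
    qed
  qed measurable
  also have "\<dots> = site_ell 1 r"
  proof -
    have "integrable (P \<Otimes>\<^sub>M std_normal) ?f"
    proof (rule Bochner_Integration.integrable_bound)
      show "integrable (P \<Otimes>\<^sub>M std_normal) (\<lambda>(y, z). exp (kap r * (1 + sqrt r * B)) * exp (kap r * \<bar>z\<bar>))"
        by (rule SP.Fubini_integrable) (auto simp: integrable_std_normal_exp_abs)
      show "AE w in P \<Otimes>\<^sub>M std_normal. norm (?f w) \<le> norm (case w of (y, z) \<Rightarrow> exp (kap r * (1 + sqrt r * B)) * exp (kap r * \<bar>z\<bar>))"
        using abs_le_exp_const[OF llr_shift_bound[OF r, of 1]] by (auto intro!: AE_I2)
    qed measurable
    from SP.integral_fst'[OF this] show ?thesis by (simp add: site_ell_def)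
  qed
  finally show ?thesis .
qed

theorem site_moment:
  assumes "0 \<le> r" "sg = 1 \<or> sg = -1" "0 < d"
  shows "\<exists>s. 0 < s \<and> s < 1 \<and> (\<integral>y. site_gen sg r s y \<partial>P) \<le> exp (s * (psi P r + d))"
proof -
  have "site_ell sg r \<le> psi P r"
    using assms(2) site_ell_minus_le[OF assms(1)] psi_eq[OF assms(1)] by auto
  moreover obtain s where s: "0 < s" "s < 1" "(\<integral>y. site_gen sg r s y \<partial>P) \<le> exp (s * (site_ell sg r + d))"
    using site_small_moment[OF assms(1) _ assms(3), of sg] assms(2) by auto
  ultimately have "exp (s * (site_ell sg r + d)) \<le> exp (s * (psi P r + d))" by simp
  then show ?thesis using s by (meson order_trans)
qed

end

section \<open>Large overlaps\<close>

context gibbs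
begin

lemma measurable_ener2[measurable (raw)]:
  assumes "f \<in> Q \<rightarrow>\<^sub>M gauss K" "g \<in> Q \<rightarrow>\<^sub>M M"
  shows "(\<lambda>z. ener c (f z) (g z)) \<in> borel_measurable Q"
  using measurable_compose[OF measurable_Pair[OF assms] measurable_ener_pair[of c]] by simp

end

context spins
begin

definition ovm :: "(nat \<Rightarrow> real) \<Rightarrow> (nat \<Rightarrow> real) \<Rightarrow> real" where
  "ovm x y = (\<Sum>i<N. xi i x * xi i y)"

lemma ovm_eq: "ovm x y = replicas.ov N xi (x, y)"
  unfolding ovm_def using replicas.ov_def[OF replicas_pm[of undefined undefined], of "(x, y)"] by simp

lemma measurable_ovm[measurable (raw)]:
  "f \<in> Q \<rightarrow>\<^sub>M M \<Longrightarrow> g \<in> Q \<rightarrow>\<^sub>M M \<Longrightarrow> (\<lambda>z. ovm (f z) (g z)) \<in> borel_measurable Q"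
  unfolding ovm_def
  by (intro borel_measurable_sum borel_measurable_times measurable_compose[OF _ measurable_xi]) auto

lemma ovm_bounded: "\<bar>ovm x y\<bar> \<le> B\<^sup>2 * N"
  unfolding ovm_eq by (rule replicas.ov_bounded[OF replicas_pm[of undefined undefined]])

text \<open>The diagonal terms missing from the left side are squares, so leaving them out only
  lowers it.\<close>

lemma edge_overlap_le:
  "a\<^sup>2 / N * (\<Sum>k\<in>upper_pairs N. edge k x * edge k y) \<le> a\<^sup>2 / (2 * N) * (ovm x y)\<^sup>2"
proof -
  have "(ovm x y)\<^sup>2 = (\<Sum>i<N. \<Sum>j<N. (xi i x * xi j x) * (xi i y * xi j y))"
    unfolding ovm_def power2_eq_square sum_product by (simp add: mult_ac)
  also have "\<dots> = (\<Sum>i<N. (xi i x * xi i x) * (xi i y * xi i y) + (\<Sum>j\<in>others i. (xi i x * xi j x) * (xi i y * xi j y)))"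
    by (intro sum.cong refl) (simp add: sum.remove)
  also have "\<dots> = (\<Sum>i<N. (xi i x * xi i y)\<^sup>2) + 2 * (\<Sum>k\<in>upper_pairs N. edge k x * edge k y)"
    unfolding sum.distrib sum_off_diagonal[where h = "\<lambda>U. U x * U y", symmetric]
    by (simp add: power2_eq_square mult_ac)
  finally have "2 * (\<Sum>k\<in>upper_pairs N. edge k x * edge k y) \<le> (ovm x y)\<^sup>2"
    by (simp add: sum_nonneg)
  then have "a\<^sup>2 / (2 * N) * (2 * (\<Sum>k\<in>upper_pairs N. edge k x * edge k y)) \<le> a\<^sup>2 / (2 * N) * (ovm x y)\<^sup>2"
    by (intro mult_left_mono) auto
  then show ?thesis by simp
qed

definition near :: "real \<Rightarrow> real \<Rightarrow> (nat \<Rightarrow> real) \<Rightarrow> (nat \<Rightarrow> real) \<Rightarrow> real" where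
  "near m h y x = (if \<bar>ovm x y - m * N\<bar> \<le> h * N then 1 else 0)"

lemma measurable_near[measurable (raw)]:
  "f \<in> Q \<rightarrow>\<^sub>M M \<Longrightarrow> g \<in> Q \<rightarrow>\<^sub>M M \<Longrightarrow> (\<lambda>z. near m h (f z) (g z)) \<in> borel_measurable Q"
  unfolding near_def by measurable

lemma bm_near: "y \<in> space M \<Longrightarrow> bm (near m h y)"
  by (rule bmI[of _ 1], measurable) (auto simp: near_def)

lemma near_bounds: "0 \<le> near m h y x" "near m h y x \<le> 1"
  by (auto simp: near_def)

text \<open>The posterior probability that two replicas have overlap within \<open>h * N\<close> of
  \<open>m * N\<close>, written as a ratio of explicit integrals so that measurability in
  \<open>w\<close> is immediate. The outer variable \<open>y\<close> later plays the planted
  signal.\<close>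

definition pair_near :: "real \<Rightarrow> real \<Rightarrow> (nat \<times> nat \<Rightarrow> real) \<Rightarrow> (nat \<times> nat \<Rightarrow> real) \<Rightarrow> real" where
  "pair_near m h c w = (\<integral>y. exp (ener c w y) * (\<integral>x. near m h y x * exp (ener c w x) \<partial>M) \<partial>M) / (part c w)\<^sup>2"

lemma mix_near_measurable[measurable (raw)]:
  assumes [measurable]: "f \<in> Q \<rightarrow>\<^sub>M gauss (upper_pairs N)" "g \<in> Q \<rightarrow>\<^sub>M M"
  shows "(\<lambda>z. mix c (f z) (near m h (g z))) \<in> borel_measurable Q"
  unfolding mix_def by measurable

lemma mix_near_bounds:
  assumes "y \<in> space M" shows "0 \<le> mix c w (near m h y)" "mix c w (near m h y) \<le> part c w"
proof -
  show "0 \<le> mix c w (near m h y)"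
    unfolding mix_def by (intro integral_nonneg_AE) (auto simp: near_bounds)
  show "mix c w (near m h y) \<le> part c w"
    by (rule mix_mono[OF bm_near[OF assms] bm_const]) (rule near_bounds)
qed

lemma post_near_bounds:
  assumes "y \<in> space M" shows "0 \<le> post c w (near m h y)" "post c w (near m h y) \<le> 1"
  using mix_near_bounds[OF assms, of c w m h] part_pos[of c w] by (auto simp: post_def)

text \<open>Measurability and bounds of \<open>near m h y\<close> are established for
  \<open>y\<close> in the space only; the value 0 elsewhere keeps the function bounded on the whole
  type, as \<open>bm\<close> asks.\<close>

lemma bm_post_near: "bm (\<lambda>y. if y \<in> space M then post c w (near m h y) else 0)"
proof (rule bmI[of _ 1])
  show "(\<lambda>y. if y \<in> space M then post c w (near m h y) else 0) \<in> borel_measurable M"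
  proof (rule measurable_cong[THEN iffD2])
    show "(\<lambda>y. mix c w (near m h y) / part c w) \<in> borel_measurable M"
      unfolding mix_def by measurable
  qed (simp add: post_def)
qed (use post_near_bounds in \<open>auto simp: abs_le_iff intro: order_trans[of _ 0]\<close>)

lemma pair_near_eq: "part c w * pair_near m h c w = mix c w (\<lambda>y. if y \<in> space M then post c w (near m h y) else 0)"
proof -
  have "mix c w (\<lambda>y. if y \<in> space M then post c w (near m h y) else 0)
      = (\<integral>y. (exp (ener c w y) * (\<integral>x. near m h y x * exp (ener c w x) \<partial>M)) / part c w \<partial>M)"
    unfolding mix_def[of c w "\<lambda>y. if y \<in> space M then post c w (near m h y) else 0"]
    by (intro Bochner_Integration.integral_cong refl) (simp add: post_def mix_def)
  also have "\<dots> = part c w * pair_near m h c w"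
    using part_pos[of c w] by (simp add: pair_near_def power2_eq_square)
  finally show ?thesis ..
qed

lemma pair_near_post: "pair_near m h c w = post c w (\<lambda>y. if y \<in> space M then post c w (near m h y) else 0)"
  using pair_near_eq[of c w m h] part_pos[of c w] by (simp add: post_def field_simps)

lemma nice_pair_near: "nice (pair_near m h c)"
proof (rule niceI)
  show "pair_near m h c \<in> borel_measurable (gauss (upper_pairs N))"
    unfolding pair_near_def[abs_def] by measurable
  show "\<bar>pair_near m h c w\<bar> \<le> 1" for w
    unfolding pair_near_post
    by (rule abs_post_le[OF bm_post_near]) (use post_near_bounds in \<open>auto simp: abs_le_iff intro: order_trans[of _ 0]\<close>)
qed

lemma pair_near_measure:
  fixes m h :: real
  shows "measure (pm c w \<Otimes>\<^sub>M pm c w) {z \<in> space (pm c w \<Otimes>\<^sub>M pm c w). \<bar>replicas.ov N xi z - m * N\<bar> \<le> h * N} = pair_near m h c w"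
proof -
  interpret R: replicas "pm c w" N xi B by (rule replicas_pm)
  let ?E = "{z \<in> space (pm c w \<Otimes>\<^sub>M pm c w). \<bar>R.ov z - m * N\<bar> \<le> h * N}"
  have E: "?E \<in> sets (pm c w \<Otimes>\<^sub>M pm c w)" by measurable
  have ie: "integrable (pm c w \<Otimes>\<^sub>M pm c w) (indicator ?E :: _ \<Rightarrow> real)"
    using E by (simp add: integrable_indicator_iff R.P.emeasure_eq_measure)
  have "measure (pm c w \<Otimes>\<^sub>M pm c w) ?E = (\<integral>z. indicator ?E z \<partial>(pm c w \<Otimes>\<^sub>M pm c w))"
    using E by simp
  also have "\<dots> = (\<integral>y. (\<integral>x. indicator ?E (x, y) \<partial>pm c w) \<partial>pm c w)"
  proof -
    have "integrable (pm c w \<Otimes>\<^sub>M pm c w) (\<lambda>(x, y). indicator ?E (x, y) :: real)"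
      using ie by (simp only: case_prod_eta)
    from R.P.integral_snd[OF this] show ?thesis by (simp only: case_prod_eta)
  qed
  also have "\<dots> = (\<integral>y. (if y \<in> space M then post c w (near m h y) else 0) \<partial>pm c w)"
  proof (intro Bochner_Integration.integral_cong refl)
    fix y assume y: "y \<in> space (pm c w)"
    then have "(\<integral>x. indicator ?E (x, y) \<partial>pm c w) = (\<integral>x. near m h y x \<partial>pm c w)"
      by (intro Bochner_Integration.integral_cong refl)
         (auto simp: near_def space_pair_measure ovm_eq indicator_def)
    also have "\<dots> = post c w (near m h y)"
      using bm_near[of y m h] y by (intro integral_pm) (simp add: bm_def)
    finally show "(\<integral>x. indicator ?E (x, y) \<partial>pm c w) = (if y \<in> space M then post c w (near m h y) else 0)"
      using y by simp
  qed
  also have "\<dots> = post c w (\<lambda>y. if y \<in> space M then post c w (near m h y) else 0)"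
    using bm_post_near[of c w m h] by (intro integral_pm) (simp add: bm_def)
  finally show ?thesis by (simp add: pair_near_post)
qed

text \<open>A finite net \<open>G\<close> of mesh \<open>h\<close> reduces the event of an overlap
  beyond \<open>e * N\<close> to finitely many events, each of which is estimated by a fractional
  moment.\<close>

lemma moment_4_le:
  fixes e h :: real
  assumes fin: "finite G" and e: "0 \<le> e"
    and cover: "\<And>r. e < \<bar>r\<bar> \<Longrightarrow> \<bar>r\<bar> \<le> B\<^sup>2 \<Longrightarrow> \<exists>m\<in>G. \<bar>r - m\<bar> \<le> h"
  shows "moment c 4 \<le> (e * N)\<^sup>2 * moment c 2 + (B\<^sup>2 * N) ^ 4 * (\<Sum>m\<in>G. avg c (pair_near m h c))"
proof -
  have pw: "om' 4 c w \<le> (e * N)\<^sup>2 * om' 2 c w + (B\<^sup>2 * N) ^ 4 * (\<Sum>m\<in>G. pair_near m h c w)" for w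
  proof -
    interpret R: replicas "pm c w" N xi B by (rule replicas_pm)
    let ?E = "\<lambda>m::real. {z \<in> space (pm c w \<Otimes>\<^sub>M pm c w). \<bar>R.ov z - m * N\<bar> \<le> h * N}"
    have "measure (pm c w \<Otimes>\<^sub>M pm c w) {z \<in> space (pm c w \<Otimes>\<^sub>M pm c w). \<bar>R.ov z\<bar> > e * N}
        \<le> measure (pm c w \<Otimes>\<^sub>M pm c w) (\<Union>m\<in>G. ?E m)"
    proof (rule R.P.finite_measure_mono)
      show "{z \<in> space (pm c w \<Otimes>\<^sub>M pm c w). \<bar>R.ov z\<bar> > e * N} \<subseteq> (\<Union>m\<in>G. ?E m)"
      proof
        fix z assume z: "z \<in> {z \<in> space (pm c w \<Otimes>\<^sub>M pm c w). \<bar>R.ov z\<bar> > e * N}"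
        then have N: "N > 0" using R.ov_bounded[of z] by (cases "N = 0") auto
        then have "e < \<bar>R.ov z / N\<bar>" "\<bar>R.ov z / N\<bar> \<le> B\<^sup>2" using z R.ov_bounded[of z] by (auto simp: field_simps)
        then obtain m where m: "m \<in> G" "\<bar>R.ov z / N - m\<bar> \<le> h" using cover by blast
        have "R.ov z - m * N = (R.ov z / N - m) * N" using N by (simp add: left_diff_distrib)
        then have "\<bar>R.ov z - m * N\<bar> = \<bar>R.ov z / N - m\<bar> * N" by (simp add: abs_mult)
        also have "\<dots> \<le> h * N" using m(2) by (intro mult_right_mono) auto
        finally show "z \<in> (\<Union>m\<in>G. ?E m)" using m(1) z by auto
      qed
      show "(\<Union>m\<in>G. ?E m) \<in> sets (pm c w \<Otimes>\<^sub>M pm c w)"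
        using fin by (intro sets.finite_UN) measurable
    qed
    also have "\<dots> \<le> (\<Sum>m\<in>G. measure (pm c w \<Otimes>\<^sub>M pm c w) (?E m))"
    proof (rule R.P.finite_measure_subadditive_finite[OF fin])
      have "?E m \<in> sets (pm c w \<Otimes>\<^sub>M pm c w)" for m by measurable
      then show "?E ` G \<subseteq> sets (pm c w \<Otimes>\<^sub>M pm c w)" by blast
    qed
    also have "\<dots> = (\<Sum>m\<in>G. pair_near m h c w)" by (simp only: pair_near_measure)
    finally have "(B\<^sup>2 * N) ^ 4 * measure (pm c w \<Otimes>\<^sub>M pm c w) {z \<in> space (pm c w \<Otimes>\<^sub>M pm c w). \<bar>R.ov z\<bar> > e * N}
        \<le> (B\<^sup>2 * N) ^ 4 * (\<Sum>m\<in>G. pair_near m h c w)"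
      by (intro mult_left_mono) auto
    then show ?thesis
      using R.om_4_le[of "e * N"] e om_eq[of 2 c w] om_eq[of 4 c w] by simp
  qed
  have "moment c 4 \<le> avg c (\<lambda>w. (e * N)\<^sup>2 * om' 2 c w + (B\<^sup>2 * N) ^ 4 * (\<Sum>m\<in>G. pair_near m h c w))"
    unfolding avg_om'[symmetric]
    by (rule avg_mono[OF nice_om' _ pw]) (intro nice_add nice_mult nice_const nice_om' nice_sum fin nice_pair_near)
  also have "\<dots> = (e * N)\<^sup>2 * moment c 2 + (B\<^sup>2 * N) ^ 4 * (\<Sum>m\<in>G. avg c (pair_near m h c))"
    by (simp only: avg_add avg_mult avg_sum nice_mult nice_const nice_om' nice_sum[OF fin] nice_pair_near avg_om')
  finally show ?thesis .
qed

section \<open>Fractional moments of the weight of prescribed overlaps\<close>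

text \<open>The tilt by the overlap with \<open>y\<close> merely shifts each site observation by
  \<open>sg * sqrt r\<close> times the coordinate of \<open>y\<close>.\<close>

lemma site_product:
  fixes w :: "nat \<times> nat \<Rightarrow> real"
  assumes r: "0 \<le> r"
  shows "(\<integral>x. exp (sg * r * ovm x y) * exp (site_ener (sqrt r) w x) \<partial>M)
    = (\<Prod>i<N. exp (llr r (w (i, i) + sg * sqrt r * clip B (y i))))"
proof -
  let ?f = "\<lambda>i u. exp (sqrt r * (w (i, i) + sg * sqrt r * clip B (y i)) * clip B u - r * (clip B u)\<^sup>2 / 2)"
  have "exp (sg * r * ovm x y) * exp (site_ener (sqrt r) w x) = (\<Prod>i<N. ?f i (x i))" for x
  proof -
    have "sg * r * (xi i x * xi i y) + (sqrt r * w (i, i) * xi i x - (sqrt r)\<^sup>2 * (xi i x)\<^sup>2 / 2)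
        = sqrt r * (w (i, i) + sg * sqrt r * clip B (y i)) * clip B (x i) - r * (clip B (x i))\<^sup>2 / 2" for i
    proof -
      have "sqrt r * (sg * sqrt r * clip B (y i)) = sg * r * clip B (y i)" using r by simp
      then show ?thesis using r by (simp add: distrib_left distrib_right mult_ac)
    qed
    then have "(\<Sum>i<N. sg * r * (xi i x * xi i y) + (sqrt r * w (i, i) * xi i x - (sqrt r)\<^sup>2 * (xi i x)\<^sup>2 / 2))
      = (\<Sum>i<N. sqrt r * (w (i, i) + sg * sqrt r * clip B (y i)) * clip B (x i) - r * (clip B (x i))\<^sup>2 / 2)"
      by (intro sum.cong refl)
    then show ?thesis
      unfolding exp_sum[OF finite_lessThan, symmetric] exp_add[symmetric] ovm_def site_ener_def sum.distrib sum_distrib_left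
      by simp
  qed
  then have "(\<integral>x. exp (sg * r * ovm x y) * exp (site_ener (sqrt r) w x) \<partial>M) = (\<integral>x. (\<Prod>i<N. ?f i (x i)) \<partial>(\<Pi>\<^sub>M i\<in>{..<N}. P))"
    by (simp add: spike_law_def)
  also have "\<dots> = (\<Prod>i<N. \<integral>u. ?f i u \<partial>P)"
    by (rule prior_product.product_integral_prod) (use integrable_site[OF r] in auto)
  finally show ?thesis by (simp add: exp_llr[OF r])
qed

text \<open>The inner integral is a product over sites and so is the site noise, hence the
  fractional moment factorises; the off-diagonal noise integrates to 1.\<close>

lemma site_product_powr:
  assumes r: "0 \<le> r" and sg: "\<bar>sg\<bar> \<le> 1" and s: "0 \<le> s"
  shows "(\<integral>w. (\<integral>x. exp (sg * r * ovm x y) * exp (site_ener (sqrt r) w x) \<partial>M) powr s \<partial>gauss (diag_pairs N))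
    = (\<Prod>i<N. site_gen sg r s (y i))"
proof -
  let ?F = "\<lambda>k z. if fst k = snd k then exp (s * llr r (z + sg * sqrt r * clip B (y (fst k)))) else 1"
  have pr: "(\<Prod>k\<in>diag_pairs N. g k) = (\<Prod>i<N. g (i, i))" if "\<And>k. fst k \<noteq> snd k \<Longrightarrow> g k = 1" for g :: "nat \<times> nat \<Rightarrow> real"
  proof -
    have "(\<Prod>k\<in>diag_pairs N. g k) = (\<Prod>k\<in>(\<lambda>i. (i, i)) ` {..<N}. g k)"
      by (rule prod.mono_neutral_right[OF finite_diag_pairs]) (auto simp: diag_pairs_def intro!: that)
    also have "\<dots> = (\<Prod>i<N. g (i, i))" by (subst prod.reindex) (auto simp: inj_on_def)
    finally show ?thesis .
  qed
  have "(\<integral>x. exp (sg * r * ovm x y) * exp (site_ener (sqrt r) w x) \<partial>M) powr s = (\<Prod>k\<in>diag_pairs N. ?F k (w k))" for w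
  proof -
    have "(\<Prod>i<N. exp (llr r (w (i, i) + sg * sqrt r * clip B (y i)))) powr s
        = (\<Prod>i<N. exp (s * llr r (w (i, i) + sg * sqrt r * clip B (y i))))"
      by (simp add: exp_sum[symmetric] powr_def sum_distrib_left)
    then show ?thesis unfolding site_product[OF r] by (subst pr) auto
  qed
  then have "(\<integral>w. (\<integral>x. exp (sg * r * ovm x y) * exp (site_ener (sqrt r) w x) \<partial>M) powr s \<partial>gauss (diag_pairs N))
    = (\<integral>w. (\<Prod>k\<in>diag_pairs N. ?F k (w k)) \<partial>gauss (diag_pairs N))" by simp
  also have "\<dots> = (\<Prod>k\<in>diag_pairs N. \<integral>z. ?F k z \<partial>std_normal)"
  proof (rule gauss.product_integral_prod[OF finite_diag_pairs])
    fix k show "integrable std_normal (?F k)"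
      using integrable_exp_llr_shift(1)[OF r sg s] by (cases "fst k = snd k") auto
  qed
  also have "\<dots> = (\<Prod>i<N. site_gen sg r s (y i))"
    using std_normal.prob_space by (subst pr) (auto simp: site_gen_def)
  finally show ?thesis .
qed

end

context gibbs
begin

lemma integrable_mix_powr:
  assumes T: "bm T" "\<And>x. 0 \<le> T x" and s: "0 \<le> s"
  shows "integrable (gauss K) (\<lambda>w. mix c w T powr s)"
proof -
  obtain L where L: "T \<in> borel_measurable M" "L \<ge> 0" "\<And>x. \<bar>T x\<bar> \<le> L" using T(1) by (rule bmE) blast
  have [measurable]: "T \<in> borel_measurable M" by fact
  show ?thesis
  proof (rule Bochner_Integration.integrable_bound)
    show "integrable (gauss K) (\<lambda>w. L powr s * (part c w powr s * 1))"
      using integrable_part_powr[OF nice_const[of 1], of c s] by (intro integrable_mult_right)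
    show "AE w in gauss K. norm (mix c w T powr s) \<le> norm (L powr s * (part c w powr s * 1))"
    proof (rule AE_I2)
      fix w
      have "0 \<le> mix c w T" unfolding mix_def using T(2) by (intro integral_nonneg_AE) auto
      then have "mix c w T powr s \<le> (L * part c w) powr s"
        using mix_abs_le[OF T(1) L(3), of c w] s by (intro powr_mono2) auto
      then show "norm (mix c w T powr s) \<le> norm (L powr s * (part c w powr s * 1))"
        using L(2) part_pos[of c w] by (simp add: powr_mult)
    qed
  qed measurable
qed

end

context spins
begin

text \<open>Planting \<open>y\<close> adds at most \<open>a\<^sup>2 / (2 * N)\<close> times the
  squared overlap to the energy. For overlaps near \<open>m * N\<close> the square is within a term
  in \<open>h\<close> of its tangent at \<open>m * N\<close>, and the linear tilt that remains
  factorises over sites.\<close>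

lemma near_shift_le:
  fixes a m h :: real
  assumes N: "N > 0" and y: "y \<in> space M"
  shows "mix (unif a) (\<lambda>k\<in>upper_pairs N. w k + unif a k * edge k y) (near m h y)
    \<le> exp (a\<^sup>2 * N * (h\<^sup>2 - m\<^sup>2) / 2) * mix (unif a) w (\<lambda>x. exp (a\<^sup>2 * m * ovm x y))"
proof -
  let ?ka = "a\<^sup>2 * N * (h\<^sup>2 - m\<^sup>2) / 2"
  have bT: "bm (\<lambda>x. exp (a\<^sup>2 * m * ovm x y))"
  proof (rule bmI[of _ "exp (\<bar>a\<^sup>2 * m\<bar> * (B\<^sup>2 * N))"])
    show "(\<lambda>x. exp (a\<^sup>2 * m * ovm x y)) \<in> borel_measurable M" using y by measurable
    show "\<bar>exp (a\<^sup>2 * m * ovm x y)\<bar> \<le> exp (\<bar>a\<^sup>2 * m\<bar> * (B\<^sup>2 * N))" for x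
    proof -
      have "a\<^sup>2 * m * ovm x y \<le> \<bar>a\<^sup>2 * m\<bar> * \<bar>ovm x y\<bar>" by (metis abs_ge_self abs_mult)
      also have "\<dots> \<le> \<bar>a\<^sup>2 * m\<bar> * (B\<^sup>2 * N)" by (intro mult_left_mono ovm_bounded) auto
      finally show ?thesis by simp
    qed
  qed
  have "mix (unif a) (\<lambda>k\<in>upper_pairs N. w k + unif a k * edge k y) (near m h y)
      \<le> (\<integral>x. exp ?ka * (exp (a\<^sup>2 * m * ovm x y) * exp (ener (unif a) w x)) \<partial>M)"
    unfolding mix_def
  proof (rule integral_mono)
    show "integrable M (\<lambda>x. near m h y x * exp (ener (unif a) (\<lambda>k\<in>upper_pairs N. w k + unif a k * edge k y) x))"
      by (rule integrable_mix[OF bm_near[OF y]])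
    show "integrable M (\<lambda>x. exp ?ka * (exp (a\<^sup>2 * m * ovm x y) * exp (ener (unif a) w x)))"
      by (intro integrable_mult_right integrable_mix[OF bT])
    fix x
    show "near m h y x * exp (ener (unif a) (\<lambda>k\<in>upper_pairs N. w k + unif a k * edge k y) x)
      \<le> exp ?ka * (exp (a\<^sup>2 * m * ovm x y) * exp (ener (unif a) w x))"
    proof (cases "\<bar>ovm x y - m * N\<bar> \<le> h * N")
      case False
      then show ?thesis by (simp add: near_def)
    next
      case True
      have "ener (unif a) (\<lambda>k\<in>upper_pairs N. w k + unif a k * edge k y) x
          = ener (unif a) w x + (\<Sum>k\<in>upper_pairs N. (unif a k)\<^sup>2 * (edge k x * edge k y))"
        unfolding ener_def sum.distrib[symmetric]
        by (intro sum.cong refl) (simp add: algebra_simps power2_eq_square)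
      also have "(\<Sum>k\<in>upper_pairs N. (unif a k)\<^sup>2 * (edge k x * edge k y)) = a\<^sup>2 / N * (\<Sum>k\<in>upper_pairs N. edge k x * edge k y)"
        by (simp add: unif_def power_divide sum_distrib_left)
      also have "\<dots> \<le> a\<^sup>2 / (2 * N) * (ovm x y)\<^sup>2" by (rule edge_overlap_le)
      also have "\<dots> \<le> a\<^sup>2 / (2 * N) * (2 * m * N * ovm x y + N\<^sup>2 * (h\<^sup>2 - m\<^sup>2))"
      proof (rule mult_left_mono)
        have "(ovm x y - m * N)\<^sup>2 \<le> (h * N)\<^sup>2" using power_mono[OF True, of 2] by simp
        then show "(ovm x y)\<^sup>2 \<le> 2 * m * N * ovm x y + N\<^sup>2 * (h\<^sup>2 - m\<^sup>2)"
          by (simp add: power2_diff algebra_simps power_mult_distrib)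
      qed simp
      also have "\<dots> = a\<^sup>2 * m * ovm x y + ?ka"
        using N by (simp add: field_simps power2_eq_square)
      finally have "ener (unif a) (\<lambda>k\<in>upper_pairs N. w k + unif a k * edge k y) x \<le> ?ka + (a\<^sup>2 * m * ovm x y + ener (unif a) w x)"
        by linarith
      then show ?thesis using True by (simp add: near_def exp_add[symmetric])
    qed
  qed
  then show ?thesis unfolding mix_def[of "unif a" w] by simp
qed

text \<open>The weight of \<open>y\<close> turns pure noise into noise planted at \<open>y\<close>.
  The comparison is taken at \<open>q = \<bar>m\<bar>\<close>, for which tilt and site fields have
  the same strength \<open>a\<^sup>2 * \<bar>m\<bar>\<close> and form one scalar channel. The
  quadratic terms in \<open>m\<close> then add up to minus \<open>a\<^sup>2 * m\<^sup>2 / 4\<close>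
  per site, as in \<open>rs_potential\<close>.\<close>

lemma near_powr_le:
  fixes a m h s :: real
  assumes N: "N > 0" and y: "y \<in> space M" and a: "0 \<le> a" and s: "0 < s" "s < 1"
  defines "sg \<equiv> (if 0 \<le> m then 1 else - 1 :: real)"
  shows "(\<integral>\<^sup>+w. ennreal (exp (ener (unif a) w y) * mix (unif a) w (near m h y) powr s) \<partial>gauss (upper_pairs N))
    \<le> ennreal (exp (s * (a\<^sup>2 * N * (h\<^sup>2 - m\<^sup>2) / 2 + (a\<^sup>2 * N * m\<^sup>2 / 2 + a\<^sup>2 * B ^ 4 / 2) / 2))
        * (\<Prod>i<N. site_gen sg (a\<^sup>2 * \<bar>m\<bar>) s (y i)))"
proof -
  let ?ka = "a\<^sup>2 * N * (h\<^sup>2 - m\<^sup>2) / 2"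
  let ?rho = "\<lambda>x. exp (a\<^sup>2 * m * ovm x y)"
  let ?f = "\<lambda>w. ennreal (mix (unif a) w (near m h y) powr s)"
  have rho_b: "?rho x \<le> exp (\<bar>a\<^sup>2 * m\<bar> * (B\<^sup>2 * N))" for x
  proof -
    have "a\<^sup>2 * m * ovm x y \<le> \<bar>a\<^sup>2 * m\<bar> * \<bar>ovm x y\<bar>" by (metis abs_ge_self abs_mult)
    also have "\<dots> \<le> \<bar>a\<^sup>2 * m\<bar> * (B\<^sup>2 * N)" by (intro mult_left_mono ovm_bounded) auto
    finally show ?thesis by simp
  qed
  have rho_m[measurable]: "?rho \<in> borel_measurable M" using y by measurable
  have rho_bm: "bm ?rho" by (rule bmI[OF rho_m]) (use rho_b in auto)
  have [measurable]: "near m h y \<in> borel_measurable M" using bm_near[OF y] by (simp add: bm_def)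
  have fm: "?f \<in> borel_measurable (gauss (upper_pairs N))" by measurable
  have ex: "exp (ener (unif a) w y) = exp (\<Sum>k\<in>upper_pairs N. (unif a k * edge k y) * w k - (unif a k * edge k y)\<^sup>2 / 2)" for w
    unfolding ener_def by (intro arg_cong[where f = exp] sum.cong refl) (simp add: power_mult_distrib mult_ac)
  have "(\<integral>\<^sup>+w. ennreal (exp (ener (unif a) w y) * mix (unif a) w (near m h y) powr s) \<partial>gauss (upper_pairs N))
      = (\<integral>\<^sup>+w. exp (\<Sum>k\<in>upper_pairs N. (unif a k * edge k y) * w k - (unif a k * edge k y)\<^sup>2 / 2) * ?f w \<partial>gauss (upper_pairs N))"
    by (simp only: ex ennreal_mult' exp_ge_zero)
  also have "\<dots> = (\<integral>\<^sup>+w. ?f (\<lambda>k\<in>upper_pairs N. w k + unif a k * edge k y) \<partial>gauss (upper_pairs N))"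
    by (rule nn_integral_gauss_shift[OF finite_upper_pairs fm, symmetric])
  also have "\<dots> \<le> (\<integral>\<^sup>+w. ennreal (exp (s * ?ka) * mix (unif a) w ?rho powr s) \<partial>gauss (upper_pairs N))"
  proof (intro nn_integral_mono ennreal_leI)
    fix w
    have "0 \<le> mix (unif a) w ?rho" unfolding mix_def by (intro integral_nonneg_AE) auto
    moreover have "mix (unif a) (\<lambda>k\<in>upper_pairs N. w k + unif a k * edge k y) (near m h y) powr s
        \<le> (exp ?ka * mix (unif a) w ?rho) powr s"
      using s mix_near_bounds(1)[OF y] by (intro powr_mono2 near_shift_le[OF N y]) auto
    ultimately show "mix (unif a) (\<lambda>k\<in>upper_pairs N. w k + unif a k * edge k y) (near m h y) powr s
        \<le> exp (s * ?ka) * mix (unif a) w ?rho powr s"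
      by (simp add: powr_mult exp_powr_real mult.commute)
  qed
  also have "\<dots> = ennreal (\<integral>w. exp (s * ?ka) * mix (unif a) w ?rho powr s \<partial>gauss (upper_pairs N))"
    using s by (intro nn_integral_eq_integral integrable_mult_right integrable_mix_powr rho_bm) auto
  also have "\<dots> \<le> ennreal (exp (s * ?ka) * (exp (s * (a\<^sup>2 * N * m\<^sup>2 / 2 + a\<^sup>2 * B ^ 4 / 2) / 2) * (\<Prod>i<N. site_gen sg (a\<^sup>2 * \<bar>m\<bar>) s (y i))))"
  proof (rule ennreal_leI)
    have am: "a\<^sup>2 * m = sg * (a\<^sup>2 * \<bar>m\<bar>)" by (simp add: sg_def abs_if)
    have "(\<integral>w. mix (unif a) w ?rho powr s \<partial>gauss (upper_pairs N))
      \<le> exp (s * (a\<^sup>2 * N * \<bar>m\<bar>\<^sup>2 / 2 + a\<^sup>2 * B ^ 4 / 2) / 2)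
        * (\<integral>w. (\<integral>x. ?rho x * exp (site_ener (a * sqrt \<bar>m\<bar>) w x) \<partial>M) powr s \<partial>gauss (diag_pairs N))"
      by (rule kahane_comparison[OF rho_m _ rho_b s]) auto
    also have "a * sqrt \<bar>m\<bar> = sqrt (a\<^sup>2 * \<bar>m\<bar>)" using a by (simp add: real_sqrt_mult)
    also have "(\<integral>w. (\<integral>x. ?rho x * exp (site_ener (sqrt (a\<^sup>2 * \<bar>m\<bar>)) w x) \<partial>M) powr s \<partial>gauss (diag_pairs N))
        = (\<Prod>i<N. site_gen sg (a\<^sup>2 * \<bar>m\<bar>) s (y i))"
      unfolding am using s by (intro site_product_powr) (auto simp: sg_def)
    finally have "(\<integral>w. mix (unif a) w ?rho powr s \<partial>gauss (upper_pairs N))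
      \<le> exp (s * (a\<^sup>2 * N * m\<^sup>2 / 2 + a\<^sup>2 * B ^ 4 / 2) / 2) * (\<Prod>i<N. site_gen sg (a\<^sup>2 * \<bar>m\<bar>) s (y i))"
      by (simp only: power2_abs)
    then show "(\<integral>w. exp (s * ?ka) * mix (unif a) w ?rho powr s \<partial>gauss (upper_pairs N))
      \<le> exp (s * ?ka) * (exp (s * (a\<^sup>2 * N * m\<^sup>2 / 2 + a\<^sup>2 * B ^ 4 / 2) / 2) * (\<Prod>i<N. site_gen sg (a\<^sup>2 * \<bar>m\<bar>) s (y i)))"
      unfolding integral_mult_right_zero by (intro mult_left_mono) auto
  qed
  also have "exp (s * ?ka) * (exp (s * (a\<^sup>2 * N * m\<^sup>2 / 2 + a\<^sup>2 * B ^ 4 / 2) / 2) * (\<Prod>i<N. site_gen sg (a\<^sup>2 * \<bar>m\<bar>) s (y i)))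
    = exp (s * (?ka + (a\<^sup>2 * N * m\<^sup>2 / 2 + a\<^sup>2 * B ^ 4 / 2) / 2)) * (\<Prod>i<N. site_gen sg (a\<^sup>2 * \<bar>m\<bar>) s (y i))"
    by (simp only: mult.assoc[symmetric] exp_add[symmetric] distrib_left times_divide_eq_right)
  finally show ?thesis .
qed

text \<open>A small \<open>part\<close> already makes the left side small, since the conditional
  probability is at most 1. Otherwise the normalisation is bounded below, and a probability is at
  most its power of order \<open>s\<close>, so that only a power of the numerator is left to
  estimate.\<close>

lemma pair_near_split:
  assumes s: "0 < s" "s < 1"
  shows "ennreal (part c w * pair_near m h c w)
    \<le> ennreal (exp (- b)) + ennreal (exp (s * b)) * (\<integral>\<^sup>+y. ennreal (exp (ener c w y) * mix c w (near m h y) powr s) \<partial>M)"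
proof (cases "part c w < exp (- b)")
  case True
  have "\<bar>pair_near m h c w\<bar> \<le> 1"
    unfolding pair_near_post
    by (rule abs_post_le[OF bm_post_near]) (use post_near_bounds in \<open>auto simp: abs_le_iff intro: order_trans[of _ 0]\<close>)
  then have "pair_near m h c w \<le> 1" by linarith
  then have "part c w * pair_near m h c w \<le> part c w"
    using part_pos[of c w] by (simp add: mult_left_le)
  then have "ennreal (part c w * pair_near m h c w) \<le> ennreal (exp (- b))"
    using True by (intro ennreal_leI) linarith
  then show ?thesis by (rule order_trans) simp
next
  case False
  have "ennreal (part c w * pair_near m h c w)
      = (\<integral>\<^sup>+y. ennreal ((if y \<in> space M then post c w (near m h y) else 0) * exp (ener c w y)) \<partial>M)"
    unfolding pair_near_eq mix_def[of c w "\<lambda>y. if y \<in> space M then post c w (near m h y) else 0"]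
    using post_near_bounds by (intro nn_integral_eq_integral[symmetric] integrable_mix bm_post_near) auto
  also have "\<dots> \<le> (\<integral>\<^sup>+y. ennreal (exp (s * b)) * ennreal (exp (ener c w y) * mix c w (near m h y) powr s) \<partial>M)"
  proof (rule nn_integral_mono)
    fix y assume y: "y \<in> space M"
    define p where "p = post c w (near m h y)"
    have p: "0 \<le> p" "p \<le> 1" using post_near_bounds[OF y] by (auto simp: p_def)
    have "p \<le> p powr s"
    proof (cases "p = 0")
      case False
      then have "p powr 1 \<le> p powr s" using p s by (intro powr_mono') auto
      then show ?thesis using p False by simp
    qed simp
    also have "p powr s = mix c w (near m h y) powr s / part c w powr s"
      unfolding p_def post_def by (rule powr_divide)
    also have "\<dots> \<le> mix c w (near m h y) powr s / exp (- b) powr s"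
      using False s part_pos[of c w] by (intro divide_left_mono powr_mono2) auto
    also have "\<dots> = exp (s * b) * mix c w (near m h y) powr s"
    proof -
      have "exp (- b) powr s = exp (- (s * b))" by (subst exp_powr_real) (simp add: mult.commute)
      then show ?thesis by (simp only: exp_minus) (simp add: field_simps)
    qed
    finally have "p * exp (ener c w y) \<le> (exp (s * b) * mix c w (near m h y) powr s) * exp (ener c w y)"
      by (intro mult_right_mono) auto
    then show "ennreal ((if y \<in> space M then post c w (near m h y) else 0) * exp (ener c w y))
        \<le> ennreal (exp (s * b)) * ennreal (exp (ener c w y) * mix c w (near m h y) powr s)"
      using y by (simp add: ennreal_mult'[symmetric] p_def[symmetric] mult_ac ennreal_leI)
  qed
  also have "\<dots> = ennreal (exp (s * b)) * (\<integral>\<^sup>+y. ennreal (exp (ener c w y) * mix c w (near m h y) powr s) \<partial>M)"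
  proof (rule nn_integral_cmult)
    show "(\<lambda>y. ennreal (exp (ener c w y) * mix c w (near m h y) powr s)) \<in> borel_measurable M"
      unfolding mix_def by measurable
  qed
  finally show ?thesis by (rule order_trans) simp
qed

theorem avg_pair_near_le:
  fixes a m h s b :: real
  assumes N: "N > 0" and a: "0 \<le> a" and s: "0 < s" "s < 1"
  defines "sg \<equiv> (if 0 \<le> m then 1 else - 1 :: real)"
  shows "avg (unif a) (pair_near m h (unif a)) \<le> exp (- b)
    + exp (s * (b + a\<^sup>2 * N * (h\<^sup>2 - m\<^sup>2) / 2 + (a\<^sup>2 * N * m\<^sup>2 / 2 + a\<^sup>2 * B ^ 4 / 2) / 2))
      * (\<integral>y. site_gen sg (a\<^sup>2 * \<bar>m\<bar>) s y \<partial>P) ^ N"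
proof -
  let ?c = "unif a" and ?G = "gauss (upper_pairs N)"
  let ?K = "exp (s * (a\<^sup>2 * N * (h\<^sup>2 - m\<^sup>2) / 2 + (a\<^sup>2 * N * m\<^sup>2 / 2 + a\<^sup>2 * B ^ 4 / 2) / 2))"
  let ?g = "site_gen sg (a\<^sup>2 * \<bar>m\<bar>) s"
  let ?F = "\<lambda>w y. ennreal (exp (ener ?c w y) * mix ?c w (near m h y) powr s)"
  have gb: "0 \<le> ?g y" for y using s by (intro site_gen_bound) (auto simp: sg_def)
  have gi: "integrable P ?g" using s by (intro integrable_site_gen) (auto simp: sg_def)
  interpret G: prob_space ?G by (rule prob_space_gauss)
  interpret GM: pair_sigma_finite ?G M ..
  have pn: "0 \<le> part ?c w * pair_near m h ?c w" for w
  proof -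
    have "0 \<le> mix ?c w (\<lambda>y. if y \<in> space M then post ?c w (near m h y) else 0)"
      unfolding mix_def using post_near_bounds(1) by (intro integral_nonneg_AE) auto
    then show ?thesis by (simp only: pair_near_eq)
  qed
  have Fm[measurable]: "case_prod ?F \<in> borel_measurable (?G \<Otimes>\<^sub>M M)" by measurable
  have "ennreal (avg ?c (pair_near m h ?c)) = (\<integral>\<^sup>+w. ennreal (part ?c w * pair_near m h ?c w) \<partial>?G)"
    unfolding avg_def using pn by (intro nn_integral_eq_integral[symmetric] integrable_avg nice_pair_near) auto
  also have "\<dots> \<le> (\<integral>\<^sup>+w. ennreal (exp (- b)) + ennreal (exp (s * b)) * (\<integral>\<^sup>+y. ?F w y \<partial>M) \<partial>?G)"
    by (intro nn_integral_mono pair_near_split s)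
  also have "\<dots> = ennreal (exp (- b)) + ennreal (exp (s * b)) * (\<integral>\<^sup>+w. \<integral>\<^sup>+y. ?F w y \<partial>M \<partial>?G)"
  proof -
    have "(\<integral>\<^sup>+w. ennreal (exp (- b)) + ennreal (exp (s * b)) * (\<integral>\<^sup>+y. ?F w y \<partial>M) \<partial>?G)
        = (\<integral>\<^sup>+w. ennreal (exp (- b)) \<partial>?G) + (\<integral>\<^sup>+w. ennreal (exp (s * b)) * (\<integral>\<^sup>+y. ?F w y \<partial>M) \<partial>?G)"
      by (rule nn_integral_add) measurable
    also have "(\<integral>\<^sup>+w. ennreal (exp (s * b)) * (\<integral>\<^sup>+y. ?F w y \<partial>M) \<partial>?G) = ennreal (exp (s * b)) * (\<integral>\<^sup>+w. \<integral>\<^sup>+y. ?F w y \<partial>M \<partial>?G)"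
      by (rule nn_integral_cmult) measurable
    finally show ?thesis by (simp add: G.emeasure_space_1)
  qed
  \<comment> \<open>Exchanged so that the noise is integrated first, at a fixed planted signal
    \<open>y\<close>.\<close>
  also have "(\<integral>\<^sup>+w. \<integral>\<^sup>+y. ?F w y \<partial>M \<partial>?G) = (\<integral>\<^sup>+y. \<integral>\<^sup>+w. ?F w y \<partial>?G \<partial>M)"
    by (rule GM.Fubini'[symmetric, OF Fm])
  also have "\<dots> \<le> (\<integral>\<^sup>+y. ennreal (?K * (\<Prod>i<N. ?g (y i))) \<partial>M)"
    unfolding sg_def by (intro nn_integral_mono near_powr_le N a s)
  also have "\<dots> = ennreal (\<integral>y. ?K * (\<Prod>i<N. ?g (y i)) \<partial>M)"
  proof (rule nn_integral_eq_integral)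
    show "integrable M (\<lambda>y. ?K * (\<Prod>i<N. ?g (y i)))"
      unfolding spike_law_def using gi
      by (intro integrable_mult_right prior_product.product_integrable_prod) auto
    show "AE y in M. 0 \<le> ?K * (\<Prod>i<N. ?g (y i))"
      using gb by (intro AE_I2 mult_nonneg_nonneg prod_nonneg) auto
  qed
  also have "(\<integral>y. ?K * (\<Prod>i<N. ?g (y i)) \<partial>M) = ?K * (\<integral>y. ?g y \<partial>P) ^ N"
    unfolding spike_law_def integral_mult_right_zero
    by (subst prior_product.product_integral_prod) (auto simp: gi)
  finally have "ennreal (avg ?c (pair_near m h ?c)) \<le> ennreal (exp (- b)) + ennreal (exp (s * b)) * ennreal (?K * (\<integral>y. ?g y \<partial>P) ^ N)"
    by (simp add: add_left_mono mult_left_mono)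
  also have "\<dots> = ennreal (exp (- b) + exp (s * b) * (?K * (\<integral>y. ?g y \<partial>P) ^ N))"
    using gb by (simp add: ennreal_mult'[symmetric] ennreal_plus[symmetric] del: ennreal_plus)
  finally have "avg ?c (pair_near m h ?c) \<le> exp (- b) + exp (s * b) * (?K * (\<integral>y. ?g y \<partial>P) ^ N)"
    using gb by (subst (asm) ennreal_le_iff) (auto intro!: add_nonneg_nonneg)
  also have "exp (s * b) * (?K * (\<integral>y. ?g y \<partial>P) ^ N)
    = exp (s * (b + a\<^sup>2 * N * (h\<^sup>2 - m\<^sup>2) / 2 + (a\<^sup>2 * N * m\<^sup>2 / 2 + a\<^sup>2 * B ^ 4 / 2) / 2)) * (\<integral>y. ?g y \<partial>P) ^ N"
    by (simp only: mult.assoc[symmetric] exp_add[symmetric] distrib_left add.assoc)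
  finally show ?thesis .
qed

end

section \<open>Relative entropy\<close>

context spins
begin

lemma AE_clip_all: "AE x in M. \<forall>i<N. clip B (x i) = x i"
proof -
  have "AE x in M. clip B (x i) = x i" if "i \<in> {..<N}" for i
    unfolding spike_law_def
    by (rule AE_PiM_component[OF prior.prob_space_axioms that clip_AE])
  then have "AE x in M. \<forall>i\<in>{..<N}. clip B (x i) = x i"
    by (intro AE_finite_allI) auto
  then show ?thesis by eventually_elim auto
qed

text \<open>Cameron-Martin conditionally on the signal, after which the signal is integrated out.
  The observation is built from unclipped coordinates; the passage to clipped ones is an almost-sure
  identity under the prior.\<close>

lemma spiked_wigner_density:
  assumes a: "0 \<le> a"
  shows "spiked_wigner P (a\<^sup>2) N = density (gauss (upper_pairs N)) (\<lambda>w. part (unif a) w)"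
proof (rule measure_eqI)
  let ?G = "gauss (upper_pairs N)" and ?Q = "\<Pi>\<^sub>M p\<in>upper_pairs N. (borel :: real measure)"
  interpret G: prob_space ?G by (rule prob_space_gauss)
  interpret GM: pair_sigma_finite M ?G ..
  have sQ: "sets ?Q = sets ?G" by (rule measurable_gauss_cong[symmetric])
  show "sets (spiked_wigner P (a\<^sup>2) N) = sets (density ?G (\<lambda>w. part (unif a) w))"
    by (simp add: spiked_wigner_def sQ)
  fix A assume "A \<in> sets (spiked_wigner P (a\<^sup>2) N)"
  then have A[measurable]: "A \<in> sets ?G" by (simp add: spiked_wigner_def sQ)
  have AQ: "A \<in> sets ?Q" using A sQ by simp
  define sh where "sh x k = unif a k * (case k of (i, j) \<Rightarrow> x i * x j)" for x :: "nat \<Rightarrow> real" and k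
  have xm[measurable]: "(\<lambda>x. x i) \<in> borel_measurable M" if "i < N" for i
    using measurable_component_singleton[of i "{..<N}" "\<lambda>_. P"] that
    unfolding spike_law_def by (simp add: measurable_cong_sets[OF refl sets_P])
  have shm: "(\<lambda>x. sh x k) \<in> borel_measurable M" if "k \<in> upper_pairs N" for k
    using that unfolding sh_def by (cases k) (auto simp: upper_pairs_def)
  have obs: "observation (a\<^sup>2) N x w = (\<lambda>k\<in>upper_pairs N. w k + sh x k)" for x w
    using a by (auto simp: observation_def fun_eq_iff sh_def unif_def real_sqrt_divide)
  have m1: "(\<lambda>z. sh (fst z) k) \<in> borel_measurable (M \<Otimes>\<^sub>M ?G)" if "k \<in> upper_pairs N" for k
    using measurable_compose[OF measurable_fst shm[OF that]] .
  have m2: "(\<lambda>z. snd z k) \<in> borel_measurable (M \<Otimes>\<^sub>M ?G)" if "k \<in> upper_pairs N" for k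
    using measurable_compose[OF measurable_snd measurable_component_singleton[OF that, of "\<lambda>_. std_normal"]] by simp
  have mo: "(\<lambda>z. \<lambda>k\<in>upper_pairs N. snd z k + sh (fst z) k) \<in> M \<Otimes>\<^sub>M ?G \<rightarrow>\<^sub>M ?G"
    by (intro measurable_restrict) (simp add: m1 m2 borel_measurable_add)
  have me: "(\<lambda>z. exp (\<Sum>k\<in>upper_pairs N. sh (fst z) k * snd z k - (sh (fst z) k)\<^sup>2 / 2)) \<in> borel_measurable (M \<Otimes>\<^sub>M ?G)"
    by (intro borel_measurable_exp borel_measurable_sum borel_measurable_diff borel_measurable_times
        borel_measurable_divide borel_measurable_power m1 m2 borel_measurable_const measurable_compose[OF _ borel_measurable_exp])
  have "emeasure (spiked_wigner P (a\<^sup>2) N) A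
      = (\<integral>\<^sup>+z. indicator A (\<lambda>k\<in>upper_pairs N. snd z k + sh (fst z) k) \<partial>(M \<Otimes>\<^sub>M ?G))"
  proof -
    have s: "spiked_wigner P (a\<^sup>2) N = distr (M \<Otimes>\<^sub>M ?G) ?Q (\<lambda>z. \<lambda>k\<in>upper_pairs N. snd z k + sh (fst z) k)"
      unfolding spiked_wigner_def wigner_noise_def split_def obs ..
    have mo': "(\<lambda>z. \<lambda>k\<in>upper_pairs N. snd z k + sh (fst z) k) \<in> M \<Otimes>\<^sub>M ?G \<rightarrow>\<^sub>M ?Q"
      using mo measurable_cong_sets[OF refl sQ] by blast
    have "emeasure (spiked_wigner P (a\<^sup>2) N) A = (\<integral>\<^sup>+y. indicator A y \<partial>spiked_wigner P (a\<^sup>2) N)"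
      using AQ by (simp add: s)
    also have "\<dots> = (\<integral>\<^sup>+z. indicator A (\<lambda>k\<in>upper_pairs N. snd z k + sh (fst z) k) \<partial>(M \<Otimes>\<^sub>M ?G))"
      unfolding s by (rule nn_integral_distr[OF mo']) (use AQ in simp)
    finally show ?thesis .
  qed
  also have "\<dots> = (\<integral>\<^sup>+x. \<integral>\<^sup>+w. indicator A (\<lambda>k\<in>upper_pairs N. w k + sh x k) \<partial>?G \<partial>M)"
    using measurable_compose[OF mo borel_measurable_indicator[OF A]]
    by (subst G.nn_integral_fst[symmetric]) auto
  also have "\<dots> = (\<integral>\<^sup>+x. \<integral>\<^sup>+w. ennreal (exp (\<Sum>k\<in>upper_pairs N. sh x k * w k - (sh x k)\<^sup>2 / 2)) * indicator A w \<partial>?G \<partial>M)"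
  proof (rule nn_integral_cong)
    fix x
    show "(\<integral>\<^sup>+w. indicator A (\<lambda>k\<in>upper_pairs N. w k + sh x k) \<partial>?G)
      = (\<integral>\<^sup>+w. ennreal (exp (\<Sum>k\<in>upper_pairs N. sh x k * w k - (sh x k)\<^sup>2 / 2)) * indicator A w \<partial>?G)"
      by (rule nn_integral_gauss_shift) auto
  qed
  also have "\<dots> = (\<integral>\<^sup>+w. \<integral>\<^sup>+x. ennreal (exp (\<Sum>k\<in>upper_pairs N. sh x k * w k - (sh x k)\<^sup>2 / 2)) * indicator A w \<partial>M \<partial>?G)"
  proof (rule GM.Fubini'[symmetric])
    show "(\<lambda>(x, w). ennreal (exp (\<Sum>k\<in>upper_pairs N. sh x k * w k - (sh x k)\<^sup>2 / 2)) * indicator A w) \<in> borel_measurable (M \<Otimes>\<^sub>M ?G)"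
      unfolding split_def
      by (rule borel_measurable_times_ennreal[OF measurable_compose[OF me measurable_ennreal]
            measurable_compose[OF measurable_snd borel_measurable_indicator[OF A]]])
  qed
  also have "\<dots> = (\<integral>\<^sup>+w. ennreal (part (unif a) w) * indicator A w \<partial>?G)"
  proof (rule nn_integral_cong)
    fix w assume w: "w \<in> space ?G"
    have "(\<integral>\<^sup>+x. ennreal (exp (\<Sum>k\<in>upper_pairs N. sh x k * w k - (sh x k)\<^sup>2 / 2)) * indicator A w \<partial>M)
        = (\<integral>\<^sup>+x. ennreal (exp (ener (unif a) w x)) * indicator A w \<partial>M)"
    proof (rule nn_integral_cong_AE, use AE_clip_all in eventually_elim)
      case (elim x)
      have "(\<Sum>k\<in>upper_pairs N. sh x k * w k - (sh x k)\<^sup>2 / 2) = ener (unif a) w x"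
        unfolding ener_def
      proof (intro sum.cong refl)
        fix k assume "k \<in> upper_pairs N"
        then obtain i j where "k = (i, j)" "i < N" "j < N" by (auto simp: upper_pairs_def)
        then show "sh x k * w k - (sh x k)\<^sup>2 / 2 = unif a k * w k * edge k x - (unif a k)\<^sup>2 * (edge k x)\<^sup>2 / 2"
          using elim by (simp add: sh_def power_mult_distrib mult_ac)
      qed
      then show ?case by simp
    qed
    also have "\<dots> = ennreal (part (unif a) w) * indicator A w"
      unfolding nn_integral_part
      by (rule nn_integral_multc[OF measurable_compose[OF measurable_compose[OF measurable_ener borel_measurable_exp] measurable_ennreal]])
    finally show "(\<integral>\<^sup>+x. ennreal (exp (\<Sum>k\<in>upper_pairs N. sh x k * w k - (sh x k)\<^sup>2 / 2)) * indicator A w \<partial>M)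
      = ennreal (part (unif a) w) * indicator A w" .
  qed
  also have "\<dots> = emeasure (density ?G (\<lambda>w. part (unif a) w)) A"
  proof (rule emeasure_density[symmetric, OF _ A])
    show "(\<lambda>w. ennreal (part (unif a) w)) \<in> borel_measurable ?G"
      by (rule measurable_compose[OF measurable_mix[OF borel_measurable_const] measurable_ennreal])
  qed
  finally show "emeasure (spiked_wigner P (a\<^sup>2) N) A = emeasure (density ?G (\<lambda>w. part (unif a) w)) A" .
qed

lemma part_unif_0: "part (unif 0) w = 1"
proof -
  interpret M: prob_space M by (rule prob_space_M)
  show ?thesis by (simp add: mix_def ener_def unif_def M.prob_space)
qed

lemma D_KL_eq:
  assumes a: "0 \<le> a"
  shows "D_KL (spiked_wigner P (a\<^sup>2) N) (spiked_wigner P 0 N) = entropy_rel a"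
proof -
  interpret G: prob_space "gauss (upper_pairs N)" by (rule prob_space_gauss)
  have "spiked_wigner P 0 N = gauss (upper_pairs N)"
    using spiked_wigner_density[of 0] by (simp add: part_unif_0 density_1)
  then have "D_KL (spiked_wigner P (a\<^sup>2) N) (spiked_wigner P 0 N)
    = (\<integral>w. part (unif a) w * log (exp 1) (part (unif a) w) \<partial>gauss (upper_pairs N))"
    unfolding D_KL_def spiked_wigner_density[OF a]
    by (simp only:) (rule G.KL_density; auto intro!: AE_I2 less_imp_le part_pos)
  then show ?thesis by (simp add: entropy_rel_def log_def)
qed

lemma entropy_rel_0: "entropy_rel 0 = 0"
  by (simp add: entropy_rel_def part_unif_0)

text \<open>In terms of the normalised overlap, \<open>q2 = N E\<langle>R\<^sup>2\<rangle>\<close> and \<open>q4 = N E\<langle>R\<^sup>4\<rangle>\<close>.\<close>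
definition al :: "real \<Rightarrow> real" where "al a = (\<Sum>v<N. link a v) / N"
definition q2 :: "real \<Rightarrow> real" where "q2 a = moment (unif a) 2 / N"
definition q4 :: "real \<Rightarrow> real" where "q4 a = moment (unif a) 4 / real N ^ 3"

section \<open>The inequalities in normalised form\<close>

lemma moment_nonneg: "0 \<le> moment c n"
  unfolding moment_def by (intro sum_nonneg avg_nonneg) auto

lemma q_nonneg: "0 \<le> q2 a" "0 \<le> q4 a" "0 \<le> al a"
  by (auto simp: q2_def q4_def al_def moment_nonneg intro!: divide_nonneg_nonneg sum_nonneg link_nonneg)

lemma q_mono: "0 \<le> a \<Longrightarrow> a \<le> b \<Longrightarrow> q2 a \<le> q2 b" "0 \<le> a \<Longrightarrow> a \<le> b \<Longrightarrow> q4 a \<le> q4 b"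
  unfolding q2_def q4_def by (intro divide_right_mono moment_unif_mono; simp)+

text \<open>Young's scale is taken proportional to \<open>N\<close>, the size of an unnormalised
  overlap of order one, so that \<open>d\<close> becomes the free parameter between
  \<open>q2\<close> and \<open>q4\<close>.\<close>

lemma E3_eq:
  fixes d :: real
  shows "N > 0 \<Longrightarrow> d > 0 \<Longrightarrow> E3 a (d * N) = (real N)\<^sup>2 * ((d * q2 a + q4 a / d) / 2)"
  by (simp add: E3_def q2_def q4_def field_simps power2_eq_square power3_eq_cube)

lemma E1_eq:
  fixes d :: real
  shows "N > 0 \<Longrightarrow> d > 0 \<Longrightarrow> E1 a (d * N) = N * ((d + q2 a / (d * N)) / 2)"
  by (simp add: E1_def q2_def field_simps power2_eq_square)

lemma al_le_q2:
  assumes N: "N > 0" shows "al a \<le> q2 a - 1"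
proof -
  have "(\<Sum>v<N. 1) \<le> (\<Sum>v<N. self a v)" by (intro sum_mono self_bounds(1)[of _ 1]) auto
  then have "(\<Sum>v<N. link a v) \<le> moment (unif a) 2 - N" unfolding sum_link by simp
  then show ?thesis using N unfolding al_def q2_def by (simp add: field_simps)
qed

lemma al_ge_q2:
  fixes d :: real
  assumes N: "N > 0" and d: "d > 0"
  shows "q2 a - 1 - 2 * a\<^sup>2 * B ^ 6 * (d + q2 a / (d * N)) \<le> al a"
proof -
  have "(\<Sum>v<N. self a v) \<le> (\<Sum>v<N. 1 + a\<^sup>2 / N * (4 * B ^ 6 * E1 a (d * N)))"
    using N d by (intro sum_mono self_bounds(2)) auto
  also have "\<dots> = N * (1 + 2 * a\<^sup>2 * B ^ 6 * (d + q2 a / (d * N)))"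
    using N unfolding E1_eq[OF N d] by simp
  finally have "moment (unif a) 2 - N * (1 + 2 * a\<^sup>2 * B ^ 6 * (d + q2 a / (d * N))) \<le> (\<Sum>v<N. link a v)"
    unfolding sum_link by simp
  then have "(moment (unif a) 2 - N * (1 + 2 * a\<^sup>2 * B ^ 6 * (d + q2 a / (d * N)))) / N \<le> al a"
    unfolding al_def by (intro divide_right_mono) auto
  then show ?thesis using N by (simp add: diff_divide_distrib q2_def)
qed

lemma al_upper:
  fixes d :: real
  assumes N: "N > 0" and d: "d > 0"
  shows "al a \<le> a\<^sup>2 * q2 a + 2 * a ^ 4 * B ^ 6 * (d * q2 a + q4 a / d)"
proof -
  let ?e = "(d * q2 a + q4 a / d) / 2"
  have "(\<Sum>v<N. link a v) \<le> (\<Sum>v<N. a\<^sup>2 / N * (moment (unif a) 2 + a\<^sup>2 / N * (4 * B ^ 6 * E3 a (d * N))))"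
  proof (rule sum_mono)
    fix v assume "v \<in> {..<N}"
    then have "link a v \<le> a\<^sup>2 / N * (hole a v + a\<^sup>2 / N * (4 * B ^ 6 * E3 a (d * N)))"
      using N d by (intro link_upper) auto
    also have "\<dots> \<le> a\<^sup>2 / N * (moment (unif a) 2 + a\<^sup>2 / N * (4 * B ^ 6 * E3 a (d * N)))"
      using \<open>v \<in> {..<N}\<close> by (intro mult_left_mono add_right_mono hole_le) auto
    finally show "link a v \<le> a\<^sup>2 / N * (moment (unif a) 2 + a\<^sup>2 / N * (4 * B ^ 6 * E3 a (d * N)))" .
  qed
  also have "\<dots> = a\<^sup>2 * (moment (unif a) 2 + a\<^sup>2 * (4 * B ^ 6 * (N * ?e)))"
    using N unfolding E3_eq[OF N d] by (simp add: power2_eq_square)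
  also have "\<dots> = (a\<^sup>2 * q2 a + 2 * a ^ 4 * B ^ 6 * (d * q2 a + q4 a / d)) * N"
    using N by (simp add: q2_def algebra_simps power2_eq_square power4_eq_xxxx)
  finally show ?thesis unfolding al_def using N by (subst pos_divide_le_eq) auto
qed

text \<open>The term \<open>2 / N\<close> stems from the row and column deleted in
  \<open>hole\<close>; \<open>h\<close> is the centering parameter of \<open>link_lower\<close>,
  rescaled by \<open>N\<close>.\<close>

lemma al_lower:
  fixes d h :: real
  assumes N: "N > 0" and d: "d > 0" and h: "h > 0"
  shows "a\<^sup>2 * q2 a - a\<^sup>2 * (2 / N + h) * al a - a\<^sup>2 * B ^ 4 / N
    - (2 * a ^ 4 * B ^ 6 + a\<^sup>2 * B ^ 6 / (2 * h)) * (d * q2 a + q4 a / d) \<le> al a"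
proof -
  let ?e = "(d * q2 a + q4 a / d) / 2"
  let ?m = "moment (unif a) 2"
  let ?X = "?m - B ^ 4 - a\<^sup>2 * (4 * B ^ 6 * (N * ?e)) - B ^ 6 / h * (N * ?e)"
  have "(\<Sum>v<N. a\<^sup>2 / N * (?X - (2 + h * N) * link a v)) \<le> (\<Sum>v<N. link a v)"
  proof (rule sum_mono)
    fix v assume "v \<in> {..<N}"
    then have v: "v < N" by simp
    have dN: "d * N > 0" "h * N > 0" using N d h by auto
    have e1: "a\<^sup>2 / N * (4 * B ^ 6 * E3 a (d * N)) = a\<^sup>2 * (4 * B ^ 6 * (N * ?e))"
      using N unfolding E3_eq[OF N d] by (simp add: power2_eq_square)
    have e2: "B ^ 6 / (h * N) * E3 a (d * N) = B ^ 6 / h * (N * ?e)"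
      using N h unfolding E3_eq[OF N d] by (simp add: power2_eq_square)
    have "?X - (2 + h * N) * link a v \<le> hole a v - (h * N) * link a v - B ^ 6 / (h * N) * E3 a (d * N)"
      using hole_lower[OF v dN(1), of a] unfolding e1 e2 by (simp add: distrib_right)
    then have "a\<^sup>2 / N * (?X - (2 + h * N) * link a v)
        \<le> a\<^sup>2 / N * (hole a v - (h * N) * link a v - B ^ 6 / (h * N) * E3 a (d * N))"
      by (intro mult_left_mono) auto
    also have "\<dots> \<le> link a v" by (rule link_lower[OF v dN])
    finally show "a\<^sup>2 / N * (?X - (2 + h * N) * link a v) \<le> link a v" .
  qed
  also have "(\<Sum>v<N. a\<^sup>2 / N * (?X - (2 + h * N) * link a v)) = a\<^sup>2 / N * (N * ?X - (2 + h * N) * (\<Sum>v<N. link a v))"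
  proof -
    have "(\<Sum>v<N. A * (X - C * link a v)) = A * (N * X - C * (\<Sum>v<N. link a v))" for A X C :: real
      by (simp add: sum_distrib_left[symmetric] sum_subtractf)
    then show ?thesis .
  qed
  finally have "a\<^sup>2 / N * (N * ?X - (2 + h * N) * (\<Sum>v<N. link a v)) / N \<le> al a"
    unfolding al_def by (intro divide_right_mono) auto
  moreover have "a\<^sup>2 / N * (N * ?X - (2 + h * N) * (\<Sum>v<N. link a v)) / N
    = a\<^sup>2 * (?X / N) - a\<^sup>2 * (2 / N + h) * al a"
    using N by (simp add: al_def field_simps)
  moreover have "?X / N = q2 a - B ^ 4 / N - a\<^sup>2 * (4 * B ^ 6 * ?e) - B ^ 6 / h * ?e"
    using N h unfolding q2_def by (simp add: diff_divide_distrib)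
  ultimately have "a\<^sup>2 * (q2 a - B ^ 4 / N - a\<^sup>2 * (4 * B ^ 6 * ?e) - B ^ 6 / h * ?e) - a\<^sup>2 * (2 / N + h) * al a \<le> al a"
    by (simp only:)
  moreover have "a\<^sup>2 * (q2 a - B ^ 4 / N - a\<^sup>2 * (4 * B ^ 6 * ?e) - B ^ 6 / h * ?e)
    = a\<^sup>2 * q2 a - a\<^sup>2 * B ^ 4 / N - (2 * a ^ 4 * B ^ 6 + a\<^sup>2 * B ^ 6 / (2 * h)) * (d * q2 a + q4 a / d)"
  proof -
    have "A * (q - b / n - A * (4 * c * (z / 2)) - c / h * (z / 2)) = A * q - A * b / n - (2 * A\<^sup>2 * c + A * c / (2 * h)) * z"
      for A q b n c z :: real
      using h by (simp add: algebra_simps power2_eq_square add_divide_distrib)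
    moreover have "a ^ 4 = (a\<^sup>2)\<^sup>2" by simp
    ultimately show ?thesis by presburger
  qed
  ultimately show ?thesis by linarith
qed

lemma entropy_rel_derivative_al:
  "0 \<le> t \<Longrightarrow> (entropy_rel has_real_derivative t / 2 * al t) (at t)"
  using entropy_rel_derivative by (simp add: al_def)

text \<open>\<open>c\<close> is the depth of the replica-symmetric potential: for overlaps of size
  at least \<open>e\<close> the bound on \<open>psi\<close> with \<open>l\<close> strictly above
  \<open>a\<^sup>2\<close> leaves at most \<open>- c\<close>. The sum over the net is then
  exponentially small in \<open>N\<close>.\<close>

lemma q4_deviation:
  assumes N: "N > 0" and a: "0 \<le> a" and fin: "finite G" and e: "0 < e"
    and cover: "\<And>r. e < \<bar>r\<bar> \<Longrightarrow> \<bar>r\<bar> \<le> B\<^sup>2 \<Longrightarrow> \<exists>m\<in>G. \<bar>r - m\<bar> \<le> h"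
    and G: "\<And>m. m \<in> G \<Longrightarrow> e \<le> \<bar>m\<bar>"
    and psi: "\<And>r. 0 \<le> r \<Longrightarrow> psi P r \<le> r\<^sup>2 / (4 * l)" and l: "a\<^sup>2 < l"
    and s: "\<And>m. m \<in> G \<Longrightarrow> 0 < s m \<and> s m < 1 \<and>
      (\<integral>y. site_gen (if 0 \<le> m then 1 else -1) (a\<^sup>2 * \<bar>m\<bar>) (s m) y \<partial>P) \<le> exp (s m * (psi P (a\<^sup>2 * \<bar>m\<bar>) + c / 4))"
    and c: "c = a\<^sup>2 * e\<^sup>2 / 4 * (1 - a\<^sup>2 / l)" and h: "a\<^sup>2 * h\<^sup>2 / 2 \<le> c / 4"
  shows "q4 a \<le> e\<^sup>2 * q2 a + B ^ 8 * (\<Sum>m\<in>G. N * exp (- (c / 4)) ^ N + exp (s m * (a\<^sup>2 * B ^ 4 / 4)) * (N * exp (- (s m * c / 4)) ^ N))"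
proof -
  have l0: "l > 0" using l zero_le_power2[of a] by linarith
  have term_le: "avg (unif a) (pair_near m h (unif a)) \<le> exp (- (c / 4)) ^ N + exp (s m * (a\<^sup>2 * B ^ 4 / 4)) * exp (- (s m * c / 4)) ^ N"
    if m: "m \<in> G" for m
  proof -
    let ?g = "\<integral>y. site_gen (if 0 \<le> m then 1 else -1) (a\<^sup>2 * \<bar>m\<bar>) (s m) y \<partial>P"
    note sm = s[OF m]
    have g0: "0 \<le> ?g" using sm by (intro integral_nonneg_AE AE_I2 site_gen_bound) auto
    have cm: "c \<le> a\<^sup>2 * m\<^sup>2 / 4 * (1 - a\<^sup>2 / l)"
    proof -
      have "e\<^sup>2 \<le> m\<^sup>2" using G[OF m] e by (simp add: abs_le_square_iff[symmetric])
      moreover have "0 \<le> 1 - a\<^sup>2 / l" using l l0 by simp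
      ultimately show ?thesis unfolding c by (intro mult_right_mono divide_right_mono mult_left_mono) auto
    qed
    have "psi P (a\<^sup>2 * \<bar>m\<bar>) \<le> (a\<^sup>2 * \<bar>m\<bar>)\<^sup>2 / (4 * l)" by (rule psi) simp
    also have "\<dots> = a\<^sup>2 * m\<^sup>2 / 4 * (a\<^sup>2 / l)" by (simp add: power_mult_distrib power2_eq_square)
    finally have ps: "psi P (a\<^sup>2 * \<bar>m\<bar>) \<le> a\<^sup>2 * m\<^sup>2 / 4 - c" using cm by (simp add: right_diff_distrib)
    \<comment> \<open>The depth \<open>c\<close> is spent in quarters: one on the cut-off
      \<open>b = c / 4 * N\<close>, one on the small-moment error, one on the mesh \<open>h\<close>,
      and the last is the surviving rate.\<close>
    let ?E = "c / 4 * N + a\<^sup>2 * N * (h\<^sup>2 - m\<^sup>2) / 2 + (a\<^sup>2 * N * m\<^sup>2 / 2 + a\<^sup>2 * B ^ 4 / 2) / 2"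
    have "?E + N * (psi P (a\<^sup>2 * \<bar>m\<bar>) + c / 4) = N * (c / 2 + a\<^sup>2 * h\<^sup>2 / 2 - a\<^sup>2 * m\<^sup>2 / 4 + psi P (a\<^sup>2 * \<bar>m\<bar>)) + a\<^sup>2 * B ^ 4 / 4"
      by (simp add: field_simps)
    also have "\<dots> \<le> N * (- (c / 4)) + a\<^sup>2 * B ^ 4 / 4"
      using ps h by (intro add_right_mono mult_left_mono) auto
    finally have "s m * (?E + N * (psi P (a\<^sup>2 * \<bar>m\<bar>) + c / 4)) \<le> s m * (N * (- (c / 4)) + a\<^sup>2 * B ^ 4 / 4)"
      using sm by (intro mult_left_mono) auto
    then have ee: "exp (s m * (?E + N * (psi P (a\<^sup>2 * \<bar>m\<bar>) + c / 4))) \<le> exp (s m * (N * (- (c / 4)) + a\<^sup>2 * B ^ 4 / 4))"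
      by simp
    have "avg (unif a) (pair_near m h (unif a)) \<le> exp (- (c / 4 * N)) + exp (s m * ?E) * ?g ^ N"
      using avg_pair_near_le[OF N a, of "s m" m h "c / 4 * N"] sm by simp
    also have "?g ^ N \<le> exp (s m * (psi P (a\<^sup>2 * \<bar>m\<bar>) + c / 4)) ^ N" using sm g0 by (intro power_mono) auto
    also have "exp (s m * (psi P (a\<^sup>2 * \<bar>m\<bar>) + c / 4)) ^ N = exp (s m * (N * (psi P (a\<^sup>2 * \<bar>m\<bar>) + c / 4)))"
      by (simp add: exp_of_nat_mult[symmetric] mult_ac)
    also have "exp (s m * ?E) * \<dots> = exp (s m * (?E + N * (psi P (a\<^sup>2 * \<bar>m\<bar>) + c / 4)))"
      by (simp only: exp_add[symmetric] distrib_left)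
    also note ee
    also have "exp (s m * (N * (- (c / 4)) + a\<^sup>2 * B ^ 4 / 4)) = exp (s m * (a\<^sup>2 * B ^ 4 / 4)) * exp (- (s m * c / 4)) ^ N"
      unfolding exp_of_nat_mult[symmetric] exp_add[symmetric] by (simp add: algebra_simps)
    also have "exp (- (c / 4 * N)) = exp (- (c / 4)) ^ N"
      unfolding exp_of_nat_mult[symmetric] by (simp add: mult.commute)
    finally show ?thesis by simp
  qed
  have "moment (unif a) 4 \<le> (e * N)\<^sup>2 * moment (unif a) 2 + (B\<^sup>2 * N) ^ 4 * (\<Sum>m\<in>G. avg (unif a) (pair_near m h (unif a)))"
    using e by (intro moment_4_le fin cover) auto
  also have "\<dots> \<le> (e * N)\<^sup>2 * moment (unif a) 2 + (B\<^sup>2 * N) ^ 4 * (\<Sum>m\<in>G. exp (- (c / 4)) ^ N + exp (s m * (a\<^sup>2 * B ^ 4 / 4)) * exp (- (s m * c / 4)) ^ N)"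
    by (intro add_left_mono mult_left_mono sum_mono term_le) auto
  finally have "q4 a \<le> ((e * N)\<^sup>2 * moment (unif a) 2 + (B\<^sup>2 * N) ^ 4 * (\<Sum>m\<in>G. exp (- (c / 4)) ^ N + exp (s m * (a\<^sup>2 * B ^ 4 / 4)) * exp (- (s m * c / 4)) ^ N)) / real N ^ 3"
    unfolding q4_def by (intro divide_right_mono) auto
  also have "\<dots> = e\<^sup>2 * q2 a + B ^ 8 * (N * (\<Sum>m\<in>G. exp (- (c / 4)) ^ N + exp (s m * (a\<^sup>2 * B ^ 4 / 4)) * exp (- (s m * c / 4)) ^ N))"
    using N by (simp add: q2_def field_simps power_mult_distrib power2_eq_square eval_nat_numeral)
  also have "N * (\<Sum>m\<in>G. exp (- (c / 4)) ^ N + exp (s m * (a\<^sup>2 * B ^ 4 / 4)) * exp (- (s m * c / 4)) ^ N)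
    = (\<Sum>m\<in>G. N * exp (- (c / 4)) ^ N + exp (s m * (a\<^sup>2 * B ^ 4 / 4)) * (N * exp (- (s m * c / 4)) ^ N))"
    by (simp add: sum_distrib_left distrib_left mult_ac)
  finally show ?thesis .
qed

end

section \<open>Asymptotics\<close>

text \<open>Only these inequalities between real functions enter the limit, so it is taken without
  reference to the measures behind them.\<close>

locale cavity_estimates =
  fixes al q2 q4 :: "nat \<Rightarrow> real \<Rightarrow> real" and B :: real
  assumes B_ge_1: "1 \<le> B"
    and nonneg: "0 \<le> q2 N a" "0 \<le> q4 N a" "0 \<le> al N a"
    and q2_mono: "0 \<le> a \<Longrightarrow> a \<le> b \<Longrightarrow> q2 N a \<le> q2 N b"
    and q4_mono: "0 \<le> a \<Longrightarrow> a \<le> b \<Longrightarrow> q4 N a \<le> q4 N b"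
    and al_le_q2: "0 < N \<Longrightarrow> al N a \<le> q2 N a - 1"
    and al_ge_q2: "0 < N \<Longrightarrow> 0 < d \<Longrightarrow> q2 N a - 1 - 2 * a\<^sup>2 * B ^ 6 * (d + q2 N a / (d * N)) \<le> al N a"
    and al_upper: "0 < N \<Longrightarrow> 0 < d \<Longrightarrow> al N a \<le> a\<^sup>2 * q2 N a + 2 * a ^ 4 * B ^ 6 * (d * q2 N a + q4 N a / d)"
    and al_lower: "0 < N \<Longrightarrow> 0 < d \<Longrightarrow> 0 < h \<Longrightarrow>
      a\<^sup>2 * q2 N a - a\<^sup>2 * (2 / N + h) * al N a - a\<^sup>2 * B ^ 4 / N
        - (2 * a ^ 4 * B ^ 6 + a\<^sup>2 * B ^ 6 / (2 * h)) * (d * q2 N a + q4 N a / d) \<le> al N a"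
begin

text \<open>The only global input; below the threshold it follows from the replica-symmetric bound.\<close>
definition no_overlap :: "real \<Rightarrow> bool" where
  "no_overlap a \<longleftrightarrow> (\<forall>e>0. \<exists>t. t \<longlonglongrightarrow> 0 \<and> (\<forall>N>0. q4 N a \<le> e\<^sup>2 * q2 N a + t N))"

lemma q2_ge_1: "0 < N \<Longrightarrow> 1 \<le> q2 N a"
  using al_le_q2[of N a] nonneg(3)[of N a] by linarith

lemma q4_div_le:
  assumes "q4 N a \<le> e\<^sup>2 * q2 N a + t" "e > 0"
  shows "e * q2 N a + q4 N a / e \<le> 2 * e * q2 N a + \<bar>t\<bar> / e"
proof -
  have "q4 N a / e \<le> (e\<^sup>2 * q2 N a + \<bar>t\<bar>) / e" using assms by (intro divide_right_mono) auto
  also have "\<dots> = e * q2 N a + \<bar>t\<bar> / e" using assms(2) by (simp add: add_divide_distrib power2_eq_square)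
  finally show ?thesis by simp
qed

text \<open>As \<open>q2\<close> is at least 1, every error is a small multiple of
  \<open>q2\<close>, and dividing by \<open>q2\<close> requires no prior bound on it. If
  \<open>a\<^sup>2\<close> exceeded 1, \<open>al\<close> would exceed \<open>q2\<close>.\<close>

lemma subcritical:
  assumes dev: "no_overlap a" shows "a\<^sup>2 \<le> 1"
proof (rule ccontr)
  assume "\<not> a\<^sup>2 \<le> 1"
  define D where "D = a\<^sup>2 - 1"
  have D: "D > 0" "a\<^sup>2 > 0" using \<open>\<not> a\<^sup>2 \<le> 1\<close> by (auto simp: D_def)
  \<comment> \<open>A quarter of the excess \<open>D\<close> is allotted to the term with
    \<open>h\<close> and a quarter to the one with \<open>C\<close>; the other errors vanish in the
    limit.\<close>
  define h where "h = D / (4 * a\<^sup>2)"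
  have h: "h > 0" "a\<^sup>2 * h = D / 4" using D by (auto simp: h_def)
  define C where "C = 2 * a ^ 4 * B ^ 6 + a\<^sup>2 * B ^ 6 / (2 * h)"
  have C: "C \<ge> 0" using h B_ge_1 by (simp add: C_def)
  define e where "e = D / (8 * (C + 1))"
  have e: "e > 0" using D C by (simp add: e_def)
  have Ce: "C * (2 * e) \<le> D / 4" using D C by (simp add: e_def field_simps)
  obtain t where t: "t \<longlonglongrightarrow> 0" "\<And>N. N > 0 \<Longrightarrow> q4 N a \<le> e\<^sup>2 * q2 N a + t N"
    using dev e unfolding no_overlap_def by blast
  have bound: "a\<^sup>2 \<le> 1 + a\<^sup>2 * (2 / N + h) + a\<^sup>2 * B ^ 4 / N + C * (2 * e + \<bar>t N\<bar> / e)" if N: "N > 0" for N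
  proof -
    let ?q = "q2 N a"
    have q: "1 \<le> ?q" by (rule q2_ge_1[OF N])
    have c: "0 \<le> a\<^sup>2 * (2 / N + h)" "0 \<le> a\<^sup>2 * B ^ 4 / N" "0 \<le> C * (\<bar>t N\<bar> / e)"
      using h e C B_ge_1 by auto
    have "a\<^sup>2 * ?q - a\<^sup>2 * (2 / N + h) * al N a - a\<^sup>2 * B ^ 4 / N - C * (e * ?q + q4 N a / e) \<le> al N a"
      unfolding C_def by (rule al_lower[OF N e h(1)])
    moreover have "C * (e * ?q + q4 N a / e) \<le> C * (2 * e * ?q + \<bar>t N\<bar> / e)"
      using q4_div_le[OF t(2)[OF N] e] C by (rule mult_left_mono)
    moreover have "al N a \<le> ?q" using al_le_q2[OF N, of a] by linarith
    moreover have "a\<^sup>2 * (2 / N + h) * al N a \<le> a\<^sup>2 * (2 / N + h) * ?q"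
      using \<open>al N a \<le> ?q\<close> c(1) by (rule mult_left_mono)
    moreover have "a\<^sup>2 * B ^ 4 / N \<le> a\<^sup>2 * B ^ 4 / N * ?q" "C * (\<bar>t N\<bar> / e) \<le> C * (\<bar>t N\<bar> / e) * ?q"
      using mult_left_mono[OF q c(2)] mult_left_mono[OF q c(3)] by auto
    moreover have "C * (2 * e * ?q + \<bar>t N\<bar> / e) = C * (2 * e) * ?q + C * (\<bar>t N\<bar> / e)"
      by (simp add: distrib_left mult.assoc)
    ultimately have "a\<^sup>2 * ?q \<le> ?q + a\<^sup>2 * (2 / N + h) * ?q + a\<^sup>2 * B ^ 4 / N * ?q + C * (2 * e) * ?q + C * (\<bar>t N\<bar> / e) * ?q"
      by linarith
    then have "a\<^sup>2 * ?q \<le> (1 + a\<^sup>2 * (2 / N + h) + a\<^sup>2 * B ^ 4 / N + C * (2 * e + \<bar>t N\<bar> / e)) * ?q"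
      by (simp add: distrib_left distrib_right)
    then show ?thesis using q by (simp add: mult_le_cancel_right)
  qed
  have "(\<lambda>N. 1 + a\<^sup>2 * (2 / real N + h) + a\<^sup>2 * B ^ 4 / real N + C * (2 * e + \<bar>t N\<bar> / e))
      \<longlonglongrightarrow> 1 + a\<^sup>2 * (0 + h) + 0 + C * (2 * e + \<bar>0\<bar> / e)"
    using e by (intro tendsto_intros lim_const_over_n t(1)) auto
  then have "a\<^sup>2 \<le> 1 + a\<^sup>2 * (0 + h) + 0 + C * (2 * e + \<bar>0\<bar> / e)"
    by (rule LIMSEQ_le_const) (use bound in \<open>auto intro!: exI[of _ 1]\<close>)
  then have "a\<^sup>2 \<le> 1 + D / 4 + C * (2 * e)" using h(2) by simp
  moreover have "a\<^sup>2 = 1 + D" by (simp add: D_def)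
  ultimately have "D \<le> D / 2" using Ce by linarith
  then show False using D(1) by simp
qed

text \<open>Eliminating \<open>al\<close> between its upper and lower bounds leaves
  \<open>(1 - a\<^sup>2) * q2\<close> below a constant plus a small multiple of \<open>q2\<close>,
  which is absorbed on the left.\<close>

lemma q2_bounded:
  assumes dev: "no_overlap a" and a: "a\<^sup>2 < 1"
  shows "\<exists>Q\<ge>1. \<exists>N0>0. \<forall>N\<ge>N0. q2 N a \<le> Q"
proof -
  define D where "D = 1 - a\<^sup>2"
  have D: "D > 0" using a by (simp add: D_def)
  have B6: "B ^ 6 \<ge> 1" using B_ge_1 by simp
  \<comment> \<open>Makes \<open>2 * B ^ 6 * (2 * e * q2)\<close> a quarter of
    \<open>D * q2\<close>; another quarter is absorbed by taking \<open>N\<close> large.\<close>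
  define e where "e = D / (16 * B ^ 6)"
  have "B ^ 6 > 0" using B6 by linarith
  then have e: "e > 0" using D by (simp add: e_def)
  obtain t where t: "t \<longlonglongrightarrow> 0" "\<And>N. N > 0 \<Longrightarrow> q4 N a \<le> e\<^sup>2 * q2 N a + t N"
    using dev e unfolding no_overlap_def by blast
  have "\<forall>\<^sub>F N in sequentially. \<bar>t N\<bar> < 1"
    using tendstoD[OF t(1), of 1] by simp
  moreover have "\<forall>\<^sub>F N in sequentially. 8 * B ^ 6 / (e * D) \<le> real N"
    by (rule eventually_sequentiallyI[of "nat \<lceil>8 * B ^ 6 / (e * D)\<rceil>"]) linarith
  ultimately have "\<forall>\<^sub>F N in sequentially. \<bar>t N\<bar> < 1 \<and> 8 * B ^ 6 / (e * D) \<le> real N" by eventually_elim simp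
  then obtain N1 where N1: "\<And>N. N \<ge> N1 \<Longrightarrow> \<bar>t N\<bar> < 1 \<and> 8 * B ^ 6 / (e * D) \<le> real N"
    by (auto simp: eventually_sequentially)
  define R where "R = 1 + 2 * B ^ 6 * e + 2 * B ^ 6 / e"
  have "q2 N a \<le> 2 * R / D" if N: "N \<ge> Suc N1" for N
  proof -
    have N0: "N > 0" using N by simp
    let ?q = "q2 N a"
    have q: "1 \<le> ?q" by (rule q2_ge_1[OF N0])
    have a4: "a ^ 4 \<le> 1" "0 \<le> a ^ 4" using a power_le_one[of "a\<^sup>2" 2] by auto
    have tN: "\<bar>t N\<bar> / e \<le> 1 / e" using N1[of N] N e by (intro divide_right_mono) auto
    have "2 * a ^ 4 * B ^ 6 * (e * ?q + q4 N a / e) \<le> 2 * 1 * B ^ 6 * (2 * e * ?q + 1 / e)"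
      using a4 B6 q4_div_le[OF t(2)[OF N0] e] tN nonneg e
      by (intro mult_mono mult_left_mono mult_right_mono) auto
    then have up: "al N a \<le> a\<^sup>2 * ?q + 2 * B ^ 6 * (2 * e * ?q + 1 / e)" using al_upper[OF N0 e, of a] by linarith
    have "2 * a\<^sup>2 * B ^ 6 * (e + ?q / (e * N)) \<le> 2 * 1 * B ^ 6 * (e + ?q / (e * N))"
      using a B6 q e by (intro mult_right_mono mult_left_mono) auto
    then have "?q - 1 - 2 * B ^ 6 * (e + ?q / (e * N)) \<le> al N a" using al_ge_q2[OF N0 e, of a] by linarith
    with up have 1: "D * ?q \<le> 1 + 2 * B ^ 6 * (e + ?q / (e * N)) + 2 * B ^ 6 * (2 * e * ?q + 1 / e)"
      by (simp add: D_def left_diff_distrib)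
    have 2: "2 * B ^ 6 * (2 * e * ?q) = D / 4 * ?q" using B6 B_ge_1 by (simp add: e_def)
    have "2 * B ^ 6 / (e * N) \<le> D / 4"
      using N1[of N] N N0 e D by (simp add: field_simps)
    then have 3: "2 * B ^ 6 / (e * N) * ?q \<le> D / 4 * ?q" using q by (intro mult_right_mono) auto
    have "2 * B ^ 6 * (e + ?q / (e * N)) = 2 * B ^ 6 * e + 2 * B ^ 6 / (e * N) * ?q"
      "2 * B ^ 6 * (2 * e * ?q + 1 / e) = 2 * B ^ 6 * (2 * e * ?q) + 2 * B ^ 6 / e"
      by (simp_all add: distrib_left)
    with 1 2 3 have "D * ?q \<le> R + D / 2 * ?q" unfolding R_def by linarith
    then have "D * ?q \<le> 2 * R" by simp
    then show ?thesis using D by (simp add: field_simps)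
  qed
  then show ?thesis
    by (intro exI[of _ "max 1 (2 * R / D)"] conjI exI[of _ "Suc N1"]) (auto simp: le_max_iff_disj)
qed

lemma q4_tendsto_0:
  assumes dev: "no_overlap a" and Q: "1 \<le> Q" and N0: "\<And>N. N0 \<le> N \<Longrightarrow> q2 N a \<le> Q"
  shows "(\<lambda>N. q4 N a) \<longlonglongrightarrow> 0"
proof (rule LIMSEQ_I)
  fix r :: real assume r: "0 < r"
  define e where "e = sqrt (r / (2 * Q))"
  have e: "e > 0" "e\<^sup>2 * Q = r / 2" using r Q by (auto simp: e_def)
  obtain t where t: "t \<longlonglongrightarrow> 0" "\<And>N. N > 0 \<Longrightarrow> q4 N a \<le> e\<^sup>2 * q2 N a + t N"
    using dev e(1) unfolding no_overlap_def by blast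
  obtain N1 where N1: "\<And>N. N \<ge> N1 \<Longrightarrow> \<bar>t N\<bar> < r / 2"
    using LIMSEQ_D[OF t(1), of "r / 2"] r by auto
  show "\<exists>no. \<forall>n\<ge>no. norm (q4 n a - 0) < r"
  proof (intro exI allI impI)
    fix N assume N: "N \<ge> Suc (max N0 N1)"
    then have "q4 N a \<le> e\<^sup>2 * q2 N a + t N" by (intro t(2)) auto
    also have "e\<^sup>2 * q2 N a \<le> e\<^sup>2 * Q" using N by (intro mult_left_mono N0) auto
    finally have "q4 N a \<le> r / 2 + t N" using e(2) by simp
    moreover have "\<bar>t N\<bar> < r / 2" using N1[of N] N by simp
    ultimately have "q4 N a < r" by linarith
    then show "norm (q4 N a - 0) < r" using nonneg(2)[of N a] by simp
  qed
qed

text \<open>The two relations form a linear system for \<open>al\<close> and \<open>q2\<close> with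
  solution b^2/(1 - b^2) and 1/(1 - b^2). Monotonicity of \<open>q2\<close> and \<open>q4\<close>
  makes the errors at \<open>a\<close> valid for all smaller \<open>b\<close>.\<close>

lemma al_uniform:
  assumes dev: "no_overlap a" and a: "0 \<le> a" "a\<^sup>2 < 1"
  shows "\<exists>err N0. err \<longlonglongrightarrow> 0 \<and> (\<forall>N\<ge>N0. \<forall>b. 0 \<le> b \<longrightarrow> b \<le> a \<longrightarrow> \<bar>al N b - b\<^sup>2 / (1 - b\<^sup>2)\<bar> \<le> err N)"
proof -
  obtain Q N0 where Q: "1 \<le> Q" "N0 > 0" "\<And>N. N0 \<le> N \<Longrightarrow> q2 N a \<le> Q"
    using q2_bounded[OF dev a(2)] by blast
  have x: "(\<lambda>N. q4 N a) \<longlonglongrightarrow> 0" by (rule q4_tendsto_0[OF dev Q(1,3)])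
  define D where "D = 1 - a\<^sup>2"
  have D: "D > 0" using a(2) by (simp add: D_def)
  \<comment> \<open>\<open>u\<close> serves as the parameter \<open>d\<close> and its square root
    \<open>g\<close> as \<open>h\<close>. Then \<open>q4 / u\<close> and \<open>1 / (u * N)\<close>
    are at most \<open>u\<close>, and \<open>u / g\<close> equals \<open>g\<close>, so all errors
    tend to 0; the added \<open>1 / N\<close> also keeps \<open>u\<close> positive.\<close>
  define u where "u N = sqrt (q4 N a + 1 / real N)" for N
  define g where "g N = sqrt (u N)" for N
  have u0: "u \<longlonglongrightarrow> 0"
    unfolding u_def[abs_def] using tendsto_real_sqrt[OF tendsto_add[OF x lim_const_over_n[of 1]]] by simp
  have g0: "g \<longlonglongrightarrow> 0"
    unfolding g_def[abs_def] using tendsto_real_sqrt[OF u0] by simp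
  define e1 where "e1 N = 2 * B ^ 6 * (Q + 1) * u N" for N
  define e2 where "e2 N = (2 * (u N)\<^sup>2 + g N) * Q + B ^ 4 * (u N)\<^sup>2 + e1 N + B ^ 6 * (Q + 1) * g N / 2" for N
  define err where "err N = (e1 N + e2 N) * (1 + 2 / D)" for N
  have e1_0: "e1 \<longlonglongrightarrow> 0" unfolding e1_def[abs_def] using tendsto_mult_left[OF u0] by simp
  have "e2 \<longlonglongrightarrow> (2 * 0\<^sup>2 + 0) * Q + B ^ 4 * 0\<^sup>2 + 0 + B ^ 6 * (Q + 1) * 0 / 2"
    unfolding e2_def[abs_def] by (intro tendsto_intros u0 g0 e1_0) auto
  then have "err \<longlonglongrightarrow> (0 + 0) * (1 + 2 / D)"
    unfolding err_def[abs_def] by (intro tendsto_intros e1_0) simp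
  then have err0: "err \<longlonglongrightarrow> 0" by simp
  have "\<bar>al N b - b\<^sup>2 / (1 - b\<^sup>2)\<bar> \<le> err N" if N: "N \<ge> N0" and b: "0 \<le> b" "b \<le> a" for N b
  proof -
    have N1: "N > 0" using N Q(2) by simp
    let ?q = "q2 N b" and ?l = "b\<^sup>2" and ?u = "u N" and ?g = "g N"
    have l: "0 \<le> ?l" "?l \<le> 1" "D \<le> 1 - ?l"
      using power_mono[OF b(2,1), of 2] a(2) by (auto simp: D_def)
    have l4: "0 \<le> b ^ 4" "b ^ 4 \<le> 1" using power_le_one[OF l(1,2), of 2] by auto
    have y: "0 < q4 N a + 1 / real N" using nonneg(2)[of N a] N1 by (simp add: add_nonneg_pos)
    have up: "?u > 0" using y by (simp add: u_def)
    have gp: "?g > 0" "?g * ?g = ?u" using up by (auto simp: g_def)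
    have u2: "?u\<^sup>2 = q4 N a + 1 / real N" using y by (simp add: u_def)
    have x2: "q4 N b \<le> ?u\<^sup>2" "1 / real N \<le> ?u\<^sup>2"
    proof -
      have "0 \<le> 1 / real N" by simp
      then show "q4 N b \<le> ?u\<^sup>2" "1 / real N \<le> ?u\<^sup>2"
        using q4_mono[OF b, of N] nonneg(2)[of N a] unfolding u2 by linarith+
    qed
    have q: "1 \<le> ?q" "?q \<le> Q" using q2_ge_1[OF N1, of b] q2_mono[OF b, of N] Q(3)[OF N] by auto
    have B6: "1 \<le> B ^ 6" using B_ge_1 by simp
    have E: "?u * ?q + q4 N b / ?u \<le> (Q + 1) * ?u" "0 \<le> ?u * ?q + q4 N b / ?u"
    proof -
      have "q4 N b / ?u \<le> ?u\<^sup>2 / ?u" using x2 up by (intro divide_right_mono) auto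
      moreover have "?u * ?q \<le> ?u * Q" using q up by (intro mult_left_mono) auto
      moreover have "?u\<^sup>2 / ?u = ?u" "(Q + 1) * ?u = ?u * Q + ?u" using up by (auto simp: power2_eq_square algebra_simps)
      ultimately show "?u * ?q + q4 N b / ?u \<le> (Q + 1) * ?u" by linarith
      show "0 \<le> ?u * ?q + q4 N b / ?u" using up q nonneg(2)[of N b] by simp
    qed
    have A: "al N b \<le> ?l * ?q + e1 N"
    proof -
      have "2 * b ^ 4 * B ^ 6 * (?u * ?q + q4 N b / ?u) \<le> 2 * 1 * B ^ 6 * ((Q + 1) * ?u)"
        using E l4 B6 by (intro mult_mono mult_left_mono mult_right_mono) auto
      then show ?thesis using al_upper[OF N1 up, of b] by (simp add: e1_def mult_ac)
    qed
    have Bd: "?q - 1 - e1 N \<le> al N b"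
    proof -
      have "?q / (?u * N) = (?q / ?u) * (1 / N)" by simp
      also have "\<dots> \<le> (Q / ?u) * ?u\<^sup>2" using q up x2 by (intro mult_mono divide_right_mono) auto
      also have "\<dots> = Q * ?u" using up by (simp add: power2_eq_square)
      finally have "?u + ?q / (?u * N) \<le> (Q + 1) * ?u" by (simp add: algebra_simps)
      then have "2 * ?l * B ^ 6 * (?u + ?q / (?u * N)) \<le> 2 * 1 * B ^ 6 * ((Q + 1) * ?u)"
        using l B6 up q by (intro mult_mono mult_left_mono mult_right_mono) auto
      then show ?thesis using al_ge_q2[OF N1 up, of b] by (simp add: e1_def mult_ac)
    qed
    have C: "?l * ?q - e2 N \<le> al N b"
    proof -
      have alQ: "0 \<le> al N b" "al N b \<le> Q" using nonneg(3)[of N b] al_le_q2[OF N1, of b] q by auto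
      have 1: "?l * (2 / N + ?g) * al N b \<le> 1 * (2 * ?u\<^sup>2 + ?g) * Q"
        using l alQ x2 gp by (intro mult_mono) auto
      have 2: "?l * B ^ 4 / N \<le> B ^ 4 * ?u\<^sup>2"
      proof -
        have "?l * B ^ 4 / N = (?l * B ^ 4) * (1 / N)" by simp
        also have "\<dots> \<le> (1 * B ^ 4) * ?u\<^sup>2" using l x2 B_ge_1 by (intro mult_mono mult_right_mono) auto
        finally show ?thesis by simp
      qed
      have 3: "(2 * b ^ 4 * B ^ 6 + ?l * B ^ 6 / (2 * ?g)) * (?u * ?q + q4 N b / ?u) \<le> (2 * B ^ 6 + B ^ 6 / (2 * ?g)) * ((Q + 1) * ?u)"
      proof (rule mult_mono)
        have "2 * b ^ 4 * B ^ 6 \<le> 2 * 1 * B ^ 6" "?l * B ^ 6 / (2 * ?g) \<le> 1 * B ^ 6 / (2 * ?g)"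
          using l l4 B6 gp by (intro mult_right_mono mult_left_mono divide_right_mono; simp)+
        then show "2 * b ^ 4 * B ^ 6 + ?l * B ^ 6 / (2 * ?g) \<le> 2 * B ^ 6 + B ^ 6 / (2 * ?g)" by simp
      qed (use E B6 gp up Q in auto)
      have "B ^ 6 / (2 * ?g) * ((Q + 1) * ?u) = B ^ 6 / (2 * ?g) * ((Q + 1) * (?g * ?g))" by (simp only: gp(2))
      also have "\<dots> = B ^ 6 * (Q + 1) * ?g / 2" using gp(1) by simp
      finally have "B ^ 6 / (2 * ?g) * ((Q + 1) * ?u) = B ^ 6 * (Q + 1) * ?g / 2" .
      moreover have "2 * B ^ 6 * ((Q + 1) * ?u) = e1 N" by (simp add: e1_def mult.assoc)
      ultimately have "(2 * B ^ 6 + B ^ 6 / (2 * ?g)) * ((Q + 1) * ?u) = e1 N + B ^ 6 * (Q + 1) * ?g / 2"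
        by (simp only: distrib_right)
      then show ?thesis using al_lower[OF N1 up gp(1), of b] 1 2 3 by (simp add: e2_def)
    qed
    have e: "0 \<le> e1 N" "0 \<le> e2 N" using up gp Q(1) B_ge_1 by (auto simp: e1_def e2_def)
    have l1: "0 < 1 - ?l" using l D by linarith
    \<comment> \<open>Eliminating \<open>al\<close>: \<open>A\<close> with \<open>Bd\<close>, and
      \<open>C\<close> with \<open>al_le_q2\<close>, bound \<open>q2 * (1 - b\<^sup>2)\<close> from
      above and below.\<close>
    have T: "?l * ?q * (1 - ?l) \<le> ?l * (1 + 2 * e1 N)" "?l * (1 - e2 N) \<le> ?l * ?q * (1 - ?l)"
    proof -
      have "?q * (1 - ?l) \<le> 1 + 2 * e1 N" using A Bd by (simp add: algebra_simps)
      then show "?l * ?q * (1 - ?l) \<le> ?l * (1 + 2 * e1 N)" using l(1) mult_left_mono by (simp only: mult.assoc)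
      have "1 - e2 N \<le> ?q * (1 - ?l)" using C al_le_q2[OF N1, of b] by (simp add: algebra_simps)
      then show "?l * (1 - e2 N) \<le> ?l * ?q * (1 - ?l)" using l(1) mult_left_mono by (simp only: mult.assoc)
    qed
    have U: "?l * ?q \<le> ?l / (1 - ?l) + 2 * e1 N / D"
    proof -
      have "?l * ?q \<le> ?l * (1 + 2 * e1 N) / (1 - ?l)" using T(1) l1 by (simp add: le_divide_eq)
      also have "\<dots> = ?l / (1 - ?l) + ?l * (2 * e1 N) / (1 - ?l)" by (simp add: distrib_left add_divide_distrib)
      also have "?l * (2 * e1 N) / (1 - ?l) \<le> 1 * (2 * e1 N) / D"
        using l e D by (intro frac_le mult_right_mono) auto
      finally show ?thesis by simp
    qed
    have V: "?l / (1 - ?l) - e2 N / D \<le> ?l * ?q"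
    proof -
      have "?l * e2 N / (1 - ?l) \<le> 1 * e2 N / D" using l e D by (intro frac_le mult_right_mono) auto
      moreover have "?l * (1 - e2 N) / (1 - ?l) \<le> ?l * ?q" using T(2) l1 by (simp add: divide_le_eq)
      moreover have "?l * (1 - e2 N) / (1 - ?l) = ?l / (1 - ?l) - ?l * e2 N / (1 - ?l)"
        by (simp add: right_diff_distrib diff_divide_distrib)
      ultimately show ?thesis by simp
    qed
    have err: "err N = e1 N + e2 N + 2 * e1 N / D + 2 * e2 N / D" using D by (simp add: err_def field_simps)
    have p: "0 \<le> 2 * e1 N / D" "0 \<le> e2 N / D" "2 * e2 N / D = e2 N / D + e2 N / D" using e D by (auto simp: field_simps)
    show ?thesis unfolding err abs_le_iff using A C U V e p by linarith
  qed
  then show ?thesis using err0 by blast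
qed

lemma entropy_limit:
  fixes S :: "nat \<Rightarrow> real \<Rightarrow> real"
  assumes dev: "no_overlap a" and a: "0 \<le> a" "a\<^sup>2 < 1"
    and S0: "\<And>N. S N 0 = 0" and S: "\<And>N t. 0 \<le> t \<Longrightarrow> (S N has_real_derivative t / 2 * al N t) (at t)"
  shows "(\<lambda>N. S N a) \<longlonglongrightarrow> 1 / 4 * (- ln (1 - a\<^sup>2) - a\<^sup>2)"
proof -
  obtain err N0 where err: "err \<longlonglongrightarrow> 0"
    and E: "\<And>N b. N \<ge> N0 \<Longrightarrow> 0 \<le> b \<Longrightarrow> b \<le> a \<Longrightarrow> \<bar>al N b - b\<^sup>2 / (1 - b\<^sup>2)\<bar> \<le> err N"
    using al_uniform[OF dev a] by blast
  \<comment> \<open>The antiderivative of \<open>t / 2 * (t\<^sup>2 / (1 - t\<^sup>2))\<close> that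
    vanishes at 0; a uniform error \<open>k\<close> in \<open>al\<close> adds
    \<open>k * t\<^sup>2 / 4\<close>.\<close>
  define T where "T t = 1 / 4 * (- ln (1 - t\<^sup>2) - t\<^sup>2)" for t :: real
  have T: "((\<lambda>t. T t + k * t\<^sup>2 / 4) has_real_derivative t / 2 * (t\<^sup>2 / (1 - t\<^sup>2) + k)) (at t)"
    if t: "0 \<le> t" "t \<le> a" for t k
  proof -
    have "t\<^sup>2 < 1" using power_mono[OF t(2,1), of 2] a(2) by linarith
    then show ?thesis unfolding T_def
      by (auto intro!: derivative_eq_intros simp: field_simps power2_eq_square)
  qed
  have le: "S N a - S N 0 \<le> (T a + err N * a\<^sup>2 / 4) - (T 0 + err N * 0\<^sup>2 / 4)" if N: "N \<ge> N0" for N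
  proof (rule DERIV_le_diff[OF a(1)])
    fix t assume t: "0 \<le> t" "t \<le> a"
    show "(S N has_real_derivative t / 2 * al N t) (at t)" by (rule S[OF t(1)])
    show "((\<lambda>t. T t + err N * t\<^sup>2 / 4) has_real_derivative t / 2 * (t\<^sup>2 / (1 - t\<^sup>2) + err N)) (at t)" by (rule T[OF t])
    show "t / 2 * al N t \<le> t / 2 * (t\<^sup>2 / (1 - t\<^sup>2) + err N)"
      using E[OF N t] t by (intro mult_left_mono) auto
  qed
  have ge: "(T a + - err N * a\<^sup>2 / 4) - (T 0 + - err N * 0\<^sup>2 / 4) \<le> S N a - S N 0" if N: "N \<ge> N0" for N
  proof (rule DERIV_le_diff[OF a(1)])
    fix t assume t: "0 \<le> t" "t \<le> a"
    show "(S N has_real_derivative t / 2 * al N t) (at t)" by (rule S[OF t(1)])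
    show "((\<lambda>t. T t + - err N * t\<^sup>2 / 4) has_real_derivative t / 2 * (t\<^sup>2 / (1 - t\<^sup>2) + - err N)) (at t)" by (rule T[OF t])
    show "t / 2 * (t\<^sup>2 / (1 - t\<^sup>2) + - err N) \<le> t / 2 * al N t"
      using E[OF N t] t by (intro mult_left_mono) auto
  qed
  have T0: "T 0 = 0" by (simp add: T_def)
  have "(\<lambda>N. S N a) \<longlonglongrightarrow> T a"
  proof (rule tendsto_sandwich)
    show "\<forall>\<^sub>F N in sequentially. T a + - err N * a\<^sup>2 / 4 \<le> S N a"
      using ge S0 T0 by (intro eventually_sequentiallyI[of N0]) simp
    show "\<forall>\<^sub>F N in sequentially. S N a \<le> T a + err N * a\<^sup>2 / 4"
      using le S0 T0 by (intro eventually_sequentiallyI[of N0]) simp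
    have "(\<lambda>N. T a + - err N * a\<^sup>2 / 4) \<longlonglongrightarrow> T a + - 0 * a\<^sup>2 / 4" by (intro tendsto_intros err) auto
    then show "(\<lambda>N. T a + - err N * a\<^sup>2 / 4) \<longlonglongrightarrow> T a" by simp
    have "(\<lambda>N. T a + err N * a\<^sup>2 / 4) \<longlonglongrightarrow> T a + 0 * a\<^sup>2 / 4" by (intro tendsto_intros err) auto
    then show "(\<lambda>N. T a + err N * a\<^sup>2 / 4) \<longlonglongrightarrow> T a" by simp
  qed
  then show ?thesis by (simp add: T_def)
qed

end

section \<open>Application to the spin model and conclusion\<close>

lemma cavity_estimates_spins:
  assumes sp: "spins P B" shows "cavity_estimates (spins.al P B) (spins.q2 P B) (spins.q4 P B) B"
proof (rule cavity_estimates.intro)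
  show "1 \<le> B" by (rule spins.B_ge_1[OF sp])
  show "0 \<le> spins.q2 P B N a" "0 \<le> spins.q4 P B N a" "0 \<le> spins.al P B N a" for N a
    by (rule spins.q_nonneg[OF sp])+
  show "spins.q2 P B N a \<le> spins.q2 P B N b" "spins.q4 P B N a \<le> spins.q4 P B N b" if "0 \<le> a" "a \<le> b" for N a b
    by (rule spins.q_mono[OF sp that])+
qed (rule spins.al_le_q2[OF sp] spins.al_ge_q2[OF sp] spins.al_upper[OF sp] spins.al_lower[OF sp]; assumption)+

text \<open>The order \<open>s\<close> of the moment depends on the point of the net. Compactness
  gives a finite net chosen independently of \<open>N\<close>, so finitely many geometric rates
  suffice.\<close>

lemma no_overlap_spins:
  assumes sp: "spins P B" and a: "0 < a" and l: "a\<^sup>2 < l"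
    and psi: "\<And>r. 0 \<le> r \<Longrightarrow> psi P r \<le> r\<^sup>2 / (4 * l)"
  shows "cavity_estimates.no_overlap (spins.q2 P B) (spins.q4 P B) a"
  unfolding cavity_estimates.no_overlap_def[OF cavity_estimates_spins[OF sp]]
proof (intro allI impI)
  fix e :: real assume e: "0 < e"
  define c where "c = a\<^sup>2 * e\<^sup>2 / 4 * (1 - a\<^sup>2 / l)"
  have l0: "l > 0" using l zero_le_power2[of a] by linarith
  have c: "c > 0" using a e l l0 by (simp add: c_def)
  define h where "h = sqrt (c / (2 * a\<^sup>2))"
  have h2: "h\<^sup>2 = c / (2 * a\<^sup>2)" using c unfolding h_def by (intro real_sqrt_pow2) simp
  have h: "h > 0" using a c unfolding h_def by (intro real_sqrt_gt_zero divide_pos_pos) auto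
  have h': "a\<^sup>2 * h\<^sup>2 / 2 \<le> c / 4" using a unfolding h2 by simp
  let ?S = "{r. e \<le> \<bar>r\<bar> \<and> \<bar>r\<bar> \<le> B\<^sup>2}"
  have "compact ?S"
  proof -
    have "?S = cball 0 (B\<^sup>2) - ball 0 e" by (auto simp: dist_real_def)
    then show ?thesis by (simp add: compact_diff)
  qed
  moreover have "?S \<subseteq> (\<Union>x\<in>?S. ball x h)" using h by (intro subsetI UN_I) (assumption, simp)
  ultimately obtain G where G: "G \<subseteq> ?S" "finite G" "?S \<subseteq> (\<Union>x\<in>G. ball x h)"
    by (rule compactE_image[OF _ open_ball])
  have cover: "\<exists>m\<in>G. \<bar>r - m\<bar> \<le> h" if "e < \<bar>r\<bar>" "\<bar>r\<bar> \<le> B\<^sup>2" for r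
  proof -
    have "r \<in> ?S" using that by simp
    then have "r \<in> (\<Union>x\<in>G. ball x h)" using G(3) by (rule rev_subsetD)
    then obtain x where "x \<in> G" "dist x r < h" by auto
    then show ?thesis by (intro bexI[of _ x]) (auto simp: dist_real_def)
  qed
  have "\<forall>m. \<exists>s. 0 < s \<and> s < 1 \<and>
    (\<integral>y. spins.site_gen P B (if 0 \<le> m then 1 else -1) (a\<^sup>2 * \<bar>m\<bar>) s y \<partial>P) \<le> exp (s * (psi P (a\<^sup>2 * \<bar>m\<bar>) + c / 4))"
    using c by (intro allI spins.site_moment[OF sp]) auto
  then obtain s where s: "\<And>m. 0 < s m \<and> s m < 1 \<and>
    (\<integral>y. spins.site_gen P B (if 0 \<le> m then 1 else -1) (a\<^sup>2 * \<bar>m\<bar>) (s m) y \<partial>P) \<le> exp (s m * (psi P (a\<^sup>2 * \<bar>m\<bar>) + c / 4))"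
    by metis
  define t where "t N = B ^ 8 * (\<Sum>m\<in>G. real N * exp (- (c / 4)) ^ N + exp (s m * (a\<^sup>2 * B ^ 4 / 4)) * (real N * exp (- (s m * c / 4)) ^ N))" for N :: nat
  have pw: "(\<lambda>N. real N * exp (- k) ^ N) \<longlonglongrightarrow> 0" if "k > 0" for k :: real
    using powser_times_n_limit_0[of "exp (- k)"] that by simp
  have "t \<longlonglongrightarrow> B ^ 8 * (\<Sum>m\<in>G. 0 + exp (s m * (a\<^sup>2 * B ^ 4 / 4)) * 0)"
    unfolding t_def[abs_def] using c s by (intro tendsto_intros pw) auto
  then have "t \<longlonglongrightarrow> 0" by simp
  moreover have "spins.q4 P B N a \<le> e\<^sup>2 * spins.q2 P B N a + t N" if "N > 0" for N
    unfolding t_def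
  proof (rule spins.q4_deviation[where s = s and h = h and l = l and c = c])
    show "spins P B" by (rule sp)
    show "0 < N" by (rule that)
    show "0 \<le> a" using a by simp
    show "finite G" by (rule G(2))
    show "0 < e" by (rule e)
    show "\<exists>m\<in>G. \<bar>r - m\<bar> \<le> h" if "e < \<bar>r\<bar>" "\<bar>r\<bar> \<le> B\<^sup>2" for r by (rule cover[OF that])
    show "e \<le> \<bar>m\<bar>" if "m \<in> G" for m using subsetD[OF G(1) that] by simp
    show "psi P r \<le> r\<^sup>2 / (4 * l)" if "0 \<le> r" for r by (rule psi[OF that])
    show "a\<^sup>2 < l" by (rule l)
    show "0 < s m \<and> s m < 1 \<and> (\<integral>y. spins.site_gen P B (if 0 \<le> m then 1 else -1) (a\<^sup>2 * \<bar>m\<bar>) (s m) y \<partial>P)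
      \<le> exp (s m * (psi P (a\<^sup>2 * \<bar>m\<bar>) + c / 4))" for m by (rule s)
    show "c = a\<^sup>2 * e\<^sup>2 / 4 * (1 - a\<^sup>2 / l)" by (rule c_def)
    show "a\<^sup>2 * h\<^sup>2 / 2 \<le> c / 4" by (rule h')
  qed
  ultimately show "\<exists>t. t \<longlonglongrightarrow> 0 \<and> (\<forall>N>0. spins.q4 P B N a \<le> e\<^sup>2 * spins.q2 P B N a + t N)" by blast
qed

text \<open>The complement of the support is a union of open null sets, and second countability
  reduces it to a countable union.\<close>

lemma AE_measure_support:
  fixes M :: "'a::second_countable_topology measure"
  assumes [simp]: "sets M = sets borel"
  shows "AE x in M. x \<in> measure_support M"
proof -
  let ?F = "{U. open U \<and> emeasure M U = 0}"
  obtain F' where F': "F' \<subseteq> ?F" "countable F'" "\<Union>F' = \<Union>?F"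
    using Lindelof[of ?F] by auto
  have "(\<Union>U\<in>F'. U) \<in> null_sets M"
    using F'(1,2) by (intro null_sets_UN') (auto simp: null_sets_def)
  then have "\<Union>?F \<in> null_sets M" using F'(3) by simp
  moreover have "{x \<in> space M. x \<notin> measure_support M} \<subseteq> \<Union>?F"
    by (auto simp: measure_support_def)
  ultimately show ?thesis by (rule AE_I')
qed

text \<open>The potential is tested at \<open>q = r / l\<close>, where \<open>l * q = r\<close> and
  the quadratic term is \<open>r\<^sup>2 / (4 * l)\<close>.\<close>

lemma phi_RS_zeroD:
  assumes "phi_RS P l = 0" "0 < l" "0 \<le> r" shows "psi P r \<le> r\<^sup>2 / (4 * l)"
proof -
  have "ereal (rs_potential P l (r / l)) \<le> phi_RS P l"
    unfolding phi_RS_def using assms by (intro SUP_upper) auto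
  then have "rs_potential P l (r / l) \<le> 0" using assms(1) by (simp add: zero_ereal_def)
  then show ?thesis using assms(2) by (simp add: rs_potential_def power2_eq_square field_simps)
qed

theorem corollary6:
  fixes P :: "real measure" and lam :: real
  assumes "real_distribution P"
    and bounded_support: "bounded (measure_support P)"
    and centered: "prob_space.expectation P (\<lambda>x. x) = 0"
    and unit_variance: "prob_space.variance P (\<lambda>x. x) = 1"
    and "0 \<le> lam" and "ereal lam < reconstruction_threshold P"
  shows "(\<lambda>N. D_KL (spiked_wigner P lam N) (spiked_wigner P 0 N))
           \<longlonglongrightarrow> 1 / 4 * (- ln (1 - lam) - lam)"
proof -
  interpret real_distribution P by fact
  obtain b where b: "\<And>x. x \<in> measure_support P \<Longrightarrow> \<bar>x\<bar> \<le> b"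
    using bounded_support by (auto simp: bounded_iff)
  define B where "B = max 1 b"
  have "AE x in P. x \<in> measure_support P" by (rule AE_measure_support) simp
  then have AE_B: "AE x in P. \<bar>x\<bar> \<le> B" by eventually_elim (use b in \<open>fastforce simp: B_def le_max_iff_disj\<close>)
  have sp: "spins P B"
  proof
    show "sets P = sets borel" by simp
    show "1 \<le> B" by (simp add: B_def)
    show "AE x in P. \<bar>x\<bar> \<le> B" by (rule AE_B)
    show "expectation (\<lambda>x. x) = 0" by (rule centered)
    show "expectation (\<lambda>x. x\<^sup>2) = 1" using unit_variance centered by simp
  qed
  interpret C: cavity_estimates "spins.al P B" "spins.q2 P B" "spins.q4 P B" B
    by (rule cavity_estimates_spins[OF sp])
  have KL: "D_KL (spiked_wigner P lam N) (spiked_wigner P 0 N) = spins.entropy_rel P B N (sqrt lam)" for N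
    using spins.D_KL_eq[OF sp, of "sqrt lam" N] \<open>0 \<le> lam\<close> by simp
  show ?thesis
  \<comment> \<open>At \<open>lam = 0\<close> the two laws coincide; elsewhere the amplitude is
    positive, which the exclusion of large overlaps requires.\<close>
  proof (cases "lam = 0")
    case True
    then show ?thesis unfolding KL using spins.entropy_rel_0[OF sp] by simp
  next
    case False
    then have lam: "0 < lam" using \<open>0 \<le> lam\<close> by simp
    \<comment> \<open>As \<open>lam\<close> lies strictly below the supremum, some member lies
      strictly above \<open>lam\<close>; the inserted 0 is ruled out by
      \<open>lam > 0\<close>.\<close>
    obtain l where l: "lam < l" "phi_RS P l = 0"
    proof -
      obtain z where z: "z \<in> insert 0 (ereal ` {lam. lam > 0 \<and> phi_RS P lam = 0})" "ereal lam < z"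
        using assms(6) unfolding reconstruction_threshold_def less_Sup_iff by blast
      then show ?thesis using lam that by (auto simp: zero_ereal_def)
    qed
    have psi: "psi P r \<le> r\<^sup>2 / (4 * l)" if "0 \<le> r" for r
      using phi_RS_zeroD[OF l(2) _ that] l(1) lam by simp
    \<comment> \<open>The criterion only gives a weak inequality; applied at a point between
      \<open>lam\<close> and \<open>l\<close> it yields the strict \<open>lam < 1\<close>.\<close>
    define l' where "l' = (lam + l) / 2"
    have l': "lam < l'" "l' < l" using l(1) by (auto simp: l'_def)
    have "(sqrt l')\<^sup>2 \<le> 1"
      using l' lam psi by (intro C.subcritical no_overlap_spins[OF sp, of _ l]) auto
    then have "lam < 1" using l' lam by simp
    then have "(\<lambda>N. spins.entropy_rel P B N (sqrt lam)) \<longlonglongrightarrow> 1 / 4 * (- ln (1 - (sqrt lam)\<^sup>2) - (sqrt lam)\<^sup>2)"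
      using lam l(1) psi
      by (intro C.entropy_limit no_overlap_spins[OF sp, of _ l] spins.entropy_rel_0[OF sp] spins.entropy_rel_derivative_al[OF sp]) auto
    then show ?thesis unfolding KL using lam by simp
  qed
qed

end
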